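(* There is a parallel algorithm which, given a sequence $S$ of length $n$ over the alphabet $\Sigma=\{0,\ldots,\sigma-1\}$ with $\sigma\le n$, constructs the wavelet matrix of $S$ using $O(n\log\sigma)$ work and $O(\log n\log\sigma)$ depth.
   Context: Model: work-depth model with concurrent reads and writes permitted, with unit-cost operations on machine words of $\Theta(\log n)$ bits. The work is the total number of operations and the depth is the number of parallel time steps. $\log$ is base 2, and, as usual in asymptotic bounds, logarithmic factors are read as being at least $1$. The wavelet matrix of $S$ has levels $l=0,\ldots,\lceil\log\sigma\rceil-1$, each storing one bitmap of length $n$. Symbols are viewed as $\lceil\log\sigma\rceil$-bit numbers. The sequence on level $0$ is $S$ itself. For $l\ge1$, the sequence on level $l$ is obtained from the sequence on level $l-1$ by stably reordering it by the $l$'th highest bit of the symbols: all symbols with $l$'th highest bit $0$ are placed on the left and all symbols with $l$'th highest bit $1$ on the right, the relative order within each group being preserved. The bitmap on level $l$ records, position by position, the $(l+1)$'st highest bit of the symbols of the level's sequence. Each level also stores the number of $0$'s on the level, and a succinct rank/select structure (of size sub-linear in the bitmap length) supporting rank and select queries on its bitmap in $O(1)$ work. *)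

theory Defs
  imports "HOL-Library.Landau_Symbols"
begin

section \<open>The work-depth model\<close>

text \<open>
  A program is a finite, structured piece of three-address code over private registers and a
  shared memory, both holding words of \<open>w\<close> bits.  Nested parallelism is created by \<open>Pardo\<close>, and
  all running strands proceed in lock step: in one time step every running strand executes one
  instruction, all reads see the memory before the step, and all writes take effect afterwards.
\<close>

datatype binop =
  Add | Sub | Mul | Div | Mod | And | Or | Xor | Shl | Shr | Less | Eq

text \<open>All results are reduced modulo \<open>2 ^ w\<close>; in particular subtraction wraps around.\<close>

fun eval_binop :: "nat \<Rightarrow> binop \<Rightarrow> nat \<Rightarrow> nat \<Rightarrow> nat" where
  "eval_binop w Add x y = (x + y) mod 2 ^ w"
| "eval_binop w Sub x y = (2 ^ w + x - y) mod 2 ^ w"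
| "eval_binop w Mul x y = (x * y) mod 2 ^ w"
| "eval_binop w Div x y = (x div y) mod 2 ^ w"
| "eval_binop w Mod x y = (x mod y) mod 2 ^ w"
| "eval_binop w And x y = (semiring_bit_operations_class.and x y) mod 2 ^ w"
| "eval_binop w Or x y = (semiring_bit_operations_class.or x y) mod 2 ^ w"
| "eval_binop w Xor x y = (semiring_bit_operations_class.xor x y) mod 2 ^ w"
| "eval_binop w Shl x y = push_bit y x mod 2 ^ w"
| "eval_binop w Shr x y = drop_bit y x mod 2 ^ w"
| "eval_binop w Less x y = of_bool (x < y) mod 2 ^ w"
| "eval_binop w Eq x y = of_bool (x = y) mod 2 ^ w"

type_synonym regs = "nat \<Rightarrow> nat"
type_synonym mem = "nat \<Rightarrow> nat"

text \<open>
  Natural-number arguments are register numbers, except for the second argument of \<open>Const\<close>, the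
  literal.  \<open>Load r a\<close> is \<open>r := M[a]\<close>, and \<open>Store a r\<close> is \<open>M[a] := r\<close>, with the address in
  register \<open>a\<close>; \<open>If\<close> and \<open>While\<close> test a register for being nonzero; \<open>Pardo i k c\<close> runs \<open>c\<close> in
  parallel for \<open>i = 0, \<dots>, k - 1\<close>, the bound being the content of register \<open>k\<close>.
\<close>

datatype instr =
  Const nat nat
| Op binop nat nat nat
| Load nat nat
| Store nat nat
| If nat "instr list" "instr list"
| While nat "instr list"
| Pardo nat nat "instr list"

type_synonym code = "instr list"

text \<open>
  A strand is either active, with its registers and the code still to be executed, or it has
  forked and waits for its children, remembering its own registers and continuation.
\<close>

datatype strand =
  Active regs code
| Waiting regs code "strand list"

fun finished :: "strand \<Rightarrow> bool" where
  "finished (Active r c) \<longleftrightarrow> c = []"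
| "finished (Waiting r c ts) \<longleftrightarrow> False"

fun exec_instr :: "nat \<Rightarrow> mem \<Rightarrow> regs \<Rightarrow> instr \<Rightarrow> code \<Rightarrow> strand" where
  "exec_instr w m r (Const x v) c = Active (r(x := v mod 2 ^ w)) c"
| "exec_instr w m r (Op f x y z) c = Active (r(x := eval_binop w f (r y) (r z))) c"
| "exec_instr w m r (Load x a) c = Active (r(x := m (r a))) c"
| "exec_instr w m r (Store a x) c = Active r c"
| "exec_instr w m r (If x c1 c2) c = Active r ((if r x \<noteq> 0 then c1 else c2) @ c)"
| "exec_instr w m r (While x c1) c = Active r (if r x \<noteq> 0 then c1 @ While x c1 # c else c)"
| "exec_instr w m r (Pardo i k c1) c =
     Waiting r c (map (\<lambda>j. Active (r(i := j)) c1) [0..<r k])"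

fun next_strand :: "nat \<Rightarrow> mem \<Rightarrow> strand \<Rightarrow> strand" where
  "next_strand w m (Active r []) = Active r []"
| "next_strand w m (Active r (i # c)) = exec_instr w m r i c"
| "next_strand w m (Waiting r c ts) =
     (if list_all finished ts then Active r c else Waiting r c (map (next_strand w m) ts))"

text \<open>The pairs of an address and a value written to it in one time step.\<close>

fun writes :: "strand \<Rightarrow> (nat \<times> nat) set" where
  "writes (Active r (Store a x # c)) = {(r a, r x)}"
| "writes (Active r c) = {}"
| "writes (Waiting r c ts) = \<Union> (set (map writes ts))"

text \<open>
  The number of unit-cost operations performed in one time step.  Forking \<open>k\<close> children is
  charged \<open>k + 1\<close> operations, joining them one.
\<close>

fun ops :: "strand \<Rightarrow> nat" where
  "ops (Active r []) = 0"
| "ops (Active r (Pardo i k c1 # c)) = r k + 1"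
| "ops (Active r (i # c)) = 1"
| "ops (Waiting r c ts) = (if list_all finished ts then 1 else sum_list (map ops ts))"

text \<open>Concurrent writes to one address: an arbitrary one of them succeeds.\<close>

definition crcw_update :: "mem \<Rightarrow> (nat \<times> nat) set \<Rightarrow> mem \<Rightarrow> bool" where
  "crcw_update m W m' \<longleftrightarrow>
     (\<forall>a. if \<exists>v. (a, v) \<in> W then (a, m' a) \<in> W else m' a = m a)"

text \<open>
  Executions are infinite sequences of configurations; a finished strand just stays as it is, at
  no cost.
\<close>

definition execution :: "nat \<Rightarrow> code \<Rightarrow> regs \<Rightarrow> mem \<Rightarrow> (nat \<Rightarrow> mem) \<Rightarrow> (nat \<Rightarrow> strand) \<Rightarrow> bool" where
  "execution w P r m M T \<longleftrightarrow>
     M 0 = m \<and> T 0 = Active r P \<and>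
     (\<forall>t. crcw_update (M t) (writes (T t)) (M (Suc t)) \<and>
          T (Suc t) = next_strand w (M t) (T t))"

text \<open>
  However write conflicts are resolved, \<open>P\<close> started with registers \<open>r\<close> and memory \<open>m\<close> halts
  after at most \<open>depth\<close> time steps and \<open>work\<close> operations, in a memory and with registers
  satisfying \<open>Q\<close>.
\<close>

definition runs_within ::
  "nat \<Rightarrow> code \<Rightarrow> regs \<Rightarrow> mem \<Rightarrow> real \<Rightarrow> real \<Rightarrow> (mem \<Rightarrow> regs \<Rightarrow> bool) \<Rightarrow> bool" where
  "runs_within w P r m work depth Q \<longleftrightarrow>
     (\<forall>M T. execution w P r m M T \<longrightarrow>
        (\<exists>d r'. T d = Active r' [] \<and> Q (M d) r' \<and>
           real d \<le> depth \<and> real (\<Sum>t<d. ops (T t)) \<le> work))"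

definition word_memory :: "nat \<Rightarrow> mem \<Rightarrow> bool" where
  "word_memory w m \<longleftrightarrow> (\<forall>a. m a < 2 ^ w)"

definition init_regs :: "nat list \<Rightarrow> regs" where
  "init_regs xs = (\<lambda>i. if i < length xs then xs ! i else 0)"

text \<open>Every program has an execution, so that \<open>runs_within\<close> is never vacuous, and time steps of
  an unfinished computation are never free.\<close>

lemma crcw_update_exists: "\<exists>m'. crcw_update m W m'"
proof
  show "crcw_update m W (\<lambda>a. if \<exists>v. (a, v) \<in> W then SOME v. (a, v) \<in> W else m a)"
    by (auto simp: crcw_update_def intro: someI)
qed

lemma execution_exists: "\<exists>M T. execution w P r m M T"
proof -
  define step where "step = (\<lambda>(m, t).
    (SOME m'. crcw_update m (writes t) m', next_strand w m t))"
  define C where "C = (\<lambda>k. (step ^^ k) (m, Active r P))"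
  have "crcw_update (fst (C k)) (writes (snd (C k))) (fst (C (Suc k))) \<and>
      snd (C (Suc k)) = next_strand w (fst (C k)) (snd (C k))" for k
    unfolding C_def
    by (auto simp: step_def case_prod_beta intro: someI_ex[OF crcw_update_exists])
  then have "execution w P r m (fst \<circ> C) (snd \<circ> C)"
    by (simp add: execution_def C_def)
  then show ?thesis by blast
qed

lemma ops_pos: "\<not> finished t \<Longrightarrow> ops t > 0"
proof (induction t)
  case (Active r c)
  then obtain i c' where "c = i # c'" by (cases c) auto
  then show ?case by (cases i) auto
next
  case (Waiting r c ts)
  show ?case
  proof (cases "list_all finished ts")
    case False
    then obtain t where t: "t \<in> set ts" "\<not> finished t" by (auto simp: list_all_iff)
    then have "0 < ops t" using Waiting.IH by blast
    moreover have "ops t \<le> sum_list (map ops ts)" using t(1) by (auto intro: member_le_sum_list)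
    ultimately show ?thesis using False by simp
  qed simp
qed


section \<open>Wavelet matrices\<close>

definition num_levels :: "nat \<Rightarrow> nat" where
  "num_levels \<sigma> = nat \<lceil>log 2 (real \<sigma>)\<rceil>"

text \<open>The \<open>k\<close>-th highest bit, \<open>1 \<le> k \<le> d\<close>, of \<open>x\<close> viewed as a \<open>d\<close>-bit number.\<close>

definition high_bit :: "nat \<Rightarrow> nat \<Rightarrow> nat \<Rightarrow> bool" where
  "high_bit d k x = bit x (d - k)"

primrec level_seq :: "nat \<Rightarrow> nat list \<Rightarrow> nat \<Rightarrow> nat list" where
  "level_seq d S 0 = S"
| "level_seq d S (Suc l) =
     filter (\<lambda>x. \<not> high_bit d (Suc l) x) (level_seq d S l) @
     filter (\<lambda>x. high_bit d (Suc l) x) (level_seq d S l)"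

definition level_bitmap :: "nat \<Rightarrow> nat list \<Rightarrow> nat \<Rightarrow> bool list" where
  "level_bitmap \<sigma> S l =
     map (high_bit (num_levels \<sigma>) (Suc l)) (level_seq (num_levels \<sigma>) S l)"

definition bit_rank :: "bool \<Rightarrow> bool list \<Rightarrow> nat \<Rightarrow> nat" where
  "bit_rank b B i = count_list (take i B) b"

text \<open>The (0-based) position of the \<open>j\<close>-th occurrence of \<open>b\<close>, for
  \<open>1 \<le> j \<le> count_list B b\<close>.\<close>

definition bit_select :: "bool \<Rightarrow> bool list \<Rightarrow> nat \<Rightarrow> nat" where
  "bit_select b B j = filter (\<lambda>p. B ! p = b) [0..<length B] ! (j - 1)"


section \<open>Wavelet matrices in memory\<close>

text \<open>The number of words occupied by a bitmap of length \<open>n\<close>.\<close>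

definition bitmap_words :: "nat \<Rightarrow> nat \<Rightarrow> nat" where
  "bitmap_words w n = nat \<lceil>real n / real w\<rceil>"

definition stores_bitmap :: "nat \<Rightarrow> mem \<Rightarrow> nat \<Rightarrow> bool list \<Rightarrow> bool" where
  "stores_bitmap w m p B \<longleftrightarrow>
     (\<forall>i<length B. bit (m (p + i div w)) (i mod w) = B ! i)"

text \<open>
  The \<open>z\<close> words of \<open>m\<close> from address \<open>q\<close> on form a rank/select structure for the bitmap \<open>B\<close>
  stored at address \<open>p\<close>, with query programs \<open>rk\<close> and \<open>sl\<close> of work at most \<open>K\<close>.  A query gets
  the length of the bitmap, the word size, the two addresses, the queried bit and the argument
  in registers \<open>0\<close> to \<open>5\<close>, and returns its answer in register \<open>0\<close>.  It leaves the memory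
  unchanged, and it may depend on the bitmap and the structure only: the memory \<open>m'\<close> on which it
  is run is arbitrary outside of these two regions.
\<close>

definition rank_select_structure ::
  "nat \<Rightarrow> code \<Rightarrow> code \<Rightarrow> real \<Rightarrow> mem \<Rightarrow> nat \<Rightarrow> bool list \<Rightarrow> nat \<Rightarrow> nat \<Rightarrow> bool" where
  "rank_select_structure w rk sl K m p B q z \<longleftrightarrow>
     (\<forall>m' b. word_memory w m' \<and>
        (\<forall>a \<in> {p..<p + bitmap_words w (length B)} \<union> {q..<q + z}. m' a = m a) \<longrightarrow>
        (\<forall>i\<le>length B.
           runs_within w rk (init_regs [length B, w, p, q, of_bool b, i]) m' K K
             (\<lambda>m'' r. m'' = m' \<and> r 0 = bit_rank b B i)) \<and>
        (\<forall>j\<in>{1..count_list B b}.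
           runs_within w sl (init_regs [length B, w, p, q, of_bool b, j]) m' K K
             (\<lambda>m'' r. m'' = m' \<and> r 0 = bit_select b B j)))"

text \<open>
  From address \<open>D\<close> on there are three words for each level: the address of its bitmap, the
  number of zeros on the level, and the address of its rank/select structure, which consists of
  at most \<open>s\<close> bits.
\<close>

definition stores_wavelet_matrix ::
  "nat \<Rightarrow> code \<Rightarrow> code \<Rightarrow> real \<Rightarrow> nat \<Rightarrow> nat \<Rightarrow> nat list \<Rightarrow> mem \<Rightarrow> nat \<Rightarrow> bool" where
  "stores_wavelet_matrix w rk sl K s \<sigma> S m D \<longleftrightarrow>
     (\<forall>l<num_levels \<sigma>.
        stores_bitmap w m (m (D + 3 * l)) (level_bitmap \<sigma> S l) \<and>
        m (D + 3 * l + 1) = count_list (level_bitmap \<sigma> S l) False \<and>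
        (\<exists>z. z * w \<le> s \<and>
           rank_select_structure w rk sl K m (m (D + 3 * l)) (level_bitmap \<sigma> S l)
             (m (D + 3 * l + 2)) z))"

text \<open>Logarithmic factors in asymptotic bounds are read as being at least 1.\<close>

definition lg :: "nat \<Rightarrow> real" where
  "lg n = max 1 (log 2 (real n))"

text \<open>
  The program \<open>P\<close> gets \<open>n\<close>, \<open>\<sigma>\<close> and the word size in registers \<open>0\<close> to \<open>2\<close>, and \<open>S\<close> in memory
  cells \<open>0\<close> to \<open>n - 1\<close>, the rest of the memory being arbitrary.  It returns the address of the
  wavelet matrix in register \<open>0\<close>.
\<close>

definition constructs_wavelet_matrix ::
  "code \<Rightarrow> code \<Rightarrow> code \<Rightarrow> real \<Rightarrow> nat \<Rightarrow> nat \<Rightarrow> nat \<Rightarrow> nat list \<Rightarrow> real \<Rightarrow> real \<Rightarrow> bool" where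
  "constructs_wavelet_matrix P rk sl K s w \<sigma> S work depth \<longleftrightarrow>
     (\<forall>m. word_memory w m \<and> (\<forall>i<length S. m i = S ! i) \<longrightarrow>
        runs_within w P (init_regs [length S, \<sigma>, w]) m work depth
          (\<lambda>m' r. stores_wavelet_matrix w rk sl K s \<sigma> S m' (r 0)))"

end

theory Submission
  imports Defs "HOL-Real_Asymp.Real_Asymp"
begin

text \<open>
  All parallelism is expressed by one statement: every strand evaluates an address and a value by
  straight-line code of the same length, and then all strands store simultaneously.  Since the
  strands run in lock step, all reads precede all writes, and the statement is a simultaneous
  assignment; no interference argument is needed, and a sequential program logic suffices.

  On each level the prefix ranks of the bits are computed by summing blocks of \<open>w\<close> bits,
  a Hillis-Steele scan of the fewer than \<open>n / w + 1\<close> block totals, and a backward pass through the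
  blocks.  They yield the positions of the zeros and of the ones, and by these the next sequence.

  Let \<open>u = \<lceil>log w\<rceil>\<close>.  Rank is answered by absolute counts for every \<open>u\<^sup>4 w\<close>-th position, by
  counts of \<open>5 u\<close> bits relative to these for every \<open>u\<^sup>4\<close>-th position, and by a table for windows of
  \<open>u\<^sup>4\<close> bits.  Select follows Clark: the occurrences are split into groups of \<open>u\<^sup>4 w\<close>, and a group
  spanning at least \<open>2 ^ (5 u)\<close> positions is stored explicitly.  In the other groups every \<open>u\<^sup>2\<close>-th
  occurrence is stored in \<open>5 u\<close> bits relative to the start of the group.  An occurrence is
  then found by the table if it lies less than \<open>u\<^sup>4\<close> positions behind the preceding stored one,
  and is stored explicitly in \<open>5 u\<close> bits otherwise.  No pointers are needed for the explicit
  parts: their slots are indexed by the start of the group divided by its least span.  Each part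
  takes \<open>O(n / u)\<close> bits plus lower order terms, which is \<open>o(n)\<close> since \<open>u\<close> is about
  \<open>log log n\<close>.
\<close>

section \<open>Program logic\<close>

text \<open>The exponents balance the space. A field of \<open>5 u\<close> bits for every
  \<open>u^2\<close>-th occurrence and \<open>u^2\<close> such fields for every \<open>u^4\<close>
  positions both amount to \<open>O(n / u)\<close> bits. An explicit group takes
  \<open>u^4 w\<close> full words, but at most one of them starts in each stretch of
  \<open>2 ^ (5 u)\<close> positions, and \<open>2 ^ (5 u)\<close> is at least \<open>w^5\<close>.
  The table has \<open>2 ^ (u^4)\<close> rows, which is \<open>n^o(1)\<close>. The logarithmic
  factor in the work of the scan is absorbed because it runs on about \<open>n / w\<close> totals
  only.

  Branching would destroy the common length of the strands. So a choice is made by arithmetic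
  (\<open>Ite\<close>), and a store that must not happen goes to a dummy block. All other targets
  are pairwise distinct, so it does not matter how write conflicts are resolved.

  For words of at least \<open>2 ^ 24 * lg n\<close> bits, \<open>n\<close> is at most
  \<open>2 ^ (w div 16)\<close>. Hence arithmetic stays clear of overflow, and memory can be split
  into blocks of \<open>2 ^ (w div 2)\<close> words, each far larger than any array: disjointness is
  a matter of block numbers, and nothing has to be allocated.\<close>

datatype expr = C nat | V nat | Bin binop expr expr | Mem expr

fun eval :: "nat \<Rightarrow> mem \<Rightarrow> regs \<Rightarrow> expr \<Rightarrow> nat" where
  "eval w m r (C c) = c mod 2 ^ w"
| "eval w m r (V x) = r x"
| "eval w m r (Bin f a b) = eval_binop w f (eval w m r a) (eval w m r b)"
| "eval w m r (Mem a) = m (eval w m r a)"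

text \<open>Register \<open>d\<close> is the top of a stack: the result of an expression is left
  there, and only registers from \<open>d\<close> on are overwritten. A copy is the bitwise or of a
  register with itself.\<close>

fun compile :: "expr \<Rightarrow> nat \<Rightarrow> code" where
  "compile (C c) d = [Const d c]"
| "compile (V x) d = [Op Or d x x]"
| "compile (Bin f a b) d = compile a d @ compile b (Suc d) @ [Op f d d (Suc d)]"
| "compile (Mem a) d = compile a d @ [Load d d]"

fun elen :: "expr \<Rightarrow> nat" where
  "elen (C c) = 1"
| "elen (V x) = 1"
| "elen (Bin f a b) = elen a + elen b + 1"
| "elen (Mem a) = elen a + 1"

lemma length_compile [simp]: "length (compile e d) = elen e"
  by (induction e d rule: compile.induct) auto

text \<open>Registers below 64 hold program variables, the others are temporaries of compiled
  expressions.\<close>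

definition NV :: nat where "NV = 64"

fun wf_expr :: "expr \<Rightarrow> bool" where
  "wf_expr (C c) = True"
| "wf_expr (V x) = (x < 64)"
| "wf_expr (Bin f a b) = (wf_expr a \<and> wf_expr b)"
| "wf_expr (Mem a) = wf_expr a"

definition vars :: "regs \<Rightarrow> regs" where
  "vars r = (\<lambda>x. if x < NV then r x else 0)"

definition wordy :: "nat \<Rightarrow> regs \<Rightarrow> bool" where
  "wordy w r \<longleftrightarrow> (\<forall>x. r x < 2 ^ w)"

fun simple :: "instr \<Rightarrow> bool" where
  "simple (Const x v) = True"
| "simple (Op f x y z) = True"
| "simple (Load x a) = True"
| "simple _ = False"

fun sstep :: "nat \<Rightarrow> mem \<Rightarrow> regs \<Rightarrow> instr \<Rightarrow> regs" where
  "sstep w m r (Const x v) = r(x := v mod 2 ^ w)"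
| "sstep w m r (Op f x y z) = r(x := eval_binop w f (r y) (r z))"
| "sstep w m r (Load x a) = r(x := m (r a))"
| "sstep w m r _ = r"

abbreviation ssteps :: "nat \<Rightarrow> mem \<Rightarrow> regs \<Rightarrow> code \<Rightarrow> regs" where
  "ssteps w m r c \<equiv> foldl (sstep w m) r c"

lemma comp_simple: "i \<in> set (compile e d) \<Longrightarrow> simple i"
  by (induction e d rule: compile.induct) auto

lemma eval_binop_less: "eval_binop w f x y < 2 ^ w"
  by (cases f) auto

lemma eval_less:
  assumes "word_memory w m" "wordy w r"
  shows "eval w m r e < 2 ^ w"
  using assms by (induction e) (auto simp: eval_binop_less word_memory_def wordy_def)

lemma eval_cong: "wf_expr e \<Longrightarrow> (\<And>x. x < 64 \<Longrightarrow> r x = r' x) \<Longrightarrow> eval w m r e = eval w m r' e"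
  by (induction e) auto

lemma sstep_wordy: "word_memory w m \<Longrightarrow> wordy w r \<Longrightarrow> wordy w (sstep w m r i)"
  by (cases i) (auto simp: wordy_def word_memory_def eval_binop_less)

lemma ssteps_wordy: "word_memory w m \<Longrightarrow> wordy w r \<Longrightarrow> wordy w (ssteps w m r c)"
  by (induction c arbitrary: r) (auto simp: sstep_wordy)

text \<open>The operand in \<open>d\<close> survives the evaluation of the second one at
  \<open>Suc d\<close>, and program variables lie below the stack, so \<open>eval\<close> can be
  taken in the old registers throughout. Words are assumed because a copy truncates to
  \<open>w\<close> bits.\<close>

lemma ssteps_comp:
  assumes "wf_expr e" "64 \<le> d" "word_memory w m" "wordy w r"
  shows "ssteps w m r (compile e d) d = eval w m r e \<and>
         (\<forall>x<d. ssteps w m r (compile e d) x = r x)"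
  using assms
proof (induction e d arbitrary: r rule: compile.induct)
  case (2 x d)
  then show ?case by (auto simp: wordy_def)
next
  case (3 f a b d)
  let ?r1 = "ssteps w m r (compile a d)"
  let ?r2 = "ssteps w m ?r1 (compile b (Suc d))"
  have 1: "?r1 d = eval w m r a" "\<And>x. x < d \<Longrightarrow> ?r1 x = r x"
    using 3 by auto
  have "wordy w ?r1" by (rule ssteps_wordy) (use 3 in auto)
  then have 2: "?r2 (Suc d) = eval w m ?r1 b" "\<And>x. x < Suc d \<Longrightarrow> ?r2 x = ?r1 x"
    using "3.IH"(2)[of ?r1] 3 by auto
  moreover have "eval w m ?r1 b = eval w m r b"
    by (rule eval_cong) (use 3 1 in auto)
  ultimately show ?case using 1 by auto
qed auto

section \<open>Traces, and triples with bounds on depth and work\<close>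

text \<open>\<open>execution\<close> without the initial configuration, so that every suffix of a
  trace is again a trace; sequential composition rests on this.\<close>

definition trace :: "nat \<Rightarrow> (nat \<Rightarrow> mem) \<Rightarrow> (nat \<Rightarrow> strand) \<Rightarrow> bool" where
  "trace w M T \<longleftrightarrow> (\<forall>t. crcw_update (M t) (writes (T t)) (M (Suc t)) \<and>
          T (Suc t) = next_strand w (M t) (T t))"

lemma trace_shift: "trace w M T \<Longrightarrow> trace w (\<lambda>t. M (t + s)) (\<lambda>t. T (t + s))"
  by (auto simp: trace_def)

lemma crcw_empty: "crcw_update m {} m' \<longleftrightarrow> m' = m"
  by (auto simp: crcw_update_def)

text \<open>Depth \<open>d\<close> and work \<open>k\<close> are counted in units of \<open>CC\<close> steps and operations, so that the
  lengths of compiled expressions need not be tracked.\<close>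

definition CC :: nat where "CC = 300"

text \<open>A triple for every continuation \<open>c'\<close> and every resolution of write
  conflicts. Registers are seen through \<open>vars\<close> only, so that temporaries may be
  clobbered freely.\<close>

definition run :: "nat \<Rightarrow> code \<Rightarrow> regs \<Rightarrow> mem \<Rightarrow> nat \<Rightarrow> nat \<Rightarrow> (mem \<Rightarrow> regs \<Rightarrow> bool) \<Rightarrow> bool" where
  "run w c \<rho> m d k Q \<longleftrightarrow> (\<forall>M T r c'. trace w M T \<and> M 0 = m \<and> T 0 = Active r (c @ c') \<and>
      vars r = \<rho> \<and> word_memory w m \<and> wordy w r \<longrightarrow>
      (\<exists>e r'. T e = Active r' c' \<and> e \<le> CC * d \<and> (\<Sum>t<e. ops (T t)) \<le> CC * k \<and>
         word_memory w (M e) \<and> wordy w r' \<and> Q (M e) (vars r')))"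

lemma run_cong_post:
  assumes "run w c \<rho> m d k Q" "d \<le> d'" "k \<le> k'"
    and "\<And>m' \<rho>'. word_memory w m' \<Longrightarrow> wordy w \<rho>' \<Longrightarrow> Q m' \<rho>' \<Longrightarrow> Q' m' \<rho>'"
  shows "run w c \<rho> m d' k' Q'"
  unfolding run_def
proof (intro allI impI, elim conjE)
  fix M T r c'
  assume a: "trace w M T" "M 0 = m" "T 0 = Active r (c @ c')" "vars r = \<rho>" "word_memory w m" "wordy w r"
  then obtain e r' where e: "T e = Active r' c'" "e \<le> CC * d" "(\<Sum>t<e. ops (T t)) \<le> CC * k"
    "word_memory w (M e)" "wordy w r'" "Q (M e) (vars r')"
    using assms(1) unfolding run_def by blast
  have "wordy w (vars r')" using e(5) by (auto simp: wordy_def vars_def)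
  moreover have "CC * d \<le> CC * d'" "CC * k \<le> CC * k'" using assms by auto
  ultimately show "\<exists>e r'. T e = Active r' c' \<and> e \<le> CC * d' \<and> (\<Sum>t<e. ops (T t)) \<le> CC * k' \<and>
         word_memory w (M e) \<and> wordy w r' \<and> Q' (M e) (vars r')"
    using e assms(4) by (meson order_trans)
qed

lemma run_Nil: "Q m \<rho> \<Longrightarrow> run w [] \<rho> m 0 0 Q"
  unfolding run_def by (auto intro!: exI[of _ 0])

lemma run_append:
  assumes "run w c1 \<rho> m d1 k1 R"
    and "\<And>m' \<rho>'. word_memory w m' \<Longrightarrow> wordy w \<rho>' \<Longrightarrow> R m' \<rho>' \<Longrightarrow> run w c2 \<rho>' m' d2 k2 Q"
  shows "run w (c1 @ c2) \<rho> m (d1 + d2) (k1 + k2) Q"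
  unfolding run_def
proof (intro allI impI, elim conjE)
  fix M T r c'
  assume a: "trace w M T" "M 0 = m" "T 0 = Active r ((c1 @ c2) @ c')" "vars r = \<rho>" "word_memory w m" "wordy w r"
  then obtain e r' where e: "T e = Active r' (c2 @ c')" "e \<le> CC * d1" "(\<Sum>t<e. ops (T t)) \<le> CC * k1"
    "word_memory w (M e)" "wordy w r'" "R (M e) (vars r')"
    using assms(1) unfolding run_def by (metis append.assoc)
  have "wordy w (vars r')" using e(5) by (auto simp: wordy_def vars_def)
  then have R2: "run w c2 (vars r') (M e) d2 k2 Q" using assms(2) e by blast
  have "trace w (\<lambda>t. M (t + e)) (\<lambda>t. T (t + e))" using a(1) by (rule trace_shift)
  from R2[unfolded run_def, rule_format, of "\<lambda>t. M (t + e)" "\<lambda>t. T (t + e)" r' c'] this e obtain e2 r2 where e2: "T (e2 + e) = Active r2 c'" "e2 \<le> CC * d2"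
    "(\<Sum>t<e2. ops (T (t + e))) \<le> CC * k2"
    "word_memory w (M (e2 + e))" "wordy w r2" "Q (M (e2 + e)) (vars r2)"
    by auto
  have "(\<Sum>t<e2 + e. ops (T t)) = (\<Sum>t<e. ops (T t)) + (\<Sum>t<e2. ops (T (t + e)))"
    by (induction e2) (auto simp: add.assoc)
  then show "\<exists>e r'. T e = Active r' c' \<and> e \<le> CC * (d1 + d2) \<and>
        (\<Sum>t<e. ops (T t)) \<le> CC * (k1 + k2) \<and>
         word_memory w (M e) \<and> wordy w r' \<and> Q (M e) (vars r')"
    using e e2 by (intro exI[of _ "e2 + e"] exI[of _ r2]) (auto simp: algebra_simps)
qed

lemma simple_exec: "simple i \<Longrightarrow> exec_instr w m r i c = Active (sstep w m r i) c"
  by (cases i) auto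

lemma simple_writes: "simple i \<Longrightarrow> writes (Active r (i # c)) = {}"
  by (cases i) auto

lemma simple_ops: "simple i \<Longrightarrow> ops (Active r (i # c)) = 1"
  by (cases i) auto

lemma trace_simple:
  assumes "trace w M T" "T t = Active r (s @ c)" "\<And>i. i \<in> set s \<Longrightarrow> simple i"
  shows "T (t + length s) = Active (ssteps w (M t) r s) c \<and> M (t + length s) = M t \<and>
         (\<Sum>i<length s. ops (T (t + i))) = length s"
  using assms(2,3)
proof (induction s arbitrary: t r)
  case (Cons i s)
  have st: "T (Suc t) = next_strand w (M t) (T t)" "crcw_update (M t) (writes (T t)) (M (Suc t))"
    using assms(1) by (auto simp: trace_def)
  have 1: "T (Suc t) = Active (sstep w (M t) r i) (s @ c)" "M (Suc t) = M t"
    using st Cons.prems by (auto simp: simple_exec simple_writes crcw_empty)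
  have o: "ops (T t) = 1" using Cons.prems by (auto simp: simple_ops)
  have "(\<Sum>j<length (i # s). ops (T (t + j))) = ops (T t) + (\<Sum>j<length s. ops (T (Suc t + j)))"
    by (simp add: sum.lessThan_Suc_shift del: sum.lessThan_Suc)
  then show ?case using Cons.IH[OF 1(1)] Cons.prems 1 o by (auto simp: add.commute)
qed auto

lemma finished_map_Active: "list_all finished (map (\<lambda>j. Active (\<rho> j) c) [0..<k]) \<longleftrightarrow> k = 0 \<or> c = []"
  by (auto simp: list_all_iff)

text \<open>A waiting strand joins as soon as all of its children are finished. With at least one
  child and a nonempty rest \<open>c\<close>, this cannot happen during \<open>s\<close>, so the
  children advance in lock step.\<close>

lemma trace_simple_par:
  assumes "trace w M T" "T t = Waiting r c' (map (\<lambda>j. Active (\<rho> j) (s @ c)) [0..<k])"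
    "\<And>i. i \<in> set s \<Longrightarrow> simple i" "0 < k" "c \<noteq> []"
  shows "T (t + length s) = Waiting r c' (map (\<lambda>j. Active (ssteps w (M t) (\<rho> j) s) c) [0..<k]) \<and>
         M (t + length s) = M t \<and>
         (\<Sum>i<length s. ops (T (t + i))) = k * length s"
  using assms(2,3)
proof (induction s arbitrary: t \<rho>)
  case (Cons i s)
  have st: "T (Suc t) = next_strand w (M t) (T t)" "crcw_update (M t) (writes (T t)) (M (Suc t))"
    using assms(1) by (auto simp: trace_def)
  have w0: "writes (T t) = {}" using Cons.prems by (auto simp: simple_writes)
  have nf: "\<not> list_all finished (map (\<lambda>j. Active (\<rho> j) (i # s @ c)) [0..<k])"
    using assms(4) by (simp add: finished_map_Active)
  have 1: "T (Suc t) = Waiting r c' (map (\<lambda>j. Active (sstep w (M t) (\<rho> j) i) (s @ c)) [0..<k])"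
     "M (Suc t) = M t"
    using st Cons.prems nf w0 by (auto simp: simple_exec crcw_empty)
  have o: "ops (T t) = k" using Cons.prems nf
    by (auto simp: simple_ops comp_def sum_list_triv)
  have "(\<Sum>j<length (i # s). ops (T (t + j))) = ops (T t) + (\<Sum>j<length s. ops (T (Suc t + j)))"
    by (simp add: sum.lessThan_Suc_shift del: sum.lessThan_Suc)
  then show ?case using Cons.IH[OF 1(1)] Cons.prems 1 o by (auto simp: add.commute)
qed auto

definition assign :: "nat \<Rightarrow> expr \<Rightarrow> code" where
  "assign x e = compile e 64 @ [Op Or x 64 64]"

lemma run_assign:
  assumes "wf_expr e" "x < 64" "elen e < CC"
    and "Q m (\<rho>(x := eval w m \<rho> e))"
  shows "run w (assign x e) \<rho> m 1 1 Q"
  unfolding run_def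
proof (intro allI impI, elim conjE)
  fix M T r c'
  assume a: "trace w M T" "M 0 = m" "T 0 = Active r (assign x e @ c')" "vars r = \<rho>" "word_memory w m" "wordy w r"
  let ?s = "assign x e"
  have sm: "\<And>i. i \<in> set ?s \<Longrightarrow> simple i" by (auto simp: assign_def comp_simple)
  have t: "T (length ?s) = Active (ssteps w m r ?s) c'" "M (length ?s) = m"
     "(\<Sum>i<length ?s. ops (T i)) = length ?s"
    using trace_simple[OF a(1), of 0 r ?s c'] a sm by auto
  have wd: "wordy w (ssteps w m r ?s)" using a by (simp add: ssteps_wordy)
  have ev: "eval w m r e = eval w m \<rho> e" 
    by (rule eval_cong) (use assms a in \<open>auto simp: vars_def NV_def\<close>)
  have c: "ssteps w m r (compile e 64) 64 = eval w m \<rho> e" "\<And>y. y < 64 \<Longrightarrow> ssteps w m r (compile e 64) y = r y"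
    using ssteps_comp[of e 64 w m r] assms a ev by auto
  have "eval w m r e < 2 ^ w" using a by (simp add: eval_less)
  then have "vars (ssteps w m r ?s) = \<rho>(x := eval w m \<rho> e)"
    using c a(4) assms(2) ev by (auto simp: assign_def vars_def NV_def)
  then show "\<exists>e r'. T e = Active r' c' \<and> e \<le> CC * 1 \<and> (\<Sum>t<e. ops (T t)) \<le> CC * 1 \<and>
         word_memory w (M e) \<and> wordy w r' \<and> Q (M e) (vars r')"
    using t a wd assms by (intro exI[of _ "length ?s"] exI) (auto simp: assign_def)
qed

text \<open>Register 64 holds the number of strands at the fork. Address and value are computed into
  65 and 66 by a fixed number of instructions, whence all strands reach \<open>Store\<close> in the
  same step.\<close>

definition par :: "nat \<Rightarrow> expr \<Rightarrow> expr \<Rightarrow> expr \<Rightarrow> code" where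
  "par i ce ae ve = compile ce 64 @
     [Pardo i 64 (compile ae 65 @ compile ve 66 @ [Store 65 66])]"

text \<open>A relation and not a function: if several strands share an address, any of their values
  may have won.\<close>

definition scatter :: "mem \<Rightarrow> nat \<Rightarrow> (nat \<Rightarrow> nat) \<Rightarrow> (nat \<Rightarrow> nat) \<Rightarrow> mem \<Rightarrow> bool" where
  "scatter m k addr val m' \<longleftrightarrow>
     (\<forall>a. if \<exists>j<k. addr j = a then \<exists>j<k. addr j = a \<and> m' a = val j else m' a = m a)"

lemma wordy_upd: "wordy w r \<Longrightarrow> v < 2 ^ w \<Longrightarrow> wordy w (r(x := v))"
  by (auto simp: wordy_def)

text \<open>Nothing is written before the common \<open>Store\<close> step, so both expressions are
  evaluated in the initial memory by all strands. The work is proportional to \<open>k + 1\<close>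
  for \<open>k\<close> strands because the straight-line part has bounded length.\<close>

lemma run_par:
  assumes wf: "wf_expr ce" "wf_expr ae" "wf_expr ve" "i < 64"
    and len: "elen ce + elen ae + elen ve + 4 \<le> CC"
    and post: "\<And>m'. word_memory w m' \<Longrightarrow> scatter m (eval w m \<rho> ce) (\<lambda>j. eval w m (\<rho>(i := j)) ae)
      (\<lambda>j. eval w m (\<rho>(i := j)) ve) m' \<Longrightarrow> Q m' \<rho>"
  shows "run w (par i ce ae ve) \<rho> m 1 (eval w m \<rho> ce + 1) Q"
  unfolding run_def
proof (intro allI impI, elim conjE)
  fix M T r c'
  assume a: "trace w M T" "M 0 = m" "T 0 = Active r (par i ce ae ve @ c')" "vars r = \<rho>" "word_memory w m" "wordy w r"
  let ?s = "compile ce 64"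
  let ?b = "compile ae 65 @ compile ve 66"
  let ?p = "?b @ [Store 65 66]"
  let ?k = "eval w m \<rho> ce"
  define r1 where "r1 = ssteps w m r ?s"
  let ?n = "length ?s"
  have t: "T ?n = Active r1 (Pardo i 64 ?p # c')" "M ?n = m"
     "(\<Sum>i<?n. ops (T i)) = ?n"
    using trace_simple[OF a(1), of 0 r ?s "Pardo i 64 ?p # c'"] a comp_simple by (auto simp: r1_def par_def)
  have wd: "wordy w r1" using a by (simp add: ssteps_wordy r1_def)
  have ev: "eval w m r ce = ?k"
    by (rule eval_cong) (use wf a in \<open>auto simp: vars_def NV_def\<close>)
  have c: "r1 64 = ?k" "\<And>y. y < 64 \<Longrightarrow> r1 y = r y"
    using ssteps_comp[of ce 64 w m r] wf a ev by (auto simp: r1_def)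
  have v1: "vars r1 = \<rho>" using c a(4) by (auto simp: vars_def NV_def)
  have kw: "?k < 2 ^ w" using wd c(1) by (metis wordy_def)
  have st: "T (Suc t) = next_strand w (M t) (T t)" "crcw_update (M t) (writes (T t)) (M (Suc t))" for t
    using a(1) by (auto simp: trace_def)
  have t1: "T (Suc ?n) = Waiting r1 c' (map (\<lambda>j. Active (r1(i := j)) ?p) [0..<?k])"
    using st(1)[of ?n] t c by simp
  have m1: "M (Suc ?n) = m" using st(2)[of ?n] t by (simp add: crcw_empty)
  have o1: "(\<Sum>t<Suc ?n. ops (T t)) = ?n + ?k + 1" using t c by simp
  show "\<exists>e r'. T e = Active r' c' \<and> e \<le> CC * 1 \<and> (\<Sum>t<e. ops (T t)) \<le> CC * (?k + 1) \<and>
         word_memory w (M e) \<and> wordy w r' \<and> Q (M e) (vars r')"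
  proof (cases "?k = 0")
    case True
    have t2: "T (Suc (Suc ?n)) = Active r1 c'" "M (Suc (Suc ?n)) = m"
      using st[of "Suc ?n"] t1 m1 True by (auto simp: crcw_empty)
    have o2: "(\<Sum>t<Suc (Suc ?n). ops (T t)) = ?n + 2" using o1 t1 True by simp
    have "Q m \<rho>" by (rule post) (use a True in \<open>auto simp: scatter_def\<close>)
    then show ?thesis using t2 o2 a wd v1 len
      by (intro exI[of _ "Suc (Suc ?n)"] exI[of _ r1]) auto
  next
    case False
    let ?l = "length ?b"
    define r2 where "r2 = (\<lambda>j. ssteps w m (r1(i := j)) ?b)"
    have t2: "T (Suc ?n + ?l) = Waiting r1 c' (map (\<lambda>j. Active (r2 j) [Store 65 66]) [0..<?k])"
       "M (Suc ?n + ?l) = m" "(\<Sum>i<?l. ops (T (Suc ?n + i))) = ?k * ?l"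
      using trace_simple_par[OF a(1), of "Suc ?n" r1 c' "\<lambda>j. r1(i := j)" ?b "[Store 65 66]" ?k]
        t1 m1 False comp_simple by (auto simp: r2_def)
    have r2: "r2 j 65 = eval w m (\<rho>(i := j)) ae \<and> r2 j 66 = eval w m (\<rho>(i := j)) ve"
      if "j < ?k" for j
    proof -
      let ?q = "r1(i := j)"
      let ?q1 = "ssteps w m ?q (compile ae 65)"
      have wq: "wordy w ?q" by (rule wordy_upd[OF wd]) (use that kw in simp)
      have wq1: "wordy w ?q1" using wq a(5) by (simp add: ssteps_wordy)
      have e0: "eval w m r'' e = eval w m (\<rho>(i := j)) e" if "wf_expr e"
        "\<And>x. x < 65 \<Longrightarrow> r'' x = ?q x" for e r''
        by (rule eval_cong) (use that v1 in \<open>auto simp: vars_def NV_def\<close>)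
      have 1: "?q1 65 = eval w m (\<rho>(i := j)) ae" "\<And>x. x < 65 \<Longrightarrow> ?q1 x = ?q x"
        using ssteps_comp[of ae 65 w m ?q] wf wq a(5) e0[of ae ?q] by auto
      have "ssteps w m ?q1 (compile ve 66) 66 = eval w m (\<rho>(i := j)) ve"
        "\<And>x. x < 66 \<Longrightarrow> ssteps w m ?q1 (compile ve 66) x = ?q1 x"
        using ssteps_comp[of ve 66 w m ?q1] wf wq1 a(5) e0[of ve ?q1] 1 by auto
      then show ?thesis using 1 by (simp add: r2_def)
    qed
    let ?N = "Suc ?n + ?l"
    have nf: "\<not> list_all finished (map (\<lambda>j. Active (r2 j) [Store 65 66]) [0..<?k])"
      using False by (simp only: finished_map_Active) simp
    have wr: "writes (T ?N) = {(r2 j 65, r2 j 66) | j. j < ?k}"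
      using t2 by auto
    have sc: "scatter m ?k (\<lambda>j. eval w m (\<rho>(i := j)) ae) (\<lambda>j. eval w m (\<rho>(i := j)) ve) (M (Suc ?N))"
      unfolding scatter_def
    proof
      fix x
      have "if \<exists>v. (x, v) \<in> writes (T ?N) then (x, M (Suc ?N) x) \<in> writes (T ?N) else M (Suc ?N) x = m x"
        by (rule st(2)[of ?N, unfolded t2(2) crcw_update_def, rule_format, of x])
      then show "if \<exists>j<?k. eval w m (\<rho>(i := j)) ae = x then
           \<exists>j<?k. eval w m (\<rho>(i := j)) ae = x \<and> M (Suc ?N) x = eval w m (\<rho>(i := j)) ve
         else M (Suc ?N) x = m x"
        unfolding wr using r2 by (auto split: if_splits) metis+
    qed
    have wm: "word_memory w (M (Suc ?N))"
      unfolding word_memory_def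
    proof
      fix x
      have "eval w m (\<rho>(i := j)) ve < 2 ^ w" if "j < ?k" for j
      proof (rule eval_less[OF a(5)])
        have "wordy w \<rho>" using v1 wd by (auto simp: wordy_def vars_def)
        then show "wordy w (\<rho>(i := j))" by (rule wordy_upd) (use that kw in simp)
      qed
      then show "M (Suc ?N) x < 2 ^ w" using sc[unfolded scatter_def, rule_format, of x] a(5)
        by (auto simp: word_memory_def split: if_splits)
    qed
    have t3: "T (Suc ?N) = Waiting r1 c' (map (\<lambda>j. Active (r2 j) []) [0..<?k])"
      using st(1)[of ?N] t2(1) nf by (simp add: comp_def)
    have t4: "T (Suc (Suc ?N)) = Active r1 c'"
      using st(1)[of "Suc ?N"] t3 by (simp add: finished_map_Active)
    have "writes (T (Suc ?N)) = {}" using t3 by auto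
    then have m4: "M (Suc (Suc ?N)) = M (Suc ?N)" using st(2)[of "Suc ?N"] by (simp add: crcw_empty)
    have o3: "ops (T ?N) = ?k" using t2 nf by (auto simp: comp_def sum_list_triv)
    have o4: "ops (T (Suc ?N)) = 1" using t3 by (simp add: finished_map_Active)
    have o2: "(\<Sum>t<Suc ?n + l. ops (T t)) = (\<Sum>t<Suc ?n. ops (T t)) + (\<Sum>i<l. ops (T (Suc ?n + i)))" for l
      by (induction l) auto
    have "(\<Sum>t<Suc (Suc ?N). ops (T t)) = ?n + ?k + 1 + ?k * ?l + ?k + 1"
      using o2[of ?l] o1 t2(3) o3 o4 by simp
    also have "\<dots> \<le> (?n + ?l + 4) * (?k + 1)" by (simp add: algebra_simps)
    also have "\<dots> \<le> CC * (?k + 1)" using len by (intro mult_le_mono1) simp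
    finally have o: "(\<Sum>t<Suc (Suc ?N). ops (T t)) \<le> CC * (?k + 1)" .
    have "Q (M (Suc ?N)) \<rho>" by (rule post[OF wm sc])
    then show ?thesis using o t4 m4 wm wd v1 len
      by (intro exI[of _ "Suc (Suc ?N)"] exI[of _ r1]) auto
  qed
qed

lemma run_while_False:
  assumes "\<rho> x = 0" "Q m \<rho>" "x < 64"
  shows "run w [While x c] \<rho> m 1 1 Q"
  unfolding run_def
proof (intro allI impI, elim conjE)
  fix M T r c'
  assume a: "trace w M T" "M 0 = m" "T 0 = Active r ([While x c] @ c')" "vars r = \<rho>" "word_memory w m" "wordy w r"
  have "r x = 0" using a(4) assms by (auto simp: vars_def NV_def split: if_splits)
  then have "T 1 = Active r c'" "M 1 = m" 
    using a(1)[unfolded trace_def, rule_format, of 0] a by (simp_all add: crcw_empty)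
  then show "\<exists>e r'. T e = Active r' c' \<and> e \<le> CC * 1 \<and> (\<Sum>t<e. ops (T t)) \<le> CC * 1 \<and>
         word_memory w (M e) \<and> wordy w r' \<and> Q (M e) (vars r')"
    using a assms by (intro exI[of _ 1] exI[of _ r]) (auto simp: CC_def)
qed

lemma run_while_True:
  assumes "\<rho> x \<noteq> 0" "x < 64" "run w (c @ [While x c]) \<rho> m d k Q"
  shows "run w [While x c] \<rho> m (Suc d) (Suc k) Q"
  unfolding run_def
proof (intro allI impI, elim conjE)
  fix M T r c'
  assume a: "trace w M T" "M 0 = m" "T 0 = Active r ([While x c] @ c')" "vars r = \<rho>" "word_memory w m" "wordy w r"
  have "r x \<noteq> 0" using a(4) assms by (auto simp: vars_def NV_def split: if_splits)
  then have 1: "T 1 = Active r ((c @ [While x c]) @ c')" "M 1 = m" 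
    using a(1)[unfolded trace_def, rule_format, of 0] a by (simp_all add: crcw_empty)
  have "trace w (\<lambda>t. M (t + 1)) (\<lambda>t. T (t + 1))" using a(1) by (rule trace_shift)
  from assms(3)[unfolded run_def, rule_format, of "\<lambda>t. M (t + 1)" "\<lambda>t. T (t + 1)" r c'] this 1 a obtain e r2 where e2: "T (e + 1) = Active r2 c'" "e \<le> CC * d"
    "(\<Sum>t<e. ops (T (t + 1))) \<le> CC * k"
    "word_memory w (M (e + 1))" "wordy w r2" "Q (M (e + 1)) (vars r2)"
    by auto
  have "(\<Sum>t<Suc e. ops (T t)) = ops (T 0) + (\<Sum>t<e. ops (T (t + 1)))"
    by (simp add: sum.lessThan_Suc_shift del: sum.lessThan_Suc)
  also have "ops (T 0) = 1" using a by simp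
  finally show "\<exists>e r'. T e = Active r' c' \<and> e \<le> CC * Suc d \<and>
        (\<Sum>t<e. ops (T t)) \<le> CC * Suc k \<and>
         word_memory w (M e) \<and> wordy w r' \<and> Q (M e) (vars r')"
    using e2 by (intro exI[of _ "e + 1"] exI[of _ r2]) (auto simp: CC_def)
qed

text \<open>The counter is decremented before the body, which therefore sees the values
  \<open>N - 1\<close> down to \<open>0\<close> and can use them as indices.\<close>

definition loop :: "nat \<Rightarrow> code \<Rightarrow> code" where
  "loop x c = [While x (assign x (Bin Sub (V x) (C 1)) @ c)]"

text \<open>The invariant is indexed by the number of rounds left, the value of the counter. Each
  round costs 2 units beyond its body, for the test and the decrement, and 1 unit goes to the final
  test.\<close>

lemma run_loop:
  assumes "x < 64" "\<rho> x = N" "I N m \<rho>"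
    and "\<And>k m \<rho>. k < N \<Longrightarrow> word_memory w m \<Longrightarrow> wordy w \<rho> \<Longrightarrow> \<rho> x = Suc k \<Longrightarrow> I (Suc k) m \<rho> \<Longrightarrow>
        run w c (\<rho>(x := k)) m d q (\<lambda>m' \<rho>'. \<rho>' x = k \<and> I k m' \<rho>')"
    and "wordy w \<rho>" "word_memory w m"
  shows "run w (loop x c) \<rho> m (N * (d + 2) + 1) (N * (q + 2) + 1) (\<lambda>m' \<rho>'. \<rho>' x = 0 \<and> I 0 m' \<rho>')"
  using assms(2-6)
proof (induction N arbitrary: m \<rho>)
  case 0
  then show ?case using run_while_False[of \<rho> x "\<lambda>m' \<rho>'. \<rho>' x = 0 \<and> I 0 m' \<rho>'" m] assms(1) unfolding loop_def by simp
next
  case (Suc N)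
  let ?W = "assign x (Bin Sub (V x) (C 1)) @ c"
  have lt: "Suc N < 2 ^ w" using Suc.prems by (metis wordy_def)
  then have w0: "1 < (2::nat) ^ w" using less_trans by (cases N) auto
  have ev: "eval w m \<rho> (Bin Sub (V x) (C 1)) = N"
    using Suc.prems(1) w0 lt by (simp add: mod_if)
  have "run w ((assign x (Bin Sub (V x) (C 1)) @ c) @ [While x ?W]) \<rho> m ((1 + d) + (N * (d + 2) + 1)) ((1 + q) + (N * (q + 2) + 1)) (\<lambda>m' \<rho>'. \<rho>' x = 0 \<and> I 0 m' \<rho>')"
  proof (rule run_append)
    show "run w (assign x (Bin Sub (V x) (C 1)) @ c) \<rho> m (1 + d) (1 + q) (\<lambda>m' \<rho>'. \<rho>' x = N \<and> I N m' \<rho>')"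
    proof (rule run_append)
      show "run w (assign x (Bin Sub (V x) (C 1))) \<rho> m 1 1 (\<lambda>m' \<rho>'. m' = m \<and> \<rho>' = \<rho>(x := N))"
        by (rule run_assign) (use assms(1) ev in \<open>auto simp: CC_def\<close>)
      show "run w c \<rho>' m' d q (\<lambda>m' \<rho>'. \<rho>' x = N \<and> I N m' \<rho>')" if "m' = m \<and> \<rho>' = \<rho>(x := N)" for m' \<rho>'
      proof -
        have "run w c (\<rho>(x := N)) m d q (\<lambda>m' \<rho>'. \<rho>' x = N \<and> I N m' \<rho>')"
          by (rule Suc.prems(3)) (use Suc.prems in auto)
        then show ?thesis using that by simp
      qed
    qed
    show "run w [While x ?W] \<rho>' m' (N * (d + 2) + 1) (N * (q + 2) + 1) (\<lambda>m' \<rho>'. \<rho>' x = 0 \<and> I 0 m' \<rho>')"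
      if "word_memory w m'" "wordy w \<rho>'" "\<rho>' x = N \<and> I N m' \<rho>'" for m' \<rho>'
      using Suc.IH[of \<rho>' m'] Suc.prems that unfolding loop_def by auto
  qed
  then have "run w [While x ?W] \<rho> m (Suc ((1 + d) + (N * (d + 2) + 1))) (Suc ((1 + q) + (N * (q + 2) + 1))) (\<lambda>m' \<rho>'. \<rho>' x = 0 \<and> I 0 m' \<rho>')"
    using Suc.prems(1) by (intro run_while_True) (auto simp: assms(1))
  then show ?case unfolding loop_def by (rule run_cong_post) auto
qed

text \<open>The exit from the logic: the continuation is empty, and units are converted back to
  steps and operations.\<close>

lemma run_runs_within:
  assumes "run w c (vars r) m d k Q" "wordy w r" "word_memory w m" "\<And>m' \<rho>'. Q m' \<rho>' \<Longrightarrow> Q' m' (\<rho>' 0)"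
    "real (CC * d) \<le> d'" "real (CC * k) \<le> k'"
  shows "runs_within w c r m k' d' (\<lambda>m' r'. Q' m' (r' 0))"
  unfolding runs_within_def
proof (intro allI impI)
  fix M T assume e: "execution w c r m M T"
  then have "trace w M T" "M 0 = m" "T 0 = Active r (c @ [])" by (auto simp: execution_def trace_def)
  then obtain e r' where e: "T e = Active r' []" "e \<le> CC * d" "(\<Sum>t<e. ops (T t)) \<le> CC * k"
    "Q (M e) (vars r')" using assms unfolding run_def by blast
  have "real e \<le> d'" "real (\<Sum>t<e. ops (T t)) \<le> k'" 
    using e assms(5,6) by (meson of_nat_mono order_trans)+
  then show "\<exists>d r'. T d = Active r' [] \<and> Q' (M d) (r' 0) \<and> real d \<le> d' \<and> real (\<Sum>t<d. ops (T t)) \<le> k'"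
    using e assms(4)[OF e(4)] by (auto simp: vars_def NV_def)
qed

section \<open>Ranks and positions\<close>

definition ones :: "(nat \<Rightarrow> bool) \<Rightarrow> nat \<Rightarrow> nat list" where
  "ones P k = filter P [0..<k]"

definition rnk :: "(nat \<Rightarrow> bool) \<Rightarrow> nat \<Rightarrow> nat" where
  "rnk P k = length (ones P k)"

text \<open>Counted from 0. The default \<open>n\<close> beyond the last occurrence keeps
  \<open>pos\<close> monotone and gives a span also to the last, incomplete group of
  occurrences.\<close>

definition pos :: "(nat \<Rightarrow> bool) \<Rightarrow> nat \<Rightarrow> nat \<Rightarrow> nat" where
  "pos P n j = (if j < rnk P n then ones P n ! j else n)"

lemma rnk_0 [simp]: "rnk P 0 = 0"
  by (simp add: rnk_def ones_def)

lemma rnk_Suc [simp]: "rnk P (Suc i) = rnk P i + of_bool (P i)"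
  by (simp add: rnk_def ones_def)

lemma rnk_mono: "i \<le> j \<Longrightarrow> rnk P i \<le> rnk P j"
  by (induction rule: dec_induct) auto

lemma rnk_add_le: "rnk P (i + k) \<le> rnk P i + k"
  by (induction k) auto

lemma rnk_le: "rnk P i \<le> i"
  using rnk_add_le[of P 0 i] by simp

lemma rnk_diff_le: "i \<le> j \<Longrightarrow> rnk P j - rnk P i \<le> j - i"
  using rnk_add_le[of P i "j - i"] by simp

text \<open>By this the ranks of the ones suffice for both bits. Select has no such symmetry, which
  is why its components are stored once for each bit.\<close>

lemma rnk_not: "rnk (\<lambda>i. \<not> P i) i = i - rnk P i"
proof (induction i)
  case (Suc i)
  then show ?case using rnk_le[of P i] by auto
qed simp

lemma rnk_cong: "(\<And>i. i < k \<Longrightarrow> P i = Q i) \<Longrightarrow> rnk P k = rnk Q k"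
  by (induction k) auto

lemma ones_append: "i \<le> k \<Longrightarrow> ones P k = ones P i @ filter P [i..<k]"
  by (metis ones_def filter_append le_add_diff_inverse upt_add_eq_append zero_le)

lemma nth_ones_rnk: "i < n \<Longrightarrow> P i \<Longrightarrow> rnk P i < rnk P n \<and> ones P n ! rnk P i = i"
  using ones_append[of i n P] by (auto simp: rnk_def upt_conv_Cons nth_append)

lemma pos_rnk: "i < n \<Longrightarrow> P i \<Longrightarrow> pos P n (rnk P i) = i"
  using nth_ones_rnk[of i n P] by (simp add: pos_def)

lemma nth_ones:
  assumes "j < rnk P n"
  shows "ones P n ! j < n \<and> P (ones P n ! j) \<and> rnk P (ones P n ! j) = j"
proof -
  let ?x = "ones P n ! j"
  have "?x \<in> set (ones P n)" using assms by (simp add: rnk_def)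
  then have x: "?x < n" "P ?x" by (auto simp: ones_def)
  have "distinct (ones P n)" by (simp add: ones_def)
  then have "rnk P ?x = j"
    using nth_ones_rnk[of ?x n P] x assms by (metis nth_eq_iff_index_eq rnk_def)
  then show ?thesis using x by simp
qed

lemma pos_less: "j < rnk P n \<Longrightarrow> pos P n j < n \<and> P (pos P n j) \<and> rnk P (pos P n j) = j"
  using nth_ones[of j P n] by (simp add: pos_def)

lemma pos_le: "pos P n j \<le> n"
  using pos_less[of j P n] by (cases "j < rnk P n") (auto simp: pos_def)

lemma pos_mono: "j \<le> j' \<Longrightarrow> pos P n j \<le> pos P n j'"
proof (cases "j' < rnk P n")
  case True
  assume "j \<le> j'"
  then have "\<not> pos P n j' < pos P n j"
    using pos_less[of j P n] pos_less[of j' P n] True rnk_mono[of "Suc (pos P n j')" "pos P n j" P]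
    by auto
  then show ?thesis by simp
next
  case False
  then show ?thesis using pos_le by (auto simp: pos_def)
qed

lemma rnk_window:
  assumes "\<And>i. i < k \<Longrightarrow> v i = P (y + i)"
  shows "rnk P (y + k) = rnk P y + rnk v k"
  using assms by (induction k) auto

text \<open>The number of ones in a window starting at the occurrence \<open>h\<close> tells whether
  the occurrence \<open>j\<close> lies inside it. The window may run past \<open>n\<close>, where
  its bits are arbitrary: they come behind the occurrence sought, so they cannot disturb its index,
  and in the second case the window ends before \<open>n\<close>.\<close>

lemma window_select:
  assumes j: "j < rnk P n" and hj: "h \<le> j" and y: "y = pos P n h"
    and v: "\<And>i. i < k \<Longrightarrow> y + i < n \<Longrightarrow> v i = P (y + i)"
  shows "pos P n j < y + k \<Longrightarrow> j - h < rnk v k \<and> y + ones v k ! (j - h) = pos P n j"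
    and "y + k \<le> pos P n j \<Longrightarrow> rnk v k \<le> j - h"
proof -
  have yj: "y \<le> pos P n j" unfolding y using hj by (rule pos_mono)
  have pj: "pos P n j < n" "P (pos P n j)" "rnk P (pos P n j) = j" using pos_less[OF j] by auto
  have ry: "rnk P y = h" using pos_less[of h P n] j hj unfolding y by auto
  {
    assume less: "pos P n j < y + k"
    define i where "i = pos P n j - y"
    have i: "y + i = pos P n j" "i < k" using yj less by (auto simp: i_def)
    have "rnk P (y + i) = rnk P y + rnk v i"
      by (rule rnk_window) (use v i pj in auto)
    then have "rnk v i = j - h" using i pj ry by simp
    moreover have "v i" using v[of i] i pj by simp
    ultimately show "j - h < rnk v k \<and> y + ones v k ! (j - h) = pos P n j"
      using nth_ones_rnk[of i k v] i by auto
  next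
    assume ge: "y + k \<le> pos P n j"
    have "rnk P (y + k) = rnk P y + rnk v k"
      by (rule rnk_window) (use v ge pj in auto)
    then show "rnk v k \<le> j - h" using rnk_mono[OF ge, of P] pj ry by simp
  }
qed

lemma bit_rank_rnk: "i \<le> length B \<Longrightarrow> bit_rank b B i = rnk (\<lambda>p. B ! p = b) i"
proof (induction i)
  case (Suc i)
  then have "take (Suc i) B = take i B @ [B ! i]" by (simp add: take_Suc_conv_app_nth)
  then show ?case using Suc by (auto simp: bit_rank_def)
qed (simp add: bit_rank_def)

lemma count_list_rnk: "count_list (B :: bool list) b = rnk (\<lambda>p. B ! p = b) (length B)"
  using bit_rank_rnk[of "length B" B b] by (simp add: bit_rank_def)

lemma bit_select_pos: "j < count_list B b \<Longrightarrow> bit_select b B (Suc j) = pos (\<lambda>p. B ! p = b) (length B) j"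
  by (simp add: bit_select_def pos_def ones_def count_list_rnk)

text \<open>Turns a stable filter into an index formula, which parallel strands can evaluate
  independently of each other.\<close>

lemma filter_nth_pos:
  "filter Q L = map (\<lambda>j. L ! pos (\<lambda>p. Q (L ! p)) (length L) j) [0..<rnk (\<lambda>p. Q (L ! p)) (length L)]"
proof -
  have "filter Q L = filter Q (map ((!) L) [0..<length L])" by (simp add: map_nth)
  also have "\<dots> = map ((!) L) (ones (\<lambda>p. Q (L ! p)) (length L))"
    by (simp only: filter_map ones_def comp_def)
  also have "\<dots> = map (\<lambda>j. L ! pos (\<lambda>p. Q (L ! p)) (length L) j) [0..<rnk (\<lambda>p. Q (L ! p)) (length L)]"
    by (rule nth_equalityI) (auto simp: rnk_def pos_def)
  finally show ?thesis .
qed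

text \<open>The word made of \<open>c\<close> consecutive entries of \<open>x\<close>, as digits in base \<open>F\<close>.\<close>

primrec digits :: "nat \<Rightarrow> (nat \<Rightarrow> nat) \<Rightarrow> nat \<Rightarrow> nat \<Rightarrow> nat" where
  "digits F x s 0 = 0"
| "digits F x s (Suc c) = x s mod F + F * digits F x (Suc s) c"

lemma digits_less: "0 < F \<Longrightarrow> digits F x s c < F ^ c"
proof (induction c arbitrary: s)
  case (Suc c)
  have "x s mod F + F * digits F x (Suc s) c < F + F * digits F x (Suc s) c" using Suc by simp
  also have "\<dots> = F * Suc (digits F x (Suc s) c)" by simp
  also have "\<dots> \<le> F * F ^ c" using Suc.IH[OF Suc.prems] by (intro mult_le_mono2) (simp add: Suc_leI)
  finally show ?case by simp
qed simp

lemma digits_digit: "0 < F \<Longrightarrow> i < c \<Longrightarrow> digits F x s c div F ^ i mod F = x (s + i) mod F"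
proof (induction c arbitrary: s i)
  case (Suc c)
  show ?case
  proof (cases i)
    case (Suc k)
    have "(x s mod F + F * digits F x (Suc s) c) div F ^ Suc k = digits F x (Suc s) c div F ^ k"
      using Suc.prems by (simp add: div_mult2_eq)
    then show ?thesis using Suc.IH[of k "Suc s"] Suc.prems Suc by simp
  qed auto
qed simp

section \<open>Parameters and memory layout\<close>

text \<open>For \<open>w \<ge> 1\<close>, the ceiling of the binary logarithm. It serves both for
  \<open>u\<close> and for the number of levels.\<close>

definition clog :: "nat \<Rightarrow> nat" where "clog w = (LEAST u. w \<le> 2 ^ u)"

lemma clog_ge: "w \<le> 2 ^ clog w"
  unfolding clog_def by (rule LeastI[of _ w]) (simp add: less_imp_le)

lemma clog_less: "0 < clog w \<Longrightarrow> 2 ^ (clog w - 1) < w"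
  using not_less_Least[of "clog w - 1" "\<lambda>u. w \<le> 2 ^ u"] unfolding clog_def by (simp add: not_le)

lemma clog_unique: "w \<le> 2 ^ a \<Longrightarrow> a = 0 \<or> 2 ^ (a - 1) < w \<Longrightarrow> clog w = a"
  unfolding clog_def
proof (rule Least_equality)
  fix y assume a: "w \<le> 2 ^ y" "a = 0 \<or> 2 ^ (a - 1) < w"
  then have "a \<noteq> 0 \<Longrightarrow> (2::nat) ^ (a - 1) < 2 ^ y" by linarith
  then have "a \<noteq> 0 \<Longrightarrow> a - 1 < y" by (subst (asm) power_strict_increasing_iff) auto
  then show "a \<le> y" by (cases a) auto
qed

text \<open>From 24 on the exponential has overtaken the polynomial for good, while 23 still fails.
  This is the origin of \<open>2 ^ 24\<close> in the bound on the word size. Of the factor 32, one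
  factor 2 is lost between \<open>2 ^ u\<close> and \<open>w\<close>, so that
  \<open>16 * U < w\<close> remains.\<close>

lemma pow4_le: "24 \<le> x \<Longrightarrow> 32 * x ^ 4 \<le> (2::nat) ^ x"
proof (induction x rule: dec_induct)
  case (step x)
  have e: "x ^ 4 = x * x ^ 3" "x ^ 3 = x * x ^ 2" "x ^ 2 = x * x"
    by (simp_all add: power4_eq_xxxx power3_eq_cube power2_eq_square mult.assoc)
  have p: "(x + 1) ^ 4 = x ^ 4 + 4 * x ^ 3 + 6 * x ^ 2 + 4 * x + 1"
    by (simp add: power4_eq_xxxx power3_eq_cube power2_eq_square algebra_simps)
  have "24 * x ^ 3 \<le> x ^ 4" "24 * x ^ 2 \<le> x ^ 3" "24 * x \<le> x ^ 2"
    unfolding e(1) e(2) e(3) using step by (intro mult_right_mono; simp)+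
  then have "(x + 1) ^ 4 \<le> 2 * x ^ 4"
    unfolding p using step by linarith
  then show ?case using step by simp
qed simp

section \<open>Parameters and their size inequalities\<close>

locale params =
  fixes n w :: nat
  assumes w_big: "2 ^ 24 \<le> w" and n_pos: "1 \<le> n" and n_small: "n \<le> 2 ^ (w div 16)"
begin

definition "u = clog w"
definition "f = 5 * u"
definition "F = (2::nat) ^ f"
definition "U = u ^ 4"
definition "Bs = u ^ 2"
definition "A = U * w"
definition "per = w div f"
definition "bsize = (2::nat) ^ (w div 2)"
text \<open>A common yardstick against overflow: \<open>n\<close>, \<open>w\<close>,
  \<open>A\<close>, \<open>F\<close> and \<open>2 ^ U\<close> are at most \<open>G\<close>, the size
  of a component is of order \<open>G * G\<close>, and a block has room for \<open>G ^ 8\<close>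
  words.\<close>

definition "G = (2::nat) ^ (w div 16)"
text \<open>One size for all eleven components. The summands account for the absolute samples, the
  explicit groups, the packed explicit elements of the other groups, the packed relative select
  samples, and the table; the packed relative ranks fit into the third summand because
  \<open>Bs \<ge> 1\<close>.\<close>

definition "csize = n div A + 2 + (n div F + 1) * A + ((n div U + 1) * Bs div per + 1)
  + ((n div Bs + 1) div per + 1) + (U + 1) * 2 ^ U"
definition "nb = n div w + 1"

lemma u_ge: "24 \<le> u"
proof -
  have "(2::nat) ^ 24 \<le> 2 ^ u" using clog_ge[of w] w_big unfolding u_def by linarith
  then show ?thesis by (rule power_le_imp_le_exp[rotated]) simp
qed

lemma w_le_u: "w \<le> 2 ^ u"
  using clog_ge by (simp add: u_def)

lemma w_gt_u: "2 ^ u < 2 * w"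
proof -
  have "u = Suc (u - 1)" using u_ge by simp
  then have "(2::nat) ^ u = 2 * 2 ^ (u - 1)" by (metis power_Suc)
  then show ?thesis using clog_less[of w] u_ge by (simp add: u_def)
qed

lemma U_w: "16 * U < w"
  using pow4_le[OF u_ge] w_gt_u by (simp add: U_def)

lemma U_le: "U \<le> w div 16"
  using U_w by simp

lemma n_le_G: "n \<le> G" using n_small by (simp add: G_def)

lemma U_eq: "U = Bs * Bs"
  by (simp add: U_def Bs_def power4_eq_xxxx power2_eq_square)

lemma Bs_pos: "0 < Bs" and U_pos: "0 < U" and A_pos: "0 < A" and F_pos: "0 < F" and f_pos: "0 < f"
  and w_pos: "0 < w"
  using u_ge w_big by (auto simp: Bs_def U_def A_def F_def f_def)

lemma f_le_U: "f \<le> U"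
proof -
  have "5 * u \<le> u * u" using u_ge by (intro mult_right_mono) auto
  also have "\<dots> \<le> (u * u) * (u * u)" using u_ge by simp
  finally show ?thesis by (simp add: f_def U_def power4_eq_xxxx mult.assoc)
qed

lemma f_le_w: "f \<le> w div 16"
  using f_le_U U_le by simp

lemma per_pos: "0 < per"
  using f_le_w f_pos unfolding per_def by (simp add: div_greater_zero_iff)

lemma per_le: "per \<le> w" by (simp add: per_def)

lemma f_per: "f * per \<le> w"
  by (simp add: per_def)

lemma U_pow: "2 ^ U \<le> G"
  unfolding G_def using U_le by simp

lemma F_le_G: "F \<le> G"
  unfolding F_def G_def using f_le_w by simp

lemma U_less_pow: "U + 1 \<le> 2 ^ U"
  by (simp add: Suc_leI)

text \<open>So a count relative to the preceding multiple of \<open>A\<close> fits into a field of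
  \<open>f\<close> bits. The five in \<open>f = 5 * u\<close> is generous here:
  \<open>A \<le> w * w\<close>.\<close>

lemma A_le_F: "A \<le> F"
proof -
  have "A \<le> w * w" using U_w by (simp add: A_def)
  also have "\<dots> \<le> 2 ^ u * 2 ^ u" using w_le_u by (intro mult_le_mono)
  also have "\<dots> \<le> (2::nat) ^ (5 * u)" unfolding power_add[symmetric] by (rule power_increasing) auto
  finally show ?thesis by (simp add: F_def f_def)
qed

lemma w_le_A: "w \<le> A" using U_pos by (simp add: A_def)
lemma A_le_G: "A \<le> G" using A_le_F F_le_G by simp
lemma w_le_G: "w \<le> G" using w_le_A A_le_G by simp
lemma Bs_le_U: "Bs \<le> U" using Bs_pos by (simp add: U_eq)

lemma G_big: "2 ^ 20 \<le> G"
proof -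
  have "(2::nat) ^ 20 \<le> 2 ^ (w div 16)"
    using w_big by (intro power_increasing) auto
  then show ?thesis by (simp add: G_def)
qed

lemma G_bsize: "G ^ 8 \<le> bsize"
  unfolding G_def bsize_def power_mult[symmetric] by (rule power_increasing) auto

lemma GGG_bsize: "G * G * G * G \<le> bsize"
proof -
  have "G ^ 4 \<le> G ^ 8" using G_big by (intro power_increasing) auto
  then show ?thesis using G_bsize by (simp add: power4_eq_xxxx mult.assoc)
qed

lemma bsize_w: "bsize * bsize \<le> 2 ^ w"
  unfolding bsize_def power_add[symmetric] by (rule power_increasing) auto

lemma csize_le: "csize \<le> 8 * (G * G)"
proof -
  define Q where "Q = G * G"
  have "n div A \<le> G" using n_le_G by (meson div_le_dividend le_trans)
  moreover have "(n div F + 1) * A \<le> (G + 1) * G"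
    using n_le_G A_le_G by (intro mult_le_mono add_le_mono) (meson div_le_dividend le_trans, auto)
  moreover have "(n div U + 1) * Bs div per \<le> (G + 1) * G"
  proof -
    have "(n div U + 1) * Bs div per \<le> (n div U + 1) * Bs" by simp
    also have "\<dots> \<le> (G + 1) * G"
      using n_le_G Bs_le_U U_less_pow U_pow
      by (intro mult_le_mono add_le_mono) (meson div_le_dividend le_trans, auto)
    finally show ?thesis .
  qed
  moreover have "(n div Bs + 1) div per \<le> G + 1"
    using n_le_G by (meson div_le_dividend le_trans add_le_mono le_refl)
  moreover have "(U + 1) * 2 ^ U \<le> G * G"
    using U_less_pow U_pow by (intro mult_le_mono) auto
  moreover have "2 ^ 20 * G \<le> G * G" using G_big by (intro mult_right_mono) auto
  moreover have "(G + 1) * G = G * G + G" by simp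
  ultimately have "csize \<le> G + 2 + (G * G + G) + (G * G + G + 1) + (G + 1 + 1) + G * G"
    unfolding csize_def by (intro add_le_mono) (simp_all only: le_refl)
  moreover have "1048576 * G \<le> G * G" "1048576 \<le> G" using G_big by (auto intro: mult_right_mono)
  ultimately show ?thesis unfolding Q_def[symmetric] by linarith
qed

lemma GG_bsize: "1000 * (G * G) \<le> bsize"
proof -
  define Q where "Q = G * G"
  have "1048576 * 1048576 \<le> G * G" using G_big by (intro mult_le_mono) auto
  then have q: "1000 \<le> Q" unfolding Q_def by linarith
  then have "1000 * Q \<le> Q * Q" by (rule mult_right_mono) simp
  also have "Q * Q = G * G * G * G" by (simp add: Q_def)
  finally show ?thesis using GGG_bsize unfolding Q_def by linarith
qed

text \<open>The header and the eleven components fit into one block, with some slack for bounds on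
  indices.\<close>

lemma csize_bsize: "13 * csize + 2 < bsize"
proof -
  have "1 \<le> G * G" using G_big by simp
  then show ?thesis using GG_bsize csize_le by linarith
qed

lemma G_bsize1: "100 * G < bsize"
proof -
  have "G \<le> G * G" "1 \<le> G" using G_big by simp_all
  then show ?thesis using GG_bsize by linarith
qed

lemma smalls: "u \<le> G" "Bs \<le> G" "U \<le> G" "f \<le> G" "per \<le> G"
  using u_ge Bs_le_U U_less_pow U_pow f_le_U per_le w_le_G
proof -
  show U: "U \<le> G" using U_less_pow U_pow by linarith
  then show "Bs \<le> G" "f \<le> G" "per \<le> G" using Bs_le_U f_le_U per_le w_le_G by linarith+
  then show "u \<le> G" by (simp add: f_def)
qed

lemma bsize_pos: "0 < bsize" by (simp add: bsize_def)

end

text \<open>Memory is used in blocks of \<open>2 ^ (w div 2)\<close> words; \<open>view w m b i\<close> is word \<open>i\<close> of block \<open>b\<close>.\<close>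

definition view :: "nat \<Rightarrow> mem \<Rightarrow> nat \<Rightarrow> nat \<Rightarrow> nat" where
  "view w m b i = (if i < 2 ^ (w div 2) then m (b * 2 ^ (w div 2) + i) else 0)"

abbreviation Adr :: "expr \<Rightarrow> expr \<Rightarrow> expr" where
  "Adr b i \<equiv> Bin Add (Bin Mul b (V 3)) i"
abbreviation At :: "expr \<Rightarrow> expr \<Rightarrow> expr" where
  "At b i \<equiv> Mem (Adr b i)"

text \<open>By default, arithmetic is evaluated from here on by lemmas that ask for the absence of
  overflow.\<close>

declare eval.simps(3) [simp del]

lemma eval_Add: "eval w m r a + eval w m r b < 2 ^ w \<Longrightarrow>
    eval w m r (Bin Add a b) = eval w m r a + eval w m r b"
  by (simp only: eval.simps(3) eval_binop.simps mod_less)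

lemma eval_Mul: "eval w m r a * eval w m r b < 2 ^ w \<Longrightarrow>
    eval w m r (Bin Mul a b) = eval w m r a * eval w m r b"
  by (simp only: eval.simps(3) eval_binop.simps mod_less)

lemma eval_Sub: "eval w m r b \<le> eval w m r a \<Longrightarrow> eval w m r a < 2 ^ w \<Longrightarrow>
    eval w m r (Bin Sub a b) = eval w m r a - eval w m r b"
  by (simp only: eval.simps(3) eval_binop.simps Nat.diff_add_assoc mod_add_self1 mod_less
      less_imp_diff_less)

lemma eval_Div: "eval w m r a < 2 ^ w \<Longrightarrow>
    eval w m r (Bin Div a b) = eval w m r a div eval w m r b"
  by (simp only: eval.simps(3) eval_binop.simps mod_less order_le_less_trans[OF div_le_dividend])

lemma eval_Mod: "eval w m r a < 2 ^ w \<Longrightarrow>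
    eval w m r (Bin Mod a b) = eval w m r a mod eval w m r b"
  by (simp only: eval.simps(3) eval_binop.simps mod_less order_le_less_trans[OF mod_less_eq_dividend])

lemma eval_Less: "0 < w \<Longrightarrow>
    eval w m r (Bin Less a b) = of_bool (eval w m r a < eval w m r b)"
  using one_less_power[of "2::nat" w] by (cases "eval w m r a < eval w m r b") (simp_all add: eval.simps(3))

abbreviation Ite :: "expr \<Rightarrow> expr \<Rightarrow> expr \<Rightarrow> expr" where
  "Ite c a b \<equiv> Bin Add (Bin Mul c a) (Bin Mul (Bin Sub (C 1) c) b)"

text \<open>Both branches are always evaluated. The one that is not chosen may be nonsense, such as
  a read from a wrong address; memory is total, and the factor 0 discards the value.\<close>

lemma eval_Ite:
  assumes "eval w m r c = of_bool P" "word_memory w m" "wordy w r" "0 < w"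
  shows "eval w m r (Ite c a b) = (if P then eval w m r a else eval w m r b)"
proof -
  have "(1::nat) < 2 ^ w" using assms(4) by (intro one_less_power) auto
  moreover have "eval w m r a < 2 ^ w" "eval w m r b < 2 ^ w" using assms by (auto intro: eval_less)
  ultimately have "eval w m r (Bin Sub (C 1) c) = 1 - of_bool P"
    using assms(1,4) by (subst eval_Sub) auto
  then show ?thesis using assms(1) \<open>eval w m r a < 2 ^ w\<close> \<open>eval w m r b < 2 ^ w\<close>
    by (cases P) (simp_all add: eval_Add eval_Mul)
qed

context params
begin

lemma bsize_less: "bsize < 2 ^ w"
  unfolding bsize_def using w_pos by (intro power_strict_increasing) auto

lemma view_eq: "view w m b i = (if i < bsize then m (b * bsize + i) else 0)"
  by (simp add: view_def bsize_def)

lemma adr_less: "b < bsize \<Longrightarrow> i < bsize \<Longrightarrow> b * bsize + i < 2 ^ w"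
proof -
  assume "b < bsize" "i < bsize"
  then have "b * bsize + i < Suc b * bsize" by simp
  also have "\<dots> \<le> bsize * bsize" using \<open>b < bsize\<close> by (intro mult_right_mono) auto
  finally show ?thesis using bsize_w by simp
qed

lemma eval_Adr:
  assumes "\<rho> 3 = bsize" "eval w m \<rho> b < bsize" "eval w m \<rho> i < bsize"
  shows "eval w m \<rho> (Adr b i) = eval w m \<rho> b * bsize + eval w m \<rho> i"
  using adr_less[OF assms(2,3)] assms(1) by (simp add: eval_Add eval_Mul)

lemma eval_At:
  assumes "\<rho> 3 = bsize" "eval w m \<rho> b < bsize" "eval w m \<rho> i < bsize"
  shows "eval w m \<rho> (At b i) = view w m (eval w m \<rho> b) (eval w m \<rho> i)"
  using eval_Adr[OF assms] assms(3) by (simp add: view_eq)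

lemma block_eq_iff: "i < bsize \<Longrightarrow> j < bsize \<Longrightarrow> b * bsize + i = c * bsize + j \<longleftrightarrow> b = c \<and> i = j"
proof
  assume "i < bsize" "j < bsize" "b * bsize + i = c * bsize + j"
  then have "(b * bsize + i) div bsize = (c * bsize + j) div bsize" "(b * bsize + i) mod bsize = (c * bsize + j) mod bsize" by simp_all
  then show "b = c \<and> i = j" using \<open>i < bsize\<close> \<open>j < bsize\<close> by simp
qed auto

text \<open>\<open>scatter\<close> in coordinates of block and offset. By
  \<open>block_eq_iff\<close> the coordinates are unique for offsets below
  \<open>bsize\<close>.\<close>

definition vscatter :: "mem \<Rightarrow> nat \<Rightarrow> (nat \<Rightarrow> nat) \<Rightarrow> (nat \<Rightarrow> nat) \<Rightarrow> (nat \<Rightarrow> nat) \<Rightarrow> mem \<Rightarrow> bool" where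
  "vscatter m k \<beta> \<omega> val m' \<longleftrightarrow>
     (\<forall>b i. if \<exists>j<k. \<beta> j = b \<and> \<omega> j = i then \<exists>j<k. \<beta> j = b \<and> \<omega> j = i \<and> view w m' b i = val j
        else view w m' b i = view w m b i)"

lemma run_par2:
  assumes wf: "wf_expr ce" "wf_expr be" "wf_expr oe" "wf_expr ve" "i < 64" "i \<noteq> 3"
    and len: "elen ce + elen be + elen oe + elen ve + 7 \<le> CC"
    and r3: "\<rho> 3 = bsize" and k: "eval w m \<rho> ce = k"
    and \<beta>: "\<And>j. j < k \<Longrightarrow> eval w m (\<rho>(i := j)) be = \<beta> j" "\<And>j. j < k \<Longrightarrow> \<beta> j < bsize"
    and \<omega>: "\<And>j. j < k \<Longrightarrow> eval w m (\<rho>(i := j)) oe = \<omega> j" "\<And>j. j < k \<Longrightarrow> \<omega> j < bsize"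
    and v: "\<And>j. j < k \<Longrightarrow> eval w m (\<rho>(i := j)) ve = val j"
    and post: "\<And>m'. word_memory w m' \<Longrightarrow> vscatter m k \<beta> \<omega> val m' \<Longrightarrow> Q m' \<rho>"
  shows "run w (par i ce (Adr be oe) ve) \<rho> m 1 (k + 1) Q"
  unfolding k[symmetric]
proof (rule run_par)
  fix m' assume wm: "word_memory w m'"
    and sc: "scatter m (eval w m \<rho> ce) (\<lambda>j. eval w m (\<rho>(i := j)) (Adr be oe)) (\<lambda>j. eval w m (\<rho>(i := j)) ve) m'"
  have ad: "eval w m (\<rho>(i := j)) (Adr be oe) = \<beta> j * bsize + \<omega> j" if "j < k" for j
    using eval_Adr[of "\<rho>(i := j)" m be oe] that \<beta> \<omega> r3 wf by simp
  have "vscatter m k \<beta> \<omega> val m'"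
    unfolding vscatter_def
  proof (intro allI)
    fix b x
    show "if \<exists>j<k. \<beta> j = b \<and> \<omega> j = x then \<exists>j<k. \<beta> j = b \<and> \<omega> j = x \<and> view w m' b x = val j
        else view w m' b x = view w m b x"
    proof (cases "x < bsize")
      case True
      have iff: "eval w m (\<rho>(i := j)) (Adr be oe) = b * bsize + x \<longleftrightarrow> \<beta> j = b \<and> \<omega> j = x" if "j < k" for j
        using ad[OF that] block_eq_iff[OF \<omega>(2)[OF that] True] by simp
      have "if \<exists>j<k. \<beta> j = b \<and> \<omega> j = x
        then \<exists>j<k. \<beta> j = b \<and> \<omega> j = x \<and> m' (b * bsize + x) = val j
        else m' (b * bsize + x) = m (b * bsize + x)"
        using sc[unfolded scatter_def k, rule_format, of "b * bsize + x"] iff v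
        by (smt (verit, best))
      then show ?thesis using True by (simp add: view_eq)
    next
      case False
      then have "\<not> (\<exists>j<k. \<beta> j = b \<and> \<omega> j = x)" using \<omega>(2) by blast
      then have "view w m' b x = view w m b x" using False by (simp add: view_eq)
      then show ?thesis using \<open>\<not> (\<exists>j<k. \<beta> j = b \<and> \<omega> j = x)\<close> by meson
    qed
  qed
  then show "Q m' \<rho>" using post wm by blast
qed (use wf len in auto)

text \<open>Injective offsets in a single block exclude write conflicts, so the new contents are
  determined. Most parallel steps of the construction have this form.\<close>

lemma run_fill:
  assumes wf: "wf_expr ce" "wf_expr be" "wf_expr oe" "wf_expr ve" "i < 64" "i \<noteq> 3"
    and len: "elen ce + elen be + elen oe + elen ve + 7 \<le> CC"
    and r3: "\<rho> 3 = bsize" and k: "eval w m \<rho> ce = k"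
    and \<beta>: "\<And>j. j < k \<Longrightarrow> eval w m (\<rho>(i := j)) be = b" "b < bsize"
    and \<omega>: "\<And>j. j < k \<Longrightarrow> eval w m (\<rho>(i := j)) oe = \<omega> j" "\<And>j. j < k \<Longrightarrow> \<omega> j < bsize"
    and inj: "inj_on \<omega> {..<k}"
    and v: "\<And>j. j < k \<Longrightarrow> eval w m (\<rho>(i := j)) ve = val j"
    and post: "\<And>m'. word_memory w m' \<Longrightarrow> (\<And>j. j < k \<Longrightarrow> view w m' b (\<omega> j) = val j) \<Longrightarrow>
      (\<And>b' x. b' \<noteq> b \<or> x \<notin> \<omega> ` {..<k} \<Longrightarrow> view w m' b' x = view w m b' x) \<Longrightarrow> Q m' \<rho>"
  shows "run w (par i ce (Adr be oe) ve) \<rho> m 1 (k + 1) Q"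
proof (rule run_par2[where \<beta> = "\<lambda>_. b" and \<omega> = \<omega> and val = val])
  fix m' assume wm: "word_memory w m'" and sc: "vscatter m k (\<lambda>_. b) \<omega> val m'"
  show "Q m' \<rho>"
  proof (rule post[OF wm])
    fix j assume "j < k"
    then obtain j' where "j' < k" "\<omega> j' = \<omega> j" "view w m' b (\<omega> j) = val j'"
      using sc[unfolded vscatter_def, rule_format, of  b "\<omega> j"] by (auto split: if_splits)
    then show "view w m' b (\<omega> j) = val j" using inj \<open>j < k\<close> by (auto dest: inj_onD)
  next
    fix b' x assume "b' \<noteq> b \<or> x \<notin> \<omega> ` {..<k}"
    then show "view w m' b' x = view w m b' x"
      using sc[unfolded vscatter_def, rule_format, of b' x] by (metis (no_types, lifting) imageI lessThan_iff)
  qed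
qed (use assms in auto)

end

lemma view_less: "word_memory w m \<Longrightarrow> view w m b i < 2 ^ w"
  by (auto simp: view_def word_memory_def)

section \<open>Packing digits into words\<close>

text \<open>The value depends neither on memory nor on the registers from 30 on, so it stays the
  same while a loop changes counters and stores.\<close>

definition cst :: "nat \<Rightarrow> regs \<Rightarrow> expr \<Rightarrow> nat \<Rightarrow> bool" where
  "cst w \<rho> e v \<longleftrightarrow> wf_expr e \<and> (\<forall>m \<rho>'. (\<forall>x<30. \<rho>' x = \<rho> x) \<longrightarrow> eval w m \<rho>' e = v)"

lemma cst_eval: "cst w \<rho> e v \<Longrightarrow> (\<And>x. x < 30 \<Longrightarrow> \<rho>' x = \<rho> x) \<Longrightarrow> eval w m \<rho>' e = v"
  by (auto simp: cst_def)

lemma cst_wf: "cst w \<rho> e v \<Longrightarrow> wf_expr e"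
  by (auto simp: cst_def)

lemma cst_C: "c < 2 ^ w \<Longrightarrow> cst w \<rho> (C c) c"
  and cst_V: "x < 30 \<Longrightarrow> cst w \<rho> (V x) (\<rho> x)"
  and cst_Add: "cst w \<rho> a x \<Longrightarrow> cst w \<rho> b y \<Longrightarrow> x + y < 2 ^ w \<Longrightarrow> cst w \<rho> (Bin Add a b) (x + y)"
  and cst_Mul: "cst w \<rho> a x \<Longrightarrow> cst w \<rho> b y \<Longrightarrow> x * y < 2 ^ w \<Longrightarrow> cst w \<rho> (Bin Mul a b) (x * y)"
  and cst_Div: "cst w \<rho> a x \<Longrightarrow> cst w \<rho> b y \<Longrightarrow> x < 2 ^ w \<Longrightarrow> cst w \<rho> (Bin Div a b) (x div y)"
  by (auto simp: cst_def eval_Add eval_Mul eval_Div)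

text \<open>Horner's rule. All target words are extended in parallel, by one digit per round and
  from the highest digit downwards, as the loop counts down. When the counter is \<open>k\<close>,
  word \<open>j\<close> holds its digits from number \<open>k\<close> on.\<close>

definition pack :: "expr \<Rightarrow> expr \<Rightarrow> expr \<Rightarrow> expr \<Rightarrow> expr \<Rightarrow> expr \<Rightarrow> code" where
  "pack s t ox Wx Fe pe =
     par 32 Wx (Adr t (Bin Add ox (V 32))) (C 0) @
     assign 30 pe @
     loop 30 (par 32 Wx (Adr t (Bin Add ox (V 32)))
       (Bin Add (Bin Mul (At t (Bin Add ox (V 32))) Fe)
                (Bin Mod (At s (Bin Add (Bin Mul (V 32) pe) (V 30))) Fe)))"

context params
begin

lemma run_pack:
  assumes c: "cst w \<rho> s sv" "cst w \<rho> t tv" "cst w \<rho> ox ov" "cst w \<rho> Wx Wv" "cst w \<rho> Fe Fv" "cst w \<rho> pe pv"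
    and r3: "\<rho> 3 = bsize" and b: "sv < bsize" "tv < bsize" "sv \<noteq> tv" "ov + Wv \<le> bsize" "Wv * pv \<le> bsize" "0 < Fv" "Fv ^ pv \<le> 2 ^ w"
    and len: "elen Wx + elen t + elen s + elen ox + elen Fe + elen pe \<le> 60"
    and wm: "word_memory w m" and wr: "wordy w \<rho>"
  shows "run w (pack s t ox Wx Fe pe) \<rho> m (3 * pv + 3) (pv * (Wv + 3) + Wv + 3)
    (\<lambda>m' \<rho>'. \<rho>' = \<rho>(30 := 0) \<and>
      (\<forall>b i. b \<noteq> tv \<or> i < ov \<or> ov + Wv \<le> i \<longrightarrow> view w m' b i = view w m b i) \<and>
      (\<forall>j<Wv. view w m' tv (ov + j) = digits Fv (view w m sv) (j * pv) pv))"
proof -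
  let ?I = "\<lambda>k m' \<rho>'. \<rho>' = \<rho>(30 := k) \<and>
      (\<forall>b i. b \<noteq> tv \<or> i < ov \<or> ov + Wv \<le> i \<longrightarrow> view w m' b i = view w m b i) \<and>
      (\<forall>j<Wv. view w m' tv (ov + j) = digits Fv (view w m sv) (j * pv + k) (pv - k))"
  note wf = c[THEN cst_wf]
  note ev = c[THEN cst_eval]
  have first: "run w (par 32 Wx (Adr t (Bin Add ox (V 32))) (C 0)) \<rho> m 1 (Wv + 1)
     (\<lambda>m' \<rho>'. ?I pv m' (\<rho>'(30 := pv)) \<and> \<rho>' = \<rho>)"
  proof (rule run_fill[where b = tv and \<omega> = "\<lambda>j. ov + j" and val = "\<lambda>_. 0"])
    fix j assume "j < Wv"
    then show "eval w m (\<rho>(32 := j)) (Bin Add ox (V 32)) = ov + j"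
      using b bsize_less by (subst eval_Add) (simp_all add: ev)
  next
    fix m' assume a: "\<And>j. j < Wv \<Longrightarrow> view w m' tv (ov + j) = 0"
      "\<And>b' x. b' \<noteq> tv \<or> x \<notin> (+) ov ` {..<Wv} \<Longrightarrow> view w m' b' x = view w m b' x"
    have im: "x \<notin> (+) ov ` {..<Wv}" if "x < ov \<or> ov + Wv \<le> x" for x using that by auto
    show "?I pv m' (\<rho>(30 := pv)) \<and> \<rho> = \<rho>" using a im by auto
  qed (use wf b ev r3 len in \<open>auto simp: CC_def inj_on_def\<close>)
  have "run w (pack s t ox Wx Fe pe) \<rho> m (1 + (1 + (pv * (1 + 2) + 1))) ((Wv + 1) + (1 + (pv * ((Wv + 1) + 2) + 1)))
     (\<lambda>m' \<rho>'. \<rho>' 30 = 0 \<and> ?I 0 m' \<rho>')"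
    unfolding pack_def
  proof (rule run_append[OF first], elim conjE, rule run_append)
    fix m1 \<rho>1 assume w1: "word_memory w m1" "wordy w \<rho>1" and 1: "\<rho>1 = \<rho>"
      "\<forall>b i. b \<noteq> tv \<or> i < ov \<or> ov + Wv \<le> i \<longrightarrow> view w m1 b i = view w m b i"
      "\<forall>j<Wv. view w m1 tv (ov + j) = digits Fv (view w m sv) (j * pv + pv) (pv - pv)"
    show "run w (assign 30 pe) \<rho>1 m1 1 1 (\<lambda>m' \<rho>'. m' = m1 \<and> \<rho>' = \<rho>(30 := pv))"
      by (rule run_assign) (use wf ev 1 len in \<open>auto simp: CC_def\<close>)
    fix m2 \<rho>2 assume w2: "word_memory w m2" "wordy w \<rho>2" and 2: "m2 = m1 \<and> \<rho>2 = \<rho>(30 := pv)"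
    show "run w (loop 30 (par 32 Wx (Adr t (Bin Add ox (V 32)))
       (Bin Add (Bin Mul (At t (Bin Add ox (V 32))) Fe)
                (Bin Mod (At s (Bin Add (Bin Mul (V 32) pe) (V 30))) Fe)))) \<rho>2 m2
       (pv * (1 + 2) + 1) (pv * ((Wv + 1) + 2) + 1) (\<lambda>m' \<rho>'. \<rho>' 30 = 0 \<and> ?I 0 m' \<rho>')"
    proof (rule run_loop)
      fix k m3 \<rho>3 assume k: "k < pv" and w3: "word_memory w m3" "wordy w \<rho>3" and "\<rho>3 30 = Suc k"
        and I: "?I (Suc k) m3 \<rho>3"
      let ?\<rho> = "\<rho>3(30 := k)"
      have r: "?\<rho> = \<rho>(30 := k)" using I by simp
      show "run w (par 32 Wx (Adr t (Bin Add ox (V 32)))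
       (Bin Add (Bin Mul (At t (Bin Add ox (V 32))) Fe)
                (Bin Mod (At s (Bin Add (Bin Mul (V 32) pe) (V 30))) Fe))) ?\<rho> m3 1 (Wv + 1)
          (\<lambda>m' \<rho>'. \<rho>' 30 = k \<and> ?I k m' \<rho>')"
        unfolding r
      proof (rule run_fill[where b = tv and \<omega> = "\<lambda>j. ov + j" and
            val = "\<lambda>j. digits Fv (view w m sv) (j * pv + k) (pv - k)"])
        fix j assume j: "j < Wv"
        let ?r = "\<rho>(30 := k, 32 := j)"
        show ox: "eval w m3 ?r (Bin Add ox (V 32)) = ov + j"
          using b j bsize_less by (subst eval_Add) (simp_all add: ev)
        have jp: "j * pv + k < Wv * pv"
        proof -
          have "j * pv + k < Suc j * pv" using k by simp
          also have "\<dots> \<le> Wv * pv" using j by (intro mult_right_mono) auto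
          finally show ?thesis .
        qed
        have x: "eval w m3 ?r (Bin Add (Bin Mul (V 32) pe) (V 30)) = j * pv + k"
          using b jp bsize_less by (simp add: eval_Add eval_Mul ev)
        have t: "eval w m3 ?r (At t (Bin Add ox (V 32))) = digits Fv (view w m sv) (j * pv + Suc k) (pv - Suc k)"
          by (subst eval_At) (use ox j b r3 I ev in auto)
        have s: "eval w m3 ?r (At s (Bin Add (Bin Mul (V 32) pe) (V 30))) = view w m sv (j * pv + k)"
          by (subst eval_At) (use x jp b r3 I ev in auto)
        have digits: "digits Fv (view w m sv) (j * pv + k) (pv - k) =
          view w m sv (j * pv + k) mod Fv + Fv * digits Fv (view w m sv) (j * pv + Suc k) (pv - Suc k)"
          using k by (simp add: Suc_diff_Suc[symmetric])
        have "digits Fv (view w m sv) (j * pv + k) (pv - k) < Fv ^ (pv - k)" using b by (intro digits_less)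
        also have "\<dots> \<le> Fv ^ pv" using b by (intro power_increasing) auto
        finally have pl: "digits Fv (view w m sv) (j * pv + k) (pv - k) < 2 ^ w" using b by simp
        have F: "eval w m3 ?r Fe = Fv" by (rule ev) simp
        have sl: "view w m sv (j * pv + k) < 2 ^ w" using wm by (rule view_less)
        have e1: "eval w m3 ?r (Bin Mul (At t (Bin Add ox (V 32))) Fe) =
           digits Fv (view w m sv) (j * pv + Suc k) (pv - Suc k) * Fv"
          by (subst eval_Mul; simp only: t F) (use pl digits in \<open>simp add: mult.commute\<close>)
        have e2: "eval w m3 ?r (Bin Mod (At s (Bin Add (Bin Mul (V 32) pe) (V 30))) Fe) =
           view w m sv (j * pv + k) mod Fv"
          by (subst eval_Mod; simp only: s F) (rule sl)
        show "eval w m3 ?r (Bin Add (Bin Mul (At t (Bin Add ox (V 32))) Fe)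
                (Bin Mod (At s (Bin Add (Bin Mul (V 32) pe) (V 30))) Fe))
              = digits Fv (view w m sv) (j * pv + k) (pv - k)"
          by (subst eval_Add; simp only: e1 e2) (use pl digits in \<open>simp_all add: mult.commute\<close>)
      next
        fix m' assume a: "\<And>j. j < Wv \<Longrightarrow> view w m' tv (ov + j) = digits Fv (view w m sv) (j * pv + k) (pv - k)"
          "\<And>b' x. b' \<noteq> tv \<or> x \<notin> (+) ov ` {..<Wv} \<Longrightarrow> view w m' b' x = view w m3 b' x"
        have im: "x \<notin> (+) ov ` {..<Wv}" if "x < ov \<or> ov + Wv \<le> x" for x using that by auto
        show "(\<rho>(30 := k)) 30 = k \<and> ?I k m' (\<rho>(30 := k))" using a im I by auto
      qed (use wf b ev r3 len in \<open>auto simp: CC_def inj_on_def\<close>)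
    qed (use 1 2 w1 w2 in \<open>auto simp: wordy_def\<close>)
  qed
  then show ?thesis by (rule run_cong_post) (auto simp: algebra_simps)
qed

end

section \<open>Rank and select queries\<close>

lemma run_assign_then:
  assumes "wf_expr e" "x < 64" "elen e < CC" "eval w m \<rho> e = v"
    and "word_memory w m \<Longrightarrow> wordy w (\<rho>(x := v)) \<Longrightarrow> run w c (\<rho>(x := v)) m d k Q"
  shows "run w (assign x e @ c) \<rho> m (Suc d) (Suc k) Q"
proof -
  have "run w (assign x e @ c) \<rho> m (1 + d) (1 + k) Q"
  proof (rule run_append)
    show "run w (assign x e) \<rho> m 1 1 (\<lambda>m' \<rho>'. m' = m \<and> \<rho>' = \<rho>(x := v))"
      by (rule run_assign) (use assms in auto)
  qed (use assms in auto)
  then show ?thesis by simp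
qed

lemma eval_Shl1: "eval w m r b < w \<Longrightarrow> eval w m r (Bin Shl (C (Suc 0)) b) = 2 ^ eval w m r b"
proof -
  assume a: "eval w m r b < w"
  then have "(2::nat) ^ eval w m r b < 2 ^ w" by (rule power_strict_increasing) simp
  moreover have "(1::nat) < 2 ^ w" using a by (intro one_less_power) auto
  then have "Suc 0 mod 2 ^ w = Suc 0" by (simp only: One_nat_def[symmetric] mod_less)
  ultimately show ?thesis by (simp only: eval.simps eval_binop.simps push_bit_eq_mult One_nat_def[symmetric] mult_1 mod_less)
qed

lemma eval_Shr: "eval w m r a < 2 ^ w \<Longrightarrow>
    eval w m r (Bin Shr a b) = eval w m r a div 2 ^ eval w m r b"
  by (simp only: eval.simps(3) eval_binop.simps drop_bit_eq_div mod_less order_le_less_trans[OF div_le_dividend])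

text \<open>A window of \<open>U\<close> bits meets at most two words. If it starts at a word
  boundary, the second word is shifted by all of \<open>w\<close> bits and vanishes modulo
  \<open>2 ^ w\<close>, which settles this case too. The second word may lie behind the bitmap and
  hold anything.\<close>

abbreviation (input) winE :: "nat \<Rightarrow> expr" where
  "winE x \<equiv> Bin Mod (Bin Or
     (Bin Shr (Mem (Bin Add (V 2) (Bin Div (V x) (V 1)))) (Bin Mod (V x) (V 1)))
     (Bin Shl (Mem (Bin Add (Bin Add (V 2) (Bin Div (V x) (V 1))) (C 1))) (Bin Sub (V 1) (Bin Mod (V x) (V 1)))))
     (V 18)"

abbreviation (input) cmpE :: "expr \<Rightarrow> expr" where
  "cmpE k \<equiv> Bin Add (Bin Add (V 3) (C 2)) (Bin Mul k (V 11))"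

abbreviation (input) fldE :: "expr \<Rightarrow> expr \<Rightarrow> expr" where
  "fldE k h \<equiv> Bin Mod (Bin Shr (Mem (Bin Add (cmpE k) (Bin Div h (V 14))))
     (Bin Mul (Bin Mod h (V 14)) (V 13))) (V 15)"

text \<open>\<open>u\<close> and \<open>csize\<close> are taken from the header of the structure,
  where the construction has put the result of its logarithm loop; the other parameters need only
  constantly many operations.\<close>

definition qparams :: code where
  "qparams = assign 10 (Mem (V 3)) @ assign 11 (Mem (Bin Add (V 3) (C 1))) @
     assign 17 (Bin Mul (V 10) (V 10)) @ assign 12 (Bin Mul (V 17) (V 17)) @
     assign 13 (Bin Mul (C 5) (V 10)) @ assign 14 (Bin Div (V 1) (V 13)) @
     assign 15 (Bin Shl (C 1) (V 13)) @ assign 16 (Bin Mul (V 12) (V 1)) @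
     assign 18 (Bin Shl (C 1) (V 12)) @ []"

text \<open>The rank of the ones is an absolute count, plus a relative count, plus the number of
  ones in the window cut off after \<open>i mod U\<close> bits, for which the table is consulted.
  Zeros are obtained by subtraction.\<close>

definition rk_code :: code where
  "rk_code = qparams @
     assign 20 (Bin Div (V 5) (V 12)) @
     assign 21 (Bin Mul (V 20) (V 12)) @
     assign 22 (winE 21) @
     assign 23 (fldE (C 1) (V 20)) @
     assign 24 (Bin Mod (V 22) (Bin Shl (C 1) (Bin Mod (V 5) (V 12)))) @
     assign 25 (Bin Add (Bin Add (Mem (Bin Add (cmpE (C 0)) (Bin Div (V 21) (V 16)))) (V 23))
        (Mem (Bin Add (Bin Add (cmpE (C 2)) (Bin Mul (V 24) (Bin Add (V 12) (C 1)))) (V 12)))) @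
     assign 0 (Ite (V 4) (V 25) (Bin Sub (V 5) (V 25))) @ []"

text \<open>For zeros the window is complemented, so that one table serves both bits. All candidates
  for the answer are computed and then selected by two conditions: register 28 tells whether the
  window contains enough occurrences, the last comparison whether the group spans less than
  \<open>F\<close> positions.\<close>

definition sl_code :: code where
  "sl_code = qparams @
     assign 19 (Bin Sub (V 5) (C 1)) @
     assign 20 (Bin Div (V 19) (V 17)) @
     assign 21 (Bin Div (V 19) (V 16)) @
     assign 22 (Mem (Bin Add (cmpE (Bin Add (C 3) (V 4))) (V 21))) @
     assign 23 (Mem (Bin Add (cmpE (Bin Add (C 3) (V 4))) (Bin Add (V 21) (C 1)))) @
     assign 24 (Bin Add (V 22) (fldE (Bin Add (C 7) (V 4)) (V 20))) @
     assign 25 (winE 24) @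
     assign 25 (Ite (V 4) (V 25) (Bin Xor (V 25) (Bin Sub (V 18) (C 1)))) @
     assign 26 (Bin Sub (V 19) (Bin Mul (V 20) (V 17))) @
     assign 27 (Bin Add (cmpE (C 2)) (Bin Mul (V 25) (Bin Add (V 12) (C 1)))) @
     assign 28 (Bin Less (V 26) (Mem (Bin Add (V 27) (V 12)))) @
     assign 29 (Ite (V 28) (Bin Add (V 24) (Mem (Bin Add (V 27) (V 26))))
        (Bin Add (V 22) (fldE (Bin Add (C 9) (V 4)) (Bin Add (Bin Mul (Bin Div (V 24) (V 12)) (V 17)) (V 26))))) @
     assign 0 (Ite (Bin Less (Bin Sub (V 23) (V 22)) (V 15)) (V 29)
        (Mem (Bin Add (cmpE (Bin Add (C 5) (V 4)))
           (Bin Add (Bin Mul (Bin Div (V 22) (V 15)) (V 16)) (Bin Mod (V 19) (V 16)))))) @ []"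

context params
begin

definition field_at :: "(nat \<Rightarrow> nat \<Rightarrow> nat) \<Rightarrow> nat \<Rightarrow> nat \<Rightarrow> nat" where
  "field_at c k h = c k (h div per) div 2 ^ ((h mod per) * f) mod F"

definition Pb :: "(nat \<Rightarrow> bool) \<Rightarrow> bool \<Rightarrow> nat \<Rightarrow> nat" where
  "Pb \<beta> b = pos (\<lambda>p. \<beta> p = b) n"

text \<open>The structure consists of the words \<open>u\<close> and \<open>csize\<close>, followed by eleven components of \<open>csize\<close>
  words each; \<open>c k i\<close> is word \<open>i\<close> of component \<open>k\<close>.\<close>

definition lay_rank :: "(nat \<Rightarrow> nat \<Rightarrow> nat) \<Rightarrow> (nat \<Rightarrow> bool) \<Rightarrow> bool" where
  "lay_rank c \<beta> \<longleftrightarrow>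
     (\<forall>g \<le> n div A. c 0 g = rnk \<beta> (g * A)) \<and>
     (\<forall>h \<le> n div U. field_at c 1 h = rnk \<beta> (h * U) - rnk \<beta> (h * U div A * A))"

text \<open>\<open>U + 1\<close> words for each window \<open>y\<close>: the positions of its ones, and in the last one their number.\<close>

definition lay_table :: "(nat \<Rightarrow> nat \<Rightarrow> nat) \<Rightarrow> bool" where
  "lay_table c \<longleftrightarrow>
     (\<forall>y < 2 ^ U. c 2 (y * (U + 1) + U) = rnk (bit y) U \<and>
        (\<forall>r < rnk (bit y) U. c 2 (y * (U + 1) + r) = ones (bit y) U ! r))"

text \<open>The words not mentioned here are arbitrary, so a query never relies on them: whether a group is
  stored explicitly is seen from the next sample, whether an element is, from the table.\<close>

definition lay_select :: "(nat \<Rightarrow> nat \<Rightarrow> nat) \<Rightarrow> bool \<Rightarrow> (nat \<Rightarrow> nat) \<Rightarrow> bool" where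
  "lay_select c b P \<longleftrightarrow>
     (\<forall>g \<le> n div A + 1. c (3 + of_bool b) g = P (g * A)) \<and>
     (\<forall>j. P j < n \<and> F \<le> P ((j div A + 1) * A) - P (j div A * A) \<longrightarrow>
        c (5 + of_bool b) (P (j div A * A) div F * A + j mod A) = P j) \<and>
     (\<forall>h \<le> n div Bs. field_at c (7 + of_bool b) h = (P (h * Bs) - P (h * Bs div A * A)) mod F) \<and>
     (\<forall>j. P j < n \<and> P (j div Bs * Bs) + U \<le> P j \<longrightarrow>
        field_at c (9 + of_bool b) (P (j div Bs * Bs) div U * Bs + j mod Bs) = (P j - P (j div A * A)) mod F)"

definition lay :: "(nat \<Rightarrow> nat \<Rightarrow> nat) \<Rightarrow> (nat \<Rightarrow> bool) \<Rightarrow> bool" where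
  "lay c \<beta> \<longleftrightarrow> lay_rank c \<beta> \<and> lay_table c \<and> (\<forall>b. lay_select c b (Pb \<beta> b))"

definition st :: "mem \<Rightarrow> nat \<Rightarrow> nat \<Rightarrow> nat \<Rightarrow> nat" where
  "st m q k i = m (q + 2 + k * csize + i)"

lemma csize_R1: "g \<le> n div A + 1 \<Longrightarrow> g < csize"
  unfolding csize_def by linarith

lemma csize_R2: "h \<le> n div U \<Longrightarrow> h div per < csize"
proof -
  assume "h \<le> n div U"
  then have "h \<le> (n div U + 1) * Bs" using Bs_pos by (cases Bs) auto
  then have "h div per \<le> (n div U + 1) * Bs div per" by (rule div_le_mono)
  then show ?thesis unfolding csize_def by linarith
qed

lemma csize_tab: "y < 2 ^ U \<Longrightarrow> r \<le> U \<Longrightarrow> y * (U + 1) + r < csize"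
proof -
  assume "y < 2 ^ U" "r \<le> U"
  then have "y * (U + 1) + r < Suc y * (U + 1)" by simp
  also have "\<dots> \<le> 2 ^ U * (U + 1)" using \<open>y < 2 ^ U\<close> by (intro mult_right_mono) auto
  finally show ?thesis unfolding csize_def by (simp add: mult.commute)
qed

lemma csize_E1: "x \<le> n \<Longrightarrow> r < A \<Longrightarrow> x div F * A + r < csize"
proof -
  assume "x \<le> n" "r < A"
  then have "x div F * A + r < (x div F + 1) * A" by simp
  also have "\<dots> \<le> (n div F + 1) * A" using \<open>x \<le> n\<close> by (intro mult_right_mono) (auto intro: div_le_mono)
  finally show ?thesis unfolding csize_def by linarith
qed

lemma csize_S2: "h \<le> n div Bs \<Longrightarrow> h div per < csize"
proof -
  assume "h \<le> n div Bs"
  then have "h div per \<le> (n div Bs + 1) div per" by (intro div_le_mono) simp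
  then show ?thesis unfolding csize_def by linarith
qed

lemma E2_less: "x \<le> n \<Longrightarrow> r < Bs \<Longrightarrow> x div U * Bs + r < (n div U + 1) * Bs"
proof -
  assume "x \<le> n" "r < Bs"
  then have "x div U * Bs + r < (x div U + 1) * Bs" by simp
  also have "\<dots> \<le> (n div U + 1) * Bs" using \<open>x \<le> n\<close> by (intro mult_right_mono) (auto intro: div_le_mono)
  finally show ?thesis .
qed

lemma csize_E2: "x \<le> n \<Longrightarrow> r < Bs \<Longrightarrow> (x div U * Bs + r) div per < csize"
proof -
  assume "x \<le> n" "r < Bs"
  then have "(x div U * Bs + r) div per \<le> (n div U + 1) * Bs div per"
    using E2_less by (intro div_le_mono) (simp add: less_imp_le)
  then show ?thesis unfolding csize_def by linarith
qed

lemma Pb_le: "Pb \<beta> b j \<le> n" by (simp add: Pb_def pos_le)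

text \<open>A query has to work in any memory that agrees with the given one on the words of the
  structure. All cells that \<open>lay\<close> speaks of have an index below \<open>csize\<close> in
  one of the eleven components.\<close>

lemma lay_transfer:
  assumes "lay c \<beta>" and c: "\<And>k i. k < 11 \<Longrightarrow> i < csize \<Longrightarrow> c' k i = c k i"
  shows "lay c' \<beta>"
proof -
  have fl: "field_at c' k h = field_at c k h" if "k < 11" "h div per < csize" for k h
    using that c by (simp add: field_at_def)
  have "lay_rank c' \<beta>" using assms(1) unfolding lay_def lay_rank_def
    by (auto simp: c csize_R1 csize_R2 fl)
  moreover have "lay_table c'" 
  proof -
    have "y * (U + 1) + r < csize" if "y < 2 ^ U" "r < rnk (bit y) U" for y r
      using that rnk_le[of "bit y" U] by (intro csize_tab) auto
    moreover have "y * (U + 1) + U < csize" if "y < 2 ^ U" for y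
      using that by (intro csize_tab) auto
    ultimately show ?thesis using assms(1) unfolding lay_def lay_table_def using c[of 2] by auto
  qed
  moreover have "lay_select c' b (Pb \<beta> b)" for b
    using assms(1) unfolding lay_def lay_select_def 
    by (auto simp: c fl csize_R1 csize_S2 csize_E1 csize_E2 Pb_le A_pos Bs_pos of_bool_def)
  ultimately show ?thesis by (simp add: lay_def)
qed

end

context params
begin

lemma G_1000: "1000 \<le> G"
  using G_big by simp

lemma const_small [simp]: "(c::nat) \<le> 1000 \<Longrightarrow> c mod 2 ^ w = c"
  using G_1000 G_bsize1 bsize_less by simp

declare w_pos [simp]

end

text \<open>As \<open>m1\<close> is a word, its shifted copy has no bits from \<open>w - s\<close>
  on, where those of \<open>m2\<close> begin; so the bitwise or is a concatenation.\<close>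

lemma window_bit:
  assumes "(m1::nat) < 2 ^ w" "m2 < 2 ^ w" "k < U" "U \<le> w" "s < w"
  shows "bit (or (drop_bit s m1 mod 2 ^ w) (push_bit (w - s) m2 mod 2 ^ w) mod 2 ^ w mod 2 ^ U) k =
     (if s + k < w then bit m1 (s + k) else bit m2 (s + k - w))"
proof -
  have "\<not> bit m1 (s + k)" if "\<not> s + k < w"
    using assms(1) that by (metis bit_take_bit_iff take_bit_nat_eq_self_iff)
  then show ?thesis using assms
    by (auto simp: take_bit_eq_mod[symmetric] bit_simps add.commute)
qed

lemma xor_mask:
  assumes "(v::nat) < 2 ^ U"
  shows "xor v (2 ^ U - 1) < 2 ^ U" and "k < U \<Longrightarrow> bit (xor v (2 ^ U - 1)) k = (\<not> bit v k)"
proof -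
  have "take_bit U (xor v (2 ^ U - 1)) = xor v (2 ^ U - 1)"
    using assms by (simp add: take_bit_xor take_bit_nat_eq_self flip: mask_eq_exp_minus_1)
  then show "xor v (2 ^ U - 1) < 2 ^ U" by (simp only: take_bit_nat_eq_self_iff)
  show "k < U \<Longrightarrow> bit (xor v (2 ^ U - 1)) k = (\<not> bit v k)"
    unfolding mask_eq_exp_minus_1[symmetric] by (simp add: bit_simps)
qed

section \<open>Correctness of the query programs\<close>

text \<open>All that a query may rely on. A whole block fits behind \<open>p\<close> and behind
  \<open>q\<close>, so that even a read slightly past the end of the bitmap has an address that does
  not wrap around.\<close>

locale query = params +
  fixes m :: mem and p q :: nat and \<beta> :: "nat \<Rightarrow> bool"
  assumes wm: "word_memory w m" and p: "p + bsize \<le> 2 ^ w" and q: "q + bsize \<le> 2 ^ w"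
    and bits: "\<And>i. i < n \<Longrightarrow> bit (m (p + i div w)) (i mod w) = \<beta> i"
    and head: "m q = u" "m (q + 1) = csize"
    and lay: "lay (st m q) \<beta>"
begin

lemma le_G_word: "x \<le> 100 * G \<Longrightarrow> x < 2 ^ w"
  using G_bsize1 bsize_less by linarith

definition qp :: "regs \<Rightarrow> bool" where
  "qp \<rho> \<longleftrightarrow> \<rho> 1 = w \<and> \<rho> 2 = p \<and> \<rho> 3 = q \<and> \<rho> 10 = u \<and> \<rho> 11 = csize \<and> \<rho> 12 = U \<and> \<rho> 13 = f \<and>
     \<rho> 14 = per \<and> \<rho> 15 = F \<and> \<rho> 16 = A \<and> \<rho> 17 = Bs \<and> \<rho> 18 = 2 ^ U"

lemma m_less: "m a < 2 ^ w" using wm by (simp add: word_memory_def)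

lemma run_qparams:
  assumes "\<rho> 1 = w" "\<rho> 2 = p" "\<rho> 3 = q" "wordy w \<rho>"
  shows "run w qparams \<rho> m 9 9 (\<lambda>m' \<rho>'. m' = m \<and> qp \<rho>' \<and> \<rho>' 4 = \<rho> 4 \<and> \<rho>' 5 = \<rho> 5)"
proof -
  have "Bs * Bs < 2 ^ w" using smalls unfolding U_eq[symmetric] by (auto intro: le_G_word)
  moreover have "u * u < 2 ^ w" "5 * u < 2 ^ w" "w < 2 ^ w" "U * w < 2 ^ w"
    using smalls A_le_G w_le_G unfolding A_def f_def Bs_def power2_eq_square
    by (auto intro: le_G_word)
  ultimately have l: "u * u < 2 ^ w" "Bs * Bs < 2 ^ w" "5 * u < 2 ^ w" "w < 2 ^ w" "U * w < 2 ^ w"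
    by auto
  have s: "f < w" "U < w" using U_w f_le_U by linarith+
  have q1: "q + 1 < 2 ^ w" using q csize_bsize by linarith
  have n9: "9 = Suc (Suc (Suc (Suc (Suc (Suc (Suc (Suc (Suc 0))))))))" by simp
  have w0: "5 < (2::nat) ^ w" "2 < (2::nat) ^ w" "1 < (2::nat) ^ w" using G_big by (auto intro: le_G_word)
  show ?thesis unfolding qparams_def n9
    apply (rule run_assign_then[where v = u], simp, simp, simp add: CC_def, simp add: assms head)
    apply (rule run_assign_then[where v = csize], simp, simp, simp add: CC_def, use assms head q1 w0 in \<open>simp add: eval_Add\<close>)
    apply (rule run_assign_then[where v = Bs], simp, simp, simp add: CC_def,
       use l in \<open>simp add: eval_Mul Bs_def power2_eq_square\<close>)
    apply (rule run_assign_then[where v = U], simp, simp, simp add: CC_def,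
       use l in \<open>simp add: eval_Mul U_eq\<close>)
    apply (rule run_assign_then[where v = f], simp, simp, simp add: CC_def,
       use l w0 in \<open>simp add: eval_Mul f_def\<close>)
    apply (rule run_assign_then[where v = per], simp, simp, simp add: CC_def,
       use l assms in \<open>simp add: eval_Div per_def\<close>)
    apply (rule run_assign_then[where v = F], simp, simp, simp add: CC_def,
       use s in \<open>simp add: eval_Shl1 F_def\<close>)
    apply (rule run_assign_then[where v = A], simp, simp, simp add: CC_def,
       use l assms in \<open>simp add: eval_Mul A_def\<close>)
    apply (rule run_assign_then[where v = "2 ^ U"], simp, simp, simp add: CC_def,
       use s in \<open>simp add: eval_Shl1\<close>)
    apply (rule run_Nil, use assms in \<open>simp add: qp_def\<close>)
    done
qed

lemma eval_cmp:
  assumes "qp \<rho>" "eval w m \<rho> k = kv" "kv < 11" "eval w m \<rho> i = x" "x \<le> csize"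
  shows "eval w m \<rho> (Mem (Bin Add (cmpE k) i)) = st m q kv x"
proof -
  have "kv * csize \<le> 10 * csize" using assms by (intro mult_right_mono) auto
  then have b: "q + 2 + kv * csize + x < 2 ^ w" using assms q csize_bsize by linarith
  have "eval w m \<rho> (Bin Add (V 3) (C 2)) = q + 2"
    using b assms(1) by (subst eval_Add) (auto simp: qp_def)
  moreover have "eval w m \<rho> (Bin Mul k (V 11)) = kv * csize"
    using b assms(1,2) by (subst eval_Mul) (auto simp: qp_def)
  ultimately have "eval w m \<rho> (cmpE k) = q + 2 + kv * csize"
    using b by (subst eval_Add) auto
  then have "eval w m \<rho> (Bin Add (cmpE k) i) = q + 2 + kv * csize + x"
    using b assms(4) by (subst eval_Add) auto
  then show ?thesis by (simp add: st_def)
qed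

lemma eval_fld:
  assumes "qp \<rho>" "eval w m \<rho> k = kv" "kv < 11" "eval w m \<rho> h = x" "x div per < csize" "x < 2 ^ w"
  shows "eval w m \<rho> (fldE k h) = field_at (st m q) kv x"
proof -
  have 1: "eval w m \<rho> (Mem (Bin Add (cmpE k) (Bin Div h (V 14)))) = st m q kv (x div per)"
    by (rule eval_cmp) (use assms in \<open>auto simp: eval_Div qp_def\<close>)
  have "x mod per * f \<le> f * per" using per_pos by (simp add: mult.commute less_imp_le)
  also have "\<dots> < 2 ^ w" using f_per by (meson le_less_trans less_exp)
  finally have 2: "eval w m \<rho> (Bin Mul (Bin Mod h (V 14)) (V 13)) = (x mod per) * f"
    using assms by (subst eval_Mul) (auto simp: eval_Mod qp_def)
  have "st m q kv (x div per) < 2 ^ w" using m_less by (simp add: st_def)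
  then have "eval w m \<rho> (Bin Shr (Mem (Bin Add (cmpE k) (Bin Div h (V 14))))
     (Bin Mul (Bin Mod h (V 14)) (V 13))) = st m q kv (x div per) div 2 ^ (x mod per * f)" (is "?a = ?b")
    using 1 2 by (subst eval_Shr) auto
  moreover have "?b < 2 ^ w" using \<open>st m q kv (x div per) < 2 ^ w\<close> by (meson div_le_dividend le_less_trans)
  ultimately show ?thesis using assms(1) by (subst eval_Mod) (auto simp: field_at_def qp_def)
qed

text \<open>The start may exceed \<open>n\<close> by up to \<open>F\<close>: in an explicit group,
  select computes its window from a truncated sample. The result is then discarded, but it still has
  to be a legal index into the table.\<close>

lemma eval_win:
  assumes "qp \<rho>" "\<rho> x = y" "y \<le> n + F"
  shows "eval w m \<rho> (winE x) < 2 ^ U \<and> (\<forall>k<U. y + k < n \<longrightarrow> bit (eval w m \<rho> (winE x)) k = \<beta> (y + k))"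
proof -
  have "y \<le> 2 * G" using assms(3) n_le_G F_le_G by linarith
  then have yw: "y < 2 ^ w" by (intro le_G_word) simp
  have "y div w \<le> y" by simp
  then have "y div w + 1 < bsize" using \<open>y \<le> 2 * G\<close> G_bsize1 G_1000 by linarith
  then have b: "p + y div w + 1 < 2 ^ w" using p by linarith
  let ?s = "y mod w"
  have s: "?s < w" using w_pos by simp
  have 1: "eval w m \<rho> (Bin Add (V 2) (Bin Div (V x) (V 1))) = p + y div w"
    using assms b yw by (subst eval_Add) (auto simp: eval_Div qp_def)
  have 2: "eval w m \<rho> (Bin Add (Bin Add (V 2) (Bin Div (V x) (V 1))) (C 1)) = p + y div w + 1"
    using b 1 by (subst eval_Add) auto
  have 3: "eval w m \<rho> (Bin Mod (V x) (V 1)) = ?s" using assms yw by (simp add: eval_Mod qp_def)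
  have 4: "eval w m \<rho> (Bin Sub (V 1) (Bin Mod (V x) (V 1))) = w - ?s"
    using assms 3 s by (subst eval_Sub) (auto simp: qp_def)
  let ?m1 = "m (p + y div w)" and ?m2 = "m (p + y div w + 1)"
  let ?e = "or (drop_bit ?s ?m1 mod 2 ^ w) (push_bit (w - ?s) ?m2 mod 2 ^ w) mod 2 ^ w"
  have e: "eval w m \<rho> (winE x) = ?e mod 2 ^ U"
  proof (subst eval_Mod)
    show "eval w m \<rho> (Bin Or (Bin Shr (Mem (Bin Add (V 2) (Bin Div (V x) (V 1)))) (Bin Mod (V x) (V 1)))
     (Bin Shl (Mem (Bin Add (Bin Add (V 2) (Bin Div (V x) (V 1))) (C 1))) (Bin Sub (V 1) (Bin Mod (V x) (V 1)))))
       mod eval w m \<rho> (V 18) = ?e mod 2 ^ U"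
      using assms(1) by (simp only: eval.simps(3)[of _ _ _ Or] eval.simps(3)[of _ _ _ Shr] eval.simps(3)[of _ _ _ Shl]
        eval_binop.simps eval.simps(4) eval.simps(2) 1 2 3 4 qp_def)
  qed (simp add: eval.simps(3))
  have "bit (?e mod 2 ^ U) k = \<beta> (y + k)" if k: "k < U" "y + k < n" for k
  proof -
    have kw: "k < w" using k(1) U_w by simp
    have "bit (?e mod 2 ^ U) k = (if ?s + k < w then bit ?m1 (?s + k) else bit ?m2 (?s + k - w))"
      by (rule window_bit) (use m_less k U_w s in auto)
    also have "\<dots> = bit (m (p + (y + k) div w)) ((y + k) mod w)"
    proof (cases "?s + k < w")
      case True
      have "(y + k) div w = y div w" "(y + k) mod w = ?s + k"
        using True by (metis div_mult_mod_eq add.assoc div_mult_self3 mod_mult_self3 div_less mod_less add.right_neutral w_pos not_less_zero neq0_conv)+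
      then show ?thesis using True by simp
    next
      case False
      have "y + k = (y div w + 1) * w + (?s + k - w)" using False div_mult_mod_eq[of y w] by (simp only: add_mult_distrib mult_1)
      moreover have "?s + k - w < w" using s kw by linarith
      ultimately have "(y + k) div w = y div w + 1" "(y + k) mod w = ?s + k - w"
        by (metis add.right_neutral div_less div_mult_self3 w_pos neq0_conv not_less_zero, metis mod_less mod_mult_self3)
      then show ?thesis using False by (simp add: add.assoc)
    qed
    finally show ?thesis using bits k(2) by simp
  qed
  then show ?thesis unfolding e by simp
qed

lemma bool_rnk: "i \<le> n \<Longrightarrow> rnk (\<lambda>p. \<beta> p = b) i = (if b then rnk \<beta> i else i - rnk \<beta> i)"
  by (simp add: rnk_not)

lemma qp_upd: "qp \<rho> \<Longrightarrow> 19 \<le> a \<or> a = 0 \<Longrightarrow> qp (\<rho>(a := z))"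
  by (auto simp: qp_def)

lemma run_rk:
  assumes r: "\<rho>0 1 = w" "\<rho>0 2 = p" "\<rho>0 3 = q" "\<rho>0 4 = of_bool b" "\<rho>0 5 = i" "i \<le> n" "wordy w \<rho>0"
  shows "run w rk_code \<rho>0 m 16 16 (\<lambda>m' \<rho>'. m' = m \<and> \<rho>' 0 = rnk (\<lambda>p. \<beta> p = b) i)"
  unfolding rk_code_def
proof (rule run_cong_post[OF run_append[where ?d2.0 = "Suc (Suc (Suc (Suc (Suc (Suc (Suc 0))))))"
     and ?k2.0 = "Suc (Suc (Suc (Suc (Suc (Suc (Suc 0))))))"
     and Q = "\<lambda>m' \<rho>'. m' = m \<and> \<rho>' 0 = rnk (\<lambda>p. \<beta> p = b) i", OF run_qparams]], goal_cases)
  case (5 m' \<rho>)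
  then have qp: "qp \<rho>" and [simp]: "m' = m" and r4: "\<rho> 4 = of_bool b" "\<rho> 5 = i" using r by auto
  define h where "h = i div U"
  define x where "x = h * U"
  have iG: "i \<le> G" using r n_le_G by linarith
  have xi: "x + i mod U = i" by (simp add: x_def h_def)
  have x: "x \<le> i" using xi by linarith
  have iw: "i < 2 ^ w" "x < 2 ^ w" using iG x by (auto intro!: le_G_word)
  have hn: "h \<le> n div U" unfolding h_def using r by (intro div_le_mono)
  have hw: "h < 2 ^ w" using div_le_dividend[of i U] iG unfolding h_def by (intro le_G_word) linarith
  have xA: "x div A \<le> n div A" using x r by (intro div_le_mono) linarith
  define c1 where "c1 = rnk \<beta> (x div A * A)"
  define c2 where "c2 = rnk \<beta> x - c1"
  have c12: "c1 + c2 = rnk \<beta> x" unfolding c2_def c1_def using rnk_mono[of "x div A * A" x \<beta>] by simp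
  have L: "st m q 0 (x div A) = c1" "field_at (st m q) 1 h = c2"
    using lay xA hn unfolding lay_def lay_rank_def c2_def c1_def x_def by auto
  define \<rho>1 where "\<rho>1 = \<rho>(20 := h, 21 := x)"
  have q1: "qp \<rho>1" unfolding \<rho>1_def by (intro qp_upd qp) auto
  define v where "v = eval w m \<rho>1 (winE 21)"
  define y where "y = v mod 2 ^ (i mod U)"
  have vb: "v < 2 ^ U" "\<And>k. k < U \<Longrightarrow> x + k < n \<Longrightarrow> bit v k = \<beta> (x + k)"
    using eval_win[OF q1, of 21 x] x r(6) unfolding v_def by (auto simp: \<rho>1_def)
  have y: "y < 2 ^ U" unfolding y_def using vb(1) by (meson le_less_trans mod_less_eq_dividend)
  have "rnk \<beta> (x + i mod U) = rnk \<beta> x + rnk (bit y) (i mod U)"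
  proof (rule rnk_window)
    fix k assume k: "k < i mod U"
    then have "k < U" by (metis U_pos less_trans mod_less_divisor)
    then show "bit y k = \<beta> (x + k)"
      using vb(2)[of k] k xi r(6) unfolding y_def by (simp add: bit_take_bit_iff flip: take_bit_eq_mod)
  qed
  \<comment> \<open>The bits cut off are zero, so the table entry, which counts in all
    \<open>U\<close> bits, is the count in the first \<open>i mod U\<close> bits.\<close>
  moreover have "rnk (bit y) (i mod U + d) = rnk (bit y) (i mod U)" for d
    by (induction d) (auto simp: y_def bit_take_bit_iff simp flip: take_bit_eq_mod)
  from this[of "U - i mod U"] have "rnk (bit y) U = rnk (bit y) (i mod U)" using U_pos by (simp add: less_imp_le)
  ultimately have rk: "c1 + c2 + rnk (bit y) U = rnk \<beta> i" using xi c12 by simp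
  have T: "st m q 2 (y * (U + 1) + U) = rnk (bit y) U"
    using lay y unfolding lay_def lay_table_def by auto
  have le: "rnk \<beta> i \<le> i" by (rule rnk_le)
  have cw: "c1 + c2 < 2 ^ w" "c1 + c2 + rnk (bit y) U < 2 ^ w" using rk le iw by linarith+
  have c2w: "c2 < 2 ^ w" using cw by linarith
  have Uw: "i mod U < w" using U_w mod_less_divisor[OF U_pos, of i] by linarith
  have tabZ: "y * (U + 1) + U < csize" by (rule csize_tab) (use y in auto)
  have tab: "y * (U + 1) + U < 2 ^ w" using tabZ csize_bsize bsize_less by linarith
  have U1: "U + 1 < 2 ^ w" using smalls G_1000 by (intro le_G_word) linarith
  have vw: "v < 2 ^ w" unfolding v_def using wm 5(2) iw hw unfolding \<rho>1_def by (intro eval_less wordy_upd)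
  have yw: "y < 2 ^ w" using vw unfolding y_def by (meson le_less_trans mod_less_eq_dividend)
  note ups = qp_upd[of _ 20] qp_upd[of _ 21] qp_upd[of _ 22] qp_upd[of _ 23] qp_upd[of _ 24] qp_upd[of _ 25]
  have qs: "\<rho>' 12 = U" "\<rho>' 16 = A" "\<rho>' 18 = 2 ^ U" if "qp \<rho>'" for \<rho>' using that by (auto simp: qp_def)
  show ?case unfolding \<open>m' = m\<close>
  proof (rule run_assign_then[where v = h], goal_cases)
    case 4 then show ?case using iw r4 qs[OF qp] by (simp add: eval_Div h_def)
  next
    case 5 show ?case
    proof (rule run_assign_then[where v = x], goal_cases)
      case 4 then show ?case using iw r4 qs[OF qp] by (simp add: eval_Mul x_def)
    next
      case 5 show ?case unfolding \<rho>1_def[symmetric]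
      proof (rule run_assign_then[where v = v], goal_cases)
        case 5
        have q2: "qp (\<rho>1(22 := v))" using q1 by (rule qp_upd) simp
        show ?case
        proof (rule run_assign_then[where v = c2], goal_cases)
          case 4 show ?case unfolding L(2)[symmetric]
            by (rule eval_fld[OF q2]) (use hw csize_R2[OF hn] in \<open>auto simp: \<rho>1_def\<close>)
        next
          case 5 show ?case
          proof (rule run_assign_then[where v = y], goal_cases)
            case 4 show ?case
              using r4 iw vw Uw qs[OF q2] by (simp add: eval_Mod eval_Shl1 y_def \<rho>1_def)
          next
            case 5
            let ?\<rho> = "\<rho>1(22 := v, 23 := c2, 24 := y)"
            have q3: "qp ?\<rho>" by (intro qp_upd q1) auto
            have e1: "eval w m ?\<rho> (Mem (Bin Add (cmpE (C 0)) (Bin Div (V 21) (V 16)))) = c1"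
              unfolding L(1)[symmetric]
              by (rule eval_cmp[OF q3]) (use iw xA csize_R1[of "x div A"] qs[OF q3] in \<open>auto simp: eval_Div \<rho>1_def\<close>)
            have ea: "eval w m ?\<rho> (Bin Add (V 12) (C 1)) = U + 1"
              using U1 qs[OF q3] by (simp add: eval_Add)
            have eb: "eval w m ?\<rho> (Bin Mul (V 24) (Bin Add (V 12) (C 1))) = y * (U + 1)"
              using ea tab by (subst eval_Mul) auto
            have q3': "\<rho>1 3 = q" "\<rho>1 11 = csize" "\<rho>1 12 = U" using q1 by (auto simp: qp_def)
            have b: "q + 2 + 2 * csize + (y * (U + 1) + U) < 2 ^ w" using tabZ q csize_bsize by linarith
            have ec: "eval w m ?\<rho> (Bin Add (Bin Add (cmpE (C 2)) (Bin Mul (V 24) (Bin Add (V 12) (C 1)))) (V 12))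
               = q + 2 + 2 * csize + (y * (U + 1) + U)"
              using b eb q3' by (simp add: eval_Add eval_Mul)
            have e2: "eval w m ?\<rho> (Mem (Bin Add (Bin Add (cmpE (C 2)) (Bin Mul (V 24) (Bin Add (V 12) (C 1)))) (V 12)))
               = rnk (bit y) U"
              unfolding T[symmetric] eval.simps(4) ec by (simp add: st_def add.assoc)
            have v23: "eval w m ?\<rho> (V 23) = c2" by simp
            show ?case
            proof (rule run_assign_then[where v = "rnk \<beta> i"], goal_cases)
              case 4
              have "eval w m ?\<rho> (Bin Add (Mem (Bin Add (cmpE (C 0)) (Bin Div (V 21) (V 16)))) (V 23)) = c1 + c2"
                using cw e1 v23 by (subst eval_Add) auto
              then show ?case using e2 cw rk by (subst eval_Add) auto
            next
              case 5
              show ?case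
              proof (rule run_assign_then[where v = "rnk (\<lambda>p. \<beta> p = b) i"], goal_cases)
                case 4
                show ?case
                  using 5 r4 le iw bool_rnk[OF r(6), of b] by (subst eval_Ite[where P = b]) (auto simp: \<rho>1_def eval_Sub)
              qed (auto intro: run_Nil simp: CC_def)
            qed (auto simp: CC_def)
          qed (auto simp: CC_def)
        qed (auto simp: CC_def)
      qed (auto simp: CC_def v_def)
    qed (auto simp: CC_def)
  qed (auto simp: CC_def)
qed (use r in auto)

end

context query
begin

text \<open>\<open>A\<close> is a multiple of \<open>Bs\<close>, hence an occurrence and the sample
  preceding it belong to the same group.\<close>

lemma block_div: "j div Bs * Bs div A = j div A"
proof -
  have A: "A = Bs * (Bs * w)" by (simp add: A_def U_eq mult.assoc)
  show ?thesis unfolding A div_mult2_eq using Bs_pos by simp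
qed

text \<open>Three cases: an explicit group is answered by its slot, and in the other groups the
  window decides between the table and the packed explicit element. The values computed for the
  cases that do not apply are arbitrary words.\<close>

lemma run_sl:
  assumes r: "\<rho>0 1 = w" "\<rho>0 2 = p" "\<rho>0 3 = q" "\<rho>0 4 = of_bool b" "\<rho>0 5 = Suc j" "j < rnk (\<lambda>p. \<beta> p = b) n" "wordy w \<rho>0"
  shows "run w sl_code \<rho>0 m 22 22 (\<lambda>m' \<rho>'. m' = m \<and> \<rho>' 0 = Pb \<beta> b j)"
  unfolding sl_code_def
proof (rule run_cong_post[OF run_append[where ?d2.0 = "Suc (Suc (Suc (Suc (Suc (Suc (Suc (Suc (Suc (Suc (Suc (Suc (Suc 0))))))))))))"
     and ?k2.0 = "Suc (Suc (Suc (Suc (Suc (Suc (Suc (Suc (Suc (Suc (Suc (Suc (Suc 0))))))))))))"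
     and Q = "\<lambda>m' \<rho>'. m' = m \<and> \<rho>' 0 = Pb \<beta> b j", OF run_qparams]], goal_cases)
  case (5 m' \<rho>)
  then have qp: "qp \<rho>" and [simp]: "m' = m" and r4: "\<rho> 4 = of_bool b" "\<rho> 5 = Suc j" using r by auto
  define P where "P = Pb \<beta> b"
  let ?b = "of_bool b :: nat"
  have Ple: "P x \<le> n" for x by (simp add: P_def Pb_le)
  have mono: "x \<le> y \<Longrightarrow> P x \<le> P y" for x y by (simp add: P_def Pb_def pos_mono)
  have jn: "j < n" using r(6) rnk_le[of "\<lambda>p. \<beta> p = b" n] by linarith
  then have jG: "Suc j \<le> G" "j \<le> G" using n_le_G by auto
  have Pj: "P j < n" using pos_less[OF r(6)] by (simp add: P_def Pb_def)
  define h where "h = j div Bs"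
  define g where "g = j div A"
  define x0 where "x0 = P (g * A)"
  define x1 where "x1 = P ((g + 1) * A)"
  define d where "d = (P (h * Bs) - x0) mod F"
  define y0 where "y0 = x0 + d"
  define r where "r = j - h * Bs"
  have hj: "h * Bs \<le> j" by (simp add: h_def)
  have rB: "r = j mod Bs" by (simp add: r_def h_def minus_div_mult_eq_mod)
  have gA: "g * A \<le> j" "j < (g + 1) * A"
    using A_pos by (simp_all add: g_def) (metis add.commute dividend_less_div_times mult.commute)
  have h: "h \<le> n div Bs" unfolding h_def using jn by (intro div_le_mono) simp
  have g: "g \<le> n div A" unfolding g_def using jn by (intro div_le_mono) simp
  have hB: "h * Bs div A = g" by (simp add: h_def g_def block_div)
  have hG: "h \<le> G" "g \<le> G" using jG div_le_dividend[of j Bs] div_le_dividend[of j A] unfolding h_def g_def by linarith+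
  have x0G: "x0 \<le> G" "x1 \<le> G" using Ple n_le_G unfolding x0_def x1_def by (meson le_trans)+
  have dF: "d < F" unfolding d_def using F_pos by simp
  have y0n: "y0 \<le> n + F" using dF Ple[of "g * A"] by (simp add: y0_def x0_def)
  have y0G: "y0 \<le> 2 * G" using y0n n_le_G F_le_G by linarith
  have x01: "x0 \<le> x1" unfolding x0_def x1_def by (intro mono) simp
  have sel: "lay_select (st m q) b P" and tab: "lay_table (st m q)"
    using lay unfolding lay_def P_def by auto
  have S1: "st m q (3 + ?b) g = x0" "st m q (3 + ?b) (g + 1) = x1"
    using sel g unfolding lay_select_def x0_def x1_def by auto
  have S2: "field_at (st m q) (7 + ?b) h = d"
    using sel h hB unfolding lay_select_def d_def x0_def by auto
  have E1: "st m q (5 + ?b) (x0 div F * A + j mod A) = P j" if "F \<le> x1 - x0"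
    using sel Pj that unfolding lay_select_def x0_def x1_def g_def by auto
  have E2: "field_at (st m q) (9 + ?b) (P (h * Bs) div U * Bs + r) = (P j - x0) mod F" if "P (h * Bs) + U \<le> P j"
    using sel Pj that unfolding lay_select_def x0_def g_def h_def rB by auto
  define \<rho>1 where "\<rho>1 = \<rho>(19 := j, 20 := h, 21 := g, 22 := x0, 23 := x1, 24 := y0)"
  have q1: "qp \<rho>1" unfolding \<rho>1_def by (intro qp_upd qp) auto
  have r14: "\<rho>1 4 = ?b" "\<rho>1 19 = j" "\<rho>1 20 = h" "\<rho>1 22 = x0" "\<rho>1 23 = x1" "\<rho>1 24 = y0" using r4 by (auto simp: \<rho>1_def)
  define v0 where "v0 = eval w m \<rho>1 (winE 24)"
  define v where "v = (if b then v0 else xor v0 (2 ^ U - 1))"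
  have v0: "v0 < 2 ^ U" "\<And>k. k < U \<Longrightarrow> y0 + k < n \<Longrightarrow> bit v0 k = \<beta> (y0 + k)"
    using eval_win[OF q1, of 24 y0] y0n unfolding v0_def by (auto simp: \<rho>1_def)
  have v: "v < 2 ^ U" using v0(1) xor_mask(1) by (simp add: v_def)
  have vb: "bit v k = (\<beta> (y0 + k) = b)" if "k < U" "y0 + k < n" for k
    using v0 that xor_mask(2)[OF v0(1) that(1)] by (auto simp: v_def)
  define cnt where "cnt = rnk (bit v) U"
  have T: "st m q 2 (v * (U + 1) + U) = cnt" "\<And>i. i < cnt \<Longrightarrow> st m q 2 (v * (U + 1) + i) = ones (bit v) U ! i"
    using tab v unfolding lay_table_def cnt_def by auto
  \<comment> \<open>In a group spanning less than \<open>F\<close>, differences to the start of the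
    group survive the reduction modulo \<open>F\<close>, so the sample is exact.\<close>
  have dense: "y0 = P (h * Bs)" "(P j - x0) mod F = P j - x0" "x0 \<le> P j" if "x1 - x0 < F"
  proof -
    have "P (h * Bs) \<le> x1" "x0 \<le> P (h * Bs)" "P j \<le> x1" "x0 \<le> P j"
    proof -
      have "g * A \<le> h * Bs" using hB by auto
      then show "P (h * Bs) \<le> x1" "x0 \<le> P (h * Bs)" "P j \<le> x1" "x0 \<le> P j"
        unfolding x0_def x1_def using hj gA by (blast intro: mono order.trans less_imp_le)+
    qed
    then show "y0 = P (h * Bs)" "(P j - x0) mod F = P j - x0" "x0 \<le> P j"
      using that by (auto simp: y0_def d_def)
  qed
  \<comment> \<open>The construction decides by distance which elements to store explicitly, the
    query by the count in the window. By \<open>window_select\<close>, a query that misses in the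
    window asks for an element that was stored.\<close>
  have win: "r < cnt \<Longrightarrow> y0 + ones (bit v) U ! r = P j" "\<not> r < cnt \<Longrightarrow> P (h * Bs) + U \<le> P j" if "x1 - x0 < F"
  proof -
    have y0: "y0 = pos (\<lambda>p. \<beta> p = b) n (h * Bs)" using dense(1)[OF that] by (simp add: P_def Pb_def)
    have 1: "P j < y0 + U \<Longrightarrow> r < cnt \<and> y0 + ones (bit v) U ! r = P j"
      and 2: "y0 + U \<le> P j \<Longrightarrow> cnt \<le> r"
      using window_select[of j "\<lambda>p. \<beta> p = b" n "h * Bs" y0 U "bit v", OF assms(6) hj y0 vb]
      unfolding cnt_def r_def P_def Pb_def by auto
    show "r < cnt \<Longrightarrow> y0 + ones (bit v) U ! r = P j" using 1 2 by linarith
    show "\<not> r < cnt \<Longrightarrow> P (h * Bs) + U \<le> P j" using 1 dense(1)[OF that] by linarith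
  qed
  have lts: "y0 < 2 ^ w" "x0 < 2 ^ w" "x1 < 2 ^ w" "Suc j < 2 ^ w" "j < 2 ^ w" "h < 2 ^ w" "g + 1 < 2 ^ w"
     "U + 1 < 2 ^ w" "x0 + F < 2 ^ w" "n < 2 ^ w" "F < 2 ^ w" "y0 + G < 2 ^ w"
    using x0G jG hG y0G smalls n_le_G F_le_G G_1000 by (auto intro!: le_G_word)
  have UGn: "(2::nat) ^ U < 2 ^ w" using U_w by (intro power_strict_increasing) auto
  have qs: "\<rho>' 1 = w" "\<rho>' 12 = U" "\<rho>' 16 = A" "\<rho>' 18 = 2 ^ U" "\<rho>' 17 = Bs" "\<rho>' 3 = q" "\<rho>' 11 = csize" "\<rho>' 15 = F"
    if "qp \<rho>'" for \<rho>' using that by (auto simp: qp_def)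
  have bb: "?b \<le> 1" by simp
  have bw: "k \<le> 10 \<Longrightarrow> eval w m \<rho>' (V 4) = ?b \<Longrightarrow> eval w m \<rho>' (Bin Add (C k) (V 4)) = k + ?b" for k \<rho>'
    using G_1000 by (subst eval_Add) (auto simp: intro!: le_G_word)
  have hBw: "h * Bs < 2 ^ w" using hj lts by linarith
  have q2p: "19 \<le> a \<Longrightarrow> qp \<rho>' \<Longrightarrow> qp (\<rho>'(a := z))" for a z \<rho>' by (rule qp_upd) auto
  show ?case unfolding \<open>m' = m\<close>
  proof (rule run_assign_then[where v = j], goal_cases)
    case 4 then show ?case using lts r4 by (simp add: eval_Sub)
  next
    case 5
    have q19: "qp (\<rho>(19 := j))" using qp by (rule qp_upd) simp
    show ?case
    proof (rule run_assign_then[where v = h], goal_cases)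
      case 4 then show ?case using lts qs[OF qp] by (simp add: eval_Div h_def)
    next
      case 5 show ?case
      proof (rule run_assign_then[where v = g], goal_cases)
        case 4 then show ?case using lts qs[OF qp] by (simp add: eval_Div g_def)
      next
        case 5
        have q21: "qp (\<rho>(19 := j, 20 := h, 21 := g))" by (intro q2p qp) auto
        show ?case
        proof (rule run_assign_then[where v = x0], goal_cases)
          case 4 show ?case unfolding S1(1)[symmetric]
            by (rule eval_cmp[OF q21]) (use csize_R1[of g] g bb r4 in \<open>auto simp: bw\<close>)
        next
          case 5
          have q22: "qp (\<rho>(19 := j, 20 := h, 21 := g, 22 := x0))" by (intro q2p qp) auto
          show ?case
          proof (rule run_assign_then[where v = x1], goal_cases)
            case 4 show ?case unfolding S1(2)[symmetric]
              by (rule eval_cmp[OF q22]) (use csize_R1[of "g + 1"] g bb r4 lts in \<open>auto simp: bw eval_Add\<close>)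
          next
            case 5
            have q23: "qp (\<rho>(19 := j, 20 := h, 21 := g, 22 := x0, 23 := x1))" by (intro q2p qp) auto
            show ?case
            proof (rule run_assign_then[where v = y0], goal_cases)
              case 4
              have "eval w m (\<rho>(19 := j, 20 := h, 21 := g, 22 := x0, 23 := x1)) (fldE (Bin Add (C 7) (V 4)) (V 20)) = d"
                unfolding S2[symmetric]
                by (rule eval_fld[OF q23]) (use csize_S2[OF h] bb r4 lts in \<open>auto simp: bw\<close>)
              then show ?case using lts by (subst eval_Add) (auto simp: y0_def)
            next
              case 5 show ?case unfolding \<rho>1_def[symmetric]
              proof (rule run_assign_then[where v = v0], goal_cases)
                case 5
                have q25: "qp (\<rho>1(25 := v0))" using q1 by (rule qp_upd) simp
                show ?case
                proof (rule run_assign_then[where v = v], goal_cases)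
                  case 4
                  have "eval w m (\<rho>1(25 := v0)) (Bin Sub (V 18) (C 1)) = 2 ^ U - 1"
                    using qs[OF q25] UGn by (subst eval_Sub) auto
                  moreover have "xor v0 (2 ^ U - 1) < 2 ^ w" using xor_mask(1)[OF v0(1)] UGn by (rule less_trans)
                  ultimately have "eval w m (\<rho>1(25 := v0)) (Bin Xor (V 25) (Bin Sub (V 18) (C 1))) = xor v0 (2 ^ U - 1)"
                    by (simp add: eval.simps(3))
                  then show ?case using r14 5 by (subst eval_Ite[where P = b]) (auto simp: v_def)
                next
                  case 5
                  have rup: "\<rho>1(25 := v0, 25 := v) = \<rho>1(25 := v)" by simp
                  have q26: "qp (\<rho>1(25 := v))" using q1 by (rule qp_upd) simp
                  show ?case unfolding rup
                  proof (rule run_assign_then[where v = r], goal_cases)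
                    case 4
                    show ?case using r14 hj hBw lts qs[OF q26] by (simp add: eval_Sub eval_Mul r_def)
                  next
                    case 5
                    define T0 where "T0 = q + 2 + 2 * csize + v * (U + 1)"
                    have tZ: "v * (U + 1) + U < csize" by (rule csize_tab) (use v in auto)
                    have b: "q + 2 + 2 * csize + (v * (U + 1) + U) < 2 ^ w" using tZ q csize_bsize by linarith
                    have T0w: "T0 + U < 2 ^ w" using b by (simp add: T0_def)
                    have rU: "r < U" using Bs_pos Bs_le_U mod_less_divisor[of Bs j] unfolding rB by linarith
                    show ?case
                    proof (rule run_assign_then[where v = T0], goal_cases)
                      case 4
                      have q27: "qp (\<rho>1(25 := v, 26 := r))" by (intro q2p q1) auto
                      show ?case using b qs[OF q27] lts by (simp add: eval_Add eval_Mul T0_def)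
                    next
                      case 5
                      let ?\<rho> = "\<rho>1(25 := v, 26 := r, 27 := T0)"
                      have q28: "qp ?\<rho>" by (intro q2p q1) auto
                      have mT: "m (T0 + U) = cnt" "r < cnt \<Longrightarrow> m (T0 + r) = ones (bit v) U ! r"
                        using T(1) T(2)[of r] unfolding st_def T0_def by (auto simp: add.assoc)
                      show ?case
                      proof (rule run_assign_then[where v = "of_bool (r < cnt)"], goal_cases)
                        case 4
                        show ?case using qs[OF q28] T0w mT by (simp add: eval_Less eval_Add)
                      next
                        case 5
                        let ?\<rho>2 = "?\<rho>(28 := of_bool (r < cnt))"
                        have q29: "qp ?\<rho>2" by (intro q2p q1) auto
                        let ?e29 = "Ite (V 28) (Bin Add (V 24) (Mem (Bin Add (V 27) (V 26))))
                           (Bin Add (V 22) (fldE (Bin Add (C 9) (V 4)) (Bin Add (Bin Mul (Bin Div (V 24) (V 12)) (V 17)) (V 26))))"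
                        have e29: "eval w m ?\<rho>2 ?e29 = P j" if "x1 - x0 < F"
                        proof -
                          have e: "eval w m ?\<rho>2 ?e29 = (if r < cnt then eval w m ?\<rho>2 (Bin Add (V 24) (Mem (Bin Add (V 27) (V 26))))
                             else eval w m ?\<rho>2 (Bin Add (V 22) (fldE (Bin Add (C 9) (V 4)) (Bin Add (Bin Mul (Bin Div (V 24) (V 12)) (V 17)) (V 26)))))"
                            by (rule eval_Ite) (use 5 in auto)
                          show ?thesis
                          proof (cases "r < cnt")
                            case True
                            have "eval w m ?\<rho>2 (Mem (Bin Add (V 27) (V 26))) = ones (bit v) U ! r"
                              using T0w rU mT(2)[OF True] by (simp add: eval_Add)
                            moreover have "y0 + ones (bit v) U ! r < 2 ^ w" using win(1)[OF that True] Pj lts by linarith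
                            ultimately show ?thesis unfolding e using True win(1)[OF that True] r14
                              by (simp add: eval_Add)
                          next
                            case False
                            let ?i = "y0 div U * Bs + r"
                            have y0P: "y0 = P (h * Bs)" using dense(1)[OF that] .
                            have iZ: "?i div per < csize" using csize_E2[of y0 r] Ple Bs_pos unfolding y0P rB by simp
                            have "?i \<le> G * G + G"
                            proof (intro add_le_mono mult_le_mono)
                              show "y0 div U \<le> G" using Ple n_le_G unfolding y0P by (meson div_le_dividend le_trans)
                              show "Bs \<le> G" "r \<le> G" using smalls rU by linarith+
                            qed
                            then have iw: "?i < 2 ^ w" using GG_bsize G_1000 bsize_less G_bsize1 by linarith
                            have "eval w m ?\<rho>2 (Bin Add (Bin Mul (Bin Div (V 24) (V 12)) (V 17)) (V 26)) = ?i"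
                              using iw lts qs[OF q29] r14 by (simp add: eval_Add eval_Mul eval_Div)
                            then have "eval w m ?\<rho>2 (fldE (Bin Add (C 9) (V 4)) (Bin Add (Bin Mul (Bin Div (V 24) (V 12)) (V 17)) (V 26)))
                              = field_at (st m q) (9 + ?b) ?i"
                              by (intro eval_fld[OF q29]) (use iZ iw bb r14 in \<open>auto simp: bw\<close>)
                            also have "\<dots> = P j - x0" using E2[OF win(2)[OF that False]] y0P dense(2)[OF that] by simp
                            finally have f: "eval w m ?\<rho>2 (fldE (Bin Add (C 9) (V 4)) (Bin Add (Bin Mul (Bin Div (V 24) (V 12)) (V 17)) (V 26))) = P j - x0" .
                            have "x0 + (P j - x0) = P j" using dense(3)[OF that] by simp
                            then show ?thesis unfolding e using False f Pj lts r14 by (subst eval_Add) auto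
                          qed
                        qed
                        \<comment> \<open>For an explicit group nothing is known about this value
                          except that it is a word, and that is enough for the final
                          selection.\<close>
                        define z where "z = eval w m ?\<rho>2 ?e29"
                        have z: "z < 2 ^ w" unfolding z_def using 5 by (intro eval_less)
                        show ?case
                        proof (rule run_assign_then[where v = z], goal_cases)
                          case 5
                          let ?\<rho>3 = "?\<rho>2(29 := z)"
                          have q30: "qp ?\<rho>3" by (intro q2p q1) auto
                          show ?case
                          proof (rule run_assign_then[where v = "P j"], goal_cases)
                            case 4
                            have c: "eval w m ?\<rho>3 (Bin Less (Bin Sub (V 23) (V 22)) (V 15)) = of_bool (x1 - x0 < F)"
                              using r14 x01 lts qs[OF q30] by (simp add: eval_Less eval_Sub)
                            show ?case
                            proof (subst eval_Ite[OF c])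
                              show "(if x1 - x0 < F then eval w m ?\<rho>3 (V 29) else eval w m ?\<rho>3
                                (Mem (Bin Add (cmpE (Bin Add (C 5) (V 4)))
                                 (Bin Add (Bin Mul (Bin Div (V 22) (V 15)) (V 16)) (Bin Mod (V 19) (V 16)))))) = P j"
                              proof (cases "x1 - x0 < F")
                                case True then show ?thesis using e29 by (simp add: z_def)
                              next
                                case False
                                let ?i = "x0 div F * A + j mod A"
                                have iZ: "?i < csize" by (rule csize_E1) (use Ple A_pos in \<open>auto simp: x0_def\<close>)
                                then have iw: "?i < 2 ^ w" using csize_bsize bsize_less by linarith
                                then have ie: "eval w m ?\<rho>3 (Bin Add (Bin Mul (Bin Div (V 22) (V 15)) (V 16)) (Bin Mod (V 19) (V 16))) = ?i"
                                  using lts qs[OF q30] r14 by (simp add: eval_Add eval_Mul eval_Div eval_Mod)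
                                have "eval w m ?\<rho>3 (Mem (Bin Add (cmpE (Bin Add (C 5) (V 4)))
                                 (Bin Add (Bin Mul (Bin Div (V 22) (V 15)) (V 16)) (Bin Mod (V 19) (V 16))))) = st m q (5 + ?b) ?i"
                                  by (rule eval_cmp[OF q30]) (use iZ ie bb r14 in \<open>auto simp: bw\<close>)
                                then show ?thesis using E1 False by simp
                              qed
                            qed (use 5 in auto)
                          qed (auto intro!: run_Nil simp: CC_def P_def)
                        qed (auto simp: CC_def z_def)
                      qed (auto simp: CC_def)
                    qed (auto simp: CC_def)
                  qed (auto simp: CC_def)
                qed (auto simp: CC_def)
              qed (auto simp: CC_def v0_def)
            qed (auto simp: CC_def)
          qed (auto simp: CC_def)
        qed (auto simp: CC_def)
      qed (auto simp: CC_def)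
    qed (auto simp: CC_def)
  qed (auto simp: CC_def)
qed (use r in auto)

end


lemma vars_init_regs: "length xs \<le> 64 \<Longrightarrow> vars (init_regs xs) = init_regs xs"
  by (auto simp: vars_def init_regs_def NV_def)

lemma wordy_init_regs: "(\<And>x. x \<in> set xs \<Longrightarrow> x < 2 ^ w) \<Longrightarrow> wordy w (init_regs xs)"
  by (auto simp: wordy_def init_regs_def)

lemma div_less_bitmap_words: "0 < w \<Longrightarrow> i < n \<Longrightarrow> i div w < bitmap_words w n"
proof -
  assume "0 < w" "i < n"
  then have "real (i div w) < real n / real w"
    by (meson divide_strict_right_mono le_less_trans of_nat_0_less_iff of_nat_less_iff of_nat_div_le_of_nat)
  then show ?thesis unfolding bitmap_words_def by linarith
qed

context params
begin

text \<open>The locale \<open>query\<close> is interpreted in the arbitrary memory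
  \<open>m'\<close>, which is known to agree with \<open>m\<close> only on the bitmap and on the
  \<open>2 + 11 * csize\<close> words of the structure.\<close>

lemma rank_select_structure_lay:
  assumes B: "length B = n" and wm: "word_memory w m" and p: "p + bsize \<le> 2 ^ w" and q: "q + bsize \<le> 2 ^ w"
    and bits: "\<And>i. i < n \<Longrightarrow> bit (m (p + i div w)) (i mod w) = B ! i"
    and head: "m q = u" "m (q + 1) = csize"
    and lay: "lay (st m q) (\<lambda>i. B ! i)" and K: "real (CC * 22) \<le> K"
  shows "rank_select_structure w rk_code sl_code K m p B q (2 + 11 * csize)"
  unfolding rank_select_structure_def
proof (intro allI impI conjI ballI; elim conjE)
  fix m' :: mem and b i
  assume wm': "word_memory w m'"
    and m': "\<forall>a\<in>{p..<p + bitmap_words w (length B)} \<union> {q..<q + (2 + 11 * csize)}. m' a = m a"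
  have Zp: "0 < csize" using csize_R1[of 0] by simp
  interpret query n w m' p q "\<lambda>i. B ! i"
  proof
    fix i assume i: "i < n"
    then have "m' (p + i div w) = m (p + i div w)"
      using m' B div_less_bitmap_words[OF w_pos i] by auto
    then show "bit (m' (p + i div w)) (i mod w) = B ! i" using bits i by simp
  next
    show "m' q = u" "m' (q + 1) = csize" using m' head Zp by auto
    show "params.lay n w (params.st n w m' q) ((!) B)"
    proof (rule lay_transfer[OF lay])
      fix k i :: nat assume "k < 11" "i < csize"
      then have "k * csize + i < Suc k * csize" by simp
      also have "\<dots> \<le> 11 * csize" using \<open>k < 11\<close> by (intro mult_right_mono) auto
      finally show "st m' q k i = st m q k i" using m' unfolding st_def by (auto simp: add.assoc)
    qed
  qed (use wm' p q in auto)
  have ws: "n < 2 ^ w" "w < 2 ^ w" "p < 2 ^ w" "q < 2 ^ w" "of_bool b < (2::nat) ^ w" "n + 1 < 2 ^ w"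
    using n_le_G w_le_G G_1000 p q bsize_pos by (auto intro!: le_G_word)
  {
    assume i: "i \<le> length B"
    let ?r = "init_regs [length B, w, p, q, of_bool b, i]"
    have rv: "vars ?r = ?r" by (rule vars_init_regs) simp
    have wr: "wordy w ?r" by (rule wordy_init_regs) (use ws i B in auto)
    show "runs_within w rk_code ?r m' K K (\<lambda>m'' r. m'' = m' \<and> r 0 = bit_rank b B i)"
    proof (rule run_runs_within[where Q' = "\<lambda>m'' v. m'' = m' \<and> v = bit_rank b B i"])
      show "run w rk_code (vars ?r) m' 16 16 (\<lambda>m'' \<rho>'. m'' = m' \<and> \<rho>' 0 = rnk (\<lambda>p. B ! p = b) i)"
        unfolding rv by (rule run_rk) (use i B wr in \<open>auto simp: init_regs_def\<close>)
    qed (use wr wm' K i in \<open>auto simp: bit_rank_rnk CC_def\<close>)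
  next
    assume i: "i \<in> {1..count_list B b}"
    then obtain j where j: "i = Suc j" "j < count_list B b" by (cases i) auto
    have cn: "count_list B b \<le> n" using B count_le_length by metis
    let ?r = "init_regs [length B, w, p, q, of_bool b, i]"
    have rv: "vars ?r = ?r" by (rule vars_init_regs) simp
    have wr: "wordy w ?r" by (rule wordy_init_regs) (use ws j cn B in auto)
    show "runs_within w sl_code ?r m' K K (\<lambda>m'' r. m'' = m' \<and> r 0 = bit_select b B i)"
    proof (rule run_runs_within[where Q' = "\<lambda>m'' v. m'' = m' \<and> v = bit_select b B i"])
      show "run w sl_code (vars ?r) m' 22 22 (\<lambda>m'' \<rho>'. m'' = m' \<and> \<rho>' 0 = Pb (\<lambda>i. B ! i) b j)"
        unfolding rv by (rule run_sl) (use j B wr in \<open>auto simp: init_regs_def count_list_rnk\<close>)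
    qed (use wr wm' K j B in \<open>auto simp: bit_select_pos Pb_def\<close>)
  }
qed

end

section \<open>Building the rank/select structures\<close>

definition same :: "regs \<Rightarrow> regs \<Rightarrow> bool" where
  "same \<rho> \<rho>' \<longleftrightarrow> (\<forall>x<30. \<rho>' x = \<rho> x)"

lemma same_refl [simp]: "same \<rho> \<rho>"
  and same_upd [simp]: "30 \<le> x \<Longrightarrow> same \<rho> (\<rho>'(x := v)) = same \<rho> \<rho>'"
  and same_upd1 [simp]: "30 \<le> x \<Longrightarrow> same (\<rho>(x := v)) \<rho>' = same \<rho> \<rho>'"
  by (auto simp: same_def)

lemma same_trans: "same \<rho> \<rho>' \<Longrightarrow> same \<rho>' \<rho>'' \<Longrightarrow> same \<rho> \<rho>''"
  by (auto simp: same_def)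

text \<open>A guarded read: if the condition fails, the address in \<open>a\<close> may have wrapped
  around, and whatever is found there is multiplied by 0.\<close>

lemma eval_cond:
  assumes "eval w m r c = of_bool P" "word_memory w m" "wordy w r"
  shows "eval w m r (Bin Mul c a) = (if P then eval w m r a else 0)"
  using eval_less[OF assms(2,3), of a] assms(1) by (simp add: eval.simps(3))

section \<open>Bits and prefix ranks of a level\<close>

abbreviation blk :: "nat \<Rightarrow> expr" where "blk k \<equiv> Bin Add (V 4) (C k)"

text \<open>The doubling loop works in place, which is sound because all strands read before any of
  them writes. It makes \<open>w\<close> rounds instead of a logarithm of the number of blocks; this
  depth is spent within the blocks anyway. The last loop turns inclusive totals into prefix ranks by
  taking off one bit per round.\<close>

definition scan :: code where
  "scan =
     par 32 (V 12) (Adr (blk 3) (V 32)) (C 0) @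
     (assign 30 (V 2) @
     loop 30 (par 32 (V 12) (Adr (blk 3) (V 32))
       (Bin Add (At (blk 3) (V 32)) (At (blk 1) (Bin Add (Bin Mul (V 32) (V 2)) (V 30)))))) @
     (assign 31 (C 1) @ assign 30 (V 2) @
     loop 30 (par 32 (V 12) (Adr (blk 3) (V 32))
       (Bin Add (At (blk 3) (V 32)) (Bin Mul (Bin Less (V 31) (Bin Add (V 32) (C 1))) (At (blk 3) (Bin Sub (V 32) (V 31))))) @
       assign 31 (Bin Add (V 31) (V 31)))) @
     (assign 30 (V 2) @
     loop 30 (par 32 (V 12) (Adr (blk 3) (V 32))
       (Bin Sub (At (blk 3) (V 32)) (At (blk 1) (Bin Add (Bin Mul (V 32) (V 2)) (V 30)))) @
       par 32 (V 12) (Adr (blk 4) (Bin Add (Bin Mul (V 32) (V 2)) (V 30))) (At (blk 3) (V 32))))"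

text \<open>Register 15 holds the index of the bit that the level inspects. Positions from
  \<open>n\<close> on are padded with zeros up to a multiple of \<open>w\<close>; what is read there
  from the sequence block is discarded by the guard.\<close>

definition bits_code :: code where
  "bits_code = par 32 (Bin Mul (V 12) (V 2)) (Adr (blk 1) (V 32))
     (Bin Mul (Bin Less (V 32) (V 0)) (Bin Mod (Bin Shr (At (blk 0) (V 32)) (V 15)) (C 2)))"

context params
begin

lemma le_G_bsize: "x \<le> 100 * G \<Longrightarrow> x < bsize"
  using G_bsize1 by linarith

lemma less_Vv_w: "x < bsize \<Longrightarrow> x < 2 ^ w"
  using bsize_less by linarith

text \<open>The variables of the construction; registers from 30 on are used for counters and indices.
  The blocks of a level, relative to the block \<open>b0\<close> in register 4: 0 sequence, 1 bits,
  2 bitmap, 3 block totals, 4 ranks, 5 and 6 positions of the zeros and ones, 7 unpacked fields,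
  8 rank/select structure, 9 dummy target of elements not to be stored, 32 next level.\<close>

definition regs_ok :: "regs \<Rightarrow> nat \<Rightarrow> bool" where
  "regs_ok \<rho> b0 \<longleftrightarrow> \<rho> 0 = n \<and> \<rho> 2 = w \<and> \<rho> 3 = bsize \<and> \<rho> 4 = b0 \<and> \<rho> 5 = u \<and> \<rho> 6 = f \<and> \<rho> 7 = per \<and>
     \<rho> 8 = U \<and> \<rho> 9 = Bs \<and> \<rho> 10 = A \<and> \<rho> 11 = F \<and> \<rho> 12 = nb \<and> \<rho> 13 = csize \<and> \<rho> 14 = 2 ^ U \<and> b0 + 100 < bsize"

lemma regs_okD: 
  assumes "regs_ok \<rho> b0" "same \<rho> \<rho>'"
  shows "\<rho>' 0 = n" "\<rho>' 2 = w" "\<rho>' 3 = bsize" "\<rho>' 4 = b0" "\<rho>' 5 = u" "\<rho>' 6 = f" "\<rho>' 7 = per"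
     "\<rho>' 8 = U" "\<rho>' 9 = Bs" "\<rho>' 10 = A" "\<rho>' 11 = F" "\<rho>' 12 = nb" "\<rho>' 13 = csize" "\<rho>' 14 = 2 ^ U" "b0 + 100 < bsize"
     "k \<le> 99 \<Longrightarrow> eval w m \<rho>' (blk k) = b0 + k"
  using assms bsize_less by (auto simp: regs_ok_def same_def eval_Add)

lemma regs_ok_same: "regs_ok \<rho> b0 \<Longrightarrow> same \<rho> \<rho>' \<Longrightarrow> regs_ok \<rho>' b0"
  by (auto simp: regs_ok_def same_def)

text \<open>Strict even if \<open>w\<close> divides \<open>n\<close>, so that the rank at
  \<open>n\<close>, the total number of ones, is among the prefix ranks computed.\<close>

lemma nb_w: "n < nb * w" "nb * w \<le> n + w"
  unfolding nb_def using w_pos 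
  by (metis add.commute dividend_less_times_div mult.commute mult_Suc_right Suc_eq_plus1 w_pos,
      metis add_mult_distrib div_times_less_eq_dividend mult_1 add_le_cancel_right)

lemma nb_le: "nb \<le> nb * w" using mult_le_mono2[of 1 w nb] w_pos by linarith

lemma cw_less: "c < nb \<Longrightarrow> k < w \<Longrightarrow> c * w + k < nb * w"
proof -
  assume "c < nb" "k < w"
  then have "c * w + k < Suc c * w" by simp
  also have "\<dots> \<le> nb * w" using \<open>c < nb\<close> by (intro mult_right_mono) auto
  finally show ?thesis .
qed

lemma nbw_G: "nb * w \<le> 2 * G" "nb \<le> 2 * G"
  using nb_w nb_le n_le_G w_le_G by linarith+

lemma run_bits:
  assumes regs_ok: "regs_ok \<rho> b0" and wm: "word_memory w m" and wr: "wordy w \<rho>"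
  shows "run w bits_code \<rho> m 1 (n + w + 1) (\<lambda>m' \<rho>'. \<rho>' = \<rho> \<and> (\<forall>b. b \<noteq> b0 + 1 \<longrightarrow> view w m' b = view w m b) \<and>
    (\<forall>i<nb * w. view w m' (b0 + 1) i = of_bool (i < n \<and> bit (view w m b0 i) (\<rho> 15))))"
  unfolding bits_code_def
proof (rule run_cong_post[OF run_fill[where b = "b0 + 1" and k = "nb * w" and \<omega> = "\<lambda>j. j" and
   val = "\<lambda>i. of_bool (i < n \<and> bit (view w m b0 i) (\<rho> 15))" and Q = "\<lambda>m' \<rho>'. \<rho>' = \<rho> \<and> (\<forall>b. b \<noteq> b0 + 1 \<longrightarrow> view w m' b = view w m b) \<and>
    (\<forall>i<nb * w. view w m' (b0 + 1) i = of_bool (i < n \<and> bit (view w m b0 i) (\<rho> 15)))"]])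
  have nw: "nb * w < 2 ^ w" using nbw_G by (intro less_Vv_w le_G_bsize) linarith
  note B = regs_okD[OF regs_ok same_refl]
  show "eval w m \<rho> (Bin Mul (V 12) (V 2)) = nb * w" using nw B by (simp add: eval_Mul)
  fix j assume j: "j < nb * w"
  then have jV: "j < bsize" "j < 2 ^ w" using nbw_G by (auto intro!: less_Vv_w le_G_bsize)
  let ?r = "\<rho>(32 := j)"
  have sm: "same \<rho> ?r" by simp
  note B' = regs_okD[OF regs_ok sm]
  show "eval w m ?r (blk 1) = b0 + 1" using B'(16) by simp
  show "eval w m ?r (V 32) = j" "j < bsize" using jV by auto
  have at: "eval w m ?r (At (blk 0) (V 32)) = view w m b0 j"
    by (subst eval_At) (use B' jV in auto)
  have "eval w m ?r (Bin Mod (Bin Shr (At (blk 0) (V 32)) (V 15)) (C 2)) = of_bool (bit (view w m b0 j) (\<rho> 15))"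
    using at view_less[OF wm] by (subst eval_Mod) (auto simp: eval_Shr mod_2_eq_odd bit_iff_odd order_le_less_trans[OF div_le_dividend])
  moreover have c: "eval w m ?r (Bin Less (V 32) (V 0)) = of_bool (j < n)"
    using B' by (simp add: eval_Less)
  moreover have "wordy w ?r" using wr jV by (intro wordy_upd)
  ultimately show "eval w m ?r (Bin Mul (Bin Less (V 32) (V 0)) (Bin Mod (Bin Shr (At (blk 0) (V 32)) (V 15)) (C 2)))
     = of_bool (j < n \<and> bit (view w m b0 j) (\<rho> 15))"
    using eval_cond[OF c wm] by simp
next
  show "nb * w + 1 \<le> n + w + 1" using nb_w by simp
qed (use regs_okD[OF regs_ok same_refl] in \<open>auto simp: CC_def inj_on_def\<close>)

text \<open>After \<open>t\<close> rounds of the scan, cell \<open>c\<close> holds the number of ones in the last \<open>2 ^ t\<close> blocks up to \<open>c\<close>.\<close>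

lemma run_scan:
  assumes regs_ok: "regs_ok \<rho> b0" and wm: "word_memory w m" and wr: "wordy w \<rho>"
    and bt: "\<And>i. i < nb * w \<Longrightarrow> view w m (b0 + 1) i = of_bool (\<gamma> i)"
  shows "run w scan \<rho> m (20 * w) (20 * (n + w))
    (\<lambda>m' \<rho>'. same \<rho> \<rho>' \<and> (\<forall>b. b \<noteq> b0 + 3 \<and> b \<noteq> b0 + 4 \<longrightarrow> view w m' b = view w m b) \<and>
      (\<forall>i<nb * w. view w m' (b0 + 4) i = rnk \<gamma> i))"
proof -
  note B = regs_okD[OF regs_ok same_refl]
  have nV: "nb * w < bsize" "nb < bsize" "rnk \<gamma> (nb * w) < bsize" using nbw_G rnk_le[of \<gamma> "nb * w"] by (auto intro!: le_G_bsize)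
  have rV: "rnk \<gamma> i < 2 ^ w" if "i \<le> nb * w" for i
    using rnk_mono[OF that, of \<gamma>] nV bsize_less by linarith
  have c1w: "(c + 1) * w \<le> nb * w" if "c < nb" for c using that by (intro mult_right_mono) auto
  let ?fr = "\<lambda>m'. \<forall>b. b \<noteq> b0 + 3 \<longrightarrow> view w m' b = view w m b"
  let ?I1 = "\<lambda>k m' \<rho>'. same \<rho> \<rho>' \<and> ?fr m' \<and> (\<forall>c<nb. view w m' (b0 + 3) c + rnk \<gamma> (c * w + k) = rnk \<gamma> (c * w + w))"
  \<comment> \<open>The value of the stride is not claimed after the last round, where it would be
    \<open>2 ^ w\<close> and overflows.\<close>
  let ?I2 = "\<lambda>k m' \<rho>'. same \<rho> \<rho>' \<and> ?fr m' \<and> (0 < k \<longrightarrow> \<rho>' 31 = 2 ^ (w - k)) \<and> k \<le> w \<and>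
     (\<forall>c<nb. view w m' (b0 + 3) c + rnk \<gamma> ((c + 1 - 2 ^ (w - k)) * w) = rnk \<gamma> ((c + 1) * w))"
  let ?I3 = "\<lambda>k m' \<rho>'. same \<rho> \<rho>' \<and> (\<forall>b. b \<noteq> b0 + 3 \<and> b \<noteq> b0 + 4 \<longrightarrow> view w m' b = view w m b) \<and> (\<forall>c<nb. view w m' (b0 + 3) c = rnk \<gamma> (c * w + k)) \<and>
     (\<forall>c<nb. \<forall>k'<w. k \<le> k' \<longrightarrow> view w m' (b0 + 4) (c * w + k') = rnk \<gamma> (c * w + k'))"
  have E: "eval w m' \<rho>' (V 12) = nb" "k < 99 \<Longrightarrow> eval w m' (\<rho>'(32 := j)) (blk k) = b0 + k" 
     "eval w m' (\<rho>'(32 := j)) (V 32) = j" "\<rho>' 3 = bsize" if "same \<rho> \<rho>'" for \<rho>' m' j k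
    using regs_okD[OF regs_ok, of "\<rho>'(32 := j)"] regs_okD[OF regs_ok, of \<rho>'] that by auto
  have at3: "eval w m' (\<rho>'(32 := j)) (At (blk 3) (V 32)) = view w m' (b0 + 3) j" if "same \<rho> \<rho>'" "j < nb" for \<rho>' m' j
    by (subst eval_At) (use E that nV B in auto)
  have ad: "eval w m' (\<rho>'(32 := j)) (Bin Add (Bin Mul (V 32) (V 2)) (V 30)) = j * w + k \<and> j * w + k < bsize"
    if "same \<rho> \<rho>'" "j < nb" "\<rho>' 30 = k" "k < w" for \<rho>' m' j k
    using cw_less[OF that(2,4)] nV bsize_less regs_okD[OF regs_ok, of \<rho>'] that by (simp add: eval_Add eval_Mul)
  have at1: "eval w m' (\<rho>'(32 := j)) (At (blk 1) (Bin Add (Bin Mul (V 32) (V 2)) (V 30))) = of_bool (\<gamma> (j * w + k))"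
    if "same \<rho> \<rho>'" "j < nb" "\<rho>' 30 = k" "k < w" "view w m' (b0 + 1) = view w m (b0 + 1)" for \<rho>' m' j k
    by (subst eval_At) (use E ad[OF that(1-4)] that nV B bt cw_less in auto)
  have wf: "wf_expr (V 12)" "wf_expr (blk k)" "wf_expr (V 32)" for k by simp_all
  have p1: "run w (par 32 (V 12) (Adr (blk 3) (V 32)) (C 0)) \<rho> m 1 (nb + 1) (?I1 w)"
    by (rule run_fill[where b = "b0 + 3" and \<omega> = "\<lambda>j. j" and val = "\<lambda>j. 0"])
       (use E[OF same_refl] nV B in \<open>auto simp: CC_def inj_on_def fun_eq_iff\<close>)
  have p2: "run w (assign 30 (V 2) @
     loop 30 (par 32 (V 12) (Adr (blk 3) (V 32))
       (Bin Add (At (blk 3) (V 32)) (At (blk 1) (Bin Add (Bin Mul (V 32) (V 2)) (V 30)))))) \<rho>1 m1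
     (1 + (w * (1 + 2) + 1)) (1 + (w * (nb + 1 + 2) + 1)) (\<lambda>m' \<rho>'. \<rho>' 30 = 0 \<and> ?I1 0 m' \<rho>')"
    if m1: "word_memory w m1" "wordy w \<rho>1" "?I1 w m1 \<rho>1" for \<rho>1 m1
  proof (rule run_append)
    show "run w (assign 30 (V 2)) \<rho>1 m1 1 1 (\<lambda>m' \<rho>'. ?I1 w m' \<rho>' \<and> \<rho>' 30 = w)"
      by (rule run_assign) (use m1 regs_okD[OF regs_ok, of \<rho>1] in \<open>auto simp: CC_def\<close>)
    fix m2 \<rho>2 assume a: "word_memory w m2" "wordy w \<rho>2" "?I1 w m2 \<rho>2 \<and> \<rho>2 30 = w"
    show "run w (loop 30 (par 32 (V 12) (Adr (blk 3) (V 32))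
       (Bin Add (At (blk 3) (V 32)) (At (blk 1) (Bin Add (Bin Mul (V 32) (V 2)) (V 30)))))) \<rho>2 m2 (w * (1 + 2) + 1) (w * (nb + 1 + 2) + 1)
       (\<lambda>m' \<rho>'. \<rho>' 30 = 0 \<and> ?I1 0 m' \<rho>')"
    proof (rule run_loop[where I = ?I1])
      fix k m3 \<rho>3 assume k: "k < w" and w3: "word_memory w m3" "wordy w \<rho>3" and "\<rho>3 30 = Suc k" and I: "?I1 (Suc k) m3 \<rho>3"
      let ?\<rho> = "\<rho>3(30 := k)"
      have sm: "same \<rho> ?\<rho>" using I by simp
      have v1: "view w m3 (b0 + 1) = view w m (b0 + 1)" using I by auto
      have stp: "view w m3 (b0 + 3) c + of_bool (\<gamma> (c * w + k)) + rnk \<gamma> (c * w + k) = rnk \<gamma> (c * w + w)" if "c < nb" for c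
        using I that by (auto simp: add.commute add.left_commute)
      show "run w (par 32 (V 12) (Adr (blk 3) (V 32))
       (Bin Add (At (blk 3) (V 32)) (At (blk 1) (Bin Add (Bin Mul (V 32) (V 2)) (V 30))))) ?\<rho> m3 1 (nb + 1)
          (\<lambda>m' \<rho>'. \<rho>' 30 = k \<and> ?I1 k m' \<rho>')"
      proof (rule run_fill[where b = "b0 + 3" and \<omega> = "\<lambda>j. j" and val = "\<lambda>j. view w m3 (b0 + 3) j + of_bool (\<gamma> (j * w + k))"])
        fix j assume j: "j < nb"
        have jw: "j * w + w \<le> nb * w" using c1w[OF j] by simp
        have "view w m3 (b0 + 3) j + of_bool (\<gamma> (j * w + k)) < 2 ^ w"
          using stp[OF j] rV[OF jw] by linarith
        then show "eval w m3 (?\<rho>(32 := j)) (Bin Add (At (blk 3) (V 32)) (At (blk 1) (Bin Add (Bin Mul (V 32) (V 2)) (V 30))))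
          = view w m3 (b0 + 3) j + of_bool (\<gamma> (j * w + k))"
          using at3[OF sm j] at1[OF sm j _ k v1] by (subst eval_Add) auto
      next
        fix m' assume a: "\<And>j. j < nb \<Longrightarrow> view w m' (b0 + 3) j = view w m3 (b0 + 3) j + of_bool (\<gamma> (j * w + k))"
          "\<And>b' x. b' \<noteq> b0 + 3 \<or> x \<notin> (\<lambda>j. j) ` {..<nb} \<Longrightarrow> view w m' b' x = view w m3 b' x"
        show "?\<rho> 30 = k \<and> ?I1 k m' ?\<rho>" using a I sm stp by (auto simp: fun_eq_iff)
      qed (use E[OF sm] nV B in \<open>auto simp: CC_def inj_on_def\<close>)
    qed (use a in auto)
  qed
  have p3: "run w (assign 31 (C 1) @ assign 30 (V 2) @
     loop 30 (par 32 (V 12) (Adr (blk 3) (V 32))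
       (Bin Add (At (blk 3) (V 32)) (Bin Mul (Bin Less (V 31) (Bin Add (V 32) (C 1))) (At (blk 3) (Bin Sub (V 32) (V 31))))) @
       assign 31 (Bin Add (V 31) (V 31)))) \<rho>1 m1
     (1 + (1 + (w * (1 + 1 + 2) + 1))) (1 + (1 + (w * (nb + 1 + 1 + 2) + 1))) (\<lambda>m' \<rho>'. \<rho>' 30 = 0 \<and> ?I2 0 m' \<rho>')"
    if m1: "word_memory w m1" "wordy w \<rho>1" "\<rho>1 30 = 0 \<and> ?I1 0 m1 \<rho>1" for \<rho>1 m1
  proof (rule run_append[where R = "\<lambda>m' \<rho>'. ?I1 0 m' \<rho>' \<and> \<rho>' 31 = 1"], goal_cases)
    case 1 show "run w (assign 31 (C 1)) \<rho>1 m1 1 1 (\<lambda>m' \<rho>'. ?I1 0 m' \<rho>' \<and> \<rho>' 31 = 1)"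
      by (rule run_assign) (use m1 in \<open>auto simp: CC_def\<close>)
  next
    case a: (2 m2 \<rho>2)
    show ?case
    proof (rule run_append)
      show "run w (assign 30 (V 2)) \<rho>2 m2 1 1 (\<lambda>m' \<rho>'. ?I1 0 m' \<rho>' \<and> \<rho>' 31 = 1 \<and> \<rho>' 30 = w)"
        by (rule run_assign) (use a regs_okD[OF regs_ok, of \<rho>2] in \<open>auto simp: CC_def\<close>)
      fix m2 \<rho>2 assume a: "word_memory w m2" "wordy w \<rho>2" "?I1 0 m2 \<rho>2 \<and> \<rho>2 31 = 1 \<and> \<rho>2 30 = w"
      show "run w (loop 30 (par 32 (V 12) (Adr (blk 3) (V 32))
       (Bin Add (At (blk 3) (V 32)) (Bin Mul (Bin Less (V 31) (Bin Add (V 32) (C 1))) (At (blk 3) (Bin Sub (V 32) (V 31))))) @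
       assign 31 (Bin Add (V 31) (V 31)))) \<rho>2 m2 (w * (1 + 1 + 2) + 1) (w * (nb + 1 + 1 + 2) + 1)
       (\<lambda>m' \<rho>'. \<rho>' 30 = 0 \<and> ?I2 0 m' \<rho>')"
      proof (rule run_loop[where I = ?I2])
        show "?I2 w m2 \<rho>2" using a by (auto simp: algebra_simps)
        fix k m3 \<rho>3 assume k: "k < w" and w3: "word_memory w m3" "wordy w \<rho>3" and "\<rho>3 30 = Suc k" and I: "?I2 (Suc k) m3 \<rho>3"
        let ?\<rho> = "\<rho>3(30 := k)"
        define d :: nat where "d = 2 ^ (w - Suc k)"
        have d2: "2 ^ (w - k) = d + d" using k by (simp add: d_def Suc_diff_Suc[symmetric])
        have d31: "?\<rho> 31 = d" using I by (simp add: d_def)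
        have dw: "d < 2 ^ w" unfolding d_def by (rule power_strict_increasing) (use k in auto)
        have wr: "wordy w ?\<rho>" by (rule wordy_upd[OF w3(2)]) (rule less_trans[OF k less_exp])
        have sm: "same \<rho> ?\<rho>" using I by simp
        let ?val = "\<lambda>c. view w m3 (b0 + 3) c + (if d < c + 1 then view w m3 (b0 + 3) (c - d) else 0)"
        \<comment> \<open>Either the stretch of \<open>d\<close> blocks ending at
          \<open>c - d\<close> adjoins the one ending at \<open>c\<close>, or the latter already
          reaches back to the first block.\<close>
        have stp: "?val c + rnk \<gamma> ((c + 1 - (d + d)) * w) = rnk \<gamma> ((c + 1) * w)" if "c < nb" for c
        proof (cases "d < c + 1")
          case True
          have 1: "view w m3 (b0 + 3) c + rnk \<gamma> ((c + 1 - d) * w) = rnk \<gamma> ((c + 1) * w)"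
            using I that by (simp add: d_def)
          have 2: "view w m3 (b0 + 3) (c - d) + rnk \<gamma> ((c - d + 1 - d) * w) = rnk \<gamma> ((c - d + 1) * w)"
            using I that by (simp add: d_def)
          have e: "c - d + 1 = c + 1 - d" "c + 1 - d - d = c + 1 - (d + d)" using True by auto
          show ?thesis using 1 2[unfolded e] unfolding if_P[OF True] by linarith
        next
          case False
          have "view w m3 (b0 + 3) c + rnk \<gamma> ((c + 1 - d) * w) = rnk \<gamma> ((c + 1) * w)"
            using I that by (simp add: d_def)
          moreover have "c + 1 - d = 0" "c + 1 - (d + d) = 0" using False by auto
          ultimately show ?thesis using False by simp
        qed
        show "run w (par 32 (V 12) (Adr (blk 3) (V 32))
           (Bin Add (At (blk 3) (V 32)) (Bin Mul (Bin Less (V 31) (Bin Add (V 32) (C 1))) (At (blk 3) (Bin Sub (V 32) (V 31))))) @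
           assign 31 (Bin Add (V 31) (V 31))) ?\<rho> m3 (1 + 1) (nb + 1 + 1) (\<lambda>m' \<rho>'. \<rho>' 30 = k \<and> ?I2 k m' \<rho>')"
        proof (rule run_append)
          show "run w (par 32 (V 12) (Adr (blk 3) (V 32))
           (Bin Add (At (blk 3) (V 32)) (Bin Mul (Bin Less (V 31) (Bin Add (V 32) (C 1))) (At (blk 3) (Bin Sub (V 32) (V 31))))))
            ?\<rho> m3 1 (nb + 1) (\<lambda>m' \<rho>'. \<rho>' = ?\<rho> \<and> ?fr m' \<and> (\<forall>c<nb. view w m' (b0 + 3) c = ?val c))"
          proof (rule run_fill[where b = "b0 + 3" and \<omega> = "\<lambda>j. j" and val = ?val])
            fix j assume j: "j < nb"
            have jw: "j < 2 ^ w" "j + 1 < 2 ^ w" using j nV bsize_less by linarith+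
            let ?r = "?\<rho>(32 := j)"
            have c: "eval w m3 ?r (Bin Less (V 31) (Bin Add (V 32) (C 1))) = of_bool (d < j + 1)"
              using jw d31 by (simp add: eval_Less eval_Add)
            have "eval w m3 ?r (At (blk 3) (Bin Sub (V 32) (V 31))) = view w m3 (b0 + 3) (j - d)" if "d < j + 1"
            proof -
              have "eval w m3 ?r (Bin Sub (V 32) (V 31)) = j - d" using that d31 jw by (subst eval_Sub) auto
              then show ?thesis using E[OF sm] j nV B by (subst eval_At) auto
            qed
            then have e: "eval w m3 ?r (Bin Mul (Bin Less (V 31) (Bin Add (V 32) (C 1))) (At (blk 3) (Bin Sub (V 32) (V 31))))
              = (if d < j + 1 then view w m3 (b0 + 3) (j - d) else 0)"
              using eval_cond[OF c w3(1) wordy_upd[OF wr jw(1)]] by simp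
            have "?val j < 2 ^ w" using stp[OF j] rV[OF c1w[OF j]] by linarith
            then show "eval w m3 ?r (Bin Add (At (blk 3) (V 32)) (Bin Mul (Bin Less (V 31) (Bin Add (V 32) (C 1))) (At (blk 3) (Bin Sub (V 32) (V 31))))) = ?val j"
              using at3[OF sm j] e by (subst eval_Add) auto
          next
            fix m' assume a: "\<And>j. j < nb \<Longrightarrow> view w m' (b0 + 3) j = ?val j"
              "\<And>b' x. b' \<noteq> b0 + 3 \<or> x \<notin> (\<lambda>j. j) ` {..<nb} \<Longrightarrow> view w m' b' x = view w m3 b' x"
            then show "?\<rho> = ?\<rho> \<and> ?fr m' \<and> (\<forall>c<nb. view w m' (b0 + 3) c = ?val c)" using I by (auto simp: fun_eq_iff)
          qed (use E[OF sm] nV B in \<open>auto simp: CC_def inj_on_def\<close>)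
          fix m4 \<rho>4 assume 4: "\<rho>4 = ?\<rho> \<and> ?fr m4 \<and> (\<forall>c<nb. view w m4 (b0 + 3) c = ?val c)"
          show "run w (assign 31 (Bin Add (V 31) (V 31))) \<rho>4 m4 1 1 (\<lambda>m' \<rho>'. \<rho>' 30 = k \<and> ?I2 k m' \<rho>')"
          proof (rule run_assign)
            have e: "eval w m4 \<rho>4 (Bin Add (V 31) (V 31)) = 2 ^ (w - k)" if "0 < k"
            proof -
              have "d + d < 2 ^ w" unfolding d2[symmetric] using that k by (intro power_strict_increasing) auto
              then show ?thesis using 4 d31 d2 by (simp add: eval_Add)
            qed
            have "\<forall>c<nb. view w m4 (b0 + 3) c + rnk \<gamma> ((c + 1 - 2 ^ (w - k)) * w) = rnk \<gamma> ((c + 1) * w)"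
              using 4 stp unfolding d2 by simp
            then show "(\<rho>4(31 := eval w m4 \<rho>4 (Bin Add (V 31) (V 31)))) 30 = k \<and>
              ?I2 k m4 (\<rho>4(31 := eval w m4 \<rho>4 (Bin Add (V 31) (V 31))))"
              using 4 e sm k by simp
          qed (auto simp: CC_def)
        qed
      qed (use a in auto)
    qed
  qed
  have p4: "run w (assign 30 (V 2) @
     loop 30 (par 32 (V 12) (Adr (blk 3) (V 32))
       (Bin Sub (At (blk 3) (V 32)) (At (blk 1) (Bin Add (Bin Mul (V 32) (V 2)) (V 30)))) @
       par 32 (V 12) (Adr (blk 4) (Bin Add (Bin Mul (V 32) (V 2)) (V 30))) (At (blk 3) (V 32)))) \<rho>1 m1
     (1 + (w * (1 + 1 + 2) + 1)) (1 + (w * (nb + 1 + (nb + 1) + 2) + 1)) (\<lambda>m' \<rho>'. \<rho>' 30 = 0 \<and> ?I3 0 m' \<rho>')"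
    if m1: "word_memory w m1" "wordy w \<rho>1" "\<rho>1 30 = 0 \<and> ?I2 0 m1 \<rho>1" for \<rho>1 m1
  proof (rule run_append)
    \<comment> \<open>There are fewer than \<open>2 ^ w\<close> blocks, so after \<open>w\<close>
      rounds every stretch reaches back to the first block.\<close>
    have nb2: "c + 1 - 2 ^ w = 0" if "c < nb" for c
      using that nV(2) bsize_less by linarith
    have "view w m1 (b0 + 3) c = rnk \<gamma> (c * w + w)" if "c < nb" for c
    proof -
      have "view w m1 (b0 + 3) c + rnk \<gamma> ((c + 1 - 2 ^ (w - 0)) * w) = rnk \<gamma> ((c + 1) * w)"
        using m1(3) that by blast
      then show ?thesis
        by (simp only: diff_zero nb2[OF that] mult_0 rnk_0 add_0_right add_mult_distrib mult_1)
    qed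
    then have "?I3 w m1 \<rho>1" using m1 by auto
    then show "run w (assign 30 (V 2)) \<rho>1 m1 1 1 (\<lambda>m' \<rho>'. ?I3 w m' \<rho>' \<and> \<rho>' 30 = w)"
      by (intro run_assign) (use regs_okD[OF regs_ok, of \<rho>1] in \<open>auto simp: CC_def\<close>)
    fix m2 \<rho>2 assume a: "word_memory w m2" "wordy w \<rho>2" "?I3 w m2 \<rho>2 \<and> \<rho>2 30 = w"
    show "run w (loop 30 (par 32 (V 12) (Adr (blk 3) (V 32))
       (Bin Sub (At (blk 3) (V 32)) (At (blk 1) (Bin Add (Bin Mul (V 32) (V 2)) (V 30)))) @
       par 32 (V 12) (Adr (blk 4) (Bin Add (Bin Mul (V 32) (V 2)) (V 30))) (At (blk 3) (V 32)))) \<rho>2 m2 (w * (1 + 1 + 2) + 1) (w * (nb + 1 + (nb + 1) + 2) + 1)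
       (\<lambda>m' \<rho>'. \<rho>' 30 = 0 \<and> ?I3 0 m' \<rho>')"
    proof (rule run_loop[where I = ?I3])
      fix k m3 \<rho>3 assume k: "k < w" and w3: "word_memory w m3" "wordy w \<rho>3" and "\<rho>3 30 = Suc k" and I: "?I3 (Suc k) m3 \<rho>3"
      let ?\<rho> = "\<rho>3(30 := k)"
      have sm: "same \<rho> ?\<rho>" using I by simp
      have v1: "view w m3 (b0 + 1) = view w m (b0 + 1)" using I by auto
      show "run w (par 32 (V 12) (Adr (blk 3) (V 32))
       (Bin Sub (At (blk 3) (V 32)) (At (blk 1) (Bin Add (Bin Mul (V 32) (V 2)) (V 30)))) @
       par 32 (V 12) (Adr (blk 4) (Bin Add (Bin Mul (V 32) (V 2)) (V 30))) (At (blk 3) (V 32))) ?\<rho> m3 (1 + 1) (nb + 1 + (nb + 1))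
          (\<lambda>m' \<rho>'. \<rho>' 30 = k \<and> ?I3 k m' \<rho>')"
      proof (rule run_append)
        show "run w (par 32 (V 12) (Adr (blk 3) (V 32))
          (Bin Sub (At (blk 3) (V 32)) (At (blk 1) (Bin Add (Bin Mul (V 32) (V 2)) (V 30))))) ?\<rho> m3 1 (nb + 1)
          (\<lambda>m' \<rho>'. \<rho>' = ?\<rho> \<and> (\<forall>c<nb. view w m' (b0 + 3) c = rnk \<gamma> (c * w + k)) \<and>
             (\<forall>b. b \<noteq> b0 + 3 \<longrightarrow> view w m' b = view w m3 b))"
        proof (rule run_fill[where b = "b0 + 3" and \<omega> = "\<lambda>j. j" and val = "\<lambda>c. rnk \<gamma> (c * w + k)"])
          fix j assume j: "j < nb"
          have "view w m3 (b0 + 3) j = rnk \<gamma> (j * w + k) + of_bool (\<gamma> (j * w + k))" using I j by simp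
          then show "eval w m3 (?\<rho>(32 := j)) (Bin Sub (At (blk 3) (V 32)) (At (blk 1) (Bin Add (Bin Mul (V 32) (V 2)) (V 30))))
            = rnk \<gamma> (j * w + k)"
            using at3[OF sm j] at1[OF sm j _ k v1] view_less[OF w3(1), of "b0 + 3" j] by (subst eval_Sub) auto
        qed (use E[OF sm] nV B in \<open>auto simp: CC_def inj_on_def fun_eq_iff\<close>)
        fix m4 \<rho>4 assume w4: "word_memory w m4" and 4: "\<rho>4 = ?\<rho> \<and> (\<forall>c<nb. view w m4 (b0 + 3) c = rnk \<gamma> (c * w + k)) \<and>
             (\<forall>b. b \<noteq> b0 + 3 \<longrightarrow> view w m4 b = view w m3 b)"
        have r4: "\<rho>4 = ?\<rho>" using 4 by simp
        show "run w (par 32 (V 12) (Adr (blk 4) (Bin Add (Bin Mul (V 32) (V 2)) (V 30))) (At (blk 3) (V 32))) \<rho>4 m4 1 (nb + 1)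
          (\<lambda>m' \<rho>'. \<rho>' 30 = k \<and> ?I3 k m' \<rho>')"
          unfolding r4
        proof (rule run_fill[where b = "b0 + 4" and \<omega> = "\<lambda>j. j * w + k" and val = "\<lambda>c. rnk \<gamma> (c * w + k)"])
          fix m' assume a: "\<And>j. j < nb \<Longrightarrow> view w m' (b0 + 4) (j * w + k) = rnk \<gamma> (j * w + k)"
            "\<And>b' x. b' \<noteq> b0 + 4 \<or> x \<notin> (\<lambda>j. j * w + k) ` {..<nb} \<Longrightarrow> view w m' b' x = view w m4 b' x"
          have "view w m' (b0 + 4) (c * w + k') = rnk \<gamma> (c * w + k')" if c: "c < nb" and k': "k' < w" "k \<le> k'" for c k'
          proof (cases "k' = k")
            case False
            have "c * w + k' \<notin> (\<lambda>j. j * w + k) ` {..<nb}"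
            proof
              assume "c * w + k' \<in> (\<lambda>j. j * w + k) ` {..<nb}"
              then obtain j where "c * w + k' = j * w + k" by auto
              then have "(c * w + k') mod w = (j * w + k) mod w" by simp
              then show False using k k' False by simp
            qed
            then show ?thesis using a(2) 4 I c k' False by auto
          qed (use a c in auto)
          moreover have "\<And>b. b \<noteq> b0 + 4 \<Longrightarrow> view w m' b = view w m4 b" using a(2) by (auto simp: fun_eq_iff)
          ultimately show "?\<rho> 30 = k \<and> ?I3 k m' ?\<rho>" using 4 I sm by auto
        next
          fix j assume j: "j < nb"
          show "eval w m4 (?\<rho>(32 := j)) (At (blk 3) (V 32)) = rnk \<gamma> (j * w + k)"
            using 4 j by (subst at3[OF sm j]) simp
        qed (use E[OF sm] ad[OF sm] nV B k in \<open>auto simp: CC_def inj_on_def\<close>)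
      qed
    qed (use a in auto)
  qed
  have "run w scan \<rho> m (1 + ((1 + (w * (1 + 2) + 1)) + ((1 + (1 + (w * (1 + 1 + 2) + 1))) + (1 + (w * (1 + 1 + 2) + 1)))))
     ((nb + 1) + ((1 + (w * (nb + 1 + 2) + 1)) + ((1 + (1 + (w * (nb + 1 + 1 + 2) + 1))) + (1 + (w * (nb + 1 + (nb + 1) + 2) + 1)))))
     (\<lambda>m' \<rho>'. \<rho>' 30 = 0 \<and> ?I3 0 m' \<rho>')"
    unfolding scan_def
    by (intro run_append[OF p1] run_append[OF p2] run_append[OF p3] p4; assumption)
  then show ?thesis
  proof (rule run_cong_post)
    fix m' \<rho>' assume a: "\<rho>' 30 = 0 \<and> ?I3 0 m' \<rho>'"
    have "view w m' (b0 + 4) i = rnk \<gamma> i" if "i < nb * w" for i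
    proof -
      have "i div w < nb" using that by (simp add: less_mult_imp_div_less)
      moreover have "i mod w < w" using w_pos by simp
      ultimately have "view w m' (b0 + 4) (i div w * w + i mod w) = rnk \<gamma> (i div w * w + i mod w)"
        using a zero_le by blast
      then show ?thesis by (simp only: div_mult_mod_eq)
    qed
    then show "same \<rho> \<rho>' \<and> (\<forall>b. b \<noteq> b0 + 3 \<and> b \<noteq> b0 + 4 \<longrightarrow> view w m' b = view w m b) \<and>
      (\<forall>i<nb * w. view w m' (b0 + 4) i = rnk \<gamma> i)" using a by auto
  next
    have "1000 \<le> w" using w_big by simp
    then show "1 + ((1 + (w * (1 + 2) + 1)) + ((1 + (1 + (w * (1 + 1 + 2) + 1))) + (1 + (w * (1 + 1 + 2) + 1)))) \<le> 20 * w"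
      by simp
    \<comment> \<open>Each of the \<open>O(w)\<close> rounds costs \<open>O(nb)\<close>, and
      \<open>nb * w \<le> n + w\<close>; so even the doubling rounds take only linear work.\<close>
    have "(nb + 1) + ((1 + (w * (nb + 1 + 2) + 1)) + ((1 + (1 + (w * (nb + 1 + 1 + 2) + 1))) + (1 + (w * (nb + 1 + (nb + 1) + 2) + 1))))
      = nb + 4 * (nb * w) + 11 * w + 8" by (simp add: algebra_simps)
    also have "\<dots> \<le> 20 * (n + w)"
    proof -
      have "x \<le> n + w \<Longrightarrow> y \<le> x \<Longrightarrow> 1000 \<le> w \<Longrightarrow> y + 4 * x + 11 * w + 8 \<le> 20 * (n + w)" for x y :: nat
        unfolding add_mult_distrib2 by linarith
      then show ?thesis using nb_w(2) nb_le \<open>1000 \<le> w\<close> by blast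
    qed
    finally show "(nb + 1) + ((1 + (w * (nb + 1 + 2) + 1)) + ((1 + (1 + (w * (nb + 1 + 1 + 2) + 1))) + (1 + (w * (nb + 1 + (nb + 1) + 2) + 1))))
       \<le> 20 * (n + w)" .
  qed
qed

end

section \<open>Bitmap, positions and next sequence of a level\<close>

definition bitmap_code :: code where
  "bitmap_code = pack (blk 1) (blk 2) (C 0) (V 12) (C 2) (V 2)"

abbreviation (input) gE :: expr where "gE \<equiv> At (blk 1) (V 32)"
abbreviation (input) rE :: "expr \<Rightarrow> expr" where "rE x \<equiv> At (blk 4) x"
abbreviation (input) zE :: expr where "zE \<equiv> Bin Sub (V 0) (At (blk 4) (V 0))"

text \<open>Every index is sent to the slot given by its rank among equal bits. Before that, the
  arrays are filled with the default \<open>n\<close>, up to index \<open>n + A\<close> because the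
  start of the group behind the last one is read as well.\<close>

definition pos_code :: code where
  "pos_code =
     par 32 (Bin Add (V 0) (Bin Add (V 10) (C 1))) (Adr (blk 5) (V 32)) (V 0) @
     par 32 (Bin Add (V 0) (Bin Add (V 10) (C 1))) (Adr (blk 6) (V 32)) (V 0) @
     par 32 (V 0) (Adr (Bin Add (blk 5) gE) (Ite gE (rE (V 32)) (Bin Sub (V 32) (rE (V 32))))) (V 32)"

text \<open>A gather: slot \<open>j\<close> fetches the symbol at the \<open>j\<close>-th zero or,
  behind all zeros, at the corresponding one. It is stable because positions are listed in
  increasing order.\<close>

definition next_code :: code where
  "next_code = par 32 (V 0) (Adr (blk 32) (V 32))
     (At (blk 0) (Ite (Bin Less (V 32) zE) (At (blk 5) (V 32)) (At (blk 6) (Bin Sub (V 32) zE))))"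

context params
begin

text \<open>The unit of work of a level. The last summand is the size of the table, which is built
  anew on each level; \<open>M_linear\<close> shows that all of this is \<open>O(n)\<close>.\<close>

definition "M = n + A + (U + 1) * 2 ^ U"

lemma M_G: "n \<le> M" "A \<le> M" "w \<le> M" "per \<le> M" "(U + 1) * 2 ^ U \<le> M" "2 ^ U \<le> M" "1000 \<le> M"
proof -
  show "n \<le> M" "A \<le> M" "(U + 1) * 2 ^ U \<le> M" by (simp_all add: M_def)
  then show "w \<le> M" using w_le_A by linarith
  then show "per \<le> M" using per_le by linarith
  show "1000 \<le> M" using \<open>w \<le> M\<close> w_big by simp
  have "1 * 2 ^ U \<le> (U + 1) * 2 ^ U" by (rule mult_right_mono) simp_all
  then show "2 ^ U \<le> M" using \<open>(U + 1) * 2 ^ U \<le> M\<close> by linarith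
qed

lemma atb:
  assumes "regs_ok \<rho> b0" "same \<rho> \<rho>'" "k \<le> 99" "eval w m \<rho>' e = x" "x < bsize"
  shows "eval w m \<rho>' (At (blk k) e) = view w m (b0 + k) x"
  using assms regs_okD[OF assms(1,2)] by (subst eval_At) auto

lemma run_bitmap:
  assumes regs_ok: "regs_ok \<rho> b0" and wm: "word_memory w m" and wr: "wordy w \<rho>"
    and bt: "\<And>i. i < nb * w \<Longrightarrow> view w m (b0 + 1) i = of_bool (\<gamma> i)"
  shows "run w bitmap_code \<rho> m (6 * w) (20 * M)
    (\<lambda>m' \<rho>'. same \<rho> \<rho>' \<and> (\<forall>b. b \<noteq> b0 + 2 \<longrightarrow> view w m' b = view w m b) \<and>
      (\<forall>i<n. bit (view w m' (b0 + 2) (i div w)) (i mod w) = \<gamma> i))"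
proof -
  note B = regs_okD[OF regs_ok same_refl]
  have nV: "nb * w \<le> bsize" "nb \<le> bsize" using nbw_G by (auto intro!: less_imp_le[OF le_G_bsize])
  have cb: "cst w \<rho> (blk k) (b0 + k)" if "k \<le> 99" for k
    unfolding B(4)[symmetric] by (intro cst_Add cst_V cst_C) (use that B(15) G_1000 bsize_less B(4) in auto)
  have c: "cst w \<rho> (V 12) nb" "cst w \<rho> (V 2) w" "cst w \<rho> (C 0) 0" "cst w \<rho> (C 2) 2"
    using cst_V[of 12 w \<rho>] cst_V[of 2 w \<rho>] B by (auto simp: cst_def)
  have "run w bitmap_code \<rho> m (3 * w + 3) (w * (nb + 3) + nb + 3)
    (\<lambda>m' \<rho>'. \<rho>' = \<rho>(30 := 0) \<and>
      (\<forall>b i. b \<noteq> b0 + 2 \<or> i < 0 \<or> 0 + nb \<le> i \<longrightarrow> view w m' b i = view w m b i) \<and>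
      (\<forall>j<nb. view w m' (b0 + 2) (0 + j) = digits 2 (view w m (b0 + 1)) (j * w) w))"
    unfolding bitmap_code_def
    by (rule run_pack[OF cb cb c(3) c(1) c(4) c(2)]) (use B nV wm wr in auto)
  then show ?thesis
  proof (rule run_cong_post)
    fix m' \<rho>' assume a: "\<rho>' = \<rho>(30 := 0) \<and>
      (\<forall>b i. b \<noteq> b0 + 2 \<or> i < 0 \<or> 0 + nb \<le> i \<longrightarrow> view w m' b i = view w m b i) \<and>
      (\<forall>j<nb. view w m' (b0 + 2) (0 + j) = digits 2 (view w m (b0 + 1)) (j * w) w)"
    have "bit (view w m' (b0 + 2) (i div w)) (i mod w) = \<gamma> i" if "i < n" for i
    proof -
      have i: "i < nb * w" using that nb_w by linarith
      then have "i div w < nb" by (simp add: less_mult_imp_div_less)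
      then have "view w m' (b0 + 2) (i div w) = digits 2 (view w m (b0 + 1)) (i div w * w) w"
        using a by auto
      moreover have "digits 2 (view w m (b0 + 1)) (i div w * w) w div 2 ^ (i mod w) mod 2
         = view w m (b0 + 1) (i div w * w + i mod w) mod 2"
        by (rule digits_digit) (use w_pos in auto)
      ultimately show ?thesis using bt[OF i] by (simp add: bit_iff_odd odd_iff_mod_2_eq_one)
    qed
    then show "same \<rho> \<rho>' \<and> (\<forall>b. b \<noteq> b0 + 2 \<longrightarrow> view w m' b = view w m b) \<and>
      (\<forall>i<n. bit (view w m' (b0 + 2) (i div w)) (i mod w) = \<gamma> i)"
      using a by (auto intro!: ext simp del: fun_upd_apply)
  next
    show "3 * w + 3 \<le> 6 * w" using w_big by simp
    have "w * (nb + 3) + nb + 3 = nb * w + nb + 3 * w + 3" by (simp add: algebra_simps)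
    also have "\<dots> \<le> 20 * M"
      using nb_w(2) nb_le M_G by linarith
    finally show "w * (nb + 3) + nb + 3 \<le> 20 * M" .
  qed
qed

lemma nA_small: "n + (A + 1) < bsize" "n + A + 1 < 2 ^ w"
  using n_le_G A_le_G G_1000 by (auto intro!: less_Vv_w le_G_bsize)

lemma rnk_b: "i \<le> n \<Longrightarrow> (if b then rnk \<gamma> i else i - rnk \<gamma> i) = rnk (\<lambda>p. \<gamma> p = b) i"
  by (simp add: rnk_not)

lemma run_fill0:
  assumes regs_ok: "regs_ok \<rho> b0" and k: "k \<le> 99" and e: "eval w m \<rho> ce = N" "N \<le> bsize" "wf_expr ce" "elen ce \<le> 30"
    and wf: "wf_expr ve" "elen ve \<le> 100"
    and v: "\<And>j. j < N \<Longrightarrow> eval w m (\<rho>(32 := j)) ve = val j"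
  shows "run w (par 32 ce (Adr (blk k) (V 32)) ve) \<rho> m 1 (N + 1)
     (\<lambda>m' \<rho>'. \<rho>' = \<rho> \<and> (\<forall>b. b \<noteq> b0 + k \<longrightarrow> view w m' b = view w m b) \<and> (\<forall>j<N. view w m' (b0 + k) j = val j))"
proof (rule run_fill[where b = "b0 + k" and \<omega> = "\<lambda>j. j" and val = val])
  fix j assume "j < N"
  then show "j < bsize" using e by simp
  show "eval w m (\<rho>(32 := j)) (blk k) = b0 + k" using regs_okD[OF regs_ok, of "\<rho>(32 := j)"] k by simp
qed (use assms regs_okD[OF regs_ok same_refl] in \<open>auto simp: CC_def inj_on_def fun_eq_iff\<close>)

lemma run_pos:
  assumes regs_ok: "regs_ok \<rho> b0" and wm: "word_memory w m" and wr: "wordy w \<rho>"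
    and bt: "\<And>i. i < n \<Longrightarrow> view w m (b0 + 1) i = of_bool (\<gamma> i)"
    and rk: "\<And>i. i \<le> n \<Longrightarrow> view w m (b0 + 4) i = rnk \<gamma> i"
  shows "run w pos_code \<rho> m 3 (20 * M)
    (\<lambda>m' \<rho>'. \<rho>' = \<rho> \<and> (\<forall>b. b \<noteq> b0 + 5 \<and> b \<noteq> b0 + 6 \<longrightarrow> view w m' b = view w m b) \<and>
      (\<forall>b. \<forall>j\<le>n + A. view w m' (b0 + (5 + of_bool b)) j = Pb \<gamma> b j))"
    (is "run w _ \<rho> m _ _ ?Q")
proof -
  note B = regs_okD[OF regs_ok same_refl]
  let ?N = "n + (A + 1)"
  have ce: "eval w m' \<rho> (Bin Add (V 0) (Bin Add (V 10) (C 1))) = ?N" for m'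
    using nA_small B by (simp add: eval_Add)
  have p12: "run w (par 32 (Bin Add (V 0) (Bin Add (V 10) (C 1))) (Adr (blk k) (V 32)) (V 0)) \<rho> m' 1 (?N + 1)
    (\<lambda>m'' \<rho>'. \<rho>' = \<rho> \<and> (\<forall>b. b \<noteq> b0 + k \<longrightarrow> view w m'' b = view w m' b) \<and> (\<forall>j<?N. view w m'' (b0 + k) j = n))" if "k \<le> 99" for k m'
    by (rule run_fill0[OF regs_ok that ce]) (use nA_small B in auto)
  have p3: "run w (par 32 (V 0) (Adr (Bin Add (blk 5) gE) (Ite gE (rE (V 32)) (Bin Sub (V 32) (rE (V 32))))) (V 32)) \<rho> m2 1 (n + 1)
    ?Q"
    if w2: "word_memory w m2" and fr: "\<And>b. b \<noteq> b0 + 5 \<Longrightarrow> b \<noteq> b0 + 6 \<Longrightarrow> view w m2 b = view w m b"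
      and pre: "\<And>j b. j < ?N \<Longrightarrow> view w m2 (b0 + (5 + of_bool b)) j = n" for m2
  proof (rule run_par2[where \<beta> = "\<lambda>j. b0 + (5 + of_bool (\<gamma> j))" and \<omega> = "\<lambda>j. rnk (\<lambda>p. \<gamma> p = \<gamma> j) j" and val = "\<lambda>j. j"])
    fix j assume j: "j < n"
    let ?r = "\<rho>(32 := j)"
    have sm: "same \<rho> ?r" by simp
    have jV: "j < bsize" using j nA_small by linarith
    have wr': "wordy w ?r" by (rule wordy_upd[OF wr]) (use jV bsize_less in linarith)
    have g: "eval w m2 ?r gE = of_bool (\<gamma> j)"
      using atb[OF regs_ok sm _ _ jV, of 1 m2 "V 32"] bt[OF j] fr by simp
    have r: "eval w m2 ?r (rE (V 32)) = rnk \<gamma> j"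
      using atb[OF regs_ok sm _ _ jV, of 4 m2 "V 32"] rk[of j] j fr by simp
    show "eval w m2 ?r (Bin Add (blk 5) gE) = b0 + (5 + of_bool (\<gamma> j))"
      using regs_okD(16)[OF regs_ok sm, of 5] g B(15) bsize_less by (subst eval_Add) auto
    show "b0 + (5 + of_bool (\<gamma> j)) < bsize" using B(15) by auto
    have "rnk \<gamma> j \<le> j" by (rule rnk_le)
    then have "eval w m2 ?r (Bin Sub (V 32) (rE (V 32))) = j - rnk \<gamma> j"
      using r jV bsize_less by (subst eval_Sub) auto
    then have "eval w m2 ?r (Ite gE (rE (V 32)) (Bin Sub (V 32) (rE (V 32)))) = (if \<gamma> j then rnk \<gamma> j else j - rnk \<gamma> j)"
      using r by (subst eval_Ite[OF g w2 wr' w_pos]) auto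
    then show "eval w m2 ?r (Ite gE (rE (V 32)) (Bin Sub (V 32) (rE (V 32)))) = rnk (\<lambda>p. \<gamma> p = \<gamma> j) j"
      using rnk_b[of j "\<gamma> j" \<gamma>] j by simp
    show "rnk (\<lambda>p. \<gamma> p = \<gamma> j) j < bsize" using rnk_le[of "\<lambda>p. \<gamma> p = \<gamma> j" j] jV by linarith
    show "eval w m2 ?r (V 32) = j" by simp
  next
    fix m' assume sc: "vscatter m2 n (\<lambda>j. b0 + (5 + of_bool (\<gamma> j))) (\<lambda>j. rnk (\<lambda>p. \<gamma> p = \<gamma> j) j) (\<lambda>j. j) m'"
    have "view w m' b = view w m b" if "b \<noteq> b0 + 5 \<and> b \<noteq> b0 + 6" for b
    proof
      fix x
      have "\<not> (\<exists>j<n. b0 + (5 + of_bool (\<gamma> j)) = b \<and> rnk (\<lambda>p. \<gamma> p = \<gamma> j) j = x)"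
        using that by (auto simp: of_bool_def split: if_splits)
      then show "view w m' b x = view w m b x"
        using sc[unfolded vscatter_def, rule_format, of b x] fr[of b] that by metis
    qed
    moreover have "view w m' (b0 + (5 + of_bool b)) x = Pb \<gamma> b x" if x: "x \<le> n + A" for b x
    proof (cases "\<exists>j<n. b0 + (5 + of_bool (\<gamma> j)) = b0 + (5 + of_bool b) \<and> rnk (\<lambda>p. \<gamma> p = \<gamma> j) j = x")
      case True
      then obtain j where j: "j < n" "of_bool (\<gamma> j) = (of_bool b :: nat)" "rnk (\<lambda>p. \<gamma> p = \<gamma> j) j = x"
        "view w m' (b0 + (5 + of_bool b)) x = j"
        using sc[unfolded vscatter_def, rule_format, of "b0 + (5 + of_bool b)" x] by auto
      then have "\<gamma> j = b" by (cases b) (auto split: if_splits simp: of_bool_def)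
      \<comment> \<open>\<open>pos\<close> inverts the rank among equal bits, so the value in slot
        \<open>x\<close> does not depend on which strand has written it.\<close>
      then show ?thesis using j pos_rnk[of j n "\<lambda>p. \<gamma> p = b"] by (simp add: Pb_def)
    next
      case False
      have "\<not> x < rnk (\<lambda>p. \<gamma> p = b) n"
      proof
        assume "x < rnk (\<lambda>p. \<gamma> p = b) n"
        then obtain j where j: "j < n" "\<gamma> j = b" "rnk (\<lambda>p. \<gamma> p = b) j = x"
          using nth_ones[of x "\<lambda>p. \<gamma> p = b" n] by blast
        then have "b0 + (5 + of_bool (\<gamma> j)) = b0 + (5 + of_bool b) \<and> rnk (\<lambda>p. \<gamma> p = \<gamma> j) j = x"
          by simp
        then show False using False j(1) by blast
      qed
      then have "Pb \<gamma> b x = n" by (simp add: Pb_def pos_def)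
      moreover have "view w m' (b0 + (5 + of_bool b)) x = n"
        using sc[unfolded vscatter_def, rule_format, of "b0 + (5 + of_bool b)" x] False pre[of x b] x
        by (metis (no_types, lifting) add.assoc le_imp_less_Suc Suc_eq_plus1)
      ultimately show ?thesis by simp
    qed
    ultimately show "\<rho> = \<rho> \<and> (\<forall>b. b \<noteq> b0 + 5 \<and> b \<noteq> b0 + 6 \<longrightarrow> view w m' b = view w m b) \<and>
      (\<forall>b. \<forall>j\<le>n + A. view w m' (b0 + (5 + of_bool b)) j = Pb \<gamma> b j)" by blast
  qed (use B in \<open>auto simp: CC_def\<close>)
  have "run w pos_code \<rho> m (1 + (1 + 1)) ((?N + 1) + ((?N + 1) + (n + 1)))
    ?Q"
    unfolding pos_code_def
  proof (rule run_append[OF p12])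
    fix m1 \<rho>1 assume 1: "\<rho>1 = \<rho> \<and> (\<forall>b. b \<noteq> b0 + 5 \<longrightarrow> view w m1 b = view w m b) \<and> (\<forall>j<?N. view w m1 (b0 + 5) j = n)"
    then have r1: "\<rho>1 = \<rho>" by simp
    show "run w (par 32 (Bin Add (V 0) (Bin Add (V 10) (C 1))) (Adr (blk 6) (V 32)) (V 0) @
     par 32 (V 0) (Adr (Bin Add (blk 5) gE) (Ite gE (rE (V 32)) (Bin Sub (V 32) (rE (V 32))))) (V 32)) \<rho>1 m1
      (1 + 1) ((?N + 1) + (n + 1)) ?Q"
      unfolding r1
    proof (rule run_append[OF p12])
      fix m2 \<rho>2 assume w2: "word_memory w m2" and 2: "\<rho>2 = \<rho> \<and> (\<forall>b. b \<noteq> b0 + 6 \<longrightarrow> view w m2 b = view w m1 b) \<and> (\<forall>j<?N. view w m2 (b0 + 6) j = n)"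
      then have r2: "\<rho>2 = \<rho>" by simp
      show "run w (par 32 (V 0) (Adr (Bin Add (blk 5) gE) (Ite gE (rE (V 32)) (Bin Sub (V 32) (rE (V 32))))) (V 32)) \<rho>2 m2 1 (n + 1)
       ?Q"
        unfolding r2 by (rule p3[OF w2]) (use 1 2 in \<open>auto simp: of_bool_def\<close>)
    qed simp
  qed simp
  then show ?thesis by (rule run_cong_post) (use M_G in auto)
qed

lemma run_next:
  assumes regs_ok: "regs_ok \<rho> b0" and wm: "word_memory w m" and wr: "wordy w \<rho>"
    and rk: "view w m (b0 + 4) n = rnk \<gamma> n"
    and P: "\<And>b j. j \<le> n + A \<Longrightarrow> view w m (b0 + (5 + of_bool b)) j = Pb \<gamma> b j"
  shows "run w next_code \<rho> m 1 (20 * M)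
    (\<lambda>m' \<rho>'. \<rho>' = \<rho> \<and> (\<forall>b. b \<noteq> b0 + 32 \<longrightarrow> view w m' b = view w m b) \<and>
      (\<forall>j<n. view w m' (b0 + 32) j = view w m b0 (if j < n - rnk \<gamma> n then Pb \<gamma> False j else Pb \<gamma> True (j - (n - rnk \<gamma> n)))))"
    (is "run w _ \<rho> m _ _ ?Q")
proof -
  note B = regs_okD[OF regs_ok same_refl]
  have "run w next_code \<rho> m 1 (n + 1)
    ?Q"
    unfolding next_code_def
  proof (rule run_fill0[OF regs_ok])
    fix j assume j: "j < n"
    let ?r = "\<rho>(32 := j)"
    have sm: "same \<rho> ?r" by simp
    note B' = regs_okD[OF regs_ok sm]
    have nV: "n < bsize" using nA_small by linarith
    have jV: "j < bsize" "j < 2 ^ w" using j nV bsize_less by linarith+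
    have wr': "wordy w ?r" by (rule wordy_upd[OF wr]) (use jV in simp)
    have r: "eval w m ?r (At (blk 4) (V 0)) = rnk \<gamma> n"
      using atb[OF regs_ok sm _ _ nV, of 4 m "V 0"] B'(1) rk by simp
    have z: "eval w m ?r zE = n - rnk \<gamma> n"
      using r B'(1) rnk_le[of \<gamma> n] nV bsize_less by (subst eval_Sub) auto
    have c: "eval w m ?r (Bin Less (V 32) zE) = of_bool (j < n - rnk \<gamma> n)"
      using z by (simp add: eval_Less)
    have e1: "eval w m ?r (At (blk 5) (V 32)) = Pb \<gamma> False j"
      using atb[OF regs_ok sm _ _ jV(1), of 5 m "V 32"] P[of j False] j by simp
    have e2: "eval w m ?r (At (blk 6) (Bin Sub (V 32) zE)) = Pb \<gamma> True (j - (n - rnk \<gamma> n))" if "\<not> j < n - rnk \<gamma> n"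
    proof -
      have "eval w m ?r (Bin Sub (V 32) zE) = j - (n - rnk \<gamma> n)"
        using z that jV by (subst eval_Sub) auto
      then show ?thesis using atb[OF regs_ok sm, of 6 m _ "j - (n - rnk \<gamma> n)"] jV P[of "j - (n - rnk \<gamma> n)" True] j by simp
    qed
    show "eval w m ?r (At (blk 0) (Ite (Bin Less (V 32) zE) (At (blk 5) (V 32)) (At (blk 6) (Bin Sub (V 32) zE)))) =
      view w m b0 (if j < n - rnk \<gamma> n then Pb \<gamma> False j else Pb \<gamma> True (j - (n - rnk \<gamma> n)))"
    proof -
      have e: "eval w m ?r (Ite (Bin Less (V 32) zE) (At (blk 5) (V 32)) (At (blk 6) (Bin Sub (V 32) zE)))
        = (if j < n - rnk \<gamma> n then Pb \<gamma> False j else Pb \<gamma> True (j - (n - rnk \<gamma> n)))"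
        unfolding eval_Ite[OF c wm wr' w_pos] using e1 e2 by (simp del: eval.simps)
      have lt: "(if j < n - rnk \<gamma> n then Pb \<gamma> False j else Pb \<gamma> True (j - (n - rnk \<gamma> n))) < bsize"
        using Pb_le[of \<gamma> False j] Pb_le[of \<gamma> True "j - (n - rnk \<gamma> n)"] nV by simp
      show ?thesis using atb[of \<rho> b0 ?r 0, OF regs_ok sm _ e lt] by (simp only: add_0_right zero_le simp_thms)
    qed
  qed (use B nA_small in auto)
  then show ?thesis by (rule run_cong_post) (use M_G in auto)
qed

end

section \<open>Components of the structure, and the rank samples\<close>

abbreviation cE :: "nat \<Rightarrow> expr" where "cE k \<equiv> Bin Add (C 2) (Bin Mul (C k) (V 13))"

definition pfld :: "expr \<Rightarrow> nat \<Rightarrow> code" where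
  "pfld ce k = pack (blk 7) (blk 8) (cE k) (Bin Add (Bin Div ce (V 7)) (C 1)) (V 11) (V 7)"

definition rank_code :: code where
  "rank_code =
     par 32 (Bin Add (Bin Div (V 0) (V 10)) (C 1)) (Adr (blk 8) (Bin Add (cE 0) (V 32)))
       (At (blk 4) (Bin Mul (V 32) (V 10))) @
     par 32 (Bin Add (Bin Div (V 0) (V 8)) (C 1)) (Adr (blk 7) (V 32))
       (Bin Sub (At (blk 4) (Bin Mul (V 32) (V 8)))
          (At (blk 4) (Bin Mul (Bin Div (Bin Mul (V 32) (V 8)) (V 10)) (V 10)))) @
     pfld (Bin Div (V 0) (V 8)) 1"

context params
begin

text \<open>The counterpart of \<open>st\<close> in block coordinates: the construction addresses
  blocks, a query absolute words.\<close>

definition cell :: "mem \<Rightarrow> nat \<Rightarrow> nat \<Rightarrow> nat \<Rightarrow> nat" where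
  "cell m b0 k i = view w m (b0 + 8) (2 + k * csize + i)"

text \<open>Blocks 7 and 9 are scratch. In block 8 the header and the components outside
  \<open>K\<close> persist, so that what one phase has built is still there after the following
  phases.\<close>

definition frame :: "nat \<Rightarrow> nat set \<Rightarrow> mem \<Rightarrow> mem \<Rightarrow> bool" where
  "frame b0 K m m' \<longleftrightarrow>
     (\<forall>b. b \<noteq> b0 + 7 \<and> b \<noteq> b0 + 8 \<and> b \<noteq> b0 + 9 \<longrightarrow> view w m' b = view w m b) \<and>
     (\<forall>x<2. view w m' (b0 + 8) x = view w m (b0 + 8) x) \<and>
     (\<forall>k i. k \<notin> K \<longrightarrow> i < csize \<longrightarrow> cell m' b0 k i = cell m b0 k i)"

lemma frame_trans: "frame b0 K m m' \<Longrightarrow> frame b0 K' m' m'' \<Longrightarrow> frame b0 (K \<union> K') m m''"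
  by (auto simp: frame_def)

lemma offs_inj: "i < csize \<Longrightarrow> i' < csize \<Longrightarrow> 2 + k * csize + i = 2 + k' * csize + i' \<longleftrightarrow> k = k' \<and> i = i'"
proof
  assume a: "i < csize" "i' < csize" "2 + k * csize + i = 2 + k' * csize + i'"
  then have "k * csize + i = k' * csize + i'" by linarith
  then have "(k * csize + i) div csize = (k' * csize + i') div csize" "(k * csize + i) mod csize = (k' * csize + i') mod csize" by simp_all
  then show "k = k' \<and> i = i'" using a by simp
qed auto

lemma offs_less: "k \<le> 11 \<Longrightarrow> i \<le> csize \<Longrightarrow> 2 + k * csize + i < bsize"
proof -
  assume "k \<le> 11" "i \<le> csize"
  moreover from this have "k * csize \<le> 11 * csize" by (intro mult_right_mono) auto
  ultimately show ?thesis using csize_bsize by linarith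
qed

lemma eval_cE: "regs_ok \<rho> b0 \<Longrightarrow> same \<rho> \<rho>' \<Longrightarrow> k \<le> 11 \<Longrightarrow> eval w m \<rho>' (cE k) = 2 + k * csize"
  using regs_okD(13)[of \<rho> b0 \<rho>'] offs_less[of k 0] bsize_less G_1000 by (simp add: eval_Add eval_Mul)

lemma eval_cEi: "regs_ok \<rho> b0 \<Longrightarrow> same \<rho> \<rho>' \<Longrightarrow> k \<le> 11 \<Longrightarrow> eval w m \<rho>' ie = i \<Longrightarrow> i \<le> csize \<Longrightarrow>
    eval w m \<rho>' (Bin Add (cE k) ie) = 2 + k * csize + i"
  using offs_less[of k i] bsize_less by (subst eval_Add) (auto simp: eval_cE)

lemma run_cfill:
  assumes regs_ok: "regs_ok \<rho> b0" and k: "k \<le> 11" and e: "eval w m \<rho> ce = N" "wf_expr ce" "elen ce \<le> 30"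
    and wf: "wf_expr ve" "elen ve \<le> 100" "wf_expr ie" "elen ie \<le> 100"
    and \<omega>: "\<And>j. j < N \<Longrightarrow> eval w m (\<rho>(32 := j)) ie = \<omega> j" "\<And>j. j < N \<Longrightarrow> \<omega> j < csize" "inj_on \<omega> {..<N}"
    and v: "\<And>j. j < N \<Longrightarrow> eval w m (\<rho>(32 := j)) ve = val j"
  shows "run w (par 32 ce (Adr (blk 8) (Bin Add (cE k) ie)) ve) \<rho> m 1 (N + 1)
     (\<lambda>m' \<rho>'. \<rho>' = \<rho> \<and> frame b0 {k} m m' \<and> (\<forall>j<N. cell m' b0 k (\<omega> j) = val j) \<and>
        (\<forall>i<csize. i \<notin> \<omega> ` {..<N} \<longrightarrow> cell m' b0 k i = cell m b0 k i))"
proof (rule run_fill[where b = "b0 + 8" and \<omega> = "\<lambda>j. 2 + k * csize + \<omega> j" and val = val])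
  fix j assume j: "j < N"
  show "2 + k * csize + \<omega> j < bsize" using offs_less[OF k] \<omega>(2)[OF j] by simp
  show "eval w m (\<rho>(32 := j)) (blk 8) = b0 + 8" using regs_okD[OF regs_ok, of "\<rho>(32 := j)"] by simp
  show "eval w m (\<rho>(32 := j)) (Bin Add (cE k) ie) = 2 + k * csize + \<omega> j"
    by (rule eval_cEi[OF regs_ok _ k]) (use \<omega>(1,2)[of j] j in auto)
next
  fix m' assume a: "\<And>j. j < N \<Longrightarrow> view w m' (b0 + 8) (2 + k * csize + \<omega> j) = val j"
    "\<And>b' x. b' \<noteq> b0 + 8 \<or> x \<notin> (\<lambda>j. 2 + k * csize + \<omega> j) ` {..<N} \<Longrightarrow> view w m' b' x = view w m b' x"
  have 1: "cell m' b0 k' i = cell m b0 k' i" if "i < csize" "k' \<noteq> k \<or> i \<notin> \<omega> ` {..<N}" for k' i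
  proof -
    have "2 + k' * csize + i \<notin> (\<lambda>j. 2 + k * csize + \<omega> j) ` {..<N}"
    proof
      assume "2 + k' * csize + i \<in> (\<lambda>j. 2 + k * csize + \<omega> j) ` {..<N}"
      then obtain j where "j < N" "2 + k' * csize + i = 2 + k * csize + \<omega> j" by auto
      then show False using offs_inj[OF that(1) \<omega>(2)] that(2) by auto
    qed
    then show ?thesis unfolding cell_def by (intro a(2)) simp
  qed
  have 2: "view w m' b = view w m b" if "b \<noteq> b0 + 8" for b using a(2) that by (auto simp: fun_eq_iff)
  have 3: "view w m' (b0 + 8) x = view w m (b0 + 8) x" if "x < 2" for x by (rule a(2)) (use that in auto)
  show "\<rho> = \<rho> \<and> frame b0 {k} m m' \<and> (\<forall>j<N. cell m' b0 k (\<omega> j) = val j) \<and>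
        (\<forall>i<csize. i \<notin> \<omega> ` {..<N} \<longrightarrow> cell m' b0 k i = cell m b0 k i)"
    using 1 2 3 a(1) by (auto simp: frame_def cell_def[symmetric]) (simp add: cell_def a(1))
qed (use assms regs_okD[OF regs_ok same_refl] in \<open>auto simp: CC_def inj_on_def\<close>)

text \<open>The last word may also absorb stale scratch cells beyond \<open>cnt\<close>; nothing is
  claimed about these fields.\<close>

lemma run_pfld:
  assumes regs_ok: "regs_ok \<rho> b0" and wm: "word_memory w m" and wr: "wordy w \<rho>"
    and c: "cst w \<rho> ce cnt" "elen ce \<le> 20" and cnt: "cnt \<le> 4 * G" "cnt \<le> 2 * M" and k: "k < 11" and Z: "cnt div per + 1 \<le> csize"
  shows "run w (pfld ce k) \<rho> m (6 * w) (20 * M) (\<lambda>m' \<rho>'. same \<rho> \<rho>' \<and> frame b0 {k} m m' \<and>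
     (\<forall>h\<le>cnt. field_at (cell m' b0) k h = view w m (b0 + 7) h mod F))"
proof -
  note B = regs_okD[OF regs_ok same_refl]
  let ?W = "cnt div per + 1"
  have cw: "cnt < 2 ^ w" using cnt G_1000 by (intro less_Vv_w le_G_bsize) linarith
  have Wc: "?W \<le> cnt + 1" by simp
  have Ww: "?W < 2 ^ w" using Wc cnt G_1000 by (intro less_Vv_w le_G_bsize) linarith
  have per: "?W * per \<le> cnt + per" by simp
  have cb: "cst w \<rho> (blk k) (b0 + k)" if "k \<le> 99" for k
    unfolding B(4)[symmetric] by (intro cst_Add cst_V cst_C) (use that B(15) G_1000 bsize_less B(4) in auto)
  have c7: "cst w \<rho> (V 7) per" "cst w \<rho> (V 11) F" "cst w \<rho> (V 13) csize"
    using cst_V[of 7 w \<rho>] cst_V[of 11 w \<rho>] cst_V[of 13 w \<rho>] B by auto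
  have cc: "cst w \<rho> (C c) c" if "c \<le> 99" for c
    using that by (auto simp: cst_def)
  have cW: "cst w \<rho> (Bin Add (Bin Div ce (V 7)) (C 1)) ?W"
    by (intro cst_Add cst_Div c c7 cc) (use cw Ww in auto)
  have kZ: "2 + k * csize + ?W < bsize" using offs_less[of k ?W] k Z by simp
  have cC: "cst w \<rho> (cE k) (2 + k * csize)"
    by (intro cst_Add cst_Mul c7 cc) (use k kZ bsize_less in auto)
  have WV: "?W * per \<le> bsize" using per cnt per_le w_le_G G_bsize1 by linarith
  have FP: "F ^ per \<le> 2 ^ w" using f_per unfolding F_def power_mult[symmetric] by (intro power_increasing) auto
  have "run w (pfld ce k) \<rho> m (3 * per + 3) (per * (?W + 3) + ?W + 3)
    (\<lambda>m' \<rho>'. \<rho>' = \<rho>(30 := 0) \<and>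
      (\<forall>b i. b \<noteq> b0 + 8 \<or> i < 2 + k * csize \<or> 2 + k * csize + ?W \<le> i \<longrightarrow> view w m' b i = view w m b i) \<and>
      (\<forall>j<?W. view w m' (b0 + 8) (2 + k * csize + j) = digits F (view w m (b0 + 7)) (j * per) per))"
    unfolding pfld_def
    by (rule run_pack[OF cb cb cC cW c7(2) c7(1)]) (use B WV FP kZ wm wr F_pos c(2) in auto)
  then show ?thesis
  proof (rule run_cong_post)
    fix m' \<rho>' assume a: "\<rho>' = \<rho>(30 := 0) \<and>
      (\<forall>b i. b \<noteq> b0 + 8 \<or> i < 2 + k * csize \<or> 2 + k * csize + ?W \<le> i \<longrightarrow> view w m' b i = view w m b i) \<and>
      (\<forall>j<?W. view w m' (b0 + 8) (2 + k * csize + j) = digits F (view w m (b0 + 7)) (j * per) per)"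
    have 1: "field_at (cell m' b0) k h = view w m (b0 + 7) h mod F" if "h \<le> cnt" for h
    proof -
      have "h div per \<le> cnt div per" using that by (rule div_le_mono)
      then have "cell m' b0 k (h div per) = digits F (view w m (b0 + 7)) (h div per * per) per"
        using a unfolding cell_def by auto
      moreover have "digits F (view w m (b0 + 7)) (h div per * per) per div F ^ (h mod per) mod F
         = view w m (b0 + 7) (h div per * per + h mod per) mod F"
        by (rule digits_digit) (use F_pos per_pos in auto)
      moreover have "F ^ (h mod per) = 2 ^ (h mod per * f)"
        unfolding F_def power_mult[symmetric] by (simp add: mult.commute)
      ultimately show ?thesis unfolding field_at_def by simp
    qed
    have 2: "cell m' b0 k' i = cell m b0 k' i" if "i < csize" "k' \<noteq> k" for k' i
    proof -
      have "2 + k' * csize + i < 2 + k * csize \<or> 2 + k * csize + ?W \<le> 2 + k' * csize + i"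
      proof (cases "k' < k")
        case True
        then have "Suc k' * csize \<le> k * csize" by (intro mult_right_mono) auto
        then show ?thesis using that by simp
      next
        case False
        then have "Suc k * csize \<le> k' * csize" using that by (intro mult_right_mono) auto
        then show ?thesis using Z by simp
      qed
      then show ?thesis unfolding cell_def using a by blast
    qed
    have 3: "view w m' b = view w m b" if "b \<noteq> b0 + 8" for b using a that by (auto simp: fun_eq_iff)
    have 4: "view w m' (b0 + 8) x = view w m (b0 + 8) x" if "x < 2" for x 
    proof -
      have "x < 2 + k * csize" using that by simp
      then show ?thesis using a by blast
    qed
    have "same \<rho> \<rho>'" using a by simp
    then show "same \<rho> \<rho>' \<and> frame b0 {k} m m' \<and> (\<forall>h\<le>cnt. field_at (cell m' b0) k h = view w m (b0 + 7) h mod F)"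
      using 1 2 3 4 by (auto simp: frame_def)
  next
    show "3 * per + 3 \<le> 6 * w" using per_le w_big by simp
    have "per * (?W + 3) + ?W + 3 = ?W * per + 3 * per + ?W + 3" by (simp add: algebra_simps)
    also have "\<dots> \<le> (cnt + per) + 3 * per + (cnt + 1) + 3" using per Wc by (intro add_mono) auto
    also have "\<dots> \<le> 20 * M" using cnt(2) M_G by linarith
    finally show "per * (?W + 3) + ?W + 3 \<le> 20 * M" .
  qed
qed

lemma div_mult_le: "h \<le> n div a \<Longrightarrow> h * a \<le> n"
  by (meson div_times_less_eq_dividend le_trans mult_le_mono1)

lemma run_rank:
  assumes regs_ok: "regs_ok \<rho> b0" and wm: "word_memory w m" and wr: "wordy w \<rho>"
    and rk: "\<And>i. i \<le> n \<Longrightarrow> view w m (b0 + 4) i = rnk \<gamma> i"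
  shows "run w rank_code \<rho> m (10 * w) (40 * M)
    (\<lambda>m' \<rho>'. same \<rho> \<rho>' \<and> frame b0 {0, 1} m m' \<and> lay_rank (cell m' b0) \<gamma>)"
    (is "run w _ \<rho> m _ _ ?Q")
proof -
  note B = regs_okD[OF regs_ok same_refl]
  let ?N1 = "n div A + 1" and ?N2 = "n div U + 1"
  have N: "n div A \<le> n" "n div U \<le> n" "n < bsize" "n + 1 < bsize" using nA_small by auto
  have Nw: "?N1 < 2 ^ w" "?N2 < 2 ^ w" "n < 2 ^ w" "?N2 \<le> bsize" using N bsize_less by linarith+
  have e1: "eval w m' \<rho> (Bin Add (Bin Div (V 0) (V 10)) (C 1)) = ?N1"
    and e2: "eval w m' \<rho> (Bin Add (Bin Div (V 0) (V 8)) (C 1)) = ?N2" for m'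
    using B Nw by (simp_all add: eval_Add eval_Div)
  have rb: "eval w m' \<rho>' (At (blk 4) e) = rnk \<gamma> x" if "same \<rho> \<rho>'" "eval w m' \<rho>' e = x" "x \<le> n" "view w m' (b0 + 4) = view w m (b0 + 4)" for m' \<rho>' e x
    using atb[OF regs_ok that(1) _ that(2), of 4] that rk N by simp
  have p1: "run w (par 32 (Bin Add (Bin Div (V 0) (V 10)) (C 1)) (Adr (blk 8) (Bin Add (cE 0) (V 32)))
       (At (blk 4) (Bin Mul (V 32) (V 10)))) \<rho> m 1 (?N1 + 1)
     (\<lambda>m' \<rho>'. \<rho>' = \<rho> \<and> frame b0 {0} m m' \<and> (\<forall>j<?N1. cell m' b0 0 j = rnk \<gamma> (j * A)) \<and>
        (\<forall>i<csize. i \<notin> (\<lambda>j. j) ` {..<?N1} \<longrightarrow> cell m' b0 0 i = cell m b0 0 i))"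
  proof (rule run_cfill[OF regs_ok])
    fix j assume j: "j < ?N1"
    have jA: "j * A \<le> n" by (rule div_mult_le) (use j in simp)
    show "eval w m (\<rho>(32 := j)) (At (blk 4) (Bin Mul (V 32) (V 10))) = rnk \<gamma> (j * A)"
      by (rule rb) (use jA B N bsize_less in \<open>auto simp: eval_Mul\<close>)
    show "j < csize" using csize_R1[of j] j by simp
  qed (use e1 in auto)
  have p2: "run w (par 32 (Bin Add (Bin Div (V 0) (V 8)) (C 1)) (Adr (blk 7) (V 32))
       (Bin Sub (At (blk 4) (Bin Mul (V 32) (V 8)))
          (At (blk 4) (Bin Mul (Bin Div (Bin Mul (V 32) (V 8)) (V 10)) (V 10))))) \<rho> m1 1 (?N2 + 1)
     (\<lambda>m' \<rho>'. \<rho>' = \<rho> \<and> (\<forall>b. b \<noteq> b0 + 7 \<longrightarrow> view w m' b = view w m1 b) \<and>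
       (\<forall>h<?N2. view w m' (b0 + 7) h = rnk \<gamma> (h * U) - rnk \<gamma> (h * U div A * A)))"
    if v4: "view w m1 (b0 + 4) = view w m (b0 + 4)" for m1
  proof (rule run_fill0[OF regs_ok])
    fix h assume h: "h < ?N2"
    let ?r = "\<rho>(32 := h)"
    have sm: "same \<rho> ?r" by simp
    have hU: "h * U \<le> n" by (rule div_mult_le) (use h in simp)
    have hA: "h * U div A * A \<le> h * U" by simp
    have hw: "h * U < 2 ^ w" "h * U div A * A < 2 ^ w" using hU hA N bsize_less by linarith+
    have 1: "eval w m1 ?r (Bin Mul (V 32) (V 8)) = h * U" using hw B by (simp add: eval_Mul)
    have 2: "eval w m1 ?r (Bin Mul (Bin Div (Bin Mul (V 32) (V 8)) (V 10)) (V 10)) = h * U div A * A"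
      using hw B 1 by (simp add: eval_Mul eval_Div)
    have le: "h * U div A * A \<le> n" using hU hA by linarith
    have "rnk \<gamma> (h * U) < 2 ^ w" using rnk_le[of \<gamma> "h * U"] hw by linarith
    then show "eval w m1 ?r (Bin Sub (At (blk 4) (Bin Mul (V 32) (V 8)))
          (At (blk 4) (Bin Mul (Bin Div (Bin Mul (V 32) (V 8)) (V 10)) (V 10)))) = rnk \<gamma> (h * U) - rnk \<gamma> (h * U div A * A)"
      unfolding rb[OF sm 1 hU v4, symmetric] rb[OF sm 2 le v4, symmetric]
      by (intro eval_Sub) (simp_all only: rb[OF sm 1 hU v4] rb[OF sm 2 le v4] rnk_mono[OF hA])
  qed (use e2 Nw in auto)
  have cn: "cst w \<rho> (Bin Div (V 0) (V 8)) (n div U)"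
    using cst_Div[OF cst_V[of 0 w \<rho>] cst_V[of 8 w \<rho>]] B N bsize_less by simp
  have NU: "n div U \<le> 4 * G" "n div U \<le> 2 * M" using N n_le_G M_G by linarith+
  have ZU: "n div U div per + 1 \<le> csize" using csize_R2[of "n div U"] by simp
  have "run w rank_code \<rho> m (1 + (1 + 6 * w)) ((?N1 + 1) + ((?N2 + 1) + 20 * M))
    ?Q"
    unfolding rank_code_def
  proof (rule run_append[OF p1])
    fix m1 \<rho>1 assume 1: "\<rho>1 = \<rho> \<and> frame b0 {0} m m1 \<and> (\<forall>j<?N1. cell m1 b0 0 j = rnk \<gamma> (j * A)) \<and>
        (\<forall>i<csize. i \<notin> (\<lambda>j. j) ` {..<?N1} \<longrightarrow> cell m1 b0 0 i = cell m b0 0 i)"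
    then have r1: "\<rho>1 = \<rho>" and v4: "view w m1 (b0 + 4) = view w m (b0 + 4)" by (auto simp: frame_def)
    show "run w (par 32 (Bin Add (Bin Div (V 0) (V 8)) (C 1)) (Adr (blk 7) (V 32))
       (Bin Sub (At (blk 4) (Bin Mul (V 32) (V 8)))
          (At (blk 4) (Bin Mul (Bin Div (Bin Mul (V 32) (V 8)) (V 10)) (V 10)))) @
      pfld (Bin Div (V 0) (V 8)) 1) \<rho>1 m1 (1 + 6 * w) ((?N2 + 1) + 20 * M)
      ?Q"
      unfolding r1
    proof (rule run_append[OF p2[OF v4]])
      fix m2 \<rho>2 assume w2: "word_memory w m2" and 2: "\<rho>2 = \<rho> \<and> (\<forall>b. b \<noteq> b0 + 7 \<longrightarrow> view w m2 b = view w m1 b) \<and>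
       (\<forall>h<?N2. view w m2 (b0 + 7) h = rnk \<gamma> (h * U) - rnk \<gamma> (h * U div A * A))"
      then have r2: "\<rho>2 = \<rho>" by simp
      show "run w (pfld (Bin Div (V 0) (V 8)) 1) \<rho>2 m2 (6 * w) (20 * M)
        ?Q"
        unfolding r2
      proof (rule run_cong_post[OF run_pfld[OF regs_ok w2 wr cn]])
        fix m3 \<rho>3 assume 3: "same \<rho> \<rho>3 \<and> frame b0 {1} m2 m3 \<and>
          (\<forall>h\<le>n div U. field_at (cell m3 b0) 1 h = view w m2 (b0 + 7) h mod F)"
        have f12: "frame b0 {} m1 m2" using 2 by (auto simp: frame_def cell_def)
        have "frame b0 {0} m m2" using frame_trans[of b0 "{0}" m m1 "{}" m2] 1 f12 by simp
        then have f: "frame b0 {0, 1} m m3"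
          using frame_trans[of b0 "{0}" m m2 "{1}" m3] 3 by (simp add: insert_commute)
        have "cell m3 b0 0 g = rnk \<gamma> (g * A)" if "g \<le> n div A" for g
        proof -
          have "g < csize" using csize_R1[of g] that by simp
          then have "cell m3 b0 0 g = cell m1 b0 0 g" using frame_trans[of b0 "{}" m1 m2 "{1}" m3] f12 3 by (auto simp: frame_def)
          then show ?thesis using 1 that by simp
        qed
        moreover have "field_at (cell m3 b0) 1 h = rnk \<gamma> (h * U) - rnk \<gamma> (h * U div A * A)" if "h \<le> n div U" for h
        proof -
          \<comment> \<open>The relative count is at most the distance \<open>h * U mod A\<close>,
            which is below \<open>A \<le> F\<close>, so the field does not truncate it.\<close>
          have "rnk \<gamma> (h * U) - rnk \<gamma> (h * U div A * A) \<le> h * U - h * U div A * A" by (rule rnk_diff_le) simp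
          also have "\<dots> = h * U mod A" by (simp add: minus_div_mult_eq_mod)
          also have "\<dots> < F" using A_le_F A_pos by (meson less_le_trans mod_less_divisor)
          finally show ?thesis using 2 3 that by simp
        qed
        ultimately show "same \<rho> \<rho>3 \<and> frame b0 {0, 1} m m3 \<and> lay_rank (cell m3 b0) \<gamma>"
          using 3 f by (simp add: lay_rank_def)
      qed (use ZU NU in auto)
    qed
  qed
  then show ?thesis
  proof (rule run_cong_post)
    show "1 + (1 + 6 * w) \<le> 10 * w" using w_big by simp
    show "(?N1 + 1) + ((?N2 + 1) + 20 * M) \<le> 40 * M" using N M_G by linarith
  qed auto
qed

end

section \<open>The table of windows and the select samples\<close>

abbreviation (input) rowI :: expr where "rowI \<equiv> Bin Mul (V 32) (Bin Add (V 8) (C 1))"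
abbreviation (input) cntI :: expr where "cntI \<equiv> Bin Add rowI (V 8)"
abbreviation (input) cntE :: expr where "cntE \<equiv> At (blk 8) (Bin Add (cE 2) cntI)"

text \<open>The rows of all windows grow in parallel, by one bit position per round. Cell
  \<open>U\<close> of a row is its running count, hence also the slot of the next entry.\<close>

definition table_code :: code where
  "table_code =
     par 32 (V 14) (Adr (blk 8) (Bin Add (cE 2) cntI)) (C 0) @
     assign 31 (C 0) @ assign 30 (V 8) @
     loop 30 (par 32 (V 14) (Adr (blk 8) (Bin Add (cE 2) (Bin Add rowI cntE))) (V 31) @
       par 32 (V 14) (Adr (blk 8) (Bin Add (cE 2) cntI))
         (Bin Add cntE (Bin Mod (Bin Shr (V 32) (V 31)) (C 2))) @
       assign 31 (Bin Add (V 31) (C 1)))"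

abbreviation (input) PE :: "nat \<Rightarrow> expr \<Rightarrow> expr" where "PE b e \<equiv> At (blk (5 + b)) e"
text \<open>\<open>x0\<close> and \<open>x1\<close> are the positions where the group of the
  occurrence with number \<open>V 32\<close> and the next group start; \<open>y0\<close> is the
  position of the last sample of distance \<open>Bs\<close> at or before this occurrence.\<close>

abbreviation (input) x0E :: "nat \<Rightarrow> expr" where
  "x0E b \<equiv> PE b (Bin Mul (Bin Div (V 32) (V 10)) (V 10))"
abbreviation (input) x1E :: "nat \<Rightarrow> expr" where
  "x1E b \<equiv> PE b (Bin Mul (Bin Add (Bin Div (V 32) (V 10)) (C 1)) (V 10))"
abbreviation (input) y0E :: "nat \<Rightarrow> expr" where
  "y0E b \<equiv> PE b (Bin Mul (Bin Div (V 32) (V 9)) (V 9))"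

definition S1_code :: "nat \<Rightarrow> code" where
  "S1_code b = par 32 (Bin Add (Bin Div (V 0) (V 10)) (C 2)) (Adr (blk 8) (Bin Add (cE (3 + b)) (V 32)))
     (PE b (Bin Mul (V 32) (V 10)))"

text \<open>The comparison yields 1 for a group of small span and thus moves the target from block 8
  to the dummy block 9.\<close>

definition E1_code :: "nat \<Rightarrow> code" where
  "E1_code b = par 32 (V 0)
     (Adr (Bin Add (blk 8) (Bin Less (Bin Sub (x1E b) (x0E b)) (V 11)))
       (Bin Add (cE (5 + b)) (Bin Add (Bin Mul (Bin Div (x0E b) (V 11)) (V 10)) (Bin Mod (V 32) (V 10)))))
     (PE b (V 32))"

definition S2_code :: "nat \<Rightarrow> code" where
  "S2_code b = par 32 (Bin Add (Bin Div (V 0) (V 9)) (C 1)) (Adr (blk 7) (V 32))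
     (Bin Sub (PE b (Bin Mul (V 32) (V 9))) (PE b (Bin Mul (Bin Div (Bin Mul (V 32) (V 9)) (V 10)) (V 10)))) @
     pfld (Bin Div (V 0) (V 9)) (7 + b)"

text \<open>The differences are collected in scratch block 7 and then packed; doubling the
  comparison leads from block 7 to the dummy block 9. Fields of elements in explicit groups may be
  truncated, but select consults them only in groups of small span.\<close>

definition E2_code :: "nat \<Rightarrow> code" where
  "E2_code b = par 32 (V 0)
     (Adr (Bin Add (blk 7) (Bin Mul (C 2) (Bin Less (PE b (V 32)) (Bin Add (y0E b) (V 8)))))
       (Bin Add (Bin Mul (Bin Div (y0E b) (V 8)) (V 9)) (Bin Mod (V 32) (V 9))))
     (Bin Sub (PE b (V 32)) (x0E b)) @
     pfld (Bin Mul (Bin Add (Bin Div (V 0) (V 8)) (C 1)) (V 9)) (9 + b)"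

lemma digit_inj: "(r::nat) < D \<Longrightarrow> r' < D \<Longrightarrow> y * D + r = y' * D + r' \<longleftrightarrow> y = y' \<and> r = r'"
proof
  assume a: "r < D" "r' < D" "y * D + r = y' * D + r'"
  have "(y * D + r) div D = (y' * D + r') div D" by (simp only: a(3))
  then have "y = y'" using a(1,2) by simp
  then show "y = y' \<and> r = r'" using a(3) by simp
qed auto

lemma ones_Suc: "ones P (Suc t) = ones P t @ (if P t then [t] else [])"
  by (simp add: ones_def)

context params
begin

text \<open>Round \<open>t\<close> stores \<open>t\<close> as the next position whether or not bit \<open>t\<close> is set; if it is not,
  the count does not grow and the entry is overwritten later.\<close>

lemma run_table:
  assumes regs_ok: "regs_ok \<rho> b0" and wm: "word_memory w m" and wr: "wordy w \<rho>"
  shows "run w table_code \<rho> m (6 * w) (20 * M)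
    (\<lambda>m' \<rho>'. same \<rho> \<rho>' \<and> frame b0 {2} m m' \<and> lay_table (cell m' b0))"
proof -
  note B = regs_okD[OF regs_ok same_refl]
  let ?N = "2 ^ U :: nat"
  let ?tab = "\<lambda>t m'. \<forall>y<?N. cell m' b0 2 (y * (U + 1) + U) = rnk (bit y) t \<and>
      (\<forall>r<rnk (bit y) t. cell m' b0 2 (y * (U + 1) + r) = ones (bit y) t ! r)"
  let ?I = "\<lambda>k m' \<rho>'. same \<rho> \<rho>' \<and> k \<le> U \<and> \<rho>' 31 = U - k \<and> frame b0 {2} m m' \<and> ?tab (U - k) m'"
  have Uw: "U + 1 < 2 ^ w" using smalls(3) G_1000 by (intro less_Vv_w le_G_bsize) linarith
  have zw: "y * (U + 1) + r < csize" if "y < ?N" "r \<le> U" for y r using that by (rule csize_tab)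
  have zw2: "y * (U + 1) + r < 2 ^ w" if "y < ?N" "r \<le> U" for y r
    using zw[OF that] csize_bsize bsize_less by linarith
  have row: "eval w m' \<rho>' rowI = y * (U + 1)" and cntI: "eval w m' \<rho>' cntI = y * (U + 1) + U"
    if "same \<rho> \<rho>'" "\<rho>' 32 = y" "y < ?N" for m' \<rho>' y
    using that regs_okD[OF regs_ok that(1)] zw2[OF that(3), of U] Uw by (simp_all add: eval_Add eval_Mul)
  have cnt: "eval w m' \<rho>' cntE = cell m' b0 2 (y * (U + 1) + U)"
    if "same \<rho> \<rho>'" "\<rho>' 32 = y" "y < ?N" for m' \<rho>' y
  proof -
    have "eval w m' \<rho>' (Bin Add (cE 2) cntI) = 2 + 2 * csize + (y * (U + 1) + U)"
      by (rule eval_cEi[OF regs_ok that(1)]) (use cntI[OF that] zw[OF that(3), of U] in auto)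
    then show ?thesis unfolding cell_def
      by (intro atb[OF regs_ok that(1)]) (use offs_less[of 2 "y * (U + 1) + U"] zw[OF that(3), of U] in auto)
  qed
  have inj: "inj_on (\<lambda>y. y * (U + 1) + h y) {..<?N}" if "\<And>y. h y < U + 1" for h
    using digit_inj[OF that that] by (auto intro: inj_onI)
  note rowinj = digit_inj[of _ "U + 1"]
  have p1: "run w (par 32 (V 14) (Adr (blk 8) (Bin Add (cE 2) cntI)) (C 0)) \<rho> m 1 (?N + 1)
    (\<lambda>m' \<rho>'. \<rho>' = \<rho> \<and> frame b0 {2} m m' \<and> (\<forall>y<?N. cell m' b0 2 (y * (U + 1) + U) = 0) \<and>
       (\<forall>i<csize. i \<notin> (\<lambda>y. y * (U + 1) + U) ` {..<?N} \<longrightarrow> cell m' b0 2 i = cell m b0 2 i))"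
  proof (rule run_cfill[OF regs_ok])
    fix y assume y: "y < ?N"
    show "eval w m (\<rho>(32 := y)) cntI = y * (U + 1) + U" by (rule cntI) (use y in auto)
    show "y * (U + 1) + U < csize" using zw[OF y] by simp
  qed (use B inj[of "\<lambda>_. U"] in auto)
  have "run w table_code \<rho> m (1 + (1 + (1 + (U * (1 + (1 + 1) + 2) + 1)))) ((?N + 1) + (1 + (1 + (U * ((?N + 1) + ((?N + 1) + 1) + 2) + 1))))
    (\<lambda>m' \<rho>'. \<rho>' 30 = 0 \<and> ?I 0 m' \<rho>')"
    unfolding table_code_def
  proof (rule run_append[OF p1], rule run_append[where R = "\<lambda>m' \<rho>'. ?I U m' \<rho>'"], goal_cases)
    case (1 m1 \<rho>1)
    then show ?case by (intro run_assign) (auto simp: CC_def)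
  next
    case a: (2 m1 \<rho>1 m2 \<rho>2)
    show ?case
    proof (rule run_append[where R = "\<lambda>m' \<rho>'. ?I U m' \<rho>' \<and> \<rho>' 30 = U"], goal_cases)
      case 1
      show ?case by (rule run_assign) (use a regs_okD[OF regs_ok, of \<rho>2] in \<open>auto simp: CC_def\<close>)
    next
      case b: (2 m3 \<rho>3)
      show ?case
      proof (rule run_loop[where I = ?I])
        fix k m4 \<rho>4 assume k: "k < U" and w4: "word_memory w m4" "wordy w \<rho>4" and "\<rho>4 30 = Suc k" and I: "?I (Suc k) m4 \<rho>4"
        let ?\<rho> = "\<rho>4(30 := k)"
        define t where "t = U - Suc k"
        have t: "U - k = Suc t" "t < U" using k by (auto simp: t_def)
        have sm: "same \<rho> ?\<rho>" and r31: "?\<rho> 31 = t" and tab: "?tab t m4" and f4: "frame b0 {2} m m4" using I by (auto simp: t_def)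
        have regs_ok': "regs_ok ?\<rho> b0" using regs_ok sm by (rule regs_ok_same)
        note B' = regs_okD[OF regs_ok' same_refl]
        have rt: "rnk (bit y) t \<le> t" for y :: nat by (rule rnk_le)
        \<comment> \<open>The count is below \<open>U\<close> as long as a bit is left to inspect,
          so the new entry neither hits the counter in cell \<open>U\<close> nor leaves its
          row.\<close>
        have ru: "rnk (bit y) t < U" for y :: nat using rt[of y] t by linarith
        have cn: "eval w m4 (?\<rho>(32 := y)) cntE = rnk (bit y) t" if "y < ?N" for y
          using cnt[of "?\<rho>(32 := y)" y m4] sm that tab by simp
        show "run w (par 32 (V 14) (Adr (blk 8) (Bin Add (cE 2) (Bin Add rowI cntE))) (V 31) @
          par 32 (V 14) (Adr (blk 8) (Bin Add (cE 2) cntI)) (Bin Add cntE (Bin Mod (Bin Shr (V 32) (V 31)) (C 2))) @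
          assign 31 (Bin Add (V 31) (C 1))) ?\<rho> m4 (1 + (1 + 1)) ((?N + 1) + ((?N + 1) + 1)) (\<lambda>m' \<rho>'. \<rho>' 30 = k \<and> ?I k m' \<rho>')"
        proof (rule run_append)
          show "run w (par 32 (V 14) (Adr (blk 8) (Bin Add (cE 2) (Bin Add rowI cntE))) (V 31)) ?\<rho> m4 1 (?N + 1)
            (\<lambda>m' \<rho>'. \<rho>' = ?\<rho> \<and> frame b0 {2} m4 m' \<and> (\<forall>y<?N. cell m' b0 2 (y * (U + 1) + rnk (bit y) t) = t) \<and>
              (\<forall>i<csize. i \<notin> (\<lambda>y. y * (U + 1) + rnk (bit y) t) ` {..<?N} \<longrightarrow> cell m' b0 2 i = cell m4 b0 2 i))"
          proof (rule run_cfill[OF regs_ok'])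
            fix y assume y: "y < ?N"
            have "y * (U + 1) + rnk (bit y) t < 2 ^ w" using zw2[OF y less_imp_le[OF ru]] .
            then show "eval w m4 (?\<rho>(32 := y)) (Bin Add rowI cntE) = y * (U + 1) + rnk (bit y) t"
              using row[of "?\<rho>(32 := y)" y m4] cn[OF y] sm y by (subst eval_Add) auto
            show "y * (U + 1) + rnk (bit y) t < csize" using zw[OF y less_imp_le[OF ru]] .
          next
            show "inj_on (\<lambda>y. y * (U + 1) + rnk (bit y) t) {..<?N}" by (rule inj) (use ru less_Suc_eq in auto)
          qed (use B' r31 in auto)
          fix m5 \<rho>5 assume w5: "word_memory w m5" and 5: "\<rho>5 = ?\<rho> \<and> frame b0 {2} m4 m5 \<and> (\<forall>y<?N. cell m5 b0 2 (y * (U + 1) + rnk (bit y) t) = t) \<and>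
              (\<forall>i<csize. i \<notin> (\<lambda>y. y * (U + 1) + rnk (bit y) t) ` {..<?N} \<longrightarrow> cell m5 b0 2 i = cell m4 b0 2 i)"
          then have r5: "\<rho>5 = ?\<rho>" by simp
          have keep: "cell m5 b0 2 (y * (U + 1) + r) = cell m4 b0 2 (y * (U + 1) + r)" if "y < ?N" "r \<le> U" "r \<noteq> rnk (bit y) t" for y r
          proof -
            have "y * (U + 1) + r \<notin> (\<lambda>y. y * (U + 1) + rnk (bit y) t) ` {..<?N}"
            proof
              assume "y * (U + 1) + r \<in> (\<lambda>y. y * (U + 1) + rnk (bit y) t) ` {..<?N}"
              then obtain y' where "y * (U + 1) + r = y' * (U + 1) + rnk (bit y') t" by auto
              then have "y = y' \<and> r = rnk (bit y') t" using that(2) ru[of y'] by (subst (asm) rowinj) auto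
              then show False using that(3) by simp
            qed
            then show ?thesis using 5 zw[OF that(1,2)] by blast
          qed
          have c5: "cell m5 b0 2 (y * (U + 1) + U) = rnk (bit y) t" if "y < ?N" for y
            using keep[OF that, of U] ru[of y] tab that by auto
          have e5: "cell m5 b0 2 (y * (U + 1) + r) = ones (bit y) t ! r" if "y < ?N" "r < rnk (bit y) t" for y r
            using keep[OF that(1), of r] that ru[of y] tab by auto
          show "run w (par 32 (V 14) (Adr (blk 8) (Bin Add (cE 2) cntI)) (Bin Add cntE (Bin Mod (Bin Shr (V 32) (V 31)) (C 2))) @
            assign 31 (Bin Add (V 31) (C 1))) \<rho>5 m5 (1 + 1) ((?N + 1) + 1) (\<lambda>m' \<rho>'. \<rho>' 30 = k \<and> ?I k m' \<rho>')"
            unfolding r5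
          proof (rule run_append)
            show "run w (par 32 (V 14) (Adr (blk 8) (Bin Add (cE 2) cntI)) (Bin Add cntE (Bin Mod (Bin Shr (V 32) (V 31)) (C 2)))) ?\<rho> m5 1 (?N + 1)
              (\<lambda>m' \<rho>'. \<rho>' = ?\<rho> \<and> frame b0 {2} m5 m' \<and> (\<forall>y<?N. cell m' b0 2 (y * (U + 1) + U) = rnk (bit y) (Suc t)) \<and>
                (\<forall>i<csize. i \<notin> (\<lambda>y. y * (U + 1) + U) ` {..<?N} \<longrightarrow> cell m' b0 2 i = cell m5 b0 2 i))"
            proof (rule run_cfill[OF regs_ok'])
              fix y assume y: "y < ?N"
              show "eval w m5 (?\<rho>(32 := y)) cntI = y * (U + 1) + U" by (rule cntI) (use y sm in auto)
              show "y * (U + 1) + U < csize" using zw[OF y] by simp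
              have yw: "y < 2 ^ w" using zw2[OF y, of 0] mult_le_mono2[of 1 "U + 1" y] by simp
              have "eval w m5 (?\<rho>(32 := y)) cntE = rnk (bit y) t"
                using cnt[of "?\<rho>(32 := y)" y m5] sm y c5[OF y] by simp
              moreover have "eval w m5 (?\<rho>(32 := y)) (Bin Mod (Bin Shr (V 32) (V 31)) (C 2)) = of_bool (bit y t)"
                using yw r31 order_le_less_trans[OF div_le_dividend yw, of "2 ^ t"]
                by (simp add: eval_Mod eval_Shr bit_iff_odd mod_2_eq_odd)
              moreover have "rnk (bit y) (Suc t) < 2 ^ w" using rnk_le[of "bit y" "Suc t"] t Uw by linarith
              ultimately show "eval w m5 (?\<rho>(32 := y)) (Bin Add cntE (Bin Mod (Bin Shr (V 32) (V 31)) (C 2))) = rnk (bit y) (Suc t)"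
                by (subst eval_Add) auto
            next
              show "inj_on (\<lambda>y. y * (U + 1) + U) {..<?N}" by (rule inj) auto
            qed (use B' in auto)
            fix m6 \<rho>6 assume w6: "word_memory w m6" and 6: "\<rho>6 = ?\<rho> \<and> frame b0 {2} m5 m6 \<and> (\<forall>y<?N. cell m6 b0 2 (y * (U + 1) + U) = rnk (bit y) (Suc t)) \<and>
                (\<forall>i<csize. i \<notin> (\<lambda>y. y * (U + 1) + U) ` {..<?N} \<longrightarrow> cell m6 b0 2 i = cell m5 b0 2 i)"
            then have r6: "\<rho>6 = ?\<rho>" by simp
            have f6: "frame b0 {2} m m6"
              using frame_trans[of b0 "{2}" m m4 "{2}" m5] frame_trans[of b0 "{2}" m m5 "{2}" m6] f4 5 6 by simp
            have "cell m6 b0 2 (y * (U + 1) + r) = ones (bit y) (Suc t) ! r" if y: "y < ?N" and r: "r < rnk (bit y) (Suc t)" for y r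
            proof -
              have rU: "r < U" using r rnk_le[of "bit y" "Suc t"] t by linarith
              have "y * (U + 1) + r \<notin> (\<lambda>y. y * (U + 1) + U) ` {..<?N}"
              proof
                assume "y * (U + 1) + r \<in> (\<lambda>y. y * (U + 1) + U) ` {..<?N}"
                then obtain y' where "y * (U + 1) + r = y' * (U + 1) + U" by auto
                then have "r = U" using rU by (subst (asm) rowinj) auto
                then show False using rU by simp
              qed
              then have e: "cell m6 b0 2 (y * (U + 1) + r) = cell m5 b0 2 (y * (U + 1) + r)"
                using 6 zw[OF y, of r] rU by simp
              show ?thesis
              proof (cases "r < rnk (bit y) t")
                case True
                then show ?thesis using e e5[OF y True] by (simp add: ones_Suc nth_append rnk_def)
              next
                case False
                then have "r = rnk (bit y) t" "bit y t" using r by (auto split: if_splits simp: of_bool_def)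
                then show ?thesis using e 5 y nth_ones_rnk[of t "Suc t" "bit y"] by auto
              qed
            qed
            then have tab6: "?tab (U - k) m6" using 6 unfolding t by blast
            show "run w (assign 31 (Bin Add (V 31) (C 1))) \<rho>6 m6 1 1 (\<lambda>m' \<rho>'. \<rho>' 30 = k \<and> ?I k m' \<rho>')"
              unfolding r6
            proof (rule run_assign)
              have "eval w m6 ?\<rho> (Bin Add (V 31) (C 1)) = Suc t" using r31 t Uw by (simp add: eval_Add)
              then show "(?\<rho>(31 := eval w m6 ?\<rho> (Bin Add (V 31) (C 1)))) 30 = k \<and> ?I k m6 (?\<rho>(31 := eval w m6 ?\<rho> (Bin Add (V 31) (C 1))))"
                using sm f6 tab6 k t(1) by simp
            qed (auto simp: CC_def)
          qed
        qed
      qed (use b in auto)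
    qed
  qed
  then show ?thesis
  proof (rule run_cong_post)
    fix m' \<rho>' assume "\<rho>' 30 = 0 \<and> ?I 0 m' \<rho>'"
    then show "same \<rho> \<rho>' \<and> frame b0 {2} m m' \<and> lay_table (cell m' b0)" by (auto simp: lay_table_def)
  next
    show "1 + (1 + (1 + (U * (1 + (1 + 1) + 2) + 1))) \<le> 6 * w" using U_w by simp
    have "(?N + 1) + (1 + (1 + (U * ((?N + 1) + ((?N + 1) + 1) + 2) + 1))) = ?N + 4 + 2 * (U * ?N) + 5 * U"
      by (simp add: algebra_simps)
    also have "\<dots> \<le> 20 * M"
    proof -
      have "U * ?N \<le> M" "U \<le> M" using M_G(3,5) U_w by (auto simp: algebra_simps)
      then show ?thesis using M_G(6,7) by linarith
    qed
    finally show "(?N + 1) + (1 + (1 + (U * ((?N + 1) + ((?N + 1) + 1) + 2) + 1))) \<le> 20 * M" .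
  qed
qed

end

definition sel_code :: "nat \<Rightarrow> code" where
  "sel_code b = S1_code b @ E1_code b @ S2_code b @ E2_code b"

context params
begin

text \<open>A conditional store. Nothing is claimed about the dummy block \<open>d\<close>, where
  conflicts may abound; injectivity is asked only of the strands that really store.\<close>

lemma vscatter_dummy:
  assumes sc: "vscatter m k (\<lambda>j. if ok j then b else d) \<omega> val m'" and bd: "b \<noteq> d"
    and inj: "\<And>i j. i < k \<Longrightarrow> j < k \<Longrightarrow> ok i \<Longrightarrow> ok j \<Longrightarrow> \<omega> i = \<omega> j \<Longrightarrow> i = j"
  shows "\<And>j. j < k \<Longrightarrow> ok j \<Longrightarrow> view w m' b (\<omega> j) = val j"
    and "\<And>b'. b' \<noteq> b \<Longrightarrow> b' \<noteq> d \<Longrightarrow> view w m' b' = view w m b'"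
    and "\<And>x. (\<And>j. j < k \<Longrightarrow> ok j \<Longrightarrow> \<omega> j \<noteq> x) \<Longrightarrow> view w m' b x = view w m b x"
proof -
  fix j assume j: "j < k" "ok j"
  then have "\<exists>i<k. (if ok i then b else d) = b \<and> \<omega> i = \<omega> j" by auto
  then obtain i where i: "i < k" "(if ok i then b else d) = b" "\<omega> i = \<omega> j" "view w m' b (\<omega> j) = val i"
    using sc[unfolded vscatter_def, rule_format, of b "\<omega> j"] by (auto simp del: if_split)
  then have "ok i" using bd by (auto split: if_splits)
  then show "view w m' b (\<omega> j) = val j" using inj[of i j] i j by simp
next
  fix b' assume b': "b' \<noteq> b" "b' \<noteq> d"
  show "view w m' b' = view w m b'"
  proof
    fix x
    have "\<not> (\<exists>j<k. (if ok j then b else d) = b' \<and> \<omega> j = x)" using b' by auto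
    then show "view w m' b' x = view w m b' x" using sc[unfolded vscatter_def, rule_format, of b' x] by (simp only: if_False)
  qed
next
  fix x assume x: "\<And>j. j < k \<Longrightarrow> ok j \<Longrightarrow> \<omega> j \<noteq> x"
  have "\<not> (\<exists>j<k. (if ok j then b else d) = b \<and> \<omega> j = x)" using x bd by auto
  then show "view w m' b x = view w m b x" using sc[unfolded vscatter_def, rule_format, of b x] by (simp only: if_False)
qed

lemma frame_block: "frame b0 K m m' \<Longrightarrow> k < 7 \<Longrightarrow> view w m' (b0 + k) = view w m (b0 + k)"
  unfolding frame_def by auto

text \<open>What the select phases use of the positions. The last clause matters because there is
  one strand for each \<open>j < n\<close>: these reach all occurrences that exist.\<close>

definition pos_ok :: "mem \<Rightarrow> nat \<Rightarrow> bool \<Rightarrow> (nat \<Rightarrow> nat) \<Rightarrow> bool" where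
  "pos_ok m b0 b P \<longleftrightarrow> (\<forall>j\<le>n + A. view w m (b0 + (5 + of_bool b)) j = P j) \<and> (\<forall>j. P j \<le> n) \<and> mono P \<and>
     (\<forall>j. P j < n \<longrightarrow> j < n)"

lemma pos_ok_frame: "pos_ok m b0 b P \<Longrightarrow> frame b0 K m m' \<Longrightarrow> pos_ok m' b0 b P"
  using frame_block[of b0 K m m' "5 + of_bool b"] by (simp add: pos_ok_def)

lemma eval_P:
  assumes "regs_ok \<rho> b0" "same \<rho> \<rho>'" "pos_ok m b0 b P" "eval w m \<rho>' e = x" "x \<le> n + A"
  shows "eval w m \<rho>' (PE (of_bool b) e) = P x"
proof -
  have "eval w m \<rho>' (PE (of_bool b) e) = view w m (b0 + (5 + of_bool b)) x"
    by (rule atb[OF assms(1,2) _ assms(4)]) (use assms(5) nA_small in auto)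
  then show ?thesis using assms(3,5) by (simp add: pos_ok_def)
qed

lemma div_mult_A: "j < n \<Longrightarrow> j div A * A \<le> n + A" "j < n \<Longrightarrow> (j div A + 1) * A \<le> n + A"
proof -
  assume "j < n"
  moreover have "j div A * A \<le> j" by simp
  ultimately show "j div A * A \<le> n + A" "(j div A + 1) * A \<le> n + A"
    unfolding add_mult_distrib mult_1 by linarith+
qed

lemma run_S1:
  assumes regs_ok: "regs_ok \<rho> b0" and P: "pos_ok m b0 b P"
  shows "run w (S1_code (of_bool b)) \<rho> m 1 (n div A + 3)
    (\<lambda>m' \<rho>'. \<rho>' = \<rho> \<and> frame b0 {3 + of_bool b} m m' \<and> (\<forall>g\<le>n div A + 1. cell m' b0 (3 + of_bool b) g = P (g * A)))"
proof -
  note B = regs_okD[OF regs_ok same_refl]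
  have "run w (S1_code (of_bool b)) \<rho> m 1 ((n div A + 2) + 1)
     (\<lambda>m' \<rho>'. \<rho>' = \<rho> \<and> frame b0 {3 + of_bool b} m m' \<and> (\<forall>j<n div A + 2. cell m' b0 (3 + of_bool b) j = P (j * A)) \<and>
        (\<forall>i<csize. i \<notin> (\<lambda>j. j) ` {..<n div A + 2} \<longrightarrow> cell m' b0 (3 + of_bool b) i = cell m b0 (3 + of_bool b) i))"
    unfolding S1_code_def
  proof (rule run_cfill[OF regs_ok])
    have "n div A \<le> n" by simp
    then have "n div A + 2 < 2 ^ w" "n < 2 ^ w" using n_le_G G_1000 by (intro less_Vv_w le_G_bsize; linarith)+
    then show "eval w m \<rho> (Bin Add (Bin Div (V 0) (V 10)) (C 2)) = n div A + 2"
      using B by (simp add: eval_Add eval_Div)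
    fix j assume j: "j < n div A + 2"
    show "j < csize" using csize_R1[of j] j by simp
    have "j * A \<le> (n div A + 1) * A" using j by (intro mult_right_mono) auto
    also have "\<dots> \<le> n + A" by simp
    finally have jA: "j * A \<le> n + A" .
    have "eval w m (\<rho>(32 := j)) (Bin Mul (V 32) (V 10)) = j * A"
      using jA nA_small B by (simp add: eval_Mul)
    then show "eval w m (\<rho>(32 := j)) (PE (of_bool b) (Bin Mul (V 32) (V 10))) = P (j * A)"
      by (intro eval_P[OF regs_ok _ P]) (use jA in auto)
  qed auto
  then show ?thesis by (rule run_cong_post) auto
qed

text \<open>An explicit group spans at least \<open>F\<close> positions, and the next group starts
  behind it. So the starts of two explicit groups lie in different stretches of length
  \<open>F\<close>: the start divided by \<open>F\<close> identifies the group, and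
  \<open>j mod A\<close> the element in it.\<close>

lemma run_E1:
  assumes regs_ok: "regs_ok \<rho> b0" and P: "pos_ok m b0 b P" and wm: "word_memory w m"
  shows "run w (E1_code (of_bool b)) \<rho> m 1 (n + 1)
    (\<lambda>m' \<rho>'. \<rho>' = \<rho> \<and> frame b0 {5 + of_bool b} m m' \<and> 
      (\<forall>j<n. F \<le> P ((j div A + 1) * A) - P (j div A * A) \<longrightarrow>
        cell m' b0 (5 + of_bool b) (P (j div A * A) div F * A + j mod A) = P j))"
proof -
  note B = regs_okD[OF regs_ok same_refl]
  have nV: "n < bsize" "n < 2 ^ w" using nA_small bsize_less by linarith+
  let ?k = "5 + of_bool b :: nat"
  define x0 x1 where "x0 = (\<lambda>j. P (j div A * A))" and "x1 = (\<lambda>j. P ((j div A + 1) * A))"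
  have x01: "x0 j \<le> x1 j" "x1 j \<le> n" "x0 j \<le> n" for j using P unfolding pos_ok_def x0_def x1_def
    by (auto intro: monoD)
  let ?\<omega> = "\<lambda>j. 2 + ?k * csize + (x0 j div F * A + j mod A)"
  let ?ok = "\<lambda>j. F \<le> x1 j - x0 j"
  have z: "x0 j div F * A + j mod A < csize" for j by (rule csize_E1) (use x01 A_pos in auto)
  have inj: "i = j" if "?ok i" "?ok j" "?\<omega> i = ?\<omega> j" for i j
  proof -
    have "x0 i div F * A + i mod A = x0 j div F * A + j mod A" using that(3) by linarith
    then have e: "x0 i div F = x0 j div F" "i mod A = j mod A"
      using digit_inj[of "i mod A" A "j mod A"] A_pos by auto
    have less: "\<not> i div A < j div A" if "?ok i" "x0 i div F = x0 j div F" for i j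
    proof
      assume "i div A < j div A"
      then have "(i div A + 1) * A \<le> j div A * A" by (intro mult_right_mono) auto
      then have "x1 i \<le> x0 j" using P unfolding pos_ok_def x0_def x1_def by (auto intro: monoD)
      then have "x0 i + F \<le> x0 j" using that(1) x01(1)[of i] F_pos by linarith
      then have "(x0 i + F) div F \<le> x0 j div F" by (rule div_le_mono)
      then show False using that(2) F_pos by simp
    qed
    have "i div A = j div A" using less[of i j] less[of j i] that e by simp
    then show "i = j" using e(2) by (metis div_mult_mod_eq)
  qed
  show ?thesis unfolding E1_code_def
  proof (rule run_par2[where \<beta> = "\<lambda>j. if ?ok j then b0 + 8 else b0 + 9" and \<omega> = ?\<omega> and val = P])
    fix j assume j: "j < n"
    let ?r = "\<rho>(32 := j)"
    have sm: "same \<rho> ?r" by simp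
    note B' = regs_okD[OF regs_ok sm]
    have jw: "j < 2 ^ w" using j nV by linarith
    have A1: "j div A * A < 2 ^ w" "(j div A + 1) * A < 2 ^ w" "j div A + 1 < 2 ^ w"
      using div_mult_A[OF j] nA_small nV div_le_dividend[of j A] j A_pos by linarith+
    have e0: "eval w m ?r (x0E (of_bool b)) = x0 j" unfolding x0_def
      by (rule eval_P[OF regs_ok sm P _ div_mult_A(1)[OF j]]) (use A1 B' jw in \<open>simp add: eval_Mul eval_Div\<close>)
    have e1: "eval w m ?r (x1E (of_bool b)) = x1 j" unfolding x1_def
      by (rule eval_P[OF regs_ok sm P _ div_mult_A(2)[OF j]]) (use A1 B' jw in \<open>simp add: eval_Mul eval_Div eval_Add\<close>)
    have "eval w m ?r (Bin Sub (x1E (of_bool b)) (x0E (of_bool b))) = x1 j - x0 j"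
      unfolding e0[symmetric] e1[symmetric] by (rule eval_Sub) (use e0 e1 x01[of j] nV in simp_all)
    then have c: "eval w m ?r (Bin Less (Bin Sub (x1E (of_bool b)) (x0E (of_bool b))) (V 11)) = of_bool (x1 j - x0 j < F)"
      using B' by (simp add: eval_Less)
    then show "eval w m ?r (Bin Add (blk 8) (Bin Less (Bin Sub (x1E (of_bool b)) (x0E (of_bool b))) (V 11))) =
       (if ?ok j then b0 + 8 else b0 + 9)"
      using B'(16)[of 8] B(15) bsize_less by (subst eval_Add; simp only: c) auto
    show "(if ?ok j then b0 + 8 else b0 + 9) < bsize" using B(15) by simp
    have i1: "eval w m ?r (Bin Div (x0E (of_bool b)) (V 11)) = x0 j div F"
      by (subst eval_Div; simp only: e0) (use B' x01[of j] nV in simp_all)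
    have zw: "x0 j div F * A + j mod A < 2 ^ w" using z[of j] csize_bsize bsize_less by linarith
    have i2: "eval w m ?r (Bin Mul (Bin Div (x0E (of_bool b)) (V 11)) (V 10)) = x0 j div F * A"
      by (subst eval_Mul; simp only: i1) (use B' zw in simp_all)
    have i3: "eval w m ?r (Bin Mod (V 32) (V 10)) = j mod A" using jw B' by (simp add: eval_Mod)
    have "eval w m ?r (Bin Add (Bin Mul (Bin Div (x0E (of_bool b)) (V 11)) (V 10)) (Bin Mod (V 32) (V 10)))
      = x0 j div F * A + j mod A"
      by (subst eval_Add; simp only: i2 i3) (rule zw)
    then show "eval w m ?r (Bin Add (cE ?k) (Bin Add (Bin Mul (Bin Div (x0E (of_bool b)) (V 11)) (V 10)) (Bin Mod (V 32) (V 10)))) = ?\<omega> j"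
      by (intro eval_cEi[OF regs_ok sm]) (use z[of j] in auto)
    show "?\<omega> j < bsize" using offs_less[of ?k] z[of j] by simp
    show "eval w m ?r (PE (of_bool b) (V 32)) = P j"
      by (rule eval_P[OF regs_ok sm P]) (use j in auto)
  next
    fix m' assume sc: "vscatter m n (\<lambda>j. if ?ok j then b0 + 8 else b0 + 9) ?\<omega> P m'"
    note v = vscatter_dummy[OF sc _ inj, simplified]
    have 1: "cell m' b0 ?k (x0 j div F * A + j mod A) = P j" if "j < n" "?ok j" for j
      unfolding cell_def using v(1)[OF that] by simp
    have 2: "cell m' b0 k i = cell m b0 k i" if "i < csize" "k \<noteq> ?k" for k i
      unfolding cell_def
    proof (rule v(3))
      fix j
      show "Suc (Suc (?k * csize + (x0 j div F * A + j mod A))) \<noteq> 2 + k * csize + i"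
        using offs_inj[OF z[of j] that(1), of ?k k] that(2) by auto
    qed
    have 3: "view w m' (b0 + 8) x = view w m (b0 + 8) x" if "x < 2" for x
      by (rule v(3)) (use that in auto)
    show "\<rho> = \<rho> \<and> frame b0 {?k} m m' \<and> 
      (\<forall>j<n. F \<le> P ((j div A + 1) * A) - P (j div A * A) \<longrightarrow>
        cell m' b0 ?k (P (j div A * A) div F * A + j mod A) = P j)"
      using 1 2 3 v(2) unfolding frame_def x0_def x1_def by auto
  qed (use B in \<open>auto simp: CC_def\<close>)
qed

lemma run_S2:
  assumes regs_ok: "regs_ok \<rho> b0" and P: "pos_ok m b0 b P" and wm: "word_memory w m" and wr: "wordy w \<rho>"
  shows "run w (S2_code (of_bool b)) \<rho> m (7 * w) (22 * M)
    (\<lambda>m' \<rho>'. same \<rho> \<rho>' \<and> frame b0 {7 + of_bool b} m m' \<and> 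
      (\<forall>h\<le>n div Bs. field_at (cell m' b0) (7 + of_bool b) h = (P (h * Bs) - P (h * Bs div A * A)) mod F))"
    (is "run w _ \<rho> m _ _ ?Q")
proof -
  note B = regs_okD[OF regs_ok same_refl]
  let ?N = "n div Bs + 1"
  have N: "n div Bs \<le> n" "n < bsize" "n + 1 < bsize" using nA_small by auto
  have Nw: "?N < 2 ^ w" "n < 2 ^ w" "?N \<le> bsize" using N bsize_less by linarith+
  have e1: "eval w m \<rho> (Bin Add (Bin Div (V 0) (V 9)) (C 1)) = ?N"
    using B Nw by (simp add: eval_Add eval_Div)
  have p1: "run w (par 32 (Bin Add (Bin Div (V 0) (V 9)) (C 1)) (Adr (blk 7) (V 32))
     (Bin Sub (PE (of_bool b) (Bin Mul (V 32) (V 9))) (PE (of_bool b) (Bin Mul (Bin Div (Bin Mul (V 32) (V 9)) (V 10)) (V 10))))) \<rho> m 1 (?N + 1)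
     (\<lambda>m' \<rho>'. \<rho>' = \<rho> \<and> (\<forall>b. b \<noteq> b0 + 7 \<longrightarrow> view w m' b = view w m b) \<and>
       (\<forall>h<?N. view w m' (b0 + 7) h = P (h * Bs) - P (h * Bs div A * A)))"
  proof (rule run_fill0[OF regs_ok])
    fix h assume h: "h < ?N"
    let ?r = "\<rho>(32 := h)"
    have sm: "same \<rho> ?r" by simp
    have hU: "h * Bs \<le> n" by (rule div_mult_le) (use h in simp)
    have hA: "h * Bs div A * A \<le> h * Bs" by simp
    have hw: "h * Bs < 2 ^ w" "h * Bs div A * A < 2 ^ w" using hU hA N bsize_less by linarith+
    have 1: "eval w m ?r (Bin Mul (V 32) (V 9)) = h * Bs" using hw B by (simp add: eval_Mul)
    have 2: "eval w m ?r (Bin Mul (Bin Div (Bin Mul (V 32) (V 9)) (V 10)) (V 10)) = h * Bs div A * A"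
      using hw B 1 by (simp add: eval_Mul eval_Div)
    have e1: "eval w m ?r (PE (of_bool b) (Bin Mul (V 32) (V 9))) = P (h * Bs)"
      by (rule eval_P[OF regs_ok sm P 1]) (use hU in simp)
    have e2: "eval w m ?r (PE (of_bool b) (Bin Mul (Bin Div (Bin Mul (V 32) (V 9)) (V 10)) (V 10))) = P (h * Bs div A * A)"
      by (rule eval_P[OF regs_ok sm P 2]) (use hU hA in linarith)
    have "P (h * Bs div A * A) \<le> P (h * Bs)" "P (h * Bs) < 2 ^ w" using P hA Nw(2) unfolding pos_ok_def
      by (auto intro: monoD le_less_trans)
    then show "eval w m ?r (Bin Sub (PE (of_bool b) (Bin Mul (V 32) (V 9))) (PE (of_bool b) (Bin Mul (Bin Div (Bin Mul (V 32) (V 9)) (V 10)) (V 10))))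
      = P (h * Bs) - P (h * Bs div A * A)"
      by (subst eval_Sub; simp only: e1 e2)
  qed (use e1 Nw in auto)
  have cn: "cst w \<rho> (Bin Div (V 0) (V 9)) (n div Bs)"
    using cst_Div[OF cst_V[of 0 w \<rho>] cst_V[of 9 w \<rho>]] B N bsize_less by simp
  have NU: "n div Bs \<le> 4 * G" "n div Bs \<le> 2 * M" using N n_le_G M_G by linarith+
  have ZU: "n div Bs div per + 1 \<le> csize" using csize_S2[of "n div Bs"] by simp
  have "run w (S2_code (of_bool b)) \<rho> m (1 + 6 * w) ((?N + 1) + 20 * M)
    ?Q"
    unfolding S2_code_def
  proof (rule run_append[OF p1])
    fix m2 \<rho>2 assume w2: "word_memory w m2" and 2: "\<rho>2 = \<rho> \<and> (\<forall>b. b \<noteq> b0 + 7 \<longrightarrow> view w m2 b = view w m b) \<and>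
       (\<forall>h<?N. view w m2 (b0 + 7) h = P (h * Bs) - P (h * Bs div A * A))"
    then have r2: "\<rho>2 = \<rho>" by simp
    have f12: "frame b0 {} m m2" using 2 by (auto simp: frame_def cell_def)
    show "run w (pfld (Bin Div (V 0) (V 9)) (7 + of_bool b)) \<rho>2 m2 (6 * w) (20 * M)
      ?Q"
      unfolding r2
    proof (rule run_cong_post[OF run_pfld[OF regs_ok w2 wr cn]])
      fix m3 \<rho>3 assume 3: "same \<rho> \<rho>3 \<and> frame b0 {7 + of_bool b} m2 m3 \<and>
          (\<forall>h\<le>n div Bs. field_at (cell m3 b0) (7 + of_bool b) h = view w m2 (b0 + 7) h mod F)"
      have "frame b0 {7 + of_bool b} m m3" using frame_trans[of b0 "{}" m m2 "{7 + of_bool b}" m3] f12 3 by simp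
      then show "same \<rho> \<rho>3 \<and> frame b0 {7 + of_bool b} m m3 \<and> 
      (\<forall>h\<le>n div Bs. field_at (cell m3 b0) (7 + of_bool b) h = (P (h * Bs) - P (h * Bs div A * A)) mod F)"
        using 2 3 by auto
    qed (use ZU NU in auto)
  qed
  then show ?thesis
  proof (rule run_cong_post)
    show "1 + 6 * w \<le> 7 * w" using w_pos by linarith
    show "(?N + 1) + 20 * M \<le> 22 * M" using N M_G by linarith
  qed
qed

text \<open>If an element lies at least \<open>U\<close> behind its sample, then so does the next
  sample. Hence \<open>y0 div U\<close> identifies the run of \<open>Bs\<close> occurrences among
  those with an explicit element, and \<open>j mod Bs\<close> the element in it.\<close>

lemma run_E2:
  assumes regs_ok: "regs_ok \<rho> b0" and P: "pos_ok m b0 b P" and wm: "word_memory w m" and wr: "wordy w \<rho>"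
  shows "run w (E2_code (of_bool b)) \<rho> m (7 * w) (22 * M)
    (\<lambda>m' \<rho>'. same \<rho> \<rho>' \<and> frame b0 {9 + of_bool b} m m' \<and> 
      (\<forall>j<n. P (j div Bs * Bs) + U \<le> P j \<longrightarrow>
        field_at (cell m' b0) (9 + of_bool b) (P (j div Bs * Bs) div U * Bs + j mod Bs) = (P j - P (j div A * A)) mod F))"
proof -
  note B = regs_okD[OF regs_ok same_refl]
  have nV: "n < bsize" "n < 2 ^ w" using nA_small bsize_less by linarith+
  define x0 y0 where "x0 = (\<lambda>j. P (j div A * A))" and "y0 = (\<lambda>j. P (j div Bs * Bs))"
  have x0: "x0 j \<le> P j" "P j \<le> n" "y0 j \<le> n" for j using P unfolding pos_ok_def x0_def y0_def
    by (auto intro: monoD)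
  let ?cnt = "(n div U + 1) * Bs"
  have "n div U * Bs \<le> n div U * U" using Bs_le_U by (intro mult_left_mono) auto
  also have "\<dots> \<le> n" by simp
  finally have cn: "?cnt \<le> n + Bs" by (simp add: add_mult_distrib)
  have BM: "Bs \<le> M" "Bs \<le> G" using Bs_le_U U_less_pow M_G(6) smalls by linarith+
  have cV: "?cnt \<le> 4 * G" "?cnt \<le> 2 * M" using cn BM M_G(1) n_le_G by linarith+
  have cw: "?cnt < bsize" "?cnt < 2 ^ w" using cV G_bsize1 bsize_less by linarith+
  let ?\<omega> = "\<lambda>j. y0 j div U * Bs + j mod Bs"
  let ?ok = "\<lambda>j. y0 j + U \<le> P j"
  have z: "?\<omega> j < ?cnt" for j by (rule E2_less) (use x0 Bs_pos in auto)
  have inj: "i = j" if "?ok i" "?ok j" "?\<omega> i = ?\<omega> j" for i j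
  proof -
    have e: "y0 i div U = y0 j div U" "i mod Bs = j mod Bs"
      using digit_inj[of "i mod Bs" Bs "j mod Bs"] that(3) Bs_pos by auto
    have less: "\<not> i div Bs < j div Bs" if "?ok i" "y0 i div U = y0 j div U" for i j
    proof
      assume "i div Bs < j div Bs"
      then have "(i div Bs + 1) * Bs \<le> j div Bs * Bs" by (intro mult_right_mono) auto
      moreover have "i < (i div Bs + 1) * Bs"
        using Bs_pos dividend_less_div_times[of Bs i] by (simp add: add.commute)
      ultimately have "i \<le> j div Bs * Bs" by linarith
      then have "P i \<le> y0 j" using P unfolding pos_ok_def y0_def by (auto intro: monoD)
      then have "y0 i + U \<le> y0 j" using that(1) by linarith
      then have "(y0 i + U) div U \<le> y0 j div U" by (rule div_le_mono)
      then show False using that(2) U_pos by simp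
    qed
    have "i div Bs = j div Bs" using less[of i j] less[of j i] that e by simp
    then show "i = j" using e(2) by (metis div_mult_mod_eq)
  qed
  have p1: "run w (par 32 (V 0)
     (Adr (Bin Add (blk 7) (Bin Mul (C 2) (Bin Less (PE (of_bool b) (V 32)) (Bin Add (y0E (of_bool b)) (V 8)))))
       (Bin Add (Bin Mul (Bin Div (y0E (of_bool b)) (V 8)) (V 9)) (Bin Mod (V 32) (V 9))))
     (Bin Sub (PE (of_bool b) (V 32)) (x0E (of_bool b)))) \<rho> m 1 (n + 1)
    (\<lambda>m' \<rho>'. \<rho>' = \<rho> \<and> frame b0 {} m m' \<and> (\<forall>j<n. ?ok j \<longrightarrow> view w m' (b0 + 7) (?\<omega> j) = P j - x0 j))"
  proof (rule run_par2[where \<beta> = "\<lambda>j. if ?ok j then b0 + 7 else b0 + 9" and \<omega> = ?\<omega> and val = "\<lambda>j. P j - x0 j"])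
    fix j assume j: "j < n"
    let ?r = "\<rho>(32 := j)"
    have sm: "same \<rho> ?r" by simp
    note B' = regs_okD[OF regs_ok sm]
    have jw: "j < 2 ^ w" using j nV by linarith
    have "j div A * A \<le> j" "j div Bs * Bs \<le> j" by simp_all
    then have A1: "j div A * A < 2 ^ w" "j div Bs * Bs < 2 ^ w" "j div A * A \<le> n + A" "j div Bs * Bs \<le> n + A"
      using jw j by linarith+
    have e0: "eval w m ?r (x0E (of_bool b)) = x0 j" unfolding x0_def
      by (rule eval_P[OF regs_ok sm P _ A1(3)]) (use A1 B' jw in \<open>simp add: eval_Mul eval_Div\<close>)
    have ey: "eval w m ?r (y0E (of_bool b)) = y0 j" unfolding y0_def
      by (rule eval_P[OF regs_ok sm P _ A1(4)]) (use A1 B' jw in \<open>simp add: eval_Mul eval_Div\<close>)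
    have eP: "eval w m ?r (PE (of_bool b) (V 32)) = P j"
      by (rule eval_P[OF regs_ok sm P]) (use j in auto)
    have Pw: "P j < 2 ^ w" "y0 j < 2 ^ w" using x0[of j] nV by linarith+
    show "eval w m ?r (Bin Sub (PE (of_bool b) (V 32)) (x0E (of_bool b))) = P j - x0 j"
      by (subst eval_Sub; simp only: e0 eP) (use x0[of j] Pw in simp_all)
    have yU: "y0 j + U < 2 ^ w" using x0[of j] n_le_G smalls G_1000 by (intro less_Vv_w le_G_bsize) linarith
    have e8: "eval w m ?r (V 8) = U" using B' by simp
    have "eval w m ?r (Bin Add (y0E (of_bool b)) (V 8)) = y0 j + U"
      by (subst eval_Add; simp only: ey e8) (rule yU)
    then have c: "eval w m ?r (Bin Less (PE (of_bool b) (V 32)) (Bin Add (y0E (of_bool b)) (V 8))) = of_bool (P j < y0 j + U)"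
      by (subst eval_Less; simp only: eP w_pos)
    have c2: "eval w m ?r (C 2) = 2" by simp
    have w2: "(2::nat) < 2 ^ w" using G_1000 by (intro less_Vv_w le_G_bsize) linarith
    have c': "eval w m ?r (Bin Mul (C 2) (Bin Less (PE (of_bool b) (V 32)) (Bin Add (y0E (of_bool b)) (V 8)))) = 2 * of_bool (P j < y0 j + U)"
      by (subst eval_Mul; simp only: c c2) (use w2 in auto)
    show "eval w m ?r (Bin Add (blk 7) (Bin Mul (C 2) (Bin Less (PE (of_bool b) (V 32)) (Bin Add (y0E (of_bool b)) (V 8))))) =
       (if ?ok j then b0 + 7 else b0 + 9)"
      using B'(16)[of 7] B(15) bsize_less by (subst eval_Add; simp only: c') auto
    show "(if ?ok j then b0 + 7 else b0 + 9) < bsize" using B(15) by simp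
    have i1: "eval w m ?r (Bin Div (y0E (of_bool b)) (V 8)) = y0 j div U"
      by (subst eval_Div; simp only: ey e8) (rule Pw)
    have e9: "eval w m ?r (V 9) = Bs" using B' by simp
    have zw: "?\<omega> j < 2 ^ w" using z[of j] cw by linarith
    have i2: "eval w m ?r (Bin Mul (Bin Div (y0E (of_bool b)) (V 8)) (V 9)) = y0 j div U * Bs"
      by (subst eval_Mul; simp only: i1 e9) (use zw in linarith)
    have i3: "eval w m ?r (Bin Mod (V 32) (V 9)) = j mod Bs" using jw B' by (simp add: eval_Mod)
    show "eval w m ?r (Bin Add (Bin Mul (Bin Div (y0E (of_bool b)) (V 8)) (V 9)) (Bin Mod (V 32) (V 9))) = ?\<omega> j"
      by (subst eval_Add; simp only: i2 i3) (rule zw)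
    show "?\<omega> j < bsize" using z[of j] cw by linarith
  next
    fix m' assume sc: "vscatter m n (\<lambda>j. if ?ok j then b0 + 7 else b0 + 9) ?\<omega> (\<lambda>j. P j - x0 j) m'"
    have bd: "b0 + 7 \<noteq> b0 + 9" by simp
    note v = vscatter_dummy[OF sc bd inj]
    have "view w m' b = view w m b" if "b \<noteq> b0 + 7" "b \<noteq> b0 + 9" for b by (rule v(2)) (use that in auto)
    moreover have "view w m' (b0 + 7) (?\<omega> j) = P j - x0 j" if "j < n" "?ok j" for j by (rule v(1)) (use that in auto)
    ultimately show "\<rho> = \<rho> \<and> frame b0 {} m m' \<and> (\<forall>j<n. ?ok j \<longrightarrow> view w m' (b0 + 7) (?\<omega> j) = P j - x0 j)"
      by (auto simp: frame_def cell_def)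
  qed (use B in \<open>auto simp: CC_def\<close>)
  have Uw: "n div U + 1 < 2 ^ w" "(1::nat) < 2 ^ w" using div_le_dividend[of n U] n_le_G G_1000 by (intro less_Vv_w le_G_bsize; linarith)+
  have cst: "cst w \<rho> (Bin Mul (Bin Add (Bin Div (V 0) (V 8)) (C 1)) (V 9)) ?cnt"
    by (intro cst_Mul cst_Add cst_C cw(2) Uw)
      (use cst_Div[OF cst_V[of 0 w \<rho>] cst_V[of 8 w \<rho>]] cst_V[of 9 w \<rho>] B nV in simp_all)
  have ZU: "?cnt div per + 1 \<le> csize" unfolding csize_def by linarith
  have "run w (E2_code (of_bool b)) \<rho> m (1 + 6 * w) ((n + 1) + 20 * M)
    (\<lambda>m' \<rho>'. same \<rho> \<rho>' \<and> frame b0 {9 + of_bool b} m m' \<and> 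
      (\<forall>j<n. ?ok j \<longrightarrow> field_at (cell m' b0) (9 + of_bool b) (?\<omega> j) = (P j - x0 j) mod F))"
    unfolding E2_code_def
  proof (rule run_append[OF p1])
    fix m2 \<rho>2 assume w2: "word_memory w m2" and 2: "\<rho>2 = \<rho> \<and> frame b0 {} m m2 \<and> (\<forall>j<n. ?ok j \<longrightarrow> view w m2 (b0 + 7) (?\<omega> j) = P j - x0 j)"
    then have r2: "\<rho>2 = \<rho>" by simp
    show "run w (pfld (Bin Mul (Bin Add (Bin Div (V 0) (V 8)) (C 1)) (V 9)) (9 + of_bool b)) \<rho>2 m2 (6 * w) (20 * M)
      (\<lambda>m' \<rho>'. same \<rho> \<rho>' \<and> frame b0 {9 + of_bool b} m m' \<and> 
      (\<forall>j<n. ?ok j \<longrightarrow> field_at (cell m' b0) (9 + of_bool b) (?\<omega> j) = (P j - x0 j) mod F))"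
      unfolding r2
    proof (rule run_cong_post[OF run_pfld[OF regs_ok w2 wr cst]])
      fix m3 \<rho>3 assume 3: "same \<rho> \<rho>3 \<and> frame b0 {9 + of_bool b} m2 m3 \<and>
          (\<forall>h\<le>?cnt. field_at (cell m3 b0) (9 + of_bool b) h = view w m2 (b0 + 7) h mod F)"
      have "frame b0 {9 + of_bool b} m m3" using frame_trans[of b0 "{}" m m2 "{9 + of_bool b}" m3] 2 3 by simp
      then show "same \<rho> \<rho>3 \<and> frame b0 {9 + of_bool b} m m3 \<and> 
      (\<forall>j<n. ?ok j \<longrightarrow> field_at (cell m3 b0) (9 + of_bool b) (?\<omega> j) = (P j - x0 j) mod F)"
        using 2 3 z by (simp add: less_imp_le)
    qed (use ZU cV in auto)
  qed
  then show ?thesis unfolding x0_def y0_def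
  proof (rule run_cong_post)
    show "1 + 6 * w \<le> 7 * w" using w_pos by linarith
    show "(n + 1) + 20 * M \<le> 22 * M" using M_G by linarith
  qed
qed

lemma frame_cell: "frame b0 K m m' \<Longrightarrow> k \<notin> K \<Longrightarrow> i < csize \<Longrightarrow> cell m' b0 k i = cell m b0 k i"
  by (simp add: frame_def)

lemma frame_field_at: "frame b0 K m m' \<Longrightarrow> k \<notin> K \<Longrightarrow> h div per < csize \<Longrightarrow> field_at (cell m' b0) k h = field_at (cell m b0) k h"
  by (simp add: field_at_def frame_cell)

lemma run_sel:
  assumes regs_ok: "regs_ok \<rho> b0" and P: "pos_ok m b0 b P" and wm: "word_memory w m" and wr: "wordy w \<rho>"
  shows "run w (sel_code (of_bool b)) \<rho> m (16 * w) (60 * M)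
    (\<lambda>m' \<rho>'. same \<rho> \<rho>' \<and> frame b0 {3 + of_bool b, 5 + of_bool b, 7 + of_bool b, 9 + of_bool b} m m' \<and>
       lay_select (cell m' b0) b P)"
proof -
  let ?b = "of_bool b :: nat"
  have Pn: "P j \<le> n" "P j < n \<Longrightarrow> j < n" for j using P by (auto simp: pos_ok_def)
  have "run w (sel_code ?b) \<rho> m (1 + (1 + (7 * w + 7 * w))) ((n div A + 3) + ((n + 1) + (22 * M + 22 * M)))
    (\<lambda>m' \<rho>'. same \<rho> \<rho>' \<and> frame b0 {3 + ?b, 5 + ?b, 7 + ?b, 9 + ?b} m m' \<and> lay_select (cell m' b0) b P)"
    unfolding sel_code_def
  proof (rule run_append[OF run_S1[OF regs_ok P]], elim conjE, hypsubst, goal_cases)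
    case (1 m1 \<rho>1)
    note f1 = 1(3) and s1 = 1(4)
    have P1: "pos_ok m1 b0 b P" using pos_ok_frame[OF P f1] .
    show ?case
    proof (rule run_append[OF run_E1[OF regs_ok P1 1(1)]], elim conjE, hypsubst, goal_cases)
      case (1 m2 \<rho>2)
      note f2 = 1(3) and s2 = 1(4)
      have P2: "pos_ok m2 b0 b P" using pos_ok_frame[OF P1 f2] .
      show ?case
      proof (rule run_append[OF run_S2[OF regs_ok P2 1(1) wr]], elim conjE, goal_cases)
        case (1 m3 \<rho>3)
        note sm3 = 1(3) and f3 = 1(4) and s3 = 1(5) and w3 = 1(1,2)
        have P3: "pos_ok m3 b0 b P" using pos_ok_frame[OF P2 f3] .
        show ?case
        proof (rule run_cong_post[OF run_E2[OF regs_ok_same[OF regs_ok sm3] P3 w3]], simp, simp, elim conjE)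
          fix m4 \<rho>4 assume sm4: "same \<rho>3 \<rho>4" and f4: "frame b0 {9 + ?b} m3 m4"
            and s4: "\<forall>j<n. P (j div Bs * Bs) + U \<le> P j \<longrightarrow>
              field_at (cell m4 b0) (9 + ?b) (P (j div Bs * Bs) div U * Bs + j mod Bs) = (P j - P (j div A * A)) mod F"
          have "frame b0 {3 + ?b, 5 + ?b} m m2" using frame_trans[OF f1 f2] by (simp add: insert_commute)
          then have "frame b0 {3 + ?b, 5 + ?b, 7 + ?b} m m3"
            using frame_trans[of b0 "{3 + ?b, 5 + ?b}" m m2 "{7 + ?b}" m3] f3 by (simp add: insert_commute)
          then have F: "frame b0 {3 + ?b, 5 + ?b, 7 + ?b, 9 + ?b} m m4"
            using frame_trans[of b0 "{3 + ?b, 5 + ?b, 7 + ?b}" m m3 "{9 + ?b}" m4] f4 by (simp add: insert_commute)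
          have "cell m4 b0 (3 + ?b) g = P (g * A)" if "g \<le> n div A + 1" for g
            using s1 that csize_R1[OF that] frame_cell[OF f2, of "3 + ?b" g] frame_cell[OF f3, of "3 + ?b" g] frame_cell[OF f4, of "3 + ?b" g]
            by simp
          moreover have "cell m4 b0 (5 + ?b) (P (j div A * A) div F * A + j mod A) = P j"
            if "P j < n" "F \<le> P ((j div A + 1) * A) - P (j div A * A)" for j
            using s2 that Pn csize_E1[OF Pn(1)[of "j div A * A"], of "j mod A"] A_pos
              frame_cell[OF f3, of "5 + ?b" "P (j div A * A) div F * A + j mod A"]
              frame_cell[OF f4, of "5 + ?b" "P (j div A * A) div F * A + j mod A"]
            by simp
          moreover have "field_at (cell m4 b0) (7 + ?b) h = (P (h * Bs) - P (h * Bs div A * A)) mod F" if "h \<le> n div Bs" for h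
            using s3 that csize_S2[OF that] frame_field_at[OF f4, of "7 + ?b" h] by simp
          ultimately have "lay_select (cell m4 b0) b P" unfolding lay_select_def using s4 Pn(2) by blast
          then show "same \<rho> \<rho>4 \<and> frame b0 {3 + ?b, 5 + ?b, 7 + ?b, 9 + ?b} m m4 \<and> lay_select (cell m4 b0) b P"
            using F same_trans[OF sm3 sm4] by simp
        qed
      qed
    qed
  qed
  then show ?thesis
  proof (rule run_cong_post)
    show "1 + (1 + (7 * w + 7 * w)) \<le> 16 * w" using w_pos by linarith
    show "(n div A + 3) + ((n + 1) + (22 * M + 22 * M)) \<le> 60 * M" using M_G div_le_dividend[of n A] by linarith
  qed
qed

end

definition struct_code :: code where
  "struct_code =
     par 32 (C 1) (Adr (blk 8) (C 0)) (V 5) @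
     par 32 (C 1) (Adr (blk 8) (C 1)) (V 13) @
     rank_code @ table_code @ sel_code (of_bool False) @ sel_code (of_bool True)"

definition dir_code :: code where
  "dir_code =
     par 32 (C 1) (Adr (V 18) (Bin Add (Bin Mul (C 3) (V 17)) (C 0))) (Bin Mul (blk 2) (V 3)) @
     par 32 (C 1) (Adr (V 18) (Bin Add (Bin Mul (C 3) (V 17)) (C 1))) zE @
     par 32 (C 1) (Adr (V 18) (Bin Add (Bin Mul (C 3) (V 17)) (C 2))) (Bin Mul (blk 8) (V 3))"

section \<open>Building the wavelet matrix\<close>

text \<open>Block 32 of a level is block 0 of the next one, so that advancing register 4 by 32 hands
  the new sequence on without copying it.\<close>

definition level_code :: code where
  "level_code = bits_code @ scan @ bitmap_code @ pos_code @ next_code @ struct_code @ dir_code @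
     assign 4 (blk 32) @ assign 17 (Bin Add (V 17) (C 1))"

context params
begin

lemma run_store1:
  assumes r3: "\<rho> 3 = bsize"
    and be: "\<And>j. eval w m (\<rho>(32 := j)) be = b" "b < bsize" and oe: "\<And>j. eval w m (\<rho>(32 := j)) oe = i" "i < bsize"
    and ve: "\<And>j. eval w m (\<rho>(32 := j)) ve = v"
    and wf: "wf_expr be" "wf_expr oe" "wf_expr ve" "elen be \<le> 50" "elen oe \<le> 50" "elen ve \<le> 50"
  shows "run w (par 32 (C 1) (Adr be oe) ve) \<rho> m 1 2
    (\<lambda>m' \<rho>'. \<rho>' = \<rho> \<and> view w m' b i = v \<and> (\<forall>b' x. b' \<noteq> b \<or> x \<noteq> i \<longrightarrow> view w m' b' x = view w m b' x))"
    (is "run w _ \<rho> m _ _ ?Q")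
proof -
  have "run w (par 32 (C 1) (Adr be oe) ve) \<rho> m 1 (1 + 1)
    ?Q"
    by (rule run_fill[where b = b and \<omega> = "\<lambda>_. i" and val = "\<lambda>_. v"]) (use assms in \<open>auto simp: CC_def inj_on_def\<close>)
  then show ?thesis by (simp only: one_add_one)
qed

lemma pos_ok_Pb: "(\<And>j. j \<le> n + A \<Longrightarrow> view w m (b0 + (5 + of_bool b)) j = Pb \<gamma> b j) \<Longrightarrow> pos_ok m b0 b (Pb \<gamma> b)"
proof -
  have "j < n" if "Pb \<gamma> b j < n" for j
  proof -
    have "j < rnk (\<lambda>p. \<gamma> p = b) n" using that by (auto simp: Pb_def pos_def split: if_splits)
    then show ?thesis using rnk_le[of "\<lambda>p. \<gamma> p = b" n] by linarith
  qed
  then show "(\<And>j. j \<le> n + A \<Longrightarrow> view w m (b0 + (5 + of_bool b)) j = Pb \<gamma> b j) \<Longrightarrow> ?thesis"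
    unfolding pos_ok_def by (auto simp: Pb_def pos_le intro!: monoI pos_mono)
qed

lemma lay_rank_frame: "lay_rank (cell m b0) \<gamma> \<Longrightarrow> frame b0 K m m' \<Longrightarrow> 0 \<notin> K \<Longrightarrow> 1 \<notin> K \<Longrightarrow> lay_rank (cell m' b0) \<gamma>"
  unfolding lay_rank_def using csize_R1 csize_R2 by (auto simp: frame_cell frame_field_at)

lemma lay_table_frame: "lay_table (cell m b0) \<Longrightarrow> frame b0 K m m' \<Longrightarrow> 2 \<notin> K \<Longrightarrow> lay_table (cell m' b0)"
proof -
  assume a: "lay_table (cell m b0)" "frame b0 K m m'" "2 \<notin> K"
  have "cell m' b0 2 (y * (U + 1) + r) = cell m b0 2 (y * (U + 1) + r)" if "y < 2 ^ U" "r \<le> U" for y r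
    using frame_cell[OF a(2,3) csize_tab[OF that]] .
  moreover have "r \<le> U" if "r < rnk (bit y) U" for r and y :: nat using that rnk_le[of "bit y" U] by linarith
  ultimately show ?thesis using a(1) unfolding lay_table_def by simp
qed

lemma lay_select_frame:
  assumes "lay_select (cell m b0) b P" "frame b0 K m m'" "\<And>j. P j \<le> n"
    and "3 + of_bool b \<notin> K" "5 + of_bool b \<notin> K" "7 + of_bool b \<notin> K" "9 + of_bool b \<notin> K"
  shows "lay_select (cell m' b0) b P"
proof -
  have "P (j div A * A) div F * A + j mod A < csize" for j by (rule csize_E1) (use assms A_pos in auto)
  moreover have "(P (j div Bs * Bs) div U * Bs + j mod Bs) div per < csize" for j by (rule csize_E2) (use assms Bs_pos in auto)
  ultimately show ?thesis using assms(1,2,4-) unfolding lay_select_def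
    by (simp add: frame_cell frame_field_at csize_R1 csize_S2)
qed

text \<open>Each phase changes only components of its own, so by \<open>frame\<close> the parts of
  \<open>lay\<close> can be established one after the other.\<close>

lemma run_struct:
  assumes regs_ok: "regs_ok \<rho> b0" and wm: "word_memory w m" and wr: "wordy w \<rho>"
    and rk: "\<And>i. i \<le> n \<Longrightarrow> view w m (b0 + 4) i = rnk \<gamma> i"
    and P: "\<And>b j. j \<le> n + A \<Longrightarrow> view w m (b0 + (5 + of_bool b)) j = Pb \<gamma> b j"
  shows "run w struct_code \<rho> m (50 * w) (200 * M)
    (\<lambda>m' \<rho>'. same \<rho> \<rho>' \<and> (\<forall>b. b \<noteq> b0 + 7 \<and> b \<noteq> b0 + 8 \<and> b \<noteq> b0 + 9 \<longrightarrow> view w m' b = view w m b) \<and>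
       view w m' (b0 + 8) 0 = u \<and> view w m' (b0 + 8) 1 = csize \<and> lay (cell m' b0) \<gamma>)"
    (is "run w _ \<rho> m _ _ ?Q")
proof -
  note B = regs_okD[OF regs_ok same_refl]
  have b8: "eval w m' (\<rho>(32 := j)) (blk 8) = b0 + 8" for m' j using regs_okD(16)[OF regs_ok, of "\<rho>(32 := j)" 8] by simp
  have V1: "0 < bsize" "1 < bsize" "b0 + 8 < bsize" using G_bsize1 G_1000 B(15) by linarith+
  have h1: "run w (par 32 (C 1) (Adr (blk 8) (C 0)) (V 5)) \<rho> m 1 2
    (\<lambda>m' \<rho>'. \<rho>' = \<rho> \<and> view w m' (b0 + 8) 0 = u \<and> (\<forall>b' x. b' \<noteq> b0 + 8 \<or> x \<noteq> 0 \<longrightarrow> view w m' b' x = view w m b' x))"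
    by (rule run_store1) (use B b8 V1 in auto)
  have h2: "run w (par 32 (C 1) (Adr (blk 8) (C 1)) (V 13)) \<rho> m1 1 2
    (\<lambda>m' \<rho>'. \<rho>' = \<rho> \<and> view w m' (b0 + 8) 1 = csize \<and> (\<forall>b' x. b' \<noteq> b0 + 8 \<or> x \<noteq> 1 \<longrightarrow> view w m' b' x = view w m1 b' x))" for m1
    by (rule run_store1) (use B b8 V1 in auto)
  have "run w struct_code \<rho> m (1 + (1 + (10 * w + (6 * w + (16 * w + 16 * w))))) (2 + (2 + (40 * M + (20 * M + (60 * M + 60 * M)))))
    ?Q"
    unfolding struct_code_def
  proof (rule run_append[OF h1], elim conjE, hypsubst, goal_cases)
    case (1 m1 \<rho>1)
    note v1 = 1(3,4)
    show ?case
    proof (rule run_append[OF h2], elim conjE, hypsubst, goal_cases)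
      case (1 m2 \<rho>2)
      note v2 = 1(3,4)
      have v2': "view w m2 b = view w m b" if "b \<noteq> b0 + 8" for b using v1 v2 that by (auto simp: fun_eq_iff)
      have h: "view w m2 (b0 + 8) 0 = u" "view w m2 (b0 + 8) 1 = csize" using v1 v2 by auto
      have rk2: "view w m2 (b0 + 4) i = rnk \<gamma> i" if "i \<le> n" for i using v2'[of "b0 + 4"] rk[OF that] by simp
      have P2: "pos_ok m2 b0 b (Pb \<gamma> b)" for b
        by (rule pos_ok_Pb) (use P v2'[of "b0 + (5 + of_bool b)"] in auto)
      show ?case
      proof (rule run_append[OF run_rank[OF regs_ok 1(1) wr rk2]], assumption, elim conjE, goal_cases)
        case (1 m3 \<rho>3)
        note r3 = 1
        have bp3: "regs_ok \<rho>3 b0" using regs_ok_same[OF regs_ok r3(3)] .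
        show ?case
        proof (rule run_append[OF run_table[OF bp3 r3(1,2)]], elim conjE, goal_cases)
          case (1 m4 \<rho>4)
          note r4 = 1
          have bp4: "regs_ok \<rho>4 b0" using regs_ok_same[OF bp3 r4(3)] .
          have P4: "pos_ok m4 b0 b (Pb \<gamma> b)" for b using pos_ok_frame[OF pos_ok_frame[OF P2 r3(4)] r4(4)] .
          show ?case
          proof (rule run_append[OF run_sel[OF bp4 P4 r4(1,2)]], elim conjE, goal_cases)
            case (1 m5 \<rho>5)
            note r5 = 1
            have bp5: "regs_ok \<rho>5 b0" using regs_ok_same[OF bp4 r5(3)] .
            have P5: "pos_ok m5 b0 b (Pb \<gamma> b)" for b using pos_ok_frame[OF P4 r5(4)] .
            show ?case
            proof (rule run_cong_post[OF run_sel[OF bp5 P5 r5(1,2)]], simp, simp, elim conjE, goal_cases)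
              case (1 m6 \<rho>6)
              note r6 = 1
              have sm: "same \<rho> \<rho>6" using same_trans[OF same_trans[OF same_trans[OF r3(3) r4(3)] r5(3)] r6(3)] .
              note F = frame_trans[OF frame_trans[OF frame_trans[OF r3(4) r4(4)] r5(4)] r6(4)]
              have "lay_rank (cell m6 b0) \<gamma>"
                by (rule lay_rank_frame[OF lay_rank_frame[OF lay_rank_frame[OF r3(5) r4(4)] r5(4)] r6(4)]) auto
              moreover have "lay_table (cell m6 b0)"
                by (rule lay_table_frame[OF lay_table_frame[OF r4(5) r5(4)] r6(4)]) auto
              moreover have "lay_select (cell m6 b0) False (Pb \<gamma> False)"
                by (rule lay_select_frame[OF r5(5) r6(4)]) (auto simp: Pb_le)
              moreover have "lay_select (cell m6 b0) True (Pb \<gamma> True)" using r6(5) .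
              ultimately have "lay (cell m6 b0) \<gamma>" unfolding lay_def by (metis (full_types))
              moreover have "view w m6 b = view w m b" if "b \<noteq> b0 + 7" "b \<noteq> b0 + 8" "b \<noteq> b0 + 9" for b
                using F v2'[OF that(2)] that unfolding frame_def by auto
              moreover have "view w m6 (b0 + 8) 0 = u" "view w m6 (b0 + 8) 1 = csize"
                using F h unfolding frame_def by auto
              ultimately show ?case using sm by auto
            qed
          qed
        qed
      qed
    qed
  qed
  then show ?thesis
  proof (rule run_cong_post)
    show "1 + (1 + (10 * w + (6 * w + (16 * w + 16 * w)))) \<le> 50 * w" using w_big by simp
    show "2 + (2 + (40 * M + (20 * M + (60 * M + 60 * M)))) \<le> 200 * M" using M_G by linarith
  qed
qed

lemma run_dir:
  assumes regs_ok: "regs_ok \<rho> b0" and l: "\<rho> 17 = l" "3 * l + 2 < bsize" and D: "\<rho> 18 = D" "D < bsize" "D \<noteq> b0 + 4"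
    and rk: "view w m (b0 + 4) n = rnk \<gamma> n"
  shows "run w dir_code \<rho> m 3 6
    (\<lambda>m' \<rho>'. \<rho>' = \<rho> \<and> (\<forall>b. b \<noteq> D \<longrightarrow> view w m' b = view w m b) \<and>
       (\<forall>x. x \<noteq> 3 * l \<and> x \<noteq> 3 * l + 1 \<and> x \<noteq> 3 * l + 2 \<longrightarrow> view w m' D x = view w m D x) \<and>
       view w m' D (3 * l) = (b0 + 2) * bsize \<and> view w m' D (3 * l + 1) = n - rnk \<gamma> n \<and>
       view w m' D (3 * l + 2) = (b0 + 8) * bsize)"
    (is "run w _ \<rho> m _ _ ?Q")
proof -
  note B = regs_okD[OF regs_ok same_refl]
  have lw: "3 * l + 2 < 2 ^ w" using l bsize_less by linarith
  have o: "eval w m' (\<rho>(32 := j)) (Bin Add (Bin Mul (C 3) (V 17)) (C c)) = 3 * l + c" if "c \<le> 2" for m' j c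
    using lw l that by (simp add: eval_Add eval_Mul)
  have d: "eval w m' (\<rho>(32 := j)) (V 18) = D" for m' j using D by simp
  have bl: "eval w m' (\<rho>(32 := j)) (blk k) = b0 + k" if "k \<le> 99" for m' j k using regs_okD(16)[OF regs_ok, of "\<rho>(32 := j)" k] that by simp
  have bV: "eval w m' (\<rho>(32 := j)) (Bin Mul (blk k) (V 3)) = (b0 + k) * bsize" if "k \<le> 99" for m' j k
    using bl[OF that] adr_less[of "b0 + k" 0] B(3,15) that bsize_pos by (subst eval_Mul) auto
  have nV: "n < bsize" "n < 2 ^ w" using nA_small bsize_less by linarith+
  have z: "eval w m' (\<rho>(32 := j)) zE = n - rnk \<gamma> n" if "view w m' (b0 + 4) n = rnk \<gamma> n" for m' j
  proof -
    have "eval w m' (\<rho>(32 := j)) (At (blk 4) (V 0)) = rnk \<gamma> n"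
      using atb[OF regs_ok, of "\<rho>(32 := j)" 4 m' "V 0" n] B(1) nV that by simp
    then show ?thesis using B(1) rnk_le[of \<gamma> n] nV by (subst eval_Sub) auto
  qed
  have p1: "run w (par 32 (C 1) (Adr (V 18) (Bin Add (Bin Mul (C 3) (V 17)) (C 0))) (Bin Mul (blk 2) (V 3))) \<rho> m 1 2
    (\<lambda>m' \<rho>'. \<rho>' = \<rho> \<and> view w m' D (3 * l + 0) = (b0 + 2) * bsize \<and> (\<forall>b' x. b' \<noteq> D \<or> x \<noteq> 3 * l + 0 \<longrightarrow> view w m' b' x = view w m b' x))"
    by (rule run_store1[OF B(3) d D(2) o _ bV]) (use l in auto)
  have p2: "run w (par 32 (C 1) (Adr (V 18) (Bin Add (Bin Mul (C 3) (V 17)) (C 1))) zE) \<rho> m1 1 2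
    (\<lambda>m' \<rho>'. \<rho>' = \<rho> \<and> view w m' D (3 * l + 1) = n - rnk \<gamma> n \<and> (\<forall>b' x. b' \<noteq> D \<or> x \<noteq> 3 * l + 1 \<longrightarrow> view w m' b' x = view w m1 b' x))"
    if "view w m1 (b0 + 4) n = rnk \<gamma> n" for m1
    by (rule run_store1[OF B(3) d D(2) o _ z[OF that]]) (use l in auto)
  have p3: "run w (par 32 (C 1) (Adr (V 18) (Bin Add (Bin Mul (C 3) (V 17)) (C 2))) (Bin Mul (blk 8) (V 3))) \<rho> m1 1 2
    (\<lambda>m' \<rho>'. \<rho>' = \<rho> \<and> view w m' D (3 * l + 2) = (b0 + 8) * bsize \<and> (\<forall>b' x. b' \<noteq> D \<or> x \<noteq> 3 * l + 2 \<longrightarrow> view w m' b' x = view w m1 b' x))" for m1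
    by (rule run_store1[OF B(3) d D(2) o _ bV]) (use l in auto)
  have "run w dir_code \<rho> m (1 + (1 + 1)) (2 + (2 + 2))
    ?Q"
    unfolding dir_code_def
  proof (rule run_append[OF p1], elim conjE, hypsubst, goal_cases)
    case (1 m1 \<rho>1)
    note v1 = 1(3,4)
    have rk1: "view w m1 (b0 + 4) n = rnk \<gamma> n" using v1(2) D(3) rk by metis
    show ?case
    proof (rule run_append[OF p2[OF rk1]], elim conjE, hypsubst, goal_cases)
      case (1 m2 \<rho>2)
      note v2 = 1(3,4)
      show ?case
      proof (rule run_cong_post[OF p3], simp, simp, elim conjE, hypsubst, goal_cases)
        case (1 m3)
        note v3 = 1(3,4)
        have "view w m3 b = view w m b" if "b \<noteq> D" for b using v1 v2 v3 that by (auto simp: fun_eq_iff)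
        then show ?case using v1 v2 v3 by auto
      qed
    qed
  qed
  then show ?thesis by (rule run_cong_post) auto
qed

end

lemma ones_cong: "(\<And>i. i < k \<Longrightarrow> P i = Q i) \<Longrightarrow> ones P k = ones Q k"
  by (auto simp: ones_def intro: filter_cong)

lemma pos_cong: "(\<And>i. i < n \<Longrightarrow> P i = Q i) \<Longrightarrow> pos P n j = pos Q n j"
  using ones_cong[of n P Q] by (simp add: pos_def rnk_def)

lemma length_level_seq: "length (level_seq d S l) = length S"
proof (induction l)
  case (Suc l)
  then show ?case
    using sum_length_filter_compl[of "high_bit d (Suc l)" "level_seq d S l"] by simp
qed simp

context params
begin

text \<open>Needed because \<open>\<gamma>\<close> is false from \<open>n\<close> on, while nothing
  is known of \<open>B ! i\<close> there; the layout depends only on the bits below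
  \<open>n\<close>.\<close>

lemma lay_cong:
  assumes "lay c \<gamma>" "\<And>i. i < n \<Longrightarrow> \<gamma> i = \<beta> i"
  shows "lay c \<beta>"
proof -
  have r: "rnk \<gamma> i = rnk \<beta> i" if "i \<le> n" for i using assms(2) that by (intro rnk_cong) auto
  have "lay_rank c \<beta>" unfolding lay_rank_def
  proof (intro conjI allI impI)
    fix g assume "g \<le> n div A"
    then show "c 0 g = rnk \<beta> (g * A)"
      using assms(1) r[OF div_mult_le] unfolding lay_def lay_rank_def by auto
  next
    fix h assume h: "h \<le> n div U"
    have "h * U div A * A \<le> h * U" by simp
    then have "h * U div A * A \<le> n" "h * U \<le> n" using div_mult_le[OF h] by linarith+
    then show "field_at c 1 h = rnk \<beta> (h * U) - rnk \<beta> (h * U div A * A)"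
      using assms(1) r h unfolding lay_def lay_rank_def by auto
  qed
  moreover have "Pb \<gamma> b = Pb \<beta> b" for b
    unfolding Pb_def using assms(2) by (intro ext pos_cong) auto
  ultimately show ?thesis using assms(1) by (simp add: lay_def)
qed

text \<open>What later levels must preserve lies in blocks below \<open>b0\<close>, or in the
  directory block \<open>D\<close> at entries of other levels; the first clauses of the
  postcondition protect both.\<close>

lemma run_level:
  assumes regs_ok: "regs_ok \<rho> b0" and b0: "b0 + 132 < bsize" and wm: "word_memory w m" and wr: "wordy w \<rho>"
    and l: "\<rho> 17 = l" "3 * l + 2 < bsize" and D: "\<rho> 18 = D" "D < bsize" "b0 + 32 < D"
  defines "\<gamma> \<equiv> (\<lambda>i. i < n \<and> bit (view w m b0 i) (\<rho> 15))"
  shows "run w level_code \<rho> m (100 * w) (400 * M)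
    (\<lambda>m' \<rho>'. same (\<rho>(4 := b0 + 32, 17 := l + 1)) \<rho>' \<and>
       (\<forall>b. (b \<le> b0 \<or> b0 + 32 < b) \<and> b \<noteq> D \<longrightarrow> view w m' b = view w m b) \<and>
       (\<forall>x. x \<noteq> 3 * l \<and> x \<noteq> 3 * l + 1 \<and> x \<noteq> 3 * l + 2 \<longrightarrow> view w m' D x = view w m D x) \<and>
       (\<forall>i<n. bit (view w m' (b0 + 2) (i div w)) (i mod w) = \<gamma> i) \<and>
       view w m' (b0 + 8) 0 = u \<and> view w m' (b0 + 8) 1 = csize \<and> lay (cell m' b0) \<gamma> \<and>
       view w m' D (3 * l) = (b0 + 2) * bsize \<and> view w m' D (3 * l + 1) = n - rnk \<gamma> n \<and>
       view w m' D (3 * l + 2) = (b0 + 8) * bsize \<and>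
       (\<forall>j<n. view w m' (b0 + 32) j = view w m b0 (if j < n - rnk \<gamma> n then Pb \<gamma> False j else Pb \<gamma> True (j - (n - rnk \<gamma> n)))))"
    (is "run w _ \<rho> m _ _ ?Q")
proof -
  have "run w level_code \<rho> m (1 + (20 * w + (6 * w + (3 + (1 + (50 * w + (3 + (1 + 1))))))))
    ((n + w + 1) + (20 * (n + w) + (20 * M + (20 * M + (20 * M + (200 * M + (6 + (1 + 1)))))))) ?Q"
    unfolding level_code_def
  proof (rule run_append[OF run_bits[OF regs_ok wm wr]], elim conjE, hypsubst, goal_cases)
    case (1 m1 \<rho>1)
    note v1 = 1(3)
    have g1: "view w m1 (b0 + 1) i = of_bool (\<gamma> i)" if "i < nb * w" for i
      using 1(4) that unfolding \<gamma>_def by simp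
    show ?case
    proof (rule run_append[OF run_scan[OF regs_ok 1(1) wr g1]], assumption, elim conjE, goal_cases)
      case (1 m2 \<rho>2)
      note w2 = 1(1,2) and sm2 = 1(3) and v2 = 1(4) and rk2 = 1(5)
      note bp2 = regs_ok_same[OF regs_ok sm2]
      have g2: "view w m2 (b0 + 1) i = of_bool (\<gamma> i)" if "i < nb * w" for i
        using g1[OF that] v2 by simp
      show ?case
      proof (rule run_append[OF run_bitmap[OF bp2 w2 g2]], assumption, elim conjE, goal_cases)
        case (1 m3 \<rho>3)
        note w3 = 1(1,2) and sm3 = 1(3) and v3 = 1(4) and bm3 = 1(5)
        note bp3 = regs_ok_same[OF bp2 sm3]
        have g3: "view w m3 (b0 + 1) i = of_bool (\<gamma> i)" if "i < n" for i
          using g2[of i] v3 nb_w that by simp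
        have rk3: "view w m3 (b0 + 4) i = rnk \<gamma> i" if "i \<le> n" for i
          using rk2 v3 nb_w that by simp
        show ?case
        proof (rule run_append[OF run_pos[OF bp3 w3 g3 rk3]], assumption, assumption, elim conjE, hypsubst, goal_cases)
          case (1 m4 \<rho>4)
          note w4 = 1(1) w3(2) and v4 = 1(3) and P4 = 1(4)
          have P4': "view w m4 (b0 + (5 + of_bool b)) j = Pb \<gamma> b j" if "j \<le> n + A" for b j
            using P4 that by blast
          have rk4: "view w m4 (b0 + 4) i = rnk \<gamma> i" if "i \<le> n" for i
            using rk3[OF that] v4 by simp
          have b4: "view w m4 b0 = view w m b0" using v1 v2 v3 v4 by simp
          show ?case
          proof (rule run_append[OF run_next[OF bp3 w4 rk4[OF le_refl] P4']], assumption, elim conjE, hypsubst, goal_cases)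
            case (1 m5 \<rho>5)
            note w5 = 1(1) w3(2) and v5 = 1(3) and nx5 = 1(4)
            have P5: "view w m5 (b0 + (5 + of_bool b)) j = Pb \<gamma> b j" if "j \<le> n + A" for b j
              using P4'[OF that, of b] v5 by (simp add: of_bool_def)
            have rk5: "view w m5 (b0 + 4) i = rnk \<gamma> i" if "i \<le> n" for i
              using rk4[OF that] v5 by simp
            show ?case
            proof (rule run_append[OF run_struct[OF bp3 w5 rk5 P5]], assumption, assumption, elim conjE, goal_cases)
              case (1 m6 \<rho>6)
              note w6 = 1(1,2) and sm6 = 1(3) and v6 = 1(4) and h6 = 1(5,6) and lay6 = 1(7)
              note bp6 = regs_ok_same[OF bp3 sm6]
              have sm: "same \<rho> \<rho>6" using same_trans[OF same_trans[OF sm2 sm3] sm6] .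
              have r17: "\<rho>6 17 = l" "\<rho>6 18 = D" using sm l D by (auto simp: same_def)
              have D4: "D \<noteq> b0 + 4" using D by simp
              have rk6: "view w m6 (b0 + 4) n = rnk \<gamma> n" using rk5[of n] v6 by simp
              show ?case
              proof (rule run_append[OF run_dir[OF bp6 r17(1) l(2) r17(2) D(2) D4 rk6]], elim conjE, hypsubst, goal_cases)
                case (1 m7 \<rho>7)
                note v7 = 1(3) and d7 = 1(4-7)
                have bD: "view w m7 b = view w m6 b" if "b \<le> b0 + 32" for b using v7 that D by auto
                have V: "view w m7 b = view w m b" if "(b \<le> b0 \<or> b0 + 32 < b) \<and> b \<noteq> D" for b
                  using v1 v2 v3 v4 v5 v6 v7 that by auto
                have VD: "view w m6 D = view w m D" using v1 v2 v3 v4 v5 v6 D by auto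
                have lc: "lay (cell m7 b0) \<gamma>"
                proof -
                  have "cell m7 b0 = cell m6 b0" by (intro ext) (simp add: cell_def bD)
                  then show ?thesis using lay6 by simp
                qed
                have bm: "bit (view w m7 (b0 + 2) (i div w)) (i mod w) = \<gamma> i" if "i < n" for i
                  using bm3 that bD[of "b0 + 2"] v6 v5 v4 by simp
                have nx: "view w m7 (b0 + 32) j = view w m b0 (if j < n - rnk \<gamma> n then Pb \<gamma> False j else Pb \<gamma> True (j - (n - rnk \<gamma> n)))"
                  if "j < n" for j
                  using nx5 that bD[of "b0 + 32"] v6 b4 by simp
                have q: "?Q m7 \<rho>'" if "same (\<rho>(4 := b0 + 32, 17 := l + 1)) \<rho>'" for \<rho>'
                  using that V VD lc bm nx d7 bD[of "b0 + 8"] h6 by auto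
                show ?case
                proof (rule run_append[where R = "\<lambda>m' \<rho>'. m' = m7 \<and> \<rho>' = \<rho>6(4 := b0 + 32)"], goal_cases)
                  case 1
                  show ?case
                    by (rule run_assign) (use regs_okD(16)[OF bp6 same_refl, of 32] in \<open>auto simp: CC_def\<close>)
                next
                  case (2 m8 \<rho>8)
                  then have e: "m8 = m7" "\<rho>8 = \<rho>6(4 := b0 + 32)" by auto
                  show ?case unfolding e
                  proof (rule run_assign)
                    have "eval w m7 (\<rho>6(4 := b0 + 32)) (Bin Add (V 17) (C 1)) = l + 1"
                      using r17 l bsize_less by (subst eval_Add) auto
                    moreover have "same (\<rho>(4 := b0 + 32, 17 := l + 1)) (\<rho>6(4 := b0 + 32, 17 := l + 1))"
                      using sm by (simp add: same_def)
                    ultimately show "?Q m7 (\<rho>6(4 := b0 + 32, 17 := eval w m7 (\<rho>6(4 := b0 + 32)) (Bin Add (V 17) (C 1))))"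
                      by (intro q) simp
                  qed (auto simp: CC_def)
                qed
              qed
            qed
          qed
        qed
      qed
    qed
  qed
  then show ?thesis
  proof (rule run_cong_post)
    show "1 + (20 * w + (6 * w + (3 + (1 + (50 * w + (3 + (1 + 1))))))) \<le> 100 * w" using w_big by simp
    show "(n + w + 1) + (20 * (n + w) + (20 * M + (20 * M + (20 * M + (200 * M + (6 + (1 + 1))))))) \<le> 400 * M"
      using M_G(1,3,7) unfolding add_mult_distrib2 by linarith
  qed
qed

end

section \<open>Initialisation and the loop over the levels\<close>

lemma num_levels_clog: "1 \<le> \<sigma> \<Longrightarrow> num_levels \<sigma> = clog \<sigma>"
proof -
  assume s: "1 \<le> \<sigma>"
  define a where "a = num_levels \<sigma>"
  have l0: "0 \<le> log 2 (real \<sigma>)" using s by simp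
  have "log 2 (real \<sigma>) \<le> real a" using l0 unfolding a_def num_levels_def by linarith
  then have "real \<sigma> \<le> 2 powr real a" using s by (simp add: log_le_iff)
  then have "real \<sigma> \<le> real (2 ^ a)" by (simp add: powr_realpow)
  then have 1: "\<sigma> \<le> 2 ^ a" by (simp only: of_nat_le_iff)
  have 2: "2 ^ (a - 1) < \<sigma>" if "a \<noteq> 0"
  proof -
    have "real (a - 1) < log 2 (real \<sigma>)" using that l0 unfolding a_def num_levels_def by linarith
    then have "2 powr real (a - 1) < real \<sigma>" using s by (simp add: less_log_iff)
    then have "real (2 ^ (a - 1)) < real \<sigma>" by (simp add: powr_realpow)
    then show ?thesis by (simp only: of_nat_less_iff)
  qed
  have "clog \<sigma> = a" by (rule clog_unique[OF 1]) (use 2 in blast)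
  then show ?thesis by (simp add: a_def)
qed

lemma clog_le_iff: "clog X \<le> c \<longleftrightarrow> X \<le> 2 ^ c"
proof
  assume "clog X \<le> c"
  then have "(2::nat) ^ clog X \<le> 2 ^ c" by (intro power_increasing) auto
  then show "X \<le> 2 ^ c" using clog_ge[of X] by linarith
next
  assume "X \<le> 2 ^ c" then show "clog X \<le> c" unfolding clog_def by (rule Least_le)
qed

text \<open>Doubles a power of two until it reaches the argument, and counts. There are always
  \<open>w\<close> rounds; once the comparison in register 21 is 0, power and count stand
  still.\<close>

definition lg_code :: "nat \<Rightarrow> nat \<Rightarrow> code" where
  "lg_code x y = assign 20 (C 1) @ assign y (C 0) @ assign 30 (V 2) @
     loop 30 (assign 21 (Bin Less (V 20) (V x)) @ assign y (Bin Add (V y) (V 21)) @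
       assign 20 (Bin Add (V 20) (Bin Mul (V 20) (V 21))))"

definition csizeE :: expr where
  "csizeE = Bin Add (Bin Add (Bin Add (Bin Add
        (Bin Add (Bin Div (V 0) (V 10)) (C 2))
        (Bin Mul (Bin Add (Bin Div (V 0) (V 11)) (C 1)) (V 10)))
        (Bin Add (Bin Div (Bin Mul (Bin Add (Bin Div (V 0) (V 8)) (C 1)) (V 9)) (V 7)) (C 1)))
        (Bin Add (Bin Div (Bin Add (Bin Div (V 0) (V 9)) (C 1)) (V 7)) (C 1)))
        (Bin Mul (Bin Add (V 8) (C 1)) (V 14))"

text \<open>The directory gets block \<open>32 * (clog \<sigma> + 1)\<close>, behind block
  \<open>32 * clog \<sigma>\<close>, into which the last level still writes a next sequence.\<close>

definition init_code :: code where
  "init_code = assign 3 (Bin Shl (C (Suc 0)) (Bin Div (V 2) (C 2))) @ lg_code 2 5 @ lg_code 1 16 @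
     assign 6 (Bin Mul (C 5) (V 5)) @ assign 7 (Bin Div (V 2) (V 6)) @ assign 9 (Bin Mul (V 5) (V 5)) @
     assign 8 (Bin Mul (V 9) (V 9)) @ assign 10 (Bin Mul (V 8) (V 2)) @ assign 11 (Bin Shl (C (Suc 0)) (V 6)) @
     assign 12 (Bin Add (Bin Div (V 0) (V 2)) (C 1)) @ assign 14 (Bin Shl (C (Suc 0)) (V 8)) @
     assign 13 csizeE @
     assign 15 (V 16) @ assign 4 (C 0) @ assign 17 (C 0) @
     assign 18 (Bin Mul (C 32) (Bin Add (V 16) (C 1))) @ []"

text \<open>The counter in register 15 doubles as the index of the inspected bit: with
  \<open>k\<close> rounds left after the current one, the level inspects bit \<open>k\<close> of its
  symbols.\<close>

definition wm_code :: code where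
  "wm_code = init_code @ loop 15 level_code @ assign 0 (Bin Mul (V 18) (V 3))"

context params
begin

text \<open>Identifies the gather of \<open>next_code\<close> with the two filters in the definition
  of \<open>level_seq\<close>.\<close>

lemma level_step:
  assumes L: "L = level_seq d S l" "length L = n" and j: "j < n"
  defines "\<gamma> \<equiv> (\<lambda>i. i < n \<and> bit (L ! i) (d - Suc l))"
  shows "level_seq d S (Suc l) ! j =
    L ! (if j < n - rnk \<gamma> n then Pb \<gamma> False j else Pb \<gamma> True (j - (n - rnk \<gamma> n)))"
proof -
  let ?Q = "high_bit d (Suc l)"
  have p: "pos (\<lambda>p. ?Q (L ! p)) n i = Pb \<gamma> True i" "pos (\<lambda>p. \<not> ?Q (L ! p)) n i = Pb \<gamma> False i" for i
    unfolding Pb_def by (rule pos_cong; simp add: \<gamma>_def high_bit_def)+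
  have r: "rnk (\<lambda>p. ?Q (L ! p)) n = rnk \<gamma> n"
    by (rule rnk_cong) (simp add: \<gamma>_def high_bit_def)
  have "filter ?Q L = map (\<lambda>j. L ! Pb \<gamma> True j) [0..<rnk \<gamma> n]"
    using filter_nth_pos[of ?Q L] L(2) p r by simp
  moreover have "filter (\<lambda>x. \<not> ?Q x) L = map (\<lambda>j. L ! Pb \<gamma> False j) [0..<n - rnk \<gamma> n]"
    using filter_nth_pos[of "\<lambda>x. \<not> ?Q x" L] L(2) p r rnk_not[of "\<lambda>p. ?Q (L ! p)" n] by simp
  ultimately show ?thesis using j rnk_le[of \<gamma> n] by (auto simp: L(1)[symmetric] nth_append)
qed

lemma run_lg:
  assumes r: "\<rho> 2 = w" "\<rho> x = X" "X \<le> G" and xy: "x < 20" "y < 20" "x \<noteq> y" "y \<noteq> 2" and wr: "wordy w \<rho>" and wm: "word_memory w m"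
  shows "run w (lg_code x y) \<rho> m (6 * w) (6 * w)
    (\<lambda>m' \<rho>'. m' = m \<and> \<rho>' y = clog X \<and> (\<forall>z. z \<notin> {y, 20, 21, 30} \<longrightarrow> \<rho>' z = \<rho> z))"
proof -
  let ?fr = "\<lambda>m' \<rho>'. m' = m \<and> (\<forall>z. z \<notin> {y, 20, 21, 30} \<longrightarrow> \<rho>' z = \<rho> z)"
  let ?I = "\<lambda>k m' \<rho>'. ?fr m' \<rho>' \<and> k \<le> w \<and> \<rho>' y = min (w - k) (clog X) \<and> \<rho>' 20 = 2 ^ (min (w - k) (clog X))"
  have uw: "clog X \<le> w" unfolding clog_le_iff using r(3) less_Vv_w[OF le_G_bsize, of X] by simp
  have "run w (lg_code x y) \<rho> m (1 + (1 + (1 + (w * ((1 + (1 + 1)) + 2) + 1)))) (1 + (1 + (1 + (w * ((1 + (1 + 1)) + 2) + 1))))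
    (\<lambda>m' \<rho>'. \<rho>' 30 = 0 \<and> ?I 0 m' \<rho>')"
    unfolding lg_code_def
  proof (rule run_append[where R = "\<lambda>m' \<rho>'. ?fr m' \<rho>' \<and> \<rho>' 20 = 1"], goal_cases)
    case 1 show ?case by (rule run_assign) (use xy in \<open>auto simp: CC_def\<close>)
  next
    case (2 m1 \<rho>1)
    show ?case
    proof (rule run_append[where R = "\<lambda>m' \<rho>'. ?fr m' \<rho>' \<and> \<rho>' 20 = 1 \<and> \<rho>' y = 0"], goal_cases)
      case 1 show ?case by (rule run_assign) (use 2 xy in \<open>auto simp: CC_def\<close>)
    next
      case b: (2 m2 \<rho>2)
      show ?case
      proof (rule run_append[where R = "\<lambda>m' \<rho>'. ?I w m' \<rho>' \<and> \<rho>' 30 = w"], goal_cases)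
        case 1 show ?case by (rule run_assign) (use b xy r in \<open>auto simp: CC_def\<close>)
      next
        case c: (2 m3 \<rho>3)
        show ?case
        proof (rule run_loop[where I = ?I])
          fix k m4 \<rho>4 assume k: "k < w" and w4: "word_memory w m4" "wordy w \<rho>4" "\<rho>4 30 = Suc k" and I: "?I (Suc k) m4 \<rho>4"
          let ?\<rho> = "\<rho>4(30 := k)"
          define t where "t = min (w - Suc k) (clog X)"
          define t' where "t' = min (w - k) (clog X)"
          have tX: "2 ^ t < X \<longleftrightarrow> t < clog X" using clog_le_iff[of X t] by linarith
          have tt: "t' = t + of_bool (2 ^ t < X)" unfolding tX using k by (auto simp: t_def t'_def min_def)
          have x4: "?\<rho> x = X" "?\<rho> y = t" "?\<rho> 20 = 2 ^ t" using I xy r unfolding t_def by auto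
          have le: "t' \<le> w" unfolding t'_def by simp
          have tw: "t' < 2 ^ w" using le less_exp[of w] by linarith
          have t2: "2 ^ t + 2 ^ t * of_bool (2 ^ t < X) < (2::nat) ^ w"
          proof (cases "2 ^ t < X")
            case True
            then have "2 ^ t + 2 ^ t \<le> 2 * G" using r(3) by linarith
            then show ?thesis using True less_Vv_w[OF le_G_bsize, of "2 * G"] by simp
          next
            case False
            have "\<rho>4 20 < 2 ^ w" using w4(2) unfolding wordy_def by blast
            moreover have "\<rho>4 20 = 2 ^ t" using x4(3) by simp
            ultimately have "2 ^ t < (2::nat) ^ w" by (simp only:)
            then show ?thesis using False by simp
          qed
          show "run w (assign 21 (Bin Less (V 20) (V x)) @ assign y (Bin Add (V y) (V 21)) @
             assign 20 (Bin Add (V 20) (Bin Mul (V 20) (V 21)))) ?\<rho> m4 (1 + (1 + 1)) (1 + (1 + 1)) (\<lambda>m' \<rho>'. \<rho>' 30 = k \<and> ?I k m' \<rho>')"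
          proof (rule run_append[where R = "\<lambda>m' \<rho>'. m' = m4 \<and> \<rho>' = ?\<rho>(21 := of_bool (2 ^ t < X))"], goal_cases)
            case 1 show ?case by (rule run_assign) (use x4 xy in \<open>auto simp: CC_def eval_Less\<close>)
          next
            case (2 m5 \<rho>5)
            then have e: "m5 = m4" "\<rho>5 = ?\<rho>(21 := of_bool (2 ^ t < X))" by auto
            show ?case unfolding e
            proof (rule run_append[where R = "\<lambda>m' \<rho>'. m' = m4 \<and> \<rho>' = ?\<rho>(21 := of_bool (2 ^ t < X), y := t')"], goal_cases)
              case 1
              have "eval w m4 (?\<rho>(21 := of_bool (2 ^ t < X))) (Bin Add (V y) (V 21)) = t'"
                using x4 xy tw tt by (subst eval_Add) auto
              then show ?case by (intro run_assign) (use xy in \<open>auto simp: CC_def\<close>)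
            next
              case (2 m6 \<rho>6)
              then have e: "m6 = m4" "\<rho>6 = ?\<rho>(21 := of_bool (2 ^ t < X), y := t')" by auto
              show ?case unfolding e
              proof (rule run_assign)
                let ?r = "?\<rho>(21 := of_bool (2 ^ t < X), y := t')"
                have e1: "eval w m4 ?r (Bin Mul (V 20) (V 21)) = 2 ^ t * of_bool (2 ^ t < X)"
                  using x4 xy t2 by (subst eval_Mul) auto
                have "eval w m4 ?r (Bin Add (V 20) (Bin Mul (V 20) (V 21))) = 2 ^ t + 2 ^ t * of_bool (2 ^ t < X)"
                  using x4 xy t2 e1 by (subst eval_Add) auto
                also have "\<dots> = 2 ^ t'" unfolding tt by simp
                finally have "eval w m4 ?r (Bin Add (V 20) (Bin Mul (V 20) (V 21))) = 2 ^ t'" .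
                then show "(?r(20 := eval w m4 ?r (Bin Add (V 20) (Bin Mul (V 20) (V 21))))) 30 = k \<and>
                   ?I k m4 (?r(20 := eval w m4 ?r (Bin Add (V 20) (Bin Mul (V 20) (V 21)))))"
                  using I k xy by (auto simp: t'_def)
              qed (use xy in \<open>auto simp: CC_def\<close>)
            qed
          qed
        qed (use c in auto)
      qed
    qed
  qed
  then show ?thesis
  proof (rule run_cong_post)
    show "1 + (1 + (1 + (w * ((1 + (1 + 1)) + 2) + 1))) \<le> 6 * w" using w_big by simp
    then show "1 + (1 + (1 + (w * ((1 + (1 + 1)) + 2) + 1))) \<le> 6 * w" .
    fix m' \<rho>' assume "\<rho>' 30 = 0 \<and> ?I 0 m' \<rho>'"
    then show "m' = m \<and> \<rho>' y = clog X \<and> (\<forall>z. z \<notin> {y, 20, 21, 30} \<longrightarrow> \<rho>' z = \<rho> z)" using uw by simp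
  qed
qed

lemma eval_csizeE:
  assumes r: "\<rho> 0 = n" "\<rho> 10 = A" "\<rho> 11 = F" "\<rho> 8 = U" "\<rho> 9 = Bs" "\<rho> 7 = per" "\<rho> 14 = 2 ^ U"
  shows "eval w m \<rho> csizeE = csize"
proof -
  have N1: "n div A + 2 + (n div F + 1) * A + ((n div U + 1) * Bs div per + 1)
    + ((n div Bs + 1) div per + 1) + (U + 1) * 2 ^ U < 2 ^ w"
    using csize_bsize bsize_less unfolding csize_def[symmetric] by linarith
  have BG: "(n div U + 1) * Bs < 2 ^ w"
  proof -
    have "(n div U + 1) * Bs \<le> (G + 1) * G"
      using n_le_G smalls by (intro mult_le_mono add_le_mono) (meson div_le_dividend le_trans, auto)
    also have "\<dots> = G * G + G" by simp
    finally show ?thesis using GG_bsize G_1000 bsize_less G_bsize1 by linarith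
  qed
  have dl: "n div A \<le> n" "n div Bs \<le> n" "n div U \<le> n" "n div F \<le> n" by (rule div_le_dividend)+
  have l: "n < 2 ^ w" "n div A + 2 < 2 ^ w" "n div Bs + 1 < 2 ^ w" "n div U + 1 < 2 ^ w" "n div F + 1 < 2 ^ w" "U + 1 < 2 ^ w"
    using smalls dl n_le_G G_1000 by (intro less_Vv_w le_G_bsize; linarith)+
  have a: "eval w m \<rho> (Bin Add (Bin Div (V 0) (V 10)) (C 2)) = n div A + 2"
    using l r by (simp add: eval_Add eval_Div)
  have b: "eval w m \<rho> (Bin Mul (Bin Add (Bin Div (V 0) (V 11)) (C 1)) (V 10)) = (n div F + 1) * A"
  proof -
    have 1: "eval w m \<rho> (Bin Add (Bin Div (V 0) (V 11)) (C 1)) = n div F + 1"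
      using l r by (simp add: eval_Add eval_Div)
    show ?thesis using N1 by (subst eval_Mul; simp only: 1 eval.simps(2) r; linarith)
  qed
  have c: "eval w m \<rho> (Bin Mul (Bin Add (Bin Div (V 0) (V 8)) (C 1)) (V 9)) = (n div U + 1) * Bs"
  proof -
    have 1: "eval w m \<rho> (Bin Add (Bin Div (V 0) (V 8)) (C 1)) = n div U + 1"
      using l r by (simp add: eval_Add eval_Div)
    show ?thesis by (subst eval_Mul; simp only: 1 eval.simps(2) r) (rule BG)
  qed
  have one: "eval w m \<rho> (C 1) = 1" by simp
  have c': "eval w m \<rho> (Bin Add (Bin Div (Bin Mul (Bin Add (Bin Div (V 0) (V 8)) (C 1)) (V 9)) (V 7)) (C 1))
     = (n div U + 1) * Bs div per + 1"
  proof -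
    have "eval w m \<rho> (Bin Div (Bin Mul (Bin Add (Bin Div (V 0) (V 8)) (C 1)) (V 9)) (V 7)) = (n div U + 1) * Bs div per"
      by (subst eval_Div; simp only: c eval.simps(2) r) (rule BG)
    then show ?thesis using N1 by (subst eval_Add; simp only: one; linarith)
  qed
  have d: "eval w m \<rho> (Bin Add (Bin Div (Bin Add (Bin Div (V 0) (V 9)) (C 1)) (V 7)) (C 1)) = (n div Bs + 1) div per + 1"
  proof -
    have 1: "eval w m \<rho> (Bin Add (Bin Div (V 0) (V 9)) (C 1)) = n div Bs + 1"
      using l r by (simp add: eval_Add eval_Div)
    have "eval w m \<rho> (Bin Div (Bin Add (Bin Div (V 0) (V 9)) (C 1)) (V 7)) = (n div Bs + 1) div per"
      by (subst eval_Div; simp only: 1 eval.simps(2) r) (rule l(3))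
    then show ?thesis using N1 by (subst eval_Add; simp only: one; linarith)
  qed
  have e: "eval w m \<rho> (Bin Mul (Bin Add (V 8) (C 1)) (V 14)) = (U + 1) * 2 ^ U"
  proof -
    have 1: "eval w m \<rho> (Bin Add (V 8) (C 1)) = U + 1" using l r by (simp add: eval_Add)
    show ?thesis using N1 by (subst eval_Mul; simp only: 1 eval.simps(2) r; linarith)
  qed
  have s1: "eval w m \<rho> (Bin Add (Bin Add (Bin Div (V 0) (V 10)) (C 2)) (Bin Mul (Bin Add (Bin Div (V 0) (V 11)) (C 1)) (V 10)))
    = n div A + 2 + (n div F + 1) * A"
    using N1 by (subst eval_Add; simp only: a b; linarith)
  have s2: "eval w m \<rho> (Bin Add (Bin Add (Bin Add (Bin Div (V 0) (V 10)) (C 2)) (Bin Mul (Bin Add (Bin Div (V 0) (V 11)) (C 1)) (V 10)))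
     (Bin Add (Bin Div (Bin Mul (Bin Add (Bin Div (V 0) (V 8)) (C 1)) (V 9)) (V 7)) (C 1)))
    = n div A + 2 + (n div F + 1) * A + ((n div U + 1) * Bs div per + 1)"
    using N1 by (subst eval_Add; simp only: s1 c'; linarith)
  have s3: "eval w m \<rho> (Bin Add (Bin Add (Bin Add (Bin Add (Bin Div (V 0) (V 10)) (C 2)) (Bin Mul (Bin Add (Bin Div (V 0) (V 11)) (C 1)) (V 10)))
     (Bin Add (Bin Div (Bin Mul (Bin Add (Bin Div (V 0) (V 8)) (C 1)) (V 9)) (V 7)) (C 1)))
     (Bin Add (Bin Div (Bin Add (Bin Div (V 0) (V 9)) (C 1)) (V 7)) (C 1)))
    = n div A + 2 + (n div F + 1) * A + ((n div U + 1) * Bs div per + 1) + ((n div Bs + 1) div per + 1)"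
    using N1 by (subst eval_Add; simp only: s2 d; linarith)
  show ?thesis unfolding csizeE_def csize_def
    using N1 by (subst eval_Add; simp only: s3 e)
qed

lemma run_init:
  assumes r: "\<rho> 0 = n" "\<rho> 1 = \<sigma>" "\<rho> 2 = w" and s: "1 \<le> \<sigma>" "\<sigma> \<le> n" and wr: "wordy w \<rho>" and wm: "word_memory w m"
  shows "run w init_code \<rho> m (20 * w) (20 * w)
    (\<lambda>m' \<rho>'. m' = m \<and> regs_ok \<rho>' 0 \<and> \<rho>' 15 = clog \<sigma> \<and> \<rho>' 17 = 0 \<and> \<rho>' 18 = 32 * (clog \<sigma> + 1))"
proof -
  let ?Q = "\<lambda>m' \<rho>'. m' = m \<and> regs_ok \<rho>' 0 \<and> \<rho>' 15 = clog \<sigma> \<and> \<rho>' 17 = 0 \<and> \<rho>' 18 = 32 * (clog \<sigma> + 1)"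
  have sG: "\<sigma> \<le> G" "w \<le> G" "n \<le> G" using s n_le_G w_le_G by auto
  have c5: "5 < (2::nat) ^ w" "1 < (2::nat) ^ w" using G_1000 by (intro less_Vv_w le_G_bsize; linarith)+
  have uw: "clog \<sigma> \<le> w" unfolding clog_le_iff using sG(1) less_Vv_w[OF le_G_bsize, of \<sigma>] by simp
  have dl: "n div Bs \<le> n" "n div w \<le> n" "n div U \<le> n" "n div F \<le> n" by simp_all
  have l: "u * u < 2 ^ w" "Bs * Bs < 2 ^ w" "5 * u < 2 ^ w" "w < 2 ^ w" "U * w < 2 ^ w" "n < 2 ^ w"
    "n div Bs + 1 < 2 ^ w" "n div w + 1 < 2 ^ w" "n div U + 1 < 2 ^ w" "n div F + 1 < 2 ^ w" "32 * (clog \<sigma> + 1) < 2 ^ w" "clog \<sigma> + 1 < 2 ^ w" "U + 1 < 2 ^ w"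
    using smalls A_le_G sG dl uw G_1000
    unfolding A_def f_def Bs_def[unfolded power2_eq_square, symmetric] U_eq[symmetric] add_mult_distrib2
    by (intro less_Vv_w le_G_bsize; linarith)+
  have s2: "f < w" "U < w" using U_w f_le_U by linarith+
  have V2: "eval w m \<rho> (Bin Shl (C (Suc 0)) (Bin Div (V 2) (C 2))) = bsize"
    using r l w_pos by (subst eval_Shl1) (auto simp: eval_Div bsize_def)
  have "run w init_code \<rho> m (1 + (6 * w + (6 * w + Suc (Suc (Suc (Suc (Suc (Suc (Suc (Suc (Suc (Suc (Suc (Suc (Suc 0)))))))))))))))
     (1 + (6 * w + (6 * w + Suc (Suc (Suc (Suc (Suc (Suc (Suc (Suc (Suc (Suc (Suc (Suc (Suc 0))))))))))))))) ?Q"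
    unfolding init_code_def
  proof (rule run_append[where R = "\<lambda>m' \<rho>'. m' = m \<and> \<rho>' = \<rho>(3 := bsize)"], goal_cases)
    case 1 show ?case by (rule run_assign) (use V2 in \<open>auto simp: CC_def\<close>)
  next
    case (2 m1 \<rho>1)
    then have e1: "m1 = m" "\<rho>1 = \<rho>(3 := bsize)" by auto
    have wr1: "wordy w (\<rho>(3 := bsize))" using wr bsize_less by (rule wordy_upd)
    show ?case unfolding e1
    proof (rule run_append[OF run_lg[where X = w]], goal_cases)
      case (10 m2 \<rho>2)
      then have r2: "m2 = m" "\<rho>2 5 = u" "\<rho>2 0 = n" "\<rho>2 1 = \<sigma>" "\<rho>2 2 = w" "\<rho>2 3 = bsize" using r by (auto simp: u_def)
      show ?case unfolding r2(1)
      proof (rule run_append[OF run_lg[where X = \<sigma>]], goal_cases)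
        case (10 m3 \<rho>3)
        then have r3: "m3 = m" "\<rho>3 5 = u" "\<rho>3 0 = n" "\<rho>3 2 = w" "\<rho>3 3 = bsize" "\<rho>3 16 = clog \<sigma>" using r2 by auto
        show ?case unfolding r3(1)
          apply (rule run_assign_then[where v = f], simp, simp, simp add: CC_def, use l c5 r3 in \<open>simp add: eval_Mul f_def\<close>)
          apply (rule run_assign_then[where v = per], simp, simp, simp add: CC_def, use l r3 in \<open>simp add: eval_Div per_def\<close>)
          apply (rule run_assign_then[where v = Bs], simp, simp, simp add: CC_def, use l r3 in \<open>simp add: eval_Mul Bs_def power2_eq_square\<close>)
          apply (rule run_assign_then[where v = U], simp, simp, simp add: CC_def, use l r3 in \<open>simp add: eval_Mul U_eq\<close>)
          apply (rule run_assign_then[where v = A], simp, simp, simp add: CC_def, use l r3 in \<open>simp add: eval_Mul A_def\<close>)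
          apply (rule run_assign_then[where v = F], simp, simp, simp add: CC_def, use s2 r3 in \<open>simp add: eval_Shl1 F_def\<close>)
          apply (rule run_assign_then[where v = nb], simp, simp, simp add: CC_def, use l r3 in \<open>simp add: eval_Add eval_Div nb_def\<close>)
          apply (rule run_assign_then[where v = "2 ^ U"], simp, simp, simp add: CC_def, use s2 r3 in \<open>simp add: eval_Shl1\<close>)
          apply (rule run_assign_then[where v = csize], simp add: csizeE_def, simp, simp add: csizeE_def CC_def)
          subgoal by (rule eval_csizeE) (use r3 in simp_all)
          apply (rule run_assign_then[where v = "clog \<sigma>"], simp, simp, simp add: CC_def, use r3 in simp)
          apply (rule run_assign_then[where v = 0], simp, simp, simp add: CC_def, simp)
          apply (rule run_assign_then[where v = 0], simp, simp, simp add: CC_def, simp)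
          apply (rule run_assign_then[where v = "32 * (clog \<sigma> + 1)"], simp, simp, simp add: CC_def)
          subgoal using l r3 by (simp add: eval_Add eval_Mul)
          apply (rule run_Nil)
          using r3 G_bsize1 G_1000 by (simp add: regs_ok_def)
      qed (use r2 10 sG wm in auto)
    qed (use r sG wr1 wm in auto)
  qed
  then show ?thesis by (rule run_cong_post) (use w_big in auto)
qed

end

section \<open>Correctness of the whole construction\<close>

context params
begin

definition level_ok :: "nat \<Rightarrow> nat list \<Rightarrow> nat \<Rightarrow> nat \<Rightarrow> mem \<Rightarrow> bool" where
  "level_ok \<sigma> S D l m \<longleftrightarrow> (let B = level_bitmap \<sigma> S l in
     (\<forall>i<n. bit (view w m (32 * l + 2) (i div w)) (i mod w) = B ! i) \<and>
     view w m (32 * l + 8) 0 = u \<and> view w m (32 * l + 8) 1 = csize \<and> lay (cell m (32 * l)) ((!) B) \<and>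
     view w m D (3 * l) = (32 * l + 2) * bsize \<and> view w m D (3 * l + 1) = count_list B False \<and>
     view w m D (3 * l + 2) = (32 * l + 8) * bsize)"

lemma level_ok_cong:
  assumes "level_ok \<sigma> S D l m" "view w m' (32 * l + 2) = view w m (32 * l + 2)"
    "view w m' (32 * l + 8) = view w m (32 * l + 8)"
    "view w m' D (3 * l) = view w m D (3 * l)" "view w m' D (3 * l + 1) = view w m D (3 * l + 1)"
    "view w m' D (3 * l + 2) = view w m D (3 * l + 2)"
  shows "level_ok \<sigma> S D l m'"
proof -
  have "cell m' (32 * l) = cell m (32 * l)" by (intro ext) (simp add: cell_def assms(3))
  then show ?thesis using assms unfolding level_ok_def Let_def by simp
qed

lemma run_wm:
  assumes r: "\<rho> 0 = n" "\<rho> 1 = \<sigma>" "\<rho> 2 = w" and s: "1 \<le> \<sigma>" "\<sigma> \<le> n" and S: "length S = n"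
    and wr: "wordy w \<rho>" and wm: "word_memory w m" and mS: "\<And>i. i < n \<Longrightarrow> m i = S ! i"
  defines "nl \<equiv> num_levels \<sigma>"
  shows "run w wm_code \<rho> m (20 * w + (nl * (100 * w + 2) + 1 + 1)) (20 * w + (nl * (400 * M + 2) + 1 + 1))
    (\<lambda>m' \<rho>'. word_memory w m' \<and> \<rho>' 0 = 32 * (nl + 1) * bsize \<and> (\<forall>l<nl. level_ok \<sigma> S (32 * (nl + 1)) l m'))"
  unfolding wm_code_def
proof (rule run_append[OF run_init[OF r s wr wm]], elim conjE, goal_cases)
  case (1 m1 \<rho>1)
  define D where "D = 32 * (nl + 1)"
  have nl: "nl = clog \<sigma>" unfolding nl_def using s by (simp add: num_levels_clog)
  have nlw: "nl \<le> w"
    unfolding nl clog_le_iff using s n_le_G less_Vv_w[OF le_G_bsize, of \<sigma>] by simp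
  have bnd: "32 * l + 132 < bsize" "3 * l + 2 < bsize" "32 * l + 32 < D" "32 * l + 32 = 32 * (l + 1)" if "l < nl" for l
    using that nlw w_le_G G_1000 G_bsize1 by (auto simp: D_def intro!: le_G_bsize)
  have DV: "D < bsize" "D < 2 ^ w" using nlw w_le_G G_1000 G_bsize1 bsize_less by (auto simp: D_def intro!: less_Vv_w le_G_bsize)
  let ?I = "\<lambda>k m' \<rho>'. k \<le> nl \<and> regs_ok \<rho>' (32 * (nl - k)) \<and> \<rho>' 17 = nl - k \<and> \<rho>' 18 = D \<and>
     (\<forall>i<n. view w m' (32 * (nl - k)) i = level_seq nl S (nl - k) ! i) \<and> (\<forall>l<nl - k. level_ok \<sigma> S D l m')"
  note m1 = 1(3)
  \<comment> \<open>The input occupies the cells from 0 on, which is block 0 of the first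
    level.\<close>
  have n0: "view w m 0 i = S ! i" if "i < n" for i
    using mS[OF that] that n_le_G le_G_bsize[of i] by (simp add: view_eq)
  show ?case
  proof (rule run_append[OF run_loop[where N = nl and I = ?I and d = "100 * w" and q = "400 * M"]], goal_cases)
    case 1 show ?case by simp
  next
    case 2 show ?case using 1 nl by simp
  next
    case 3 show ?case using 1 n0 nl unfolding D_def by simp
  next
    case (4 k m2 \<rho>2)
    define l where "l = nl - Suc k"
    have l: "l < nl" "nl - k = l + 1" "k = nl - Suc l" using 4(1) by (auto simp: l_def)
    have I: "regs_ok \<rho>2 (32 * l)" "\<rho>2 17 = l" "\<rho>2 18 = D" "\<And>i. i < n \<Longrightarrow> view w m2 (32 * l) i = level_seq nl S l ! i"
      "\<And>l'. l' < l \<Longrightarrow> level_ok \<sigma> S D l' m2" using 4(5) by (auto simp: l_def)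
    let ?\<rho> = "\<rho>2(15 := k)"
    have regs_ok: "regs_ok ?\<rho> (32 * l)" using I(1) by (simp add: regs_ok_def)
    have kw: "k < 2 ^ w" using l nlw less_exp[of w] by linarith
    have wr2: "wordy w ?\<rho>" using 4(3) kw by (rule wordy_upd)
    have l17: "?\<rho> 17 = l" "?\<rho> 18 = D" "?\<rho> 15 = k" using I by auto
    define \<gamma> where "\<gamma> = (\<lambda>i. i < n \<and> bit (view w m2 (32 * l) i) k)"
    have len: "length (level_seq nl S l) = n" by (simp add: length_level_seq S)
    have \<gamma>: "\<gamma> = (\<lambda>i. i < n \<and> bit (level_seq nl S l ! i) (nl - Suc l))"
      unfolding \<gamma>_def using I(4) l(3) by auto
    define B where "B = level_bitmap \<sigma> S l"
    have B: "length B = n" "\<And>i. i < n \<Longrightarrow> B ! i = \<gamma> i"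
      unfolding B_def level_bitmap_def \<gamma> by (auto simp: length_level_seq S high_bit_def nl_def[symmetric] len)
    have cf: "count_list B False = n - rnk \<gamma> n"
    proof -
      have "count_list B False = rnk (\<lambda>p. \<not> \<gamma> p) n"
        unfolding count_list_rnk B(1) by (rule rnk_cong) (simp add: B)
      then show ?thesis by (simp add: rnk_not)
    qed
    show ?case
    proof (rule run_cong_post[OF run_level[OF regs_ok bnd(1)[OF l(1)] 4(2) wr2 l17(1) bnd(2)[OF l(1)] l17(2) DV(1) bnd(3)[OF l(1)]]],
        simp, simp, elim conjE, unfold l17(3), fold \<gamma>_def, goal_cases)
      case (1 m3 \<rho>3)
      note sm = 1(3) and fr = 1(4) and frD = 1(5) and bm = 1(6) and hd = 1(7,8) and ly = 1(9) and dr = 1(10-12) and nx = 1(13)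
      have r3: "\<rho>3 x = (\<rho>2(15 := k, 4 := 32 * l + 32, 17 := l + 1)) x" if "x < 30" for x
        using sm that unfolding same_def by simp
      have "regs_ok \<rho>3 (32 * (l + 1))"
        using I(1) bnd[OF l(1)] unfolding regs_ok_def by (simp add: r3)
      moreover have "\<rho>3 15 = k" "\<rho>3 17 = l + 1" "\<rho>3 18 = D" using I by (simp_all add: r3)
      moreover have "view w m3 (32 * (l + 1)) j = level_seq nl S (l + 1) ! j" if j: "j < n" for j
      proof -
        let ?i = "if j < n - rnk \<gamma> n then Pb \<gamma> False j else Pb \<gamma> True (j - (n - rnk \<gamma> n))"
        have "level_seq nl S (Suc l) ! j = level_seq nl S l ! ?i"
          using level_step[OF refl len j] unfolding \<gamma> by simp
        \<comment> \<open>The sequence block is known below \<open>n\<close> only, so the source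
          index has to be a true position and not the default \<open>n\<close>.\<close>
        moreover have "?i < n"
        proof (cases "j < n - rnk \<gamma> n")
          case True
          then have "j < rnk (\<lambda>p. \<gamma> p = False) n" by (simp add: rnk_not)
          then show ?thesis using True pos_less[of j "\<lambda>p. \<gamma> p = False" n] by (simp add: Pb_def)
        next
          case False
          then have "j - (n - rnk \<gamma> n) < rnk (\<lambda>p. \<gamma> p = True) n" using j by simp
          then show ?thesis using False pos_less[of "j - (n - rnk \<gamma> n)" "\<lambda>p. \<gamma> p = True" n] by (simp add: Pb_def)
        qed
        ultimately show ?thesis using nx j I(4) bnd(4)[OF l(1)] by (simp only: Suc_eq_plus1[symmetric])
      qed
      moreover have "level_ok \<sigma> S D l' m3" if l': "l' < l + 1" for l'
      proof (cases "l' = l")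
        case True
        have bmB: "\<forall>i<n. bit (view w m3 (32 * l + 2) (i div w)) (i mod w) = B ! i"
          using bm B(2) unfolding \<gamma>_def by simp
        have "lay (cell m3 (32 * l)) ((!) B)" by (rule lay_cong[OF ly]) (simp add: B)
        then show ?thesis unfolding True level_ok_def Let_def B_def[symmetric]
          using bmB hd dr cf by simp
      next
        case False
        then have ll: "l' < l" using l' by simp
        show ?thesis
        proof (rule level_ok_cong[OF I(5)[OF ll]])
          show "view w m3 (32 * l' + 2) = view w m2 (32 * l' + 2)" "view w m3 (32 * l' + 8) = view w m2 (32 * l' + 8)"
            using fr ll bnd(3)[OF l(1)] by auto
          show "view w m3 D (3 * l') = view w m2 D (3 * l')" "view w m3 D (3 * l' + 1) = view w m2 D (3 * l' + 1)"
            "view w m3 D (3 * l' + 2) = view w m2 D (3 * l' + 2)"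
            using frD ll by auto
        qed
      qed
      ultimately show ?case using l unfolding l(2) by auto
    qed
  next
    case 5 show ?case using 1(2) .
  next
    case 6 show ?case using 1(1) .
  next
    case (7 m2 \<rho>2)
    then have I: "regs_ok \<rho>2 (32 * nl)" "\<rho>2 18 = D" "\<And>l. l < nl \<Longrightarrow> level_ok \<sigma> S D l m2" by auto
    show ?case
    proof (rule run_assign)
      have "D * bsize < 2 ^ w" using adr_less[of D 0] DV bsize_pos by simp
      then have "eval w m2 \<rho>2 (Bin Mul (V 18) (V 3)) = D * bsize"
        using I unfolding regs_ok_def by (simp add: eval_Mul)
      then show "word_memory w m2 \<and> (\<rho>2(0 := eval w m2 \<rho>2 (Bin Mul (V 18) (V 3)))) 0 = 32 * (nl + 1) * bsize \<and>
         (\<forall>l<nl. level_ok \<sigma> S (32 * (nl + 1)) l m2)"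
        using I(3) 7(1) unfolding D_def by simp
    qed (auto simp: CC_def)
  qed
qed

lemma stores_wm:
  assumes wm: "word_memory w m" and S: "length S = n" and s: "1 \<le> \<sigma>" "\<sigma> \<le> n" and K: "real (CC * 22) \<le> K" and z: "(2 + 11 * csize) * w \<le> s"
    and ok: "\<And>l. l < num_levels \<sigma> \<Longrightarrow> level_ok \<sigma> S (32 * (num_levels \<sigma> + 1)) l m"
  shows "stores_wavelet_matrix w rk_code sl_code K s \<sigma> S m (32 * (num_levels \<sigma> + 1) * bsize)"
  unfolding stores_wavelet_matrix_def
proof (intro allI impI)
  fix l assume l: "l < num_levels \<sigma>"
  let ?D = "32 * (num_levels \<sigma> + 1)"
  have nlw: "num_levels \<sigma> \<le> w"
    using num_levels_clog[OF s(1)] clog_le_iff[of \<sigma> w] s n_le_G less_Vv_w[OF le_G_bsize, of \<sigma>] by simp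
  have lV: "32 * l + 8 < bsize" "3 * l + 2 < bsize" using l nlw w_le_G G_1000 by (auto intro!: le_G_bsize)
  define B where "B = level_bitmap \<sigma> S l"
  have BL: "length B = n" by (simp add: B_def level_bitmap_def length_level_seq S)
  note L = ok[OF l, unfolded level_ok_def Let_def, folded B_def]
  have vD: "view w m ?D x = m (?D * bsize + x)" if "x \<le> 3 * l + 2" for x
    using that lV by (simp add: view_eq)
  have D: "m (?D * bsize + 3 * l) = (32 * l + 2) * bsize" "m (?D * bsize + 3 * l + 1) = count_list B False"
    "m (?D * bsize + 3 * l + 2) = (32 * l + 8) * bsize"
    using L vD[of "3 * l"] vD[of "3 * l + 1"] vD[of "3 * l + 2"] by (simp_all only: add.assoc)
  have bits: "bit (m ((32 * l + 2) * bsize + i div w)) (i mod w) = B ! i" if "i < n" for i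
  proof -
    have "i div w \<le> i" by simp
    then have "i div w < bsize" using that nA_small by linarith
    then have e: "view w m (32 * l + 2) (i div w) = m ((32 * l + 2) * bsize + i div w)"
      by (simp only: view_eq if_True)
    show ?thesis unfolding e[symmetric] using L that by blast
  qed
  have pq: "b * bsize + bsize \<le> 2 ^ w" if "b < bsize" for b
  proof -
    have "Suc b * bsize \<le> bsize * bsize" using that by (intro mult_right_mono) auto
    then show ?thesis using bsize_w by simp
  qed
  have hd: "m ((32 * l + 8) * bsize) = u" "m ((32 * l + 8) * bsize + 1) = csize"
    using L bsize_pos G_bsize1 G_1000 by (simp_all add: view_eq)
  have lay: "lay (st m ((32 * l + 8) * bsize)) ((!) B)"
  proof (rule lay_transfer)
    show "lay (cell m (32 * l)) ((!) B)" using L by blast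
    fix k i :: nat assume "k < 11" "i < csize"
    then have "2 + k * csize + i < bsize" by (intro offs_less) auto
    then show "st m ((32 * l + 8) * bsize) k i = cell m (32 * l) k i"
      by (simp add: st_def cell_def view_eq add.assoc)
  qed
  have "rank_select_structure w rk_code sl_code K m ((32 * l + 2) * bsize) B ((32 * l + 8) * bsize) (2 + 11 * csize)"
    by (rule rank_select_structure_lay[OF BL wm pq pq bits hd lay K]) (use lV in auto)
  then show "stores_bitmap w m (m (?D * bsize + 3 * l)) (level_bitmap \<sigma> S l) \<and>
        m (?D * bsize + 3 * l + 1) = count_list (level_bitmap \<sigma> S l) False \<and>
        (\<exists>z. z * w \<le> s \<and>
           rank_select_structure w rk_code sl_code K m (m (?D * bsize + 3 * l)) (level_bitmap \<sigma> S l)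
             (m (?D * bsize + 3 * l + 2)) z)"
    unfolding D B_def[symmetric] stores_bitmap_def BL using bits z by blast
qed

lemma constructs_wm:
  assumes S: "length S = n" and s: "1 \<le> \<sigma>" "\<sigma> \<le> n" and K: "real (CC * 22) \<le> K" and z: "(2 + 11 * csize) * w \<le> s"
    and d: "real (CC * (20 * w + (num_levels \<sigma> * (100 * w + 2) + 1 + 1))) \<le> depth"
    and k: "real (CC * (20 * w + (num_levels \<sigma> * (400 * M + 2) + 1 + 1))) \<le> work"
  shows "constructs_wavelet_matrix wm_code rk_code sl_code K s w \<sigma> S work depth"
  unfolding constructs_wavelet_matrix_def
proof (intro allI impI, elim conjE)
  fix m assume wm: "word_memory w m" and mS: "\<forall>i<length S. m i = S ! i"
  let ?r = "init_regs [length S, \<sigma>, w]"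
  have v: "vars ?r = ?r" by (rule vars_init_regs) simp
  have ws: "n < 2 ^ w" "w < 2 ^ w" using n_le_G w_le_G by (auto intro!: less_Vv_w le_G_bsize)
  have wr: "wordy w ?r" by (rule wordy_init_regs) (use ws s S in auto)
  show "runs_within w wm_code ?r m work depth (\<lambda>m' r. stores_wavelet_matrix w rk_code sl_code K s \<sigma> S m' (r 0))"
  proof (rule run_runs_within[where Q' = "\<lambda>m' v. stores_wavelet_matrix w rk_code sl_code K s \<sigma> S m' v"])
    show "run w wm_code (vars ?r) m (20 * w + (num_levels \<sigma> * (100 * w + 2) + 1 + 1)) (20 * w + (num_levels \<sigma> * (400 * M + 2) + 1 + 1))
      (\<lambda>m' \<rho>'. word_memory w m' \<and> \<rho>' 0 = 32 * (num_levels \<sigma> + 1) * bsize \<and> (\<forall>l<num_levels \<sigma>. level_ok \<sigma> S (32 * (num_levels \<sigma> + 1)) l m'))"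
      unfolding v by (rule run_wm) (use S s wr wm mS in \<open>auto simp: init_regs_def\<close>)
  qed (use wr wm d k stores_wm[OF _ S s K z] in auto)
qed

end

section \<open>Space, work and depth as functions of \<open>n\<close>\<close>

context params
begin

text \<open>The remainder of a word is shorter than one field, so the fields fill at least half of
  the word.\<close>

lemma per_half: "w \<le> 2 * (f * per)"
proof -
  have "w < f * per + f" unfolding per_def using f_pos
    by (metis mult_div_mod_eq nat_add_left_cancel_less mod_less_divisor)
  moreover have "f * 1 \<le> f * per" using per_pos by (intro mult_le_mono2) simp
  ultimately show ?thesis by linarith
qed

text \<open>Hence rounding to whole words at most doubles the \<open>f * x\<close> bits of
  \<open>x\<close> fields.\<close>

lemma div_per: "x div per * w \<le> 2 * f * x"
proof -
  have "x div per * w \<le> x div per * (2 * (f * per))" using per_half by (rule mult_le_mono2)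
  also have "\<dots> = 2 * f * (x div per * per)" by simp
  also have "\<dots> \<le> 2 * f * x" by (intro mult_le_mono2) simp
  finally show ?thesis .
qed

text \<open>An explicit group takes \<open>A\<close> words of \<open>w\<close> bits for a span of at
  least \<open>F\<close>, so this bounds its cost by \<open>1 / u\<close> bits per position. Each of
  \<open>U\<close>, \<open>w\<close>, \<open>w\<close>, \<open>u\<close> is at most
  \<open>2 ^ u\<close>, and four such factors stay below \<open>2 ^ (5 * u)\<close>.\<close>

lemma Awu: "A * w * u \<le> F"
proof -
  have "32 * u ^ 4 \<le> 2 ^ u" using pow4_le[OF u_ge] .
  then have U: "U \<le> 2 ^ u" by (simp add: U_def)
  have "U * w * w * u \<le> 2 ^ u * 2 ^ u * 2 ^ u * 2 ^ u"
    using U w_le_u less_imp_le[OF less_exp[of u]] by (intro mult_le_mono)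
  also have "\<dots> = 2 ^ (4 * u)" by (simp add: power_mult[symmetric] power4_eq_xxxx power_mult mult.commute[of 4] )
  also have "\<dots> \<le> F" unfolding F_def f_def by (intro power_increasing) auto
  finally show ?thesis by (simp add: A_def)
qed

text \<open>Multiplied by \<open>u\<close>, every summand of \<open>csize\<close> costs
  \<open>O(n)\<close> bits or a term sublinear in \<open>n\<close>. With \<open>U = u ^ 4\<close>,
  \<open>Bs = u ^ 2\<close> and \<open>f = 5 * u\<close>, the two packed summands give
  \<open>10 * n\<close> each and the samples and explicit groups \<open>n\<close> each:
  \<open>22 * n\<close> per component, and \<open>242 * n\<close> in all.\<close>

lemma csize_space: "(2 + 11 * csize) * w * u \<le> 300 * n + u * (300 * (w ^ 3 + w * ((U + 1) * 2 ^ U)))"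
proof -
  define W where "W = w * ((U + 1) * 2 ^ U)"
  have t1: "n div A * (w * u) \<le> n"
  proof -
    have "u \<le> U" using u_ge by (simp add: U_def power4_eq_xxxx)
    then have "n div A * (w * u) \<le> n div A * (w * U)" by (intro mult_le_mono2) 
    also have "\<dots> = n div A * A" by (simp add: A_def mult.commute)
    also have "\<dots> \<le> n" by simp
    finally show ?thesis .
  qed
  have Aw: "A * w \<le> w ^ 3"
  proof -
    have "A * w \<le> w * w * w" using U_w by (simp add: A_def)
    then show ?thesis by (simp add: power3_eq_cube)
  qed
  have t3: "(n div F + 1) * A * (w * u) \<le> n + w ^ 3 * u"
  proof -
    have "(n div F + 1) * A * (w * u) = n div F * (A * w * u) + A * w * u" by (simp add: algebra_simps)
    also have "\<dots> \<le> n div F * F + w ^ 3 * u" using Awu Aw by (intro add_le_mono mult_le_mono) auto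
    also have "\<dots> \<le> n + w ^ 3 * u" by simp
    finally show ?thesis .
  qed
  have t4: "(n div U + 1) * Bs div per * (w * u) \<le> 10 * n + 10 * U"
  proof -
    have "(n div U + 1) * Bs div per * (w * u) \<le> 2 * f * ((n div U + 1) * Bs) * u"
      using mult_le_mono1[OF div_per, of "(n div U + 1) * Bs" u] by (simp add: mult.assoc)
    also have "\<dots> = 10 * (n div U * U) + 10 * U"
      by (simp add: f_def U_def Bs_def power4_eq_xxxx power2_eq_square algebra_simps)
    also have "\<dots> \<le> 10 * n + 10 * U" by simp
    finally show ?thesis .
  qed
  have t5: "(n div Bs + 1) div per * (w * u) \<le> 10 * n + 10 * U"
  proof -
    have "(n div Bs + 1) div per * (w * u) \<le> 2 * f * (n div Bs + 1) * u"
      using mult_le_mono1[OF div_per, of "n div Bs + 1" u] by (simp add: mult.assoc)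
    also have "\<dots> = 10 * (n div Bs * Bs) + 10 * Bs"
      by (simp add: f_def Bs_def power2_eq_square algebra_simps)
    also have "\<dots> \<le> 10 * n + 10 * U" using Bs_le_U by (intro add_le_mono) simp_all
    finally show ?thesis .
  qed
  have wu: "16 * U \<le> w * u" "w * u \<le> w ^ 3 * u"
  proof -
    have "w * 1 \<le> w * u" using u_ge by (intro mult_le_mono2) simp
    then show "16 * U \<le> w * u" using U_w by linarith
    have "w ^ 1 \<le> w ^ 3" by (rule power_increasing) (use w_pos in linarith)+
    then show "w * u \<le> w ^ 3 * u" by (intro mult_le_mono1) simp
  qed
  have e: "csize * (w * u) = n div A * (w * u) + 4 * (w * u) + (n div F + 1) * A * (w * u)
    + (n div U + 1) * Bs div per * (w * u) + (n div Bs + 1) div per * (w * u) + W * u"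
  proof -
    have "(a + 2 + b + (c + 1) + (d + 1) + t) * (w * u) =
      a * (w * u) + 4 * (w * u) + b * (w * u) + c * (w * u) + d * (w * u) + w * t * u" for a b c d t :: nat
      by (simp add: algebra_simps)
    then show ?thesis unfolding csize_def W_def by blast
  qed
  have "csize * (w * u) \<le> n + 4 * (w ^ 3 * u) + (n + w ^ 3 * u) + (10 * n + w ^ 3 * u) + (10 * n + w ^ 3 * u) + W * u"
  proof -
    have "10 * U \<le> w ^ 3 * u" "4 * (w * u) \<le> 4 * (w ^ 3 * u)" using wu by linarith+
    then show ?thesis unfolding e using t1 t3 t4 t5 by linarith
  qed
  then have "11 * (csize * (w * u)) + 2 * (w * u) \<le> 300 * n + 300 * (w ^ 3 * u) + 300 * (W * u)"
    using wu by linarith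
  then show ?thesis unfolding W_def by (simp add: algebra_simps)
qed

lemma u_log: "real u \<le> log 2 (real w) + 1" "log 2 (real w) \<le> real u"
proof -
  have "real (2 ^ u) \<le> real (2 * w)" using w_gt_u by (simp only: of_nat_le_iff)
  then have "2 powr real u \<le> 2 * real w" by (simp add: powr_realpow)
  then have "real u \<le> log 2 (2 * real w)" using w_pos by (subst le_log_iff) auto
  also have "\<dots> = log 2 (real w) + 1" using w_pos by (simp add: log_mult)
  finally show "real u \<le> log 2 (real w) + 1" .
  have "real w \<le> real (2 ^ u)" using w_le_u by (simp only: of_nat_le_iff)
  then have "real w \<le> 2 powr real u" by (simp add: powr_realpow)
  then show "log 2 (real w) \<le> real u" using w_pos by (subst log_le_iff) auto
qed

lemma tab_le:
  assumes "real w \<le> x"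
  shows "real ((U + 1) * 2 ^ U) \<le> ((log 2 x + 1) ^ 4 + 1) * 2 powr ((log 2 x + 1) ^ 4)"
proof -
  have x: "1 \<le> real w" using w_pos by linarith
  then have "log 2 (real w) \<le> log 2 x" using assms by simp
  then have "real u \<le> log 2 x + 1" using u_log by linarith
  then have "real U \<le> (log 2 x + 1) ^ 4" unfolding U_def of_nat_power by (intro power_mono) auto
  moreover have "real ((U + 1) * 2 ^ U) = (real U + 1) * 2 powr real U"
    by (simp add: powr_realpow algebra_simps)
  ultimately show ?thesis by (simp only:) (intro mult_mono, auto)
qed

end

text \<open>\<open>O(g)\<close> is a statement about large arguments only. As \<open>g\<close> is
  positive, finitely many exceptions can be absorbed by the constant, which gives a bound valid
  everywhere.\<close>

lemma bigo_all_nat: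
  fixes f g :: "nat \<Rightarrow> real"
  assumes "f \<in> O(g)" "\<And>k. g k > 0"
  shows "\<exists>C>0. \<forall>k. f k \<le> C * g k"
proof -
  obtain c where c: "c > 0" "eventually (\<lambda>k. norm (f k) \<le> c * norm (g k)) sequentially"
    using assms(1) by (auto elim: landau_o.bigE)
  then obtain N where N: "\<And>k. k \<ge> N \<Longrightarrow> norm (f k) \<le> c * norm (g k)" by (auto simp: eventually_sequentially)
  define C where "C = c + (\<Sum>k<N. \<bar>f k\<bar> / g k)"
  have nn: "0 \<le> \<bar>f k\<bar> / g k" for k using assms(2)[of k] by simp
  have C: "c \<le> C" unfolding C_def using nn by (simp add: sum_nonneg)
  have "f k \<le> C * g k" for k
  proof (cases "k < N")
    case True
    then have "\<bar>f k\<bar> / g k \<le> (\<Sum>k<N. \<bar>f k\<bar> / g k)" using nn by (intro member_le_sum) auto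
    then have "\<bar>f k\<bar> / g k \<le> C" using c(1) by (simp add: C_def)
    then show ?thesis using assms(2)[of k] by (simp add: pos_divide_le_eq)
  next
    case False
    then have "f k \<le> c * g k" using N[of k] assms(2)[of k] by simp
    also have "\<dots> \<le> C * g k" using C assms(2)[of k] by (intro mult_right_mono) auto
    finally show ?thesis .
  qed
  then show ?thesis using c(1) C by (intro exI[of _ C]) auto
qed

text \<open>The factor 2 is due to \<open>n = 1\<close>, where \<open>lg\<close> is raised from 0 to
  1.\<close>

lemma pow_lg: "1 \<le> n \<Longrightarrow> 2 powr lg n \<le> 2 * real n"
  by (auto simp: lg_def max_def powr_log_cancel)

text \<open>The space bound freed from \<open>w\<close> and \<open>u\<close>: \<open>u\<close> in
  the denominator is replaced by its lower bound \<open>24 + log 2 (lg n)\<close>, and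
  \<open>w\<close> elsewhere by its upper bound \<open>c * lg n\<close>.\<close>

definition space_bound :: "real \<Rightarrow> nat \<Rightarrow> real" where
  "space_bound c n = 300 * (real n / (24 + log 2 (lg n)) + ((c * lg n) ^ 3 +
     c * lg n * (((log 2 (c * lg n) + 1) ^ 4 + 1) * 2 powr ((log 2 (c * lg n) + 1) ^ 4))))"

text \<open>The first term is about \<open>n / log log n\<close>. The table contributes two to the
  fourth power of about \<open>log log n\<close>, which grows more slowly than any positive power of
  \<open>n\<close>. The added 1 pays for rounding up.\<close>

lemma space_bound_smallo:
  assumes "c > 0"
  shows "(\<lambda>n. space_bound c n + 1) \<in> o(\<lambda>n. real n)"
proof -
  have "eventually (\<lambda>n. lg n = log 2 (real n)) sequentially"
    unfolding eventually_sequentially lg_def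
    by (rule exI[of _ 2]) (auto simp: max_def le_log_iff)
  then have ev: "eventually (\<lambda>n. space_bound c n + 1 = 300 * (real n / (24 + log 2 (log 2 (real n))) + ((c * log 2 (real n)) ^ 3 +
     c * log 2 (real n) * (((log 2 (c * log 2 (real n)) + 1) ^ 4 + 1) * 2 powr ((log 2 (c * log 2 (real n)) + 1) ^ 4)))) + 1) sequentially"
    by eventually_elim (simp add: space_bound_def)
  have "(\<lambda>n::nat. 300 * (real n / (24 + log 2 (log 2 (real n))) + ((c * log 2 (real n)) ^ 3 +
     c * log 2 (real n) * (((log 2 (c * log 2 (real n)) + 1) ^ 4 + 1) * 2 powr ((log 2 (c * log 2 (real n)) + 1) ^ 4)))) + 1) \<in> o(\<lambda>n. real n)"
    using assms by real_asymp
  then show ?thesis using landau_o.small.in_cong[OF ev] by simp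
qed


lemma lg_ge1: "1 \<le> lg n"
  by (simp add: lg_def)

lemma num_levels_lg: "1 \<le> \<sigma> \<Longrightarrow> real (num_levels \<sigma>) \<le> 2 * lg \<sigma>"
proof -
  assume "1 \<le> \<sigma>"
  then have "0 \<le> log 2 (real \<sigma>)" by simp
  then have "real (num_levels \<sigma>) \<le> log 2 (real \<sigma>) + 1" unfolding num_levels_def by linarith
  then show ?thesis unfolding lg_def by linarith
qed

text \<open>The single factor \<open>2 ^ 24\<close> serves twice: as \<open>lg n \<ge> 1\<close>,
  words are long enough for the estimates on \<open>u\<close>, and \<open>log n\<close> is far below
  \<open>w / 16\<close>.\<close>

lemma params_lg:
  assumes n: "1 \<le> n" and w: "2 ^ 24 * lg n \<le> real w"
  shows "params n w"
proof
  have "(2::real) ^ 24 * 1 \<le> 2 ^ 24 * lg n" by (intro mult_left_mono lg_ge1) simp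
  then have w24: "2 ^ 24 \<le> real w" using w by simp
  then have "real (2 ^ 24) \<le> real w" by simp
  then show "2 ^ 24 \<le> w" by (simp only: of_nat_le_iff)
  show "1 \<le> n" by (rule n)
  have "log 2 (real n) \<le> lg n" by (simp add: lg_def)
  then have "log 2 (real n) \<le> real w / 2 ^ 24" using w by (simp add: field_simps)
  also have "\<dots> \<le> real w / 16 - 1" using w24 by (simp add: field_simps)
  also have "\<dots> \<le> real (w div 16)" by linarith
  finally have "real n \<le> 2 powr real (w div 16)" using n by (simp add: log_le_iff)
  then have "real n \<le> real (2 ^ (w div 16))" by (simp add: powr_realpow)
  then show "n \<le> 2 ^ (w div 16)" by (simp only: of_nat_le_iff)
qed

text \<open>The upper bound on the word size enters here: it yields
  \<open>2 powr (w / c) \<le> 2 * n\<close>, and both \<open>w ^ 2\<close> and the size of the table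
  grow more slowly than any exponential in \<open>w\<close>.\<close>

lemma M_linear:
  assumes "0 < c"
  shows "\<exists>C>0. \<forall>n w. params n w \<and> real w \<le> c * lg n \<longrightarrow> real (params.M n w) \<le> C * real n"
proof -
  have "\<exists>C>0. \<forall>k. real k ^ 2 \<le> C * 2 powr (real k / c)"
  proof (rule bigo_all_nat)
    show "(\<lambda>k::nat. real k ^ 2) \<in> O(\<lambda>k. 2 powr (real k / c))" using assms by real_asymp
  qed simp
  then obtain C1 where C1: "C1 > 0" "\<And>k. real k ^ 2 \<le> C1 * 2 powr (real k / c)" by blast
  have "\<exists>C>0. \<forall>k. ((log 2 (real k) + 1) ^ 4 + 1) * 2 powr ((log 2 (real k) + 1) ^ 4) \<le> C * 2 powr (real k / c)"
  proof (rule bigo_all_nat)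
    show "(\<lambda>k::nat. ((log 2 (real k) + 1) ^ 4 + 1) * 2 powr ((log 2 (real k) + 1) ^ 4)) \<in> O(\<lambda>k. 2 powr (real k / c))"
      using assms by real_asymp
  qed simp
  then obtain C2 where C2: "C2 > 0"
    "\<And>k::nat. ((log 2 (real k) + 1) ^ 4 + 1) * 2 powr ((log 2 (real k) + 1) ^ 4) \<le> C2 * 2 powr (real k / c)"
    by blast
  have "real (params.M n w) \<le> (1 + 2 * C1 + 2 * C2) * real n" if p: "params n w" and w: "real w \<le> c * lg n" for n w
  proof -
    interpret params n w by (rule p)
    have "real w / c \<le> lg n" using w assms by (simp add: field_simps)
    then have "2 powr (real w / c) \<le> 2 powr lg n" by simp
    then have e: "2 powr (real w / c) \<le> 2 * real n" using pow_lg[OF n_pos] by linarith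
    have "A \<le> w ^ 2" using U_w by (simp add: A_def power2_eq_square)
    then have "real A \<le> real w ^ 2" by (metis of_nat_le_iff of_nat_power)
    also have "\<dots> \<le> C1 * 2 powr (real w / c)" by (rule C1)
    also have "\<dots> \<le> C1 * (2 * real n)" using e C1 by simp
    finally have 1: "real A \<le> C1 * (2 * real n)" .
    have "real ((U + 1) * 2 ^ U) \<le> C2 * 2 powr (real w / c)"
      using tab_le[OF order_refl] C2(2)[of w] by linarith
    also have "\<dots> \<le> C2 * (2 * real n)" using e C2 by simp
    finally have "real ((U + 1) * 2 ^ U) \<le> C2 * (2 * real n)" .
    then show ?thesis using 1 unfolding M_def of_nat_add[of "n + A"] of_nat_add[of n] by (simp add: algebra_simps)
  qed
  then show ?thesis using C1(1) C2(1) by (intro exI[of _ "1 + 2 * C1 + 2 * C2"]) auto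
qed

text \<open>Both bounds on the word size are used: the lower one makes \<open>u\<close> at least
  \<open>24 + log 2 (lg n)\<close>, the upper one limits the lower order terms.\<close>

lemma space_le:
  assumes p: "params n w" and w: "2 ^ 24 * lg n \<le> real w" "real w \<le> c * lg n"
  shows "real ((2 + 11 * params.csize n w) * w) \<le> space_bound c n"
proof -
  interpret params n w by (rule p)
  have l1: "1 \<le> lg n" by (rule lg_ge1)
  have "log 2 (2 ^ 24 * lg n) \<le> log 2 (real w)" using w l1 w_pos by simp
  moreover have "log 2 (2 ^ 24 * lg n) = 24 + log 2 (lg n)"
  proof -
    have "log 2 ((2::real) ^ 24) = 24" by (subst log_pow_cancel) simp_all
    then show ?thesis using l1 by (subst log_mult) simp_all
  qed
  ultimately have lu: "24 + log 2 (lg n) \<le> real u" using u_log(2) by linarith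
  have ll: "0 \<le> log 2 (lg n)" using l1 by simp
  define T where "T = (U + 1) * 2 ^ U"
  define Y where "Y = ((log 2 (c * lg n) + 1) ^ 4 + 1) * 2 powr ((log 2 (c * lg n) + 1) ^ 4)"
  have up: "0 < real u" using lu ll by linarith
  have T: "real T \<le> Y" unfolding T_def Y_def by (rule tab_le[OF w(2)])
  have "real ((2 + 11 * csize) * w * u) \<le> real (300 * n + u * (300 * (w ^ 3 + w * T)))"
    using csize_space unfolding T_def by (simp only: of_nat_le_iff)
  then have "real ((2 + 11 * csize) * w) * real u \<le> 300 * real n + real u * (300 * (real w ^ 3 + real w * real T))"
    by simp
  then have "real ((2 + 11 * csize) * w) \<le> (300 * real n + real u * (300 * (real w ^ 3 + real w * real T))) / real u"
    using up by (simp only: pos_le_divide_eq)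
  also have "\<dots> = 300 * (real n / real u + (real w ^ 3 + real w * real T))"
    using up by (simp add: add_divide_distrib algebra_simps)
  also have "\<dots> \<le> 300 * (real n / (24 + log 2 (lg n)) + ((c * lg n) ^ 3 + c * lg n * Y))"
  proof -
    have "real n / real u \<le> real n / (24 + log 2 (lg n))" using lu ll by (intro divide_left_mono) auto
    moreover have "real w ^ 3 \<le> (c * lg n) ^ 3" using w(2) by (intro power_mono) auto
    moreover have "real w * real T \<le> c * lg n * Y" using w(2) T by (intro mult_mono) auto
    ultimately show ?thesis by (intro mult_left_mono add_mono) auto
  qed
  finally show ?thesis unfolding space_bound_def Y_def .
qed

theorem mainTheorem8:
  "\<exists>c\<^sub>0::real. c\<^sub>0 > 0 \<and> (\<forall>c\<^sub>1::real. \<exists>(P::code) (rk::code) (sl::code) (K::real) (s::nat \<Rightarrow> nat).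
     (\<lambda>n. real (s n)) \<in> o(\<lambda>n. real n) \<and>
     (\<forall>(n::nat) (\<sigma>::nat) (S::nat list) (w::nat).
        1 \<le> n \<and> \<sigma> \<le> n \<and> length S = n \<and> set S \<subseteq> {0..<\<sigma>} \<and>
        c\<^sub>0 * lg n \<le> real w \<and> real w \<le> c\<^sub>1 * lg n \<longrightarrow>
        constructs_wavelet_matrix P rk sl K (s n) w \<sigma> S
          (K * (real n * lg \<sigma>)) (K * (lg n * lg \<sigma>))))"
proof (intro exI[of _ "2 ^ 24"] conjI allI)
  fix c\<^sub>1 :: real
  \<comment> \<open>\<open>c\<^sub>1\<close> is an arbitrary real number; the maximum makes the
    constant positive.\<close>
  define c where "c = max c\<^sub>1 1"
  have c: "0 < c" "1 \<le> c" by (simp_all add: c_def)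
  obtain C where C: "C > 0" "\<And>n w. params n w \<Longrightarrow> real w \<le> c * lg n \<Longrightarrow> real (params.M n w) \<le> C * real n"
    using M_linear[OF c(1)] by blast
  \<comment> \<open>\<open>226 = 22 + 2 * (100 + 2)\<close> comes from the depth and
    \<open>826 = 22 + 2 * (400 + 2)\<close> from the work of the levels, with the 2 in front from
    \<open>num_levels \<sigma> \<le> 2 * lg \<sigma>\<close>; the last 22 covers the
    queries.\<close>
  define K where "K = real CC * (226 * c + 826 * C + 22)"
  define s where "s = (\<lambda>n. nat \<lceil>space_bound c n\<rceil>)"
  have so: "(\<lambda>n. real (s n)) \<in> o(\<lambda>n. real n)"
  proof (rule landau_o.big_small_trans[OF _ space_bound_smallo[OF c(1)]])
    \<comment> \<open>Keeps the logarithm of \<open>c * lg n\<close> in \<open>space_bound\<close>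
      nonnegative.\<close>
    have "1 * 1 \<le> c * lg n" for n using c lg_ge1[of n] by (intro mult_mono) auto
    then have "0 \<le> space_bound c n" for n unfolding space_bound_def using c lg_ge1[of n]
      by (intro mult_nonneg_nonneg add_nonneg_nonneg divide_nonneg_nonneg zero_le_power) auto
    then have "real (s n) \<le> 1 * norm (space_bound c n + 1)" for n
      unfolding s_def by (smt (verit) of_nat_nat of_int_ceiling_le_add_one real_norm_def ceiling_mono ceiling_zero)
    then show "(\<lambda>n. real (s n)) \<in> O(\<lambda>n. space_bound c n + 1)"
      by (intro bigoI[of _ 1] always_eventually allI) simp
  qed
  have "constructs_wavelet_matrix wm_code rk_code sl_code K (s n) w \<sigma> S (K * (real n * lg \<sigma>)) (K * (lg n * lg \<sigma>))"
    if h: "1 \<le> n \<and> \<sigma> \<le> n \<and> length S = n \<and> set S \<subseteq> {0..<\<sigma>} \<and> 2 ^ 24 * lg n \<le> real w \<and> real w \<le> c\<^sub>1 * lg n"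
    for n \<sigma> S w
  proof -
    have p: "params n w" using h by (intro params_lg) auto
    interpret params n w by (rule p)
    have "S \<noteq> []" using h by auto
    then have \<sigma>: "1 \<le> \<sigma>" using h by (cases S) auto
    have "c\<^sub>1 * lg n \<le> c * lg n" unfolding c_def using lg_ge1[of n] by (intro mult_right_mono) auto
    then have wc: "real w \<le> c * lg n" using h by linarith
    have Mn: "real M \<le> C * real n" by (rule C(2)[OF p wc])
    define nl where "nl = num_levels \<sigma>"
    have nl: "real nl \<le> 2 * lg \<sigma>" using num_levels_lg[OF \<sigma>] by (simp add: nl_def)
    have l1: "1 \<le> lg \<sigma>" by (rule lg_ge1)
    have cost: "20 * real w + (real nl * (a * x + 2) + 2) \<le> (22 + 2 * (a + 2)) * x * lg \<sigma>"
      if "real w \<le> x" "0 \<le> a" for a x :: real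
    proof -
      have w1: "1 \<le> real w" using w_pos by linarith
      have x: "1 \<le> x" using w1 that by linarith
      have "20 * real w + 2 \<le> 22 * x" using that w1 by linarith
      also have "\<dots> \<le> 22 * x * lg \<sigma>" using mult_left_mono[OF l1, of "22 * x"] x by simp
      finally have 1: "20 * real w + 2 \<le> 22 * x * lg \<sigma>" .
      have "real nl * (a * x + 2) \<le> 2 * lg \<sigma> * ((a + 2) * x)"
        using nl x that l1 by (intro mult_mono) (auto simp: algebra_simps)
      then show ?thesis using 1 by (simp add: algebra_simps)
    qed
    show ?thesis
    proof (rule constructs_wm)
      show "length S = n" "1 \<le> \<sigma>" "\<sigma> \<le> n" using h \<sigma> by auto
      have CC0: "0 \<le> real CC" by simp
      show "real (CC * 22) \<le> K" unfolding K_def of_nat_mult using c C(1) by (intro mult_left_mono) auto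
      have "real ((2 + 11 * csize) * w) \<le> space_bound c n" using space_le[OF p _ wc] h by blast
      then have "real ((2 + 11 * csize) * w) \<le> real (s n)" unfolding s_def by linarith
      then show "(2 + 11 * csize) * w \<le> s n" by (simp only: of_nat_le_iff)
      show "real (CC * (20 * w + (num_levels \<sigma> * (100 * w + 2) + 1 + 1))) \<le> K * (lg n * lg \<sigma>)"
      proof -
        have "20 * real w + (real nl * (100 * real w + 2) + 2) \<le> 226 * real w * lg \<sigma>"
          using cost[of "real w" 100] by simp
        also have "\<dots> \<le> 226 * (c * lg n) * lg \<sigma>" using wc l1 by (intro mult_right_mono mult_left_mono) auto
        also have "\<dots> = 226 * c * (lg n * lg \<sigma>)" by simp
        also have "\<dots> \<le> (226 * c + 826 * C + 22) * (lg n * lg \<sigma>)"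
          using C(1) l1 lg_ge1[of n] by (intro mult_right_mono) auto
        finally have "real CC * (20 * real w + (real nl * (100 * real w + 2) + 2)) \<le> real CC * ((226 * c + 826 * C + 22) * (lg n * lg \<sigma>))"
          using CC0 by (rule mult_left_mono)
        moreover have "real (CC * (20 * w + (num_levels \<sigma> * (100 * w + 2) + 1 + 1))) =
          real CC * (20 * real w + (real nl * (100 * real w + 2) + 2))"
          by (simp add: nl_def algebra_simps)
        ultimately show ?thesis unfolding K_def mult.assoc[of "real CC"] by linarith
      qed
      show "real (CC * (20 * w + (num_levels \<sigma> * (400 * M + 2) + 1 + 1))) \<le> K * (real n * lg \<sigma>)"
      proof -
        have "real w \<le> real M" using M_G(3) by simp
        then have "20 * real w + (real nl * (400 * real M + 2) + 2) \<le> 826 * real M * lg \<sigma>"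
          using cost[of "real M" 400] by simp
        also have "\<dots> \<le> 826 * (C * real n) * lg \<sigma>" using Mn l1 by (intro mult_right_mono mult_left_mono) auto
        also have "\<dots> = 826 * C * (real n * lg \<sigma>)" by simp
        also have "\<dots> \<le> (226 * c + 826 * C + 22) * (real n * lg \<sigma>)"
          using c l1 by (intro mult_right_mono) auto
        finally have "real CC * (20 * real w + (real nl * (400 * real M + 2) + 2)) \<le> real CC * ((226 * c + 826 * C + 22) * (real n * lg \<sigma>))"
          using CC0 by (rule mult_left_mono)
        moreover have "real (CC * (20 * w + (num_levels \<sigma> * (400 * M + 2) + 1 + 1))) =
          real CC * (20 * real w + (real nl * (400 * real M + 2) + 2))"
          by (simp add: nl_def algebra_simps)
        ultimately show ?thesis unfolding K_def mult.assoc[of "real CC"] by linarith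
      qed
    qed
  qed
  then show "\<exists>(P::code) (rk::code) (sl::code) (K::real) (s::nat \<Rightarrow> nat).
     (\<lambda>n. real (s n)) \<in> o(\<lambda>n. real n) \<and>
     (\<forall>(n::nat) (\<sigma>::nat) (S::nat list) (w::nat).
        1 \<le> n \<and> \<sigma> \<le> n \<and> length S = n \<and> set S \<subseteq> {0..<\<sigma>} \<and>
        2 ^ 24 * lg n \<le> real w \<and> real w \<le> c\<^sub>1 * lg n \<longrightarrow>
        constructs_wavelet_matrix P rk sl K (s n) w \<sigma> S
          (K * (real n * lg \<sigma>)) (K * (lg n * lg \<sigma>)))"
    using so by blast
qed simp

end
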